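(* Let $d\ge 1$ and $d/2<p<d$. Then for every $\theta>0$, \[ \lim_{t\to\infty} t^{-1}(\log t)^{-(d-p)/d}\log \mathbb{E}_0\exp\Big\{-\theta\int_0^t \overline{V}(B_s)\,ds\Big\} =\frac{\theta d^2}{d-p}\Big(\frac{\omega_d}{d}\,\Gamma\Big(\frac{2p-d}{p}\Big)\Big)^{p/d}\qquad \mathbb{P}\text{-a.s.} \]
   Context: $\omega(dx)$ is a Poisson random measure (Poisson point field) on $\mathbb{R}^d$ whose intensity measure is Lebesgue measure $dx$; $\mathbb{P}$ denotes its law. $(B_s)_{s\ge0}$ is a $d$-dimensional standard Brownian motion independent of $\omega$; $\mathbb{P}_x,\mathbb{E}_x$ denote its law and expectation when $B_0=x$ (so $\mathbb{E}_0$ is the quenched expectation over the Brownian motion only, for a fixed realization of $\omega$). For $d/2<p<d$ the renormalized Poisson potential is $\overline{V}(x)=\int_{\mathbb{R}^d}|y-x|^{-p}\,[\omega(dy)-dy]$, $x\in\mathbb{R}^d$, understood as a compensated Poisson integral: $\overline V(x)=\int_{|y-x|\le 1}|y-x|^{-p}\omega(dy)-\int_{|y|\le1}|y|^{-p}dy+\int_{|y-x|>1}|y-x|^{-p}[\omega(dy)-dy]$, where the first integral is a.s. finite since $p<d$ and the last is the $L^2(\mathbb P)$ compensated integral, well defined since $2p>d$. $\omega_d$ is the volume of the $d$-dimensional unit ball and $\Gamma$ is the Gamma function. *)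

theory Defs
  imports "HOL-Probability.Probability"
begin

definition poisson_random_measure ::
  "'w measure \<Rightarrow> ('w \<Rightarrow> (real^'d::finite) measure) \<Rightarrow> bool" where
  "poisson_random_measure P N \<longleftrightarrow>
     prob_space P \<and>
     (\<forall>\<omega>\<in>space P. sets (N \<omega>) = sets (borel :: (real^'d) measure)) \<and>
     (\<forall>A \<in> sets (borel :: (real^'d) measure). bounded A \<longrightarrow>
        (\<lambda>\<omega>. emeasure (N \<omega>) A) \<in> borel_measurable P \<and>
        (\<forall>k::nat. measure P {\<omega>\<in>space P. emeasure (N \<omega>) A = of_nat k}
            = exp (- measure lborel A) * (measure lborel A) ^ k / fact k)) \<and>
     (\<forall>(I::nat set) (A :: nat \<Rightarrow> (real^'d) set). finite I \<longrightarrow>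
        (\<forall>i\<in>I. A i \<in> sets borel \<and> bounded (A i)) \<longrightarrow> disjoint_family_on A I \<longrightarrow>
        prob_space.indep_vars P (\<lambda>_. borel) (\<lambda>i \<omega>. emeasure (N \<omega>) (A i)) I)"

definition brownian_motion ::
  "'v measure \<Rightarrow> ('v \<Rightarrow> real \<Rightarrow> real^'d::finite) \<Rightarrow> bool" where
  "brownian_motion W B \<longleftrightarrow>
     prob_space W \<and>
     (\<forall>w\<in>space W. B w 0 = 0 \<and> continuous_on {0..} (B w)) \<and>
     (\<forall>s t. 0 \<le> s \<and> s < t \<longrightarrow>
        distributed W lborel (\<lambda>w. B w t - B w s)
          (\<lambda>x. ennreal ((2 * pi * (t - s)) powr (- real CARD('d) / 2)
                  * exp (- (norm x)\<^sup>2 / (2 * (t - s)))))) \<and>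
     (\<forall>(n::nat) (ts :: nat \<Rightarrow> real). 0 \<le> ts 0 \<longrightarrow> (\<forall>i<n. ts i < ts (Suc i)) \<longrightarrow>
        prob_space.indep_vars W (\<lambda>_. borel) (\<lambda>i w. B w (ts (Suc i)) - B w (ts i)) {..<n})"

definition Vbar :: "real \<Rightarrow> (real^'d::finite) measure \<Rightarrow> real^'d \<Rightarrow> real" where
  "Vbar p \<mu> x =
     set_lebesgue_integral \<mu> (cball x 1) (\<lambda>y. dist y x powr (- p))
     - set_lebesgue_integral lborel (cball (0::real^'d) 1) (\<lambda>y. norm y powr (- p))
     + Lim at_top (\<lambda>R::real.
          set_lebesgue_integral \<mu> {y. 1 < dist y x \<and> dist y x \<le> R} (\<lambda>y. dist y x powr (- p))
        - set_lebesgue_integral lborel {y. 1 < dist y x \<and> dist y x \<le> R} (\<lambda>y. dist y x powr (- p)))"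

definition quenched_moment ::
  "'v measure \<Rightarrow> ('v \<Rightarrow> real \<Rightarrow> real^'d::finite) \<Rightarrow> real \<Rightarrow> real \<Rightarrow> (real^'d) measure \<Rightarrow> real \<Rightarrow> ennreal" where
  "quenched_moment W B p \<theta> \<mu> t =
     (\<integral>\<^sup>+ w. ennreal (exp (- \<theta> * set_lebesgue_integral lborel {0..t} (\<lambda>s. Vbar p \<mu> (B w s)))) \<partial>W)"

end

theory Submission
  imports Defs "HOL-Real_Asymp.Real_Asymp"
begin

text \<open>
  Only the environment in a ball of radius \<open>exp n\<close> with \<open>n\<close> close to \<open>ln t\<close> matters. A layer-cake formula
  expresses \<open>- Vbar z\<close> through the numbers of points in spherical shells around \<open>z\<close> whose volumes are comparable
  to \<open>n\<close>, up to a discrepancy term that is uniform over this ball. The shell counts are independent Poisson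
  variables. With \<open>exp (d * n)\<close> essentially different centres \<open>z\<close>, the maximum of \<open>- Vbar\<close> is therefore
  \<open>n powr (1 - p / d)\<close> times the value of an entropy problem: maximise the gain of a radial density profile \<open>c\<close>
  whose cost, the integral of \<open>1 - c + c * ln c\<close>, is at most \<open>d\<close>. The optimal profile, as a function of the volume
  \<open>v\<close>, is \<open>c v = exp (- s * v powr (- p / d))\<close>, and this is where the Gamma function comes from.

  For the upper bound, Jensen's inequality in the time variable reduces the exponential moment to one-time Gaussian
  marginals, so that no fluctuation theory of the path is needed. For the lower bound, the Brownian motion is forced to
  travel to a peak at distance at most \<open>t powr (1 - \<eta>)\<close> and to stay there. The forcing prescribes only the
  positions at multiples of a step \<open>h = n powr (- \<kappa>)\<close> with \<open>0 < \<kappa> < 1 - p / d\<close>. Its density is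
  at most \<open>K ^ (t / h)\<close>, which is negligible on the exponential scale, and a first moment bound under the tilted law
  controls the positive part of the potential along the path.
\<close>

section \<open>Poisson variables\<close>

text \<open>The potential is controlled from one side only: \<open>- Vbar\<close> has a good maximum
  over large balls, whereas \<open>Vbar\<close> is unbounded near every point of the configuration.
  The upper bound therefore needs just a supremum. For the lower bound only averages of the kernel
  over unit balls are available (finite as \<open>p < d\<close>), so no fixed path can be followed;
  making the skeleton points uniform in balls of radius \<open>sqrt h\<close> gives the intermediate
  positions densities against which the potential can be integrated. The start is not randomised,
  which is why a vacant ball around 0 is required. The step \<open>h\<close> must tend to 0, since
  leaving the unit ball around the peak has weight \<open>exp (- 1 / (32 * h))\<close> and this has
  to beat every power of \<open>n\<close>; but \<open>ln K * t / h\<close> must stay below the order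
  \<open>t * n powr (1 - p / d)\<close>. The budget \<open>d\<close> of the entropy problem comes
  from the \<open>exp (d * n)\<close> available centres. The parameter \<open>s\<close> is its
  Lagrange multiplier: minimising \<open>1 - c + c * ln c + s * c * v powr (- p / d)\<close>
  pointwise gives \<open>ln c = - s * v powr (- p / d)\<close>.\<close>

lemma of_nat_ennreal_inject: "(of_nat i :: ennreal) = of_nat j \<Longrightarrow> i = j"
  by (simp add: ennreal_of_nat_eq_real_of_nat)

lemma disjoint_family_level_sets:
  "disjoint_family (\<lambda>k::nat. {\<omega>\<in>S. (f \<omega> :: ennreal) = of_nat k})"
  unfolding disjoint_family_on_def by (blast dest: of_nat_ennreal_inject trans sym)

text \<open>The values lie in \<open>ennreal\<close> because counts of the point process are given
  as \<open>emeasure\<close>. Integrality is not part of the definition: the prescribed point masses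
  already add up to 1.\<close>

definition poisson_var :: "'a measure \<Rightarrow> ('a \<Rightarrow> ennreal) \<Rightarrow> real \<Rightarrow> bool" where
  "poisson_var M X l \<longleftrightarrow> X \<in> borel_measurable M \<and>
     (\<forall>k::nat. measure M {\<omega>\<in>space M. X \<omega> = of_nat k} = exp (- l) * l ^ k / fact k)"

lemma poisson_varD: "poisson_var M X l \<Longrightarrow> X \<in> borel_measurable M"
  by (simp add: poisson_var_def)

context prob_space
begin

lemma poisson_var_AE_nat:
  assumes X: "poisson_var M X l"
  shows "AE \<omega> in M. X \<omega> \<in> range of_nat"
proof -
  note [measurable] = poisson_varD[OF X]
  let ?S = "\<lambda>k::nat. {\<omega>\<in>space M. X \<omega> = of_nat k}"
  have "(\<lambda>k. prob (?S k)) sums prob (\<Union>k. ?S k)"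
    by (rule finite_measure_UNION) (auto simp: disjoint_family_level_sets)
  moreover have "(\<lambda>k. prob (?S k)) sums (exp (- l) * exp l)"
  proof -
    have "prob (?S k) = exp (- l) * (l ^ k /\<^sub>R fact k)" for k
      using X by (simp add: poisson_var_def divide_inverse)
    then show ?thesis using sums_mult[OF exp_converges[of l], of "exp (- l)"] by simp
  qed
  ultimately have "prob (\<Union>k. ?S k) = exp (- l) * exp l" by (rule sums_unique2)
  then have "prob (\<Union>k. ?S k) = 1" by (simp add: exp_add[symmetric])
  then have "AE \<omega> in M. \<omega> \<in> (\<Union>k. ?S k)" by (subst (asm) prob_eq_1) auto
  then show ?thesis by eventually_elim auto
qed

lemma poisson_var_nn_integral:
  assumes X: "poisson_var M X l" and [measurable]: "f \<in> borel_measurable borel"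
  shows "(\<integral>\<^sup>+\<omega>. f (X \<omega>) \<partial>M) = (\<Sum>k. f (of_nat k) * ennreal (exp (- l) * l ^ k / fact k))"
proof -
  note [measurable] = poisson_varD[OF X]
  let ?S = "\<lambda>k::nat. {\<omega>\<in>space M. X \<omega> = of_nat k}"
  have "(\<integral>\<^sup>+\<omega>. f (X \<omega>) \<partial>M) = (\<integral>\<^sup>+\<omega>. (\<Sum>k. f (of_nat k) * indicator (?S k) \<omega>) \<partial>M)"
  proof (rule nn_integral_cong_AE)
    show "AE \<omega> in M. f (X \<omega>) = (\<Sum>k. f (of_nat k) * indicator (?S k) \<omega>)"
      using poisson_var_AE_nat[OF X] AE_space
    proof eventually_elim
      fix \<omega> assume *: "X \<omega> \<in> range of_nat" "\<omega> \<in> space M"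
      then obtain j where j: "X \<omega> = of_nat j" by blast
      have "f (of_nat k) * indicator (?S k) \<omega> = (if k = j then f (X \<omega>) else 0)" for k
        using j * of_nat_ennreal_inject[of k j] by (auto simp: indicator_def)
      then have "(\<Sum>k. f (of_nat k) * indicator (?S k) \<omega>) = (\<Sum>k\<in>{j}. f (of_nat k) * indicator (?S k) \<omega>)"
        by (intro suminf_finite) auto
      then show "f (X \<omega>) = (\<Sum>k. f (of_nat k) * indicator (?S k) \<omega>)" using j * by simp
    qed
  qed
  also have "\<dots> = (\<Sum>k. \<integral>\<^sup>+\<omega>. f (of_nat k) * indicator (?S k) \<omega> \<partial>M)"
    by (rule nn_integral_suminf) measurable
  also have "\<dots> = (\<Sum>k. f (of_nat k) * ennreal (exp (- l) * l ^ k / fact k))"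
  proof (rule suminf_cong)
    fix k :: nat
    have "(\<integral>\<^sup>+\<omega>. f (of_nat k) * indicator (?S k) \<omega> \<partial>M) = f (of_nat k) * emeasure M (?S k)"
      by (rule nn_integral_cmult_indicator) measurable
    then show "(\<integral>\<^sup>+\<omega>. f (of_nat k) * indicator (?S k) \<omega> \<partial>M) =
      f (of_nat k) * ennreal (exp (- l) * l ^ k / fact k)"
      using X by (simp add: emeasure_eq_measure poisson_var_def)
  qed
  finally show ?thesis .
qed

text \<open>Both signs of \<open>a\<close> are needed: either sign for the two tails of a deviation,
  the negative one for the lower tail of weighted shell counts. The value \<infinity>, which
  \<open>enn2real\<close> sends to 0, has probability 0.\<close>

lemma poisson_var_laplace:
  assumes X: "poisson_var M X l" and "l \<ge> 0"
  shows "(\<integral>\<^sup>+\<omega>. ennreal (exp (a * enn2real (X \<omega>))) \<partial>M) = ennreal (exp (l * (exp a - 1)))"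
proof -
  have s: "(\<lambda>k. exp (a * real k) * (exp (- l) * l ^ k / fact k)) sums (exp (l * (exp a - 1)))"
  proof -
    have "(\<lambda>k. exp (- l) * ((l * exp a) ^ k /\<^sub>R fact k)) sums (exp (-l) * exp (l * exp a))"
      by (intro sums_mult exp_converges)
    moreover have "exp (- l) * ((l * exp a) ^ k /\<^sub>R fact k) = exp (a * real k) * (exp (- l) * l ^ k / fact k)" for k
      by (simp add: power_mult_distrib exp_of_nat_mult[symmetric] field_simps)
    moreover have "exp (-l) * exp (l * exp a) = exp (l * (exp a - 1))"
      by (simp add: exp_add[symmetric] algebra_simps)
    ultimately show ?thesis by simp
  qed
  have "(\<integral>\<^sup>+\<omega>. ennreal (exp (a * enn2real (X \<omega>))) \<partial>M)
    = (\<Sum>k. ennreal (exp (a * real k)) * ennreal (exp (- l) * l ^ k / fact k))"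
    by (subst poisson_var_nn_integral[OF X]) (auto simp: enn2real_of_nat)
  also have "\<dots> = (\<Sum>k. ennreal (exp (a * real k) * (exp (- l) * l ^ k / fact k)))"
    using \<open>l \<ge> 0\<close> by (intro suminf_cong ennreal_mult[symmetric]) auto
  also have "\<dots> = ennreal (exp (l * (exp a - 1)))"
    by (rule suminf_ennreal_eq[OF _ s]) (use \<open>l \<ge> 0\<close> in simp)
  finally show ?thesis .
qed

text \<open>The event is left abstract so that one form serves upper and lower tails:
  \<open>Q\<close> only has to force \<open>Y\<close> above \<open>t\<close> almost surely.\<close>

lemma markov_exp:
  assumes [measurable]: "Y \<in> borel_measurable M" "{\<omega>\<in>space M. Q \<omega>} \<in> sets M"
    and "(\<integral>\<^sup>+\<omega>. ennreal (exp (Y \<omega>)) \<partial>M) \<le> ennreal c" "c \<ge> 0"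
    and "AE \<omega> in M. Q \<omega> \<longrightarrow> t \<le> Y \<omega>"
  shows "prob {\<omega>\<in>space M. Q \<omega>} \<le> c * exp (- t)"
proof -
  have "emeasure M {\<omega>\<in>space M. Q \<omega>} = (\<integral>\<^sup>+\<omega>. indicator {\<omega>\<in>space M. Q \<omega>} \<omega> \<partial>M)" by simp
  also have "\<dots> \<le> (\<integral>\<^sup>+\<omega>. ennreal (exp (Y \<omega>)) * ennreal (exp (- t)) \<partial>M)"
  proof (rule nn_integral_mono_AE)
    show "AE \<omega> in M. indicator {\<omega>\<in>space M. Q \<omega>} \<omega> \<le> ennreal (exp (Y \<omega>)) * ennreal (exp (- t))"
      using assms(5)
    proof eventually_elim
      case (elim \<omega>)
      have "1 \<le> ennreal (exp (Y \<omega>)) * ennreal (exp (- t))" if "t \<le> Y \<omega>"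
      proof -
        have "1 \<le> exp (Y \<omega> - t)" using that by simp
        then have "ennreal 1 \<le> ennreal (exp (Y \<omega> - t))" by (rule ennreal_leI)
        then show ?thesis by (simp add: ennreal_mult[symmetric] exp_add[symmetric])
      qed
      then show ?case using elim by (auto simp: indicator_def)
    qed
  qed
  also have "\<dots> = (\<integral>\<^sup>+\<omega>. ennreal (exp (Y \<omega>)) \<partial>M) * ennreal (exp (- t))"
    by (rule nn_integral_multc) measurable
  also have "\<dots> \<le> ennreal c * ennreal (exp (- t))"
    using assms(3) by (rule mult_right_mono) simp
  finally show ?thesis using assms(4)
    by (simp add: emeasure_eq_measure ennreal_mult[symmetric])
qed

lemma poisson_var_finite: "poisson_var M X l \<Longrightarrow> AE \<omega> in M. X \<omega> < \<infinity>"
  using poisson_var_AE_nat[of X l] by (auto elim!: eventually_mono simp: of_nat_less_top)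

end

lemma prm_prob_space: "poisson_random_measure P N \<Longrightarrow> prob_space P"
  by (simp add: poisson_random_measure_def)

lemma prm_sets: "poisson_random_measure P N \<Longrightarrow> \<omega> \<in> space P \<Longrightarrow> sets (N \<omega>) = sets borel"
  by (simp add: poisson_random_measure_def)

lemma prm_poisson_var:
  "poisson_random_measure P N \<Longrightarrow> A \<in> sets borel \<Longrightarrow> bounded A \<Longrightarrow>
    poisson_var P (\<lambda>\<omega>. emeasure (N \<omega>) A) (measure lborel A)"
  by (simp add: poisson_random_measure_def poisson_var_def)

section \<open>Elementary exponential and factorial estimates\<close>

lemma exp_le_quadratic:
  fixes a :: real assumes "\<bar>a\<bar> \<le> 1" shows "exp a - 1 - a \<le> a\<^sup>2"
proof (cases "a \<ge> 0")
  case True then show ?thesis using exp_bound[of a] assms by simp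
next
  case False
  define b where "b = - a"
  have b: "0 \<le> b" "b \<le> 1" using False assms by (auto simp: b_def)
  have "exp b \<ge> 1 + b" by simp
  then have "exp (-b) \<le> 1 / (1 + b)" using b by (simp add: exp_minus field_simps)
  also have "\<dots> \<le> 1 - b + b\<^sup>2" using b by (simp add: field_simps power2_eq_square)
  finally show ?thesis by (simp add: b_def)
qed

text \<open>A crude Stirling bound, sufficient for Poisson point masses on the exponential scale.
  The induction step is \<open>(1 + 1 / (k + 1)) ^ (k + 2) \<ge> exp 1\<close>.\<close>

lemma fact_le_pow: "(fact k :: real) \<le> real (Suc k) ^ Suc k * exp (- real k)"
proof (induction k)
  case 0 show ?case by simp
next
  case (Suc k)
  have l: "exp 1 \<le> (real (Suc (Suc k)) / real (Suc k)) ^ Suc (Suc k)"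
  proof -
    have "ln (real (Suc k) / real (Suc (Suc k))) \<le> real (Suc k) / real (Suc (Suc k)) - 1"
      by (rule ln_le_minus_one) simp
    then have "1 / real (Suc (Suc k)) \<le> ln (real (Suc (Suc k)) / real (Suc k))"
      by (simp add: ln_div field_simps)
    then have "1 \<le> real (Suc (Suc k)) * ln (real (Suc (Suc k)) / real (Suc k))"
      by (simp add: field_simps)
    then have "exp 1 \<le> exp (real (Suc (Suc k)) * ln (real (Suc (Suc k)) / real (Suc k)))" by simp
    also have "\<dots> = (exp (ln (real (Suc (Suc k)) / real (Suc k)))) ^ Suc (Suc k)"
      by (rule exp_of_nat_mult)
    also have "\<dots> = (real (Suc (Suc k)) / real (Suc k)) ^ Suc (Suc k)" by (subst exp_ln) auto
    finally show ?thesis .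
  qed
  have "fact (Suc k) \<le> real (Suc k) * (real (Suc k) ^ Suc k * exp (- real k))"
    using Suc by (simp add: mult_left_mono del: power_Suc)
  also have "exp (- real k) = exp 1 * exp (- real (Suc k))" by (simp add: exp_add[symmetric])
  also have "real (Suc k) * (real (Suc k) ^ Suc k * (exp 1 * exp (- real (Suc k))))
      = real (Suc k) ^ Suc (Suc k) * exp 1 * exp (- real (Suc k))"
    by (simp only: power_Suc mult.assoc)
  also have "\<dots> \<le> real (Suc k) ^ Suc (Suc k) * (real (Suc (Suc k)) / real (Suc k)) ^ Suc (Suc k) * exp (- real (Suc k))"
    using l by (intro mult_right_mono mult_left_mono) auto
  also have "\<dots> = real (Suc (Suc k)) ^ Suc (Suc k) * exp (- real (Suc k))"
    by (simp only: power_mult_distrib[symmetric]) simp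
  finally show ?case .
qed

section \<open>Discrepancy of the Poisson field\<close>

abbreviation vd :: "'d::finite itself \<Rightarrow> real" where
  "vd _ \<equiv> unit_ball_vol (real CARD('d))"

text \<open>Chernoff's bound with exponent \<open>a = u / (2 * L)\<close>. The mean is replaced by
  an upper bound \<open>L\<close> so that one estimate covers a whole family of balls, and
  \<open>u \<le> 2 * L\<close> keeps \<open>a\<close> in the range where
  \<open>exp a - 1 - a \<le> a\<^sup>2\<close>.\<close>

lemma (in prob_space) poisson_var_deviation:
  assumes X: "poisson_var M X l" and l: "0 \<le> l" "l \<le> L" and u: "0 < u" "u \<le> 2 * L"
  shows "prob {\<omega>\<in>space M. u \<le> \<bar>enn2real (X \<omega>) - l\<bar>} \<le> 2 * exp (- (u\<^sup>2 / (4 * L)))"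
proof -
  note [measurable] = poisson_varD[OF X]
  define a where "a = u / (2 * L)"
  have L: "L > 0" using u by linarith
  have a: "0 \<le> a" "a \<le> 1" "\<bar>a\<bar> \<le> 1" "\<bar>-a\<bar> \<le> 1" using u L by (auto simp: a_def field_simps)
  have *: "l * a\<^sup>2 - a * u \<le> - (u\<^sup>2 / (4 * L))"
  proof -
    have "l * a\<^sup>2 \<le> L * a\<^sup>2" using l by (intro mult_right_mono) auto
    also have "L * a\<^sup>2 - a * u = - (u\<^sup>2 / (4 * L))" using L by (simp add: a_def field_simps power2_eq_square)
    finally show ?thesis by simp
  qed
  have "prob {\<omega>\<in>space M. l + u \<le> enn2real (X \<omega>)} \<le> exp (l * (exp a - 1)) * exp (- (a * (l + u)))"
    using a by (intro markov_exp[where Y="\<lambda>\<omega>. a * enn2real (X \<omega>)"])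
      (auto simp: poisson_var_laplace[OF X \<open>0 \<le> l\<close>] intro!: mult_left_mono)
  also have "\<dots> = exp (l * (exp a - 1 - a) - a * u)" by (simp add: exp_add[symmetric] algebra_simps)
  also have "\<dots> \<le> exp (l * a\<^sup>2 - a * u)" using exp_le_quadratic[OF a(3)] l by (simp add: mult_left_mono)
  also have "\<dots> \<le> exp (- (u\<^sup>2 / (4 * L)))" using * by simp
  finally have 1: "prob {\<omega>\<in>space M. l + u \<le> enn2real (X \<omega>)} \<le> exp (- (u\<^sup>2 / (4 * L)))" .
  have "prob {\<omega>\<in>space M. enn2real (X \<omega>) \<le> l - u} \<le> exp (l * (exp (-a) - 1)) * exp (- ((-a) * (l - u)))"
    using a by (intro markov_exp[where Y="\<lambda>\<omega>. (-a) * enn2real (X \<omega>)"])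
      (auto simp: poisson_var_laplace[OF X \<open>0 \<le> l\<close>, of "-a", simplified] intro!: mult_left_mono)
  also have "\<dots> = exp (l * (exp (-a) - 1 - (-a)) - a * u)" by (simp add: exp_add[symmetric] algebra_simps)
  also have "\<dots> \<le> exp (l * a\<^sup>2 - a * u)" using exp_le_quadratic[OF a(4)] l by (simp add: mult_left_mono)
  also have "\<dots> \<le> exp (- (u\<^sup>2 / (4 * L)))" using * by simp
  finally have 2: "prob {\<omega>\<in>space M. enn2real (X \<omega>) \<le> l - u} \<le> exp (- (u\<^sup>2 / (4 * L)))" .
  have "{\<omega>\<in>space M. u \<le> \<bar>enn2real (X \<omega>) - l\<bar>} = {\<omega>\<in>space M. l + u \<le> enn2real (X \<omega>)} \<union> {\<omega>\<in>space M. enn2real (X \<omega>) \<le> l - u}"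
    by (auto simp: abs_if)
  then have "prob {\<omega>\<in>space M. u \<le> \<bar>enn2real (X \<omega>) - l\<bar>} \<le>
    prob {\<omega>\<in>space M. l + u \<le> enn2real (X \<omega>)} + prob {\<omega>\<in>space M. enn2real (X \<omega>) \<le> l - u}"
    by (simp only:) (rule measure_Un_le; measurable)
  then show ?thesis using 1 2 by linarith
qed

text \<open>Used in two ways: with a small mesh as a net that comes close to every point of a large
  ball, and with a large mesh as a family of well separated centres.\<close>

definition grid :: "real \<Rightarrow> nat \<Rightarrow> (real^'d::finite) set" where
  "grid e m = (\<lambda>k. \<chi> i. e * of_int (k i)) ` (UNIV \<rightarrow>\<^sub>E {- int m..int m})"

lemma finite_grid [simp]: "finite (grid e m :: (real^'d::finite) set)"
  unfolding grid_def by (intro finite_imageI finite_PiE) auto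

lemma card_grid: "card (grid e m :: (real^'d::finite) set) \<le> (2 * m + 1) ^ CARD('d)"
proof -
  have "card (grid e m :: (real^'d::finite) set) \<le> card ((UNIV::'d set) \<rightarrow>\<^sub>E {- int m..int m})"
    unfolding grid_def by (rule card_image_le) (intro finite_PiE; simp)
  also have "\<dots> = (2 * m + 1) ^ CARD('d)" by (simp add: card_funcsetE nat_add_distrib nat_mult_distrib)
  finally show ?thesis .
qed

lemma norm_le_card_max:
  fixes x :: "real^'d::finite" assumes "\<And>i. \<bar>x $ i\<bar> \<le> c" shows "norm x \<le> real CARD('d) * c"
proof -
  have "norm x \<le> (\<Sum>i\<in>UNIV. \<bar>x $ i\<bar>)" by (rule norm_le_l1_cart)
  also have "\<dots> \<le> (\<Sum>i\<in>(UNIV::'d set). c)" by (intro sum_mono assms)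
  finally show ?thesis by simp
qed

lemma grid_cover:
  fixes z :: "real^'d::finite" assumes "e > 0" "norm z \<le> e * real m"
  shows "\<exists>x\<in>grid e m. dist z x \<le> real CARD('d) * e"
proof -
  define k where "k i = \<lfloor>z $ i / e\<rfloor>" for i
  have b: "\<bar>z $ i / e\<bar> \<le> real m" for i
    using component_le_norm_cart[of z i] assms by (simp add: field_simps)
  have k: "k \<in> UNIV \<rightarrow>\<^sub>E {- int m..int m}"
  proof (rule PiE_I)
    fix i show "k i \<in> {- int m..int m}" using b[of i] unfolding k_def abs_le_iff by (auto simp: le_floor_iff floor_le_iff)
  qed simp
  have d: "\<bar>(z - (\<chi> i. e * of_int (k i))) $ i\<bar> \<le> e" for i
  proof -
    have "of_int (k i) \<le> z $ i / e" "z $ i / e < of_int (k i) + 1" unfolding k_def by linarith+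
    then have "e * of_int (k i) \<le> z $ i" "z $ i < e * of_int (k i) + e" using assms(1)
      by (auto simp: field_simps)
    then show ?thesis by simp
  qed
  show ?thesis
  proof (rule bexI)
    show "dist z (\<chi> i. e * of_int (k i)) \<le> real CARD('d) * e"
      unfolding dist_norm by (rule norm_le_card_max[OF d])
    show "(\<chi> i. e * of_int (k i)) \<in> grid e m" unfolding grid_def using k by (rule imageI)
  qed
qed

lemma power_diff_le:
  fixes a b :: real assumes "0 \<le> a" "a \<le> b" shows "b ^ n - a ^ n \<le> real n * (b - a) * b ^ (n - 1)"
proof (induction n)
  case (Suc n)
  show ?case
  proof (cases "n = 0")
    case False
    then obtain m where m: "n = Suc m" by (cases n) auto
    have "b ^ Suc n - a ^ Suc n = b * (b ^ n - a ^ n) + (b - a) * a ^ n" by (simp add: algebra_simps)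
    also have "\<dots> \<le> b * (real n * (b - a) * b ^ (n - 1)) + (b - a) * b ^ n"
      using assms Suc by (intro add_mono mult_left_mono power_mono) auto
    also have "\<dots> = real (Suc n) * (b - a) * b ^ (Suc n - 1)" by (simp add: m algebra_simps)
    finally show ?thesis .
  qed simp
qed simp

lemma content_cball_vec:
  "0 \<le> r \<Longrightarrow> measure lborel (cball (x::real^'d::finite) r) = vd TYPE('d) * r ^ CARD('d)"
  by (simp add: content_cball)

text \<open>Counts are almost surely finite for each single ball; the balls of integer radius around
  0 contain all others, so one null set is enough.\<close>

lemma prm_ball_finite:
  fixes N :: "'w \<Rightarrow> (real^'d::finite) measure"
  assumes prm: "poisson_random_measure P N"
  shows "AE \<omega> in P. \<forall>x r. emeasure (N \<omega>) (cball x r) < \<infinity>"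
proof -
  interpret prob_space P by (rule prm_prob_space[OF prm])
  have "AE \<omega> in P. \<forall>k::nat. emeasure (N \<omega>) (cball 0 (real k)) < \<infinity>"
    using poisson_var_finite[OF prm_poisson_var[OF prm]] by (subst AE_all_countable) auto
  then show ?thesis using AE_space
  proof eventually_elim
    case (elim \<omega>)
    show ?case
    proof (intro allI)
      fix x :: "real^'d" and r
      obtain k where k: "norm x + r \<le> real k" using real_arch_simple by blast
      have "cball x r \<subseteq> cball 0 (real k)"
      proof
        fix y assume "y \<in> cball x r"
        then have "dist x y \<le> r" by simp
        then show "y \<in> cball 0 (real k)" using k norm_triangle_ineq[of x "y - x"] by (simp add: dist_norm norm_minus_commute)
      qed
      then have "emeasure (N \<omega>) (cball x r) \<le> emeasure (N \<omega>) (cball 0 (real k))"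
        by (rule emeasure_mono) (simp add: prm_sets[OF prm elim(2)])
      then show "emeasure (N \<omega>) (cball x r) < \<infinity>" using elim(1) by (simp add: le_less_trans)
    qed
  qed
qed

section \<open>Uniform discrepancy of ball counts\<close>

lemma summable_power_exp_powr:
  fixes c g :: real assumes "c > 0" "g > 0"
  shows "summable (\<lambda>j::nat. real j ^ D * exp (- c * real j powr g))"
proof (rule summable_comparison_test_ev)
  have "(\<lambda>x::real. x ^ D * exp (- c * x powr g)) \<in> O(\<lambda>x. x powr (-2))"
    using assms by real_asymp
  then have "((\<lambda>x::real. x powr 2 * (x ^ D * exp (- c * x powr g))) \<longlongrightarrow> 0) at_top"
    using assms by real_asymp
  then have "eventually (\<lambda>x::real. x powr 2 * (x ^ D * exp (- c * x powr g)) < 1) at_top"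
    by (rule order_tendstoD) simp
  then have "eventually (\<lambda>j::nat. real j powr 2 * (real j ^ D * exp (- c * real j powr g)) < 1) sequentially"
    by (rule eventually_compose_filterlim[OF _ filterlim_real_sequentially])
  then show "\<forall>\<^sub>F j in sequentially. norm (real j ^ D * exp (- c * real j powr g)) \<le> real j powr (-2)"
    using eventually_gt_at_top[of 0]
    by eventually_elim (simp add: powr_minus field_simps)
  show "summable (\<lambda>j. real j powr (-2))" by (simp add: summable_real_powr_iff)
qed

lemma grid_bad_prob:
  fixes N :: "'w \<Rightarrow> (real^'d::finite) measure" and e u L e' :: real and m I :: nat
  assumes prm: "poisson_random_measure P N"
    and u: "0 < u" "u \<le> 2 * L" and e: "0 \<le> e" and L: "\<And>i. i \<le> I \<Longrightarrow> vd TYPE('d) * (real i * e) ^ CARD('d) \<le> L"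
  defines "Bad \<equiv> (\<Union>x\<in>grid e' m. \<Union>i\<le>I. {\<omega>\<in>space P. u \<le> \<bar>measure (N \<omega>) (cball x (real i * e)) - vd TYPE('d) * (real i * e) ^ CARD('d)\<bar>})"
  shows "Bad \<in> sets P"
    "measure P Bad \<le> real ((2 * m + 1) ^ CARD('d)) * real (I + 1) * (2 * exp (- (u\<^sup>2 / (4 * L))))"
proof -
  interpret prob_space P by (rule prm_prob_space[OF prm])
  let ?B = "\<lambda>(x::real^'d) i. {\<omega>\<in>space P. u \<le> \<bar>measure (N \<omega>) (cball x (real i * e)) - vd TYPE('d) * (real i * e) ^ CARD('d)\<bar>}"
  have pv: "poisson_var P (\<lambda>\<omega>. emeasure (N \<omega>) (cball x (real i * e))) (vd TYPE('d) * (real i * e) ^ CARD('d))"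
    for x :: "real^'d" and i
    using prm_poisson_var[OF prm, of "cball x (real i * e)"] e by (simp add: content_cball_vec)
  have m: "?B x i \<in> sets P" for x i
    using poisson_varD[OF pv[of x i]] unfolding measure_def by measurable
  show "Bad \<in> sets P" unfolding Bad_def by (intro sets.finite_UN finite_grid m) auto
  have p: "prob (?B x i) \<le> 2 * exp (- (u\<^sup>2 / (4 * L)))" if "i \<le> I" for x i
    using poisson_var_deviation[OF pv[of x i] _ L[OF that] u] e unfolding measure_def by simp
  have "measure P Bad \<le> (\<Sum>x\<in>(grid e' m :: (real^'d) set). prob (\<Union>i\<le>I. ?B x i))"
    unfolding Bad_def by (intro measure_UNION_le finite_grid sets.finite_UN m) auto
  also have "\<dots> \<le> (\<Sum>x\<in>(grid e' m :: (real^'d) set). \<Sum>i\<le>I. prob (?B x i))"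
    by (intro sum_mono measure_UNION_le m) auto
  also have "\<dots> \<le> (\<Sum>x\<in>(grid e' m :: (real^'d) set). \<Sum>i\<le>I. 2 * exp (- (u\<^sup>2 / (4 * L))))"
    by (intro sum_mono p) auto
  also have "\<dots> = real (card (grid e' m :: (real^'d) set)) * real (I + 1) * (2 * exp (- (u\<^sup>2 / (4 * L))))"
    by simp
  also have "\<dots> \<le> real ((2 * m + 1) ^ CARD('d)) * real (I + 1) * (2 * exp (- (u\<^sup>2 / (4 * L))))"
    by (intro mult_right_mono) (use card_grid[of e' m, where 'd='d] of_nat_mono in \<open>auto simp del: of_nat_power of_nat_add\<close>)
  finally show "measure P Bad \<le> real ((2 * m + 1) ^ CARD('d)) * real (I + 1) * (2 * exp (- (u\<^sup>2 / (4 * L))))" .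
qed

text \<open>Balls with centres and radii on grids of mesh \<open>j\<close> to the power \<open>-d\<close> sandwich all balls of radius in \<open>[j, j + 1]\<close>,
  at the cost of a bounded change of volume.\<close>

lemma ball_sandwich:
  fixes \<mu> :: "(real^'d::finite) measure"
  assumes sets: "sets \<mu> = sets borel" and fin: "\<And>x r. emeasure \<mu> (cball x r) < \<infinity>"
    and j: "2 \<le> j" "real j \<le> r" "r \<le> real j + 1"
    and z: "norm z \<le> 1 / (real CARD('d) * real j ^ CARD('d)) * real m"
    and close: "\<And>x i. x \<in> grid (1 / (real CARD('d) * real j ^ CARD('d))) m \<Longrightarrow> i \<le> (j + 3) * j ^ CARD('d) \<Longrightarrow>
       \<bar>measure \<mu> (cball x (real i * (1 / real j ^ CARD('d)))) - vd TYPE('d) * (real i * (1 / real j ^ CARD('d))) ^ CARD('d)\<bar> \<le> u"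
  shows "\<bar>measure \<mu> (cball z r) - vd TYPE('d) * r ^ CARD('d)\<bar> \<le> u + vd TYPE('d) * (2 * real CARD('d) * 2 ^ CARD('d))"
proof -
  let ?d = "CARD('d)" and ?w = "vd TYPE('d)"
  define e where "e = 1 / real j ^ ?d"
  have jd: "real j \<le> real j ^ ?d" using j by (intro self_le_power) auto
  have jd2: "2 \<le> real j ^ ?d" using jd j by linarith
  have e: "e > 0" "e \<le> 1/2" "e * real j ^ ?d = 1" using j jd2 by (auto simp: e_def field_simps)
  have w: "?w > 0" by simp
  obtain x :: "real^'d" where x: "x \<in> grid (1 / (real CARD('d) * real j ^ CARD('d))) m" "dist z x \<le> e"
    using grid_cover[OF _ z] j by (auto simp: e_def)
  have vol: "?w * b ^ ?d - ?w * a ^ ?d \<le> ?w * (2 * real ?d * 2 ^ ?d)"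
    if "0 \<le> a" "a \<le> b" "b - a \<le> 2 * e" "b \<le> 2 * real j" for a b
  proof -
    have "b ^ ?d - a ^ ?d \<le> real ?d * (b - a) * b ^ (?d - 1)" by (rule power_diff_le) fact+
    also have "\<dots> \<le> real ?d * (2 * e) * (2 * real j) ^ (?d - 1)"
      using that by (intro mult_mono mult_left_mono power_mono) auto
    also have "\<dots> \<le> real ?d * (2 * e) * (2 * real j) ^ ?d"
      using j e by (intro mult_left_mono power_increasing) auto
    also have "\<dots> = 2 * real ?d * 2 ^ ?d" using e(3) by (simp add: power_mult_distrib)
    finally show ?thesis using w by (simp add: right_diff_distrib[symmetric])
  qed
  have inj: "i \<le> (j + 3) * j ^ ?d" if "real i * e \<le> real j + 3" for i
  proof -
    have "real i = real i * e * real j ^ ?d" using e by (simp add: mult.assoc)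
    also have "\<dots> \<le> (real j + 3) * real j ^ ?d" using that by (intro mult_right_mono) auto
    finally have "real i \<le> real ((j + 3) * j ^ ?d)" by simp
    then show ?thesis by (simp only: of_nat_le_iff)
  qed
  have mono: "measure \<mu> (cball a s) \<le> measure \<mu> (cball b t)" if "dist a b + s \<le> t" for a b s t
  proof (rule measure_mono_fmeasurable)
    show "cball a s \<subseteq> cball b t"
    proof
      fix y assume "y \<in> cball a s"
      then show "y \<in> cball b t" using that dist_triangle[of b y a] by (simp add: dist_commute)
    qed
  qed (use sets fin in \<open>auto simp: fmeasurable_def\<close>)
  show ?thesis
  proof -
    \<comment> \<open>The offset 2 pays for the rounding and for the displacement of the centre by
      at most \<open>e\<close>. The inner radius \<open>k * e\<close> below is lowered by one mesh
      width for the same displacement.\<close>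
    define i where "i = nat \<lfloor>r / e\<rfloor> + 2"
    have r0: "r / e \<ge> 0" using j e by auto
    have i1: "r / e < real i - 1" "real i - 2 \<le> r / e" unfolding i_def using r0 by linarith+
    then have i2: "r + e < real i * e" "real i * e \<le> r + 2 * e" using e by (auto simp: field_simps)
    have "measure \<mu> (cball z r) \<le> measure \<mu> (cball x (real i * e))" using x i2 by (intro mono) auto
    also have "\<dots> \<le> ?w * (real i * e) ^ ?d + u"
      using close[OF x(1) inj, of i] i2 e j by (simp add: e_def[symmetric])
    also have "?w * (real i * e) ^ ?d \<le> ?w * r ^ ?d + ?w * (2 * real ?d * 2 ^ ?d)"
      using vol[of r "real i * e"] i2 j e by simp
    finally have up: "measure \<mu> (cball z r) - ?w * r ^ ?d \<le> u + ?w * (2 * real ?d * 2 ^ ?d)" by simp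
    define k where "k = nat \<lfloor>r / e\<rfloor> - 1"
    have re: "r / e \<ge> 1" using j e by (auto simp: field_simps)
    have "1 \<le> nat \<lfloor>r / e\<rfloor>" using re by linarith
    then have k1: "r / e < real k + 2" "real k + 1 \<le> r / e" unfolding k_def using r0 by linarith+
    then have k2: "real k * e + e \<le> r" "r \<le> real k * e + 2 * e" using e by (auto simp: field_simps)
    have "?w * r ^ ?d - ?w * (real k * e) ^ ?d \<le> ?w * (2 * real ?d * 2 ^ ?d)"
      using vol[of "real k * e" r] k2 j e by simp
    moreover have "?w * (real k * e) ^ ?d - u \<le> measure \<mu> (cball x (real k * e))"
      using close[OF x(1) inj, of k] k2 e j by (simp add: e_def[symmetric])
    moreover have "measure \<mu> (cball x (real k * e)) \<le> measure \<mu> (cball z r)"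
      using x k2 by (intro mono) (auto simp: dist_commute)
    ultimately have "?w * r ^ ?d - measure \<mu> (cball z r) \<le> u + ?w * (2 * real ?d * 2 ^ ?d)" by linarith
    with up show ?thesis by (simp add: abs_le_iff)
  qed
qed

text \<open>Why this envelope: at radii of order \<open>n powr (1 / d)\<close> it is of order
  \<open>n\<close>, comparable with the mean itself, as it must be since atypical balls of that size
  do occur among exponentially many. Because \<open>q > d / 2\<close> it outgrows the typical
  fluctuation \<open>r powr (d / 2)\<close> for larger radii. The Chernoff exponent has order
  \<open>r powr (2 * q - d) * n powr (2 - 2 * q / d)\<close>, a large multiple of \<open>n\<close>
  once \<open>K\<close> is large, and this beats the number of centres.\<close>

lemma discrepancy_AE:
  fixes N :: "'w \<Rightarrow> (real^'d::finite) measure" and q :: real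
  assumes prm: "poisson_random_measure P N" and q: "real CARD('d) / 2 < q" "q < real CARD('d)"
  shows "\<exists>K\<ge>1. AE \<omega> in P. \<forall>\<^sub>F n in sequentially. \<forall>x\<in>cball 0 (exp (real n)). \<forall>r\<ge>K * real n powr (1 / real CARD('d)).
    \<bar>measure (N \<omega>) (cball x r) - vd TYPE('d) * r ^ CARD('d)\<bar> \<le> r powr q * real n powr (1 - q / real CARD('d))"
proof -
  interpret prob_space P by (rule prm_prob_space[OF prm])
  let ?d = "CARD('d)" and ?w = "vd TYPE('d)"
  define dr where "dr = real ?d"
  have d1: "?d \<ge> 1" by (simp add: Suc_leI)
  then have dr: "dr \<ge> 1" by (simp add: dr_def)
  have w: "?w > 0" by simp
  define g where "g = 2 * q - dr"
  have g: "0 < g" "g < dr" and q': "0 < q" "q < dr" using q dr by (auto simp: g_def dr_def)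
  \<comment> \<open>Comes from the exponent \<open>(u n j)\<^sup>2 / (4 * L j) = c0 * j powr g * n
    powr (1 - g / dr)\<close>. One half of it pays for the centres and for summability in
    \<open>n\<close>, the other half for summability in \<open>j\<close>.\<close>
  define c0 where "c0 = 1 / (16 * ?w * 2 ^ ?d)"
  have c0: "c0 > 0" using w by (simp add: c0_def)
  define C' where "C' = ?w * (2 * dr * 2 ^ ?d)"
  \<comment> \<open>Three demands on \<open>K\<close>: half of the Chernoff exponent reaches
    \<open>(dr + 1) * n\<close>, the deviation stays in the range \<open>u \<le> 2 * L\<close>, and
    the volume error of the sandwich is at most half of the envelope.\<close>
  have "eventually (\<lambda>K::real. c0 / 2 * (K / 2) powr g \<ge> dr + 1) at_top"
  proof -
    have "filterlim (\<lambda>K::real. c0 / 2 * (K / 2) powr g) at_top at_top" using c0 g by real_asymp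
    then show ?thesis unfolding filterlim_at_top by blast
  qed
  moreover have "eventually (\<lambda>K::real. (2 / K) powr (dr - q) < 4 * ?w * 2 ^ ?d) at_top"
  proof -
    have "((\<lambda>K::real. (2 / K) powr (dr - q)) \<longlongrightarrow> 0) at_top" using q' by real_asymp
    then show ?thesis by (rule order_tendstoD) (use w in simp)
  qed
  moreover have "eventually (\<lambda>K::real. K powr q \<ge> 2 * C') at_top"
  proof -
    have "filterlim (\<lambda>K::real. K powr q) at_top at_top" using q' by real_asymp
    then show ?thesis unfolding filterlim_at_top by blast
  qed
  ultimately have "eventually (\<lambda>K::real. K \<ge> 2 \<and> c0 / 2 * (K / 2) powr g \<ge> dr + 1 \<and> (2 / K) powr (dr - q) < 4 * ?w * 2 ^ ?d \<and>
    K powr q \<ge> 2 * C') at_top" using eventually_ge_at_top[of "2::real"] by (simp add: eventually_conj_iff)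
  then obtain K :: real where K: "K \<ge> 2" "c0 / 2 * (K / 2) powr g \<ge> dr + 1" "(2 / K) powr (dr - q) < 4 * ?w * 2 ^ ?d"
    "K powr q \<ge> 2 * C'" by (auto dest: eventually_happens)
  define u where "u n j = real j powr q * real n powr (1 - q / dr) / 2" for n j :: nat
  define L where "L j = ?w * (2 * real j) ^ ?d" for j :: nat
  define m where "m n j = nat \<lceil>exp (real n) * (dr * real j ^ ?d)\<rceil>" for n j :: nat
  define Bad where "Bad n j = (\<Union>x\<in>grid (1 / (dr * real j ^ ?d)) (m n j). \<Union>i\<le>(j + 3) * j ^ ?d.
    {\<omega>\<in>space P. u n j \<le> \<bar>measure (N \<omega>) (cball x (real i * (1 / real j ^ ?d))) - ?w * (real i * (1 / real j ^ ?d)) ^ ?d\<bar>})" for n j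
  \<comment> \<open>Radii are treated through their integer part \<open>j\<close>, which may be
    smaller by up to 1. Hence \<open>J\<close> starts at half of \<open>K\<close>, while the result
    is obtained for radii from \<open>(K + 4) * n powr (1 / dr)\<close> on.\<close>
  define J where "J n = {j::nat. 3 \<le> j \<and> K / 2 * real n powr (1 / dr) \<le> real j}" for n :: nat
  define D where "D = ?d * ?d + (?d + 1)"
  define C1 where "C1 = (5 * dr) ^ ?d * 6"
  have bad: "Bad n j \<in> sets P" "measure P (Bad n j) \<le> C1 * exp (- real n) * (real j ^ D * exp (- (c0/2) * real j powr g))"
    if n: "n \<ge> 1" and j: "j \<in> J n" for n j
  proof -
    have j3: "3 \<le> j" and jK: "K / 2 * real n powr (1 / dr) \<le> real j" using j by (auto simp: J_def)
    have jp: "real j > 0" "real j \<ge> 1" and np: "real n > 0" "real n \<ge> 1" using j3 n by auto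
    have jd: "real j ^ ?d \<ge> 1" using jp by simp
    have upos: "0 < u n j" using jp np by (simp add: u_def)
    have nj: "real n powr (1/dr) \<le> 2 / K * real j" using jK K by (simp add: field_simps)
    have uL: "u n j \<le> 2 * L j"
    proof -
      have "real n powr (1 - q/dr) = (real n powr (1/dr)) powr (dr - q)" using dr by (simp add: powr_powr field_simps)
      also have "\<dots> \<le> (2 / K * real j) powr (dr - q)" using nj q' by (intro powr_mono2) auto
      also have "\<dots> = (2 / K) powr (dr - q) * real j powr (dr - q)" by (rule powr_mult)
      also have "\<dots> \<le> (4 * ?w * 2 ^ ?d) * real j powr (dr - q)" using K by (intro mult_right_mono) auto
      finally have "u n j \<le> real j powr q * ((4 * ?w * 2 ^ ?d) * real j powr (dr - q)) / 2"
        unfolding u_def by (intro divide_right_mono mult_left_mono) auto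
      also have "\<dots> = 2 * ?w * 2 ^ ?d * (real j powr q * real j powr (dr - q))" by simp
      also have "real j powr q * real j powr (dr - q) = real j ^ ?d" using jp by (simp add: powr_add[symmetric] dr_def powr_realpow)
      finally show ?thesis by (simp add: L_def power_mult_distrib)
    qed
    have iL: "?w * (real i * (1 / real j ^ ?d)) ^ ?d \<le> L j" if "i \<le> (j + 3) * j ^ ?d" for i
    proof -
      have "real i \<le> real ((j + 3) * j ^ ?d)" using that by (rule of_nat_mono)
      then have "real i \<le> (real j + 3) * real j ^ ?d" by simp
      then have "real i * (1 / real j ^ ?d) \<le> real j + 3" using less_le_trans[OF zero_less_one jd] by (simp add: pos_divide_le_eq)
      also have "\<dots> \<le> 2 * real j" using j3 by simp
      finally show ?thesis unfolding L_def using w by (intro mult_left_mono power_mono) auto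
    qed
    show "Bad n j \<in> sets P" unfolding Bad_def by (rule grid_bad_prob(1)[OF prm upos uL _ iL]) auto
    have expo: "(u n j)\<^sup>2 / (4 * L j) \<ge> (dr + 1) * real n + (c0/2) * real j powr g"
    proof -
      have "(u n j)\<^sup>2 = real j powr (2*q) * real n powr (2 - 2 * q/dr) / 4"
        by (simp add: u_def power2_eq_square powr_add[symmetric] field_simps)
      then have "(u n j)\<^sup>2 / (4 * L j) = c0 * (real j powr (2*q) / real j ^ ?d) * real n powr (2 - 2*q/dr)"
        unfolding L_def c0_def power_mult_distrib by (simp only:) simp
      also have "real j powr (2*q) / real j ^ ?d = real j powr g"
        using jp by (simp add: g_def powr_diff dr_def powr_realpow)
      also have "2 - 2*q/dr = 1 - g/dr" using dr by (simp add: g_def field_simps)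
      finally have eq: "(u n j)\<^sup>2 / (4 * L j) = c0 * real j powr g * real n powr (1 - g/dr)" .
      have n1: "real n powr (1 - g/dr) \<ge> 1" using np g dr by (intro ge_one_powr_ge_zero) auto
      have "real n powr (g / dr) = (real n powr (1/dr)) powr g" by (simp add: powr_powr)
      moreover have "(K/2 * real n powr (1/dr)) powr g \<le> real j powr g" using jK K g by (intro powr_mono2) auto
      ultimately have "(K/2) powr g * real n powr (g/dr) \<le> real j powr g" by (simp only: powr_mult)
      then have "c0/2 * ((K/2) powr g * real n powr (g/dr)) * real n powr (1 - g/dr) \<le> c0/2 * real j powr g * real n powr (1 - g/dr)"
        using c0 by (intro mult_right_mono mult_left_mono) auto
      also have "c0/2 * ((K/2) powr g * real n powr (g/dr)) * real n powr (1 - g/dr) = c0/2 * (K/2) powr g * real n"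
        using np by (simp add: powr_add[symmetric] mult.assoc)
      finally have 1: "(dr + 1) * real n \<le> c0/2 * real j powr g * real n powr (1 - g/dr)"
        using mult_right_mono[OF K(2), of "real n"] by simp
      have "c0/2 * real j powr g * 1 \<le> c0/2 * real j powr g * real n powr (1 - g/dr)"
        using n1 c0 by (intro mult_left_mono) auto
      with 1 eq show ?thesis by (simp add: field_simps)
    qed
    have "measure P (Bad n j) \<le> real ((2 * m n j + 1) ^ ?d) * real ((j + 3) * j ^ ?d + 1) * (2 * exp (- ((u n j)\<^sup>2 / (4 * L j))))"
      unfolding Bad_def by (rule grid_bad_prob(2)[OF prm upos uL _ iL]) auto
    also have "\<dots> \<le> ((5 * dr) ^ ?d * exp (dr * real n) * real j ^ (?d * ?d)) * (3 * real j ^ (?d + 1)) *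
       (2 * (exp (- (dr + 1) * real n) * exp (- (c0/2) * real j powr g)))"
    proof (intro mult_mono)
      have x1: "exp (real n) * (dr * real j ^ ?d) \<ge> 1 * (1 * 1)" using dr jd by (intro mult_mono) auto
      have "real (2 * m n j + 1) \<le> 5 * (exp (real n) * (dr * real j ^ ?d))" using x1 unfolding m_def by linarith
      then have "real (2 * m n j + 1) ^ ?d \<le> (5 * (exp (real n) * (dr * real j ^ ?d))) ^ ?d" by (intro power_mono) auto
      also have "\<dots> = (5 * dr) ^ ?d * exp (dr * real n) * real j ^ (?d * ?d)"
        by (simp add: power_mult_distrib power_mult dr_def exp_of_nat_mult)
      finally show "real ((2 * m n j + 1) ^ ?d) \<le> (5 * dr) ^ ?d * exp (dr * real n) * real j ^ (?d * ?d)" by simp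
      have "real ((j + 3) * j ^ ?d + 1) \<le> (real j + 3) * real j ^ ?d + real j ^ ?d" using jd by simp
      also have "\<dots> = (real j + 4) * real j ^ ?d" by (simp add: algebra_simps)
      also have "\<dots> \<le> (3 * real j) * real j ^ ?d" using j3 by (intro mult_right_mono) auto
      finally show "real ((j + 3) * j ^ ?d + 1) \<le> 3 * real j ^ (?d + 1)" by simp
      have "exp (- ((u n j)\<^sup>2 / (4 * L j))) \<le> exp (- ((dr + 1) * real n) + - (c0/2) * real j powr g)" using expo by simp
      also have "\<dots> = exp (- (dr + 1) * real n) * exp (- (c0/2) * real j powr g)" by (simp only: exp_add minus_mult_left)
      finally show "exp (- ((u n j)\<^sup>2 / (4 * L j))) \<le> exp (- (dr + 1) * real n) * exp (- (c0/2) * real j powr g)" .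
    qed (use dr in auto)
    also have "\<dots> = C1 * (exp (dr * real n) * exp (- (dr + 1) * real n)) * (real j ^ D * exp (- (c0/2) * real j powr g))"
      by (simp add: C1_def D_def power_add)
    also have "exp (dr * real n) * exp (- (dr + 1) * real n) = exp (- real n)"
      by (simp add: exp_add[symmetric] algebra_simps)
    finally show "measure P (Bad n j) \<le> C1 * exp (- real n) * (real j ^ D * exp (- (c0/2) * real j powr g))" .
  qed
  define A where "A n j = (if n \<ge> 1 \<and> j \<in> J n then Bad n j else {})" for n j
  have A: "A n j \<in> sets P" "measure P (A n j) \<le> C1 * exp (- real n) * (real j ^ D * exp (- (c0/2) * real j powr g))" for n j
    using bad[of n j] dr by (auto simp: A_def C1_def)
  have sm: "summable (\<lambda>j. real j ^ D * exp (- (c0/2) * real j powr g))"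
    using c0 g by (intro summable_power_exp_powr) auto
  have BB: "measure P (\<Union>j. A n j) \<le> C1 * exp (- real n) * (\<Sum>j. real j ^ D * exp (- (c0/2) * real j powr g))" for n
  proof -
    have sm': "summable (\<lambda>j. C1 * exp (- real n) * (real j ^ D * exp (- (c0/2) * real j powr g)))" by (intro summable_mult sm)
    have sA: "summable (\<lambda>j. measure P (A n j))" by (rule summable_comparison_test'[OF sm', of 0]) (use A in auto)
    have "measure P (\<Union>j. A n j) \<le> (\<Sum>j. measure P (A n j))"
      by (rule finite_measure_subadditive_countably[OF _ sA]) (use A in auto)
    also have "\<dots> \<le> (\<Sum>j. C1 * exp (- real n) * (real j ^ D * exp (- (c0/2) * real j powr g)))"
      by (rule suminf_le[OF A(2) sA sm'])
    also have "\<dots> = C1 * exp (- real n) * (\<Sum>j. real j ^ D * exp (- (c0/2) * real j powr g))" by (rule suminf_mult[OF sm])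
    finally show ?thesis .
  qed
  have "AE \<omega> in P. eventually (\<lambda>n. \<omega> \<in> space P - (\<Union>j. A n j)) sequentially"
  proof (rule borel_cantelli_AE1)
    show "(\<Union>j. A n j) \<in> sets P" for n using A by (intro sets.countable_UN) auto
    show "emeasure P (\<Union>j. A n j) < \<infinity>" for n by (simp add: emeasure_eq_measure)
    have "summable (\<lambda>n. exp (- 1 :: real) ^ n)" by (rule summable_geometric) simp
    then have "summable (\<lambda>n. C1 * exp (- real n) * (\<Sum>j. real j ^ D * exp (- (c0/2) * real j powr g)))"
      by (intro summable_mult2 summable_mult) (simp add: exp_of_nat_mult[symmetric])
    then show "summable (\<lambda>n. measure P (\<Union>j. A n j))"
      by (rule summable_comparison_test'[of _ 0]) (use BB in auto)
  qed
  then have "AE \<omega> in P. \<forall>\<^sub>F n in sequentially. \<forall>x\<in>cball 0 (exp (real n)). \<forall>r\<ge>(K + 4) * real n powr (1 / dr).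
    \<bar>measure (N \<omega>) (cball x r) - ?w * r ^ ?d\<bar> \<le> r powr q * real n powr (1 - q / dr)"
    using prm_ball_finite[OF prm] AE_space
  proof eventually_elim
    case (elim \<omega>)
    show ?case using elim(1) eventually_ge_at_top[of 1]
    proof eventually_elim
      case (elim n)
      show ?case
      proof (intro ballI allI impI)
        fix z :: "real^'d" and r assume z: "z \<in> cball 0 (exp (real n))" and r: "(K + 4) * real n powr (1 / dr) \<le> r"
        have n1: "real n powr (1/dr) \<ge> 1" using elim dr by (intro ge_one_powr_ge_zero) auto
        define j where "j = nat \<lfloor>r\<rfloor>"
        have "(K + 4) * 1 \<le> (K + 4) * real n powr (1 / dr)" using n1 K by (intro mult_left_mono) auto
        from order_trans[OF this r] have rK: "r \<ge> K + 4" by simp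
        then have j: "real j \<le> r" "r \<le> real j + 1" "real j \<ge> r - 1" "3 \<le> j" unfolding j_def using K by linarith+
        have "K / 2 * real n powr (1/dr) \<le> real j"
        proof -
          have "K / 2 * real n powr (1/dr) + 1 * 1 \<le> K / 2 * real n powr (1/dr) + 4 * real n powr (1/dr)"
            using n1 by linarith
          also have "\<dots> \<le> (K + 4) * real n powr (1/dr)" using K n1 by (simp add: algebra_simps)
          finally show ?thesis using r j by linarith
        qed
        then have jJ: "j \<in> J n" using j by (simp add: J_def)
        then have nb: "\<omega> \<notin> Bad n j" using elim by (auto simp: A_def)
        have jd: "real j ^ ?d > 0" using j by simp
        have "norm z \<le> exp (real n)" using z by simp
        also have "\<dots> = 1 / (dr * real j ^ ?d) * (exp (real n) * (dr * real j ^ ?d))" using jd dr j by simp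
        also have "\<dots> \<le> 1 / (dr * real j ^ ?d) * real (m n j)"
          using dr unfolding m_def by (intro mult_left_mono real_nat_ceiling_ge) auto
        finally have zm: "norm z \<le> 1 / (real ?d * real j ^ ?d) * real (m n j)" by (simp add: dr_def)
        have "\<bar>measure (N \<omega>) (cball z r) - ?w * r ^ ?d\<bar> \<le> u n j + ?w * (2 * real ?d * 2 ^ ?d)"
        proof (rule ball_sandwich[OF _ _ _ _ _ zm])
          show "sets (N \<omega>) = sets borel" by (rule prm_sets[OF prm \<open>\<omega> \<in> space P\<close>])
          show "emeasure (N \<omega>) (cball x r) < \<infinity>" for x r using \<open>\<forall>x r. emeasure (N \<omega>) (cball x r) < \<infinity>\<close> by blast
          fix x :: "real^'d" and i assume x: "x \<in> grid (1 / (real ?d * real j ^ ?d)) (m n j)" and i: "i \<le> (j + 3) * j ^ ?d"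
          show "\<bar>measure (N \<omega>) (cball x (real i * (1 / real j ^ ?d))) - ?w * (real i * (1 / real j ^ ?d)) ^ ?d\<bar> \<le> u n j"
            using nb x i \<open>\<omega> \<in> space P\<close> unfolding Bad_def dr_def by (force simp: not_le intro: less_imp_le)
        qed (use j in auto)
        also have "?w * (2 * real ?d * 2 ^ ?d) = C'" by (simp add: C'_def dr_def)
        also have "C' \<le> r powr q * real n powr (1 - q / dr) / 2"
        proof -
          have "2 * C' \<le> K powr q" by (rule K)
          also have "\<dots> \<le> r powr q" using rK K q' by (intro powr_mono2) auto
          also have "\<dots> * 1 \<le> r powr q * real n powr (1 - q / dr)"
            using elim dr q' by (intro mult_left_mono ge_one_powr_ge_zero) auto
          finally show ?thesis by simp
        qed
        also have "u n j \<le> r powr q * real n powr (1 - q / dr) / 2"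
          unfolding u_def using j q' by (intro divide_right_mono mult_right_mono powr_mono2) auto
        finally show "\<bar>measure (N \<omega>) (cball z r) - ?w * r ^ ?d\<bar> \<le> r powr q * real n powr (1 - q / dr)" by simp
      qed
    qed
  qed
  then show ?thesis using K unfolding dr_def by (intro exI[of _ "K + 4"]) auto
qed

section \<open>Layer-cake representation of the potential\<close>

lemma locally_finite_sigma_finite:
  fixes \<mu> :: "(real^'d::finite) measure"
  assumes "sets \<mu> = sets borel" and "\<And>x r. emeasure \<mu> (cball x r) < \<infinity>"
  shows "sigma_finite_measure \<mu>"
proof
  show "\<exists>A. countable A \<and> A \<subseteq> sets \<mu> \<and> \<Union>A = space \<mu> \<and> (\<forall>a\<in>A. emeasure \<mu> a \<noteq> \<infinity>)"
  proof (intro exI conjI)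
    show "countable (range (\<lambda>k::nat. cball (0::real^'d) (real k)))" by simp
    show "range (\<lambda>k::nat. cball (0::real^'d) (real k)) \<subseteq> sets \<mu>" by (auto simp: assms)
    have "x \<in> (\<Union>k::nat. cball (0::real^'d) (real k))" for x
      using real_arch_simple[of "norm x"] by auto
    then show "\<Union>(range (\<lambda>k::nat. cball (0::real^'d) (real k))) = space \<mu>"
      using sets_eq_imp_space_eq[OF assms(1)] by auto
    show "\<forall>a\<in>range (\<lambda>k::nat. cball (0::real^'d) (real k)). emeasure \<mu> a \<noteq> \<infinity>"
      using assms(2) by (auto simp: less_top)
  qed
qed

lemma powr_tail_nn_integral:
  fixes s R p :: real
  assumes "0 < s" "s \<le> R" "0 < p"
  shows "ennreal (s powr - p) = ennreal (R powr - p) + (\<integral>\<^sup>+r. ennreal (p * r powr (- p - 1)) * indicator {s..R} r \<partial>lborel)"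
proof -
  have "(\<integral>\<^sup>+r. ennreal (p * r powr (- p - 1)) * indicator {s..R} r \<partial>lborel) = ennreal (- (R powr - p) - (- (s powr - p)))"
  proof (rule nn_integral_FTC_Icc)
    show "((\<lambda>r. - (r powr - p)) has_real_derivative p * x powr (- p - 1)) (at x)" if "x \<in> {s..R}" for x
      using that assms by (auto intro!: derivative_eq_intros)
  qed (use assms in auto)
  moreover have "R powr - p \<le> s powr - p" using assms by (intro powr_mono2') auto
  ultimately show ?thesis by (simp add: ennreal_plus[symmetric] del: ennreal_plus)
qed

text \<open>Fubini for the region \<open>dist y x \<le> r \<le> R\<close>, applied to
  \<open>s powr - p\<close> written as its value at \<open>R\<close> plus the integral of its slope.
  For \<open>a = 0\<close> the strict inequality leaves out the centre.\<close>

lemma layer_cake_nn: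
  fixes \<mu> :: "(real^'d::finite) measure" and x :: "real^'d"
  assumes [measurable_cong]: "sets \<mu> = sets borel" and fin: "\<And>x r. emeasure \<mu> (cball x r) < \<infinity>"
    and a: "0 \<le> a" and p: "0 < p"
  shows "(\<integral>\<^sup>+y. ennreal (dist y x powr - p) * indicator {y. a < dist y x \<and> dist y x \<le> R} y \<partial>\<mu>)
    = ennreal (R powr - p) * emeasure \<mu> {y. a < dist y x \<and> dist y x \<le> R}
     + (\<integral>\<^sup>+r. ennreal (p * r powr (- p - 1)) * indicator {a..R} r * emeasure \<mu> {y. a < dist y x \<and> dist y x \<le> r} \<partial>lborel)"
proof -
  interpret sigma_finite_measure \<mu> by (rule locally_finite_sigma_finite[OF assms(1,2)])
  interpret pair_sigma_finite \<mu> lborel ..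
  let ?f = "\<lambda>y r. ennreal (p * r powr (- p - 1)) * indicator {a..R} r * indicator {y. a < dist y x \<and> dist y x \<le> r} y"
  have "(\<integral>\<^sup>+y. ennreal (dist y x powr - p) * indicator {y. a < dist y x \<and> dist y x \<le> R} y \<partial>\<mu>)
    = (\<integral>\<^sup>+y. ennreal (R powr - p) * indicator {y. a < dist y x \<and> dist y x \<le> R} y + (\<integral>\<^sup>+r. ?f y r \<partial>lborel) \<partial>\<mu>)"
  proof (rule nn_integral_cong)
    fix y
    show "ennreal (dist y x powr - p) * indicator {y. a < dist y x \<and> dist y x \<le> R} y
      = ennreal (R powr - p) * indicator {y. a < dist y x \<and> dist y x \<le> R} y + (\<integral>\<^sup>+r. ?f y r \<partial>lborel)"
    proof (cases "a < dist y x \<and> dist y x \<le> R")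
      case True
      have "(\<integral>\<^sup>+r. ?f y r \<partial>lborel) = (\<integral>\<^sup>+r. ennreal (p * r powr (- p - 1)) * indicator {dist y x..R} r \<partial>lborel)"
        by (rule nn_integral_cong) (use True in \<open>auto simp: indicator_def\<close>)
      moreover have "ennreal (dist y x powr - p) = ennreal (R powr - p) + (\<integral>\<^sup>+r. ennreal (p * r powr (- p - 1)) * indicator {dist y x..R} r \<partial>lborel)"
        using True a p by (intro powr_tail_nn_integral) auto
      ultimately show ?thesis using True by simp
    next
      case False
      then have *: "?f y r = 0" for r by (auto simp: indicator_def)
      have "(\<integral>\<^sup>+r. ?f y r \<partial>lborel) = 0" unfolding * by simp
      with False show ?thesis by simp
    qed
  qed
  also have "\<dots> = (\<integral>\<^sup>+y. ennreal (R powr - p) * indicator {y. a < dist y x \<and> dist y x \<le> R} y \<partial>\<mu>) + (\<integral>\<^sup>+y. (\<integral>\<^sup>+r. ?f y r \<partial>lborel) \<partial>\<mu>)"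
    by (rule nn_integral_add) measurable
  also have "(\<integral>\<^sup>+y. ennreal (R powr - p) * indicator {y. a < dist y x \<and> dist y x \<le> R} y \<partial>\<mu>)
     = ennreal (R powr - p) * emeasure \<mu> {y. a < dist y x \<and> dist y x \<le> R}"
    by (rule nn_integral_cmult_indicator) measurable
  also have "(\<integral>\<^sup>+y. (\<integral>\<^sup>+r. ?f y r \<partial>lborel) \<partial>\<mu>) = (\<integral>\<^sup>+r. (\<integral>\<^sup>+y. ?f y r \<partial>\<mu>) \<partial>lborel)"
    by (rule Fubini'[symmetric]) measurable
  also have "\<dots> = (\<integral>\<^sup>+r. ennreal (p * r powr (- p - 1)) * indicator {a..R} r * emeasure \<mu> {y. a < dist y x \<and> dist y x \<le> r} \<partial>lborel)"
    by (intro nn_integral_cong nn_integral_cmult_indicator) measurable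
  finally show ?thesis .
qed

lemma set_integral_nonneg:
  fixes f :: "'a \<Rightarrow> real"
  shows "(\<And>x. x \<in> A \<Longrightarrow> 0 \<le> f x) \<Longrightarrow> 0 \<le> set_lebesgue_integral M A f"
  unfolding set_lebesgue_integral_def by (rule Bochner_Integration.integral_nonneg) (auto simp: indicator_def)

lemma powr_integral_Icc:
  fixes a R e :: real
  assumes "0 < a" "a \<le> R" "e \<noteq> 0"
  shows "set_integrable lborel {a..R} (\<lambda>r. r powr (e - 1))"
    "(LBINT r:{a..R}. r powr (e - 1)) = (R powr e - a powr e) / e"
proof -
  have d: "((\<lambda>r. r powr e / e) has_vector_derivative r powr (e - 1)) (at r within {a..R})" if "a \<le> r" "r \<le> R" for r
    using that assms unfolding has_real_derivative_iff_has_vector_derivative[symmetric]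
    by (auto intro!: derivative_eq_intros)
  have c: "continuous_on {a..R} (\<lambda>r. r powr (e - 1))"
    using assms by (auto intro!: continuous_intros)
  show "(LBINT r:{a..R}. r powr (e - 1)) = (R powr e - a powr e) / e"
    using integral_FTC_Icc[OF assms(2) d c] by (simp add: set_lebesgue_integral_def diff_divide_distrib)
  show "set_integrable lborel {a..R} (\<lambda>r. r powr (e - 1))"
    unfolding set_integrable_def by (rule borel_integrable_compact) (use c in auto)
qed

context
  fixes \<mu> :: "(real^'d::finite) measure"
  assumes sets_mu: "sets \<mu> = sets borel" and fin: "\<And>x r. emeasure \<mu> (cball x r) < \<infinity>"
begin

lemma measure_cball_mono: "r \<le> s \<Longrightarrow> measure \<mu> (cball x r) \<le> measure \<mu> (cball x s)"
  by (rule measure_mono_fmeasurable) (use fin sets_mu in \<open>auto simp: fmeasurable_def\<close>)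

lemma measure_cball_measurable [measurable]: "(\<lambda>r. measure \<mu> (cball x r)) \<in> borel_measurable borel"
  by (rule borel_measurable_mono) (auto intro: monoI measure_cball_mono)

lemma annulus_measure:
  assumes "0 \<le> a" "a \<le> r"
  shows "emeasure \<mu> {y. a < dist y x \<and> dist y x \<le> r} = ennreal (measure \<mu> (cball x r) - measure \<mu> (cball x a))"
proof -
  have eq: "{y. a < dist y x \<and> dist y x \<le> r} = cball x r - cball x a" by (auto simp: dist_commute)
  have sub: "cball x a \<subseteq> cball x r" using assms by auto
  have "emeasure \<mu> (cball x r - cball x a) = emeasure \<mu> (cball x r) - emeasure \<mu> (cball x a)"
    by (rule emeasure_Diff) (use sub sets_mu fin[of x a] in auto)
  also have "\<dots> = ennreal (measure \<mu> (cball x r) - measure \<mu> (cball x a))"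
    using fin by (simp add: emeasure_eq_ennreal_measure ennreal_minus less_top[symmetric])
  finally show ?thesis by (simp add: eq)
qed

lemma kernel_integrable:
  assumes "0 < a" "0 < p"
  shows "set_integrable \<mu> {y. a < dist y x \<and> dist y x \<le> R} (\<lambda>y. dist y x powr - p)"
  unfolding set_integrable_def
proof (rule Bochner_Integration.integrable_bound)
  show "integrable \<mu> (\<lambda>y. indicator (cball x R) y * a powr - p)"
    using fin[of x R] sets_mu by (intro integrable_mult_left integrable_real_indicator) auto
  show "(\<lambda>y. indicat_real {y. a < dist y x \<and> dist y x \<le> R} y *\<^sub>R dist y x powr - p) \<in> borel_measurable \<mu>"
    using sets_mu by (subst measurable_cong_sets[OF sets_mu refl]) measurable
  show "AE y in \<mu>. norm (indicat_real {y. a < dist y x \<and> dist y x \<le> R} y *\<^sub>R dist y x powr - p) \<le> norm (indicator (cball x R) y * a powr - p)"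
    using assms by (auto intro!: AE_I2 powr_mono2' simp: indicator_def dist_commute)
qed

lemma layer_integrable:
  assumes "0 < a" "0 < p"
  shows "set_integrable lborel {a..R} (\<lambda>r. p * r powr (- p - 1) * measure \<mu> (cball x r))"
  unfolding set_integrable_def
proof (rule Bochner_Integration.integrable_bound)
  show "integrable lborel (\<lambda>r. indicator {a..R} r * (p * a powr (- p - 1) * measure \<mu> (cball x R)))"
    by (intro integrable_mult_left integrable_real_indicator) (auto simp: emeasure_lborel_Icc_eq)
  show "(\<lambda>r. indicat_real {a..R} r *\<^sub>R (p * r powr (- p - 1) * measure \<mu> (cball x r))) \<in> borel_measurable lborel"
    by measurable
  show "AE r in lborel. norm (indicat_real {a..R} r *\<^sub>R (p * r powr (- p - 1) * measure \<mu> (cball x r))) \<le>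
      norm (indicator {a..R} r * (p * a powr (- p - 1) * measure \<mu> (cball x R)))"
    using assms by (auto intro!: AE_I2 mult_mono powr_mono2' measure_cball_mono simp: indicator_def)
qed

text \<open>Integration by parts for the counting function
  \<open>r \<mapsto> measure \<mu> (cball x r)\<close>. A real-valued form is wanted because the
  formulas for \<mu> and for Lebesgue measure will be subtracted from each other.\<close>

lemma layer_cake:
  assumes a: "0 < a" "a \<le> R" and p: "0 < p"
  shows "set_lebesgue_integral \<mu> {y. a < dist y x \<and> dist y x \<le> R} (\<lambda>y. dist y x powr - p)
    = R powr - p * measure \<mu> (cball x R) - a powr - p * measure \<mu> (cball x a)
      + (LBINT r:{a..R}. p * r powr (- p - 1) * measure \<mu> (cball x r))"
proof -
  let ?M = "\<lambda>r. measure \<mu> (cball x r)"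
  let ?A = "{y. a < dist y x \<and> dist y x \<le> R}"
  have i1: "set_integrable lborel {a..R} (\<lambda>r. p * r powr (- p - 1) * ?M r)" by (rule layer_integrable) fact+
  have i2: "set_integrable lborel {a..R} (\<lambda>r. p * r powr (- p - 1) * ?M a)"
    using powr_integral_Icc(1)[OF a, of "-p"] p by (intro set_integrable_mult_left set_integrable_mult_right) auto
  have i3: "set_integrable lborel {a..R} (\<lambda>r. p * r powr (- p - 1) * (?M r - ?M a))"
    using set_integral_diff(1)[OF i1 i2] by (simp add: right_diff_distrib)
  have "ennreal (set_lebesgue_integral \<mu> ?A (\<lambda>y. dist y x powr - p)) = (\<integral>\<^sup>+y. ennreal (dist y x powr - p) * indicator ?A y \<partial>\<mu>)"
    using kernel_integrable[OF a(1) p, of x R] unfolding set_lebesgue_integral_def set_integrable_def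
    by (subst nn_integral_eq_integral[symmetric]) (auto intro!: nn_integral_cong simp: indicator_def)
  also have "\<dots> = ennreal (R powr - p) * emeasure \<mu> ?A
     + (\<integral>\<^sup>+r. ennreal (p * r powr (- p - 1)) * indicator {a..R} r * emeasure \<mu> {y. a < dist y x \<and> dist y x \<le> r} \<partial>lborel)"
    using a p by (intro layer_cake_nn sets_mu fin) auto
  also have "(\<integral>\<^sup>+r. ennreal (p * r powr (- p - 1)) * indicator {a..R} r * emeasure \<mu> {y. a < dist y x \<and> dist y x \<le> r} \<partial>lborel)
    = (\<integral>\<^sup>+r. ennreal (indicator {a..R} r *\<^sub>R (p * r powr (- p - 1) * (?M r - ?M a))) \<partial>lborel)"
    using p a by (intro nn_integral_cong) (auto simp: annulus_measure indicator_def ennreal_mult[symmetric] measure_cball_mono)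
  also have "\<dots> = ennreal (LBINT r:{a..R}. p * r powr (- p - 1) * (?M r - ?M a))"
    unfolding set_lebesgue_integral_def using i3 a p
    by (intro nn_integral_eq_integral) (auto simp: set_integrable_def indicator_def measure_cball_mono)
  also have "ennreal (R powr - p) * emeasure \<mu> ?A = ennreal (R powr - p * (?M R - ?M a))"
    using a by (simp add: annulus_measure ennreal_mult[symmetric] measure_cball_mono)
  also have "ennreal (R powr - p * (?M R - ?M a)) + ennreal (LBINT r:{a..R}. p * r powr (- p - 1) * (?M r - ?M a))
    = ennreal (R powr - p * (?M R - ?M a) + (LBINT r:{a..R}. p * r powr (- p - 1) * (?M r - ?M a)))"
    using a p by (intro ennreal_plus[symmetric] set_integral_nonneg) (auto simp: measure_cball_mono)
  finally have "set_lebesgue_integral \<mu> ?A (\<lambda>y. dist y x powr - p) =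
     R powr - p * (?M R - ?M a) + (LBINT r:{a..R}. p * r powr (- p - 1) * (?M r - ?M a))"
    using a p by (subst (asm) ennreal_inj) (auto simp: measure_cball_mono intro!: add_nonneg_nonneg set_integral_nonneg)
  also have "(LBINT r:{a..R}. p * r powr (- p - 1) * (?M r - ?M a)) =
     (LBINT r:{a..R}. p * r powr (- p - 1) * ?M r) - (LBINT r:{a..R}. p * r powr (- p - 1) * ?M a)"
    using set_integral_diff(2)[OF i1 i2] by (simp add: right_diff_distrib)
  also have "(LBINT r:{a..R}. p * r powr (- p - 1) * ?M a) = (a powr - p - R powr - p) * ?M a"
  proof -
    have "p * (LBINT r:{a..R}. r powr (- p - 1)) = a powr - p - R powr - p"
      using powr_integral_Icc(2)[OF a, of "-p"] p by (simp add: field_simps)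
    then show ?thesis by (simp add: mult.commute mult.left_commute)
  qed
  finally show ?thesis by (simp add: algebra_simps)
qed

end

section \<open>Near part and compensated far part of the potential\<close>

definition Vnear :: "real \<Rightarrow> (real^'d::finite) measure \<Rightarrow> real \<Rightarrow> real^'d \<Rightarrow> real" where
  "Vnear p \<mu> r x = set_lebesgue_integral \<mu> (cball x r) (\<lambda>y. dist y x powr - p)"

lemma lborel_cball_fin: "emeasure lborel (cball (x::real^'d::finite) r) < \<infinity>"
  using emeasure_bounded_finite[OF bounded_cball] by simp

lemma lborel_annulus:
  assumes "0 < a" "a \<le> R" "0 < p" "p < real CARD('d)"
  shows "set_lebesgue_integral lborel {y. a < dist y x \<and> dist y x \<le> R} (\<lambda>y. dist y (x::real^'d::finite) powr - p)
    = vd TYPE('d) * real CARD('d) / (real CARD('d) - p) * (R powr (real CARD('d) - p) - a powr (real CARD('d) - p))"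
proof -
  let ?w = "vd TYPE('d)" and ?d = "real CARD('d)"
  have "(LBINT r:{a..R}. p * r powr (- p - 1) * measure lborel (cball x r)) = (LBINT r:{a..R}. p * ?w * r powr ((?d - p) - 1))"
    unfolding set_lebesgue_integral_def
  proof (rule Bochner_Integration.integral_cong)
    fix r
    show "indicat_real {a..R} r *\<^sub>R (p * r powr (- p - 1) * measure lborel (cball x r)) = indicat_real {a..R} r *\<^sub>R (p * ?w * r powr (?d - p - 1))"
    proof (cases "r \<in> {a..R}")
      case True
      then have "r powr (- p - 1) * r ^ CARD('d) = r powr (?d - p - 1)"
        using assms by (simp add: powr_realpow[symmetric] powr_add[symmetric] algebra_simps)
      then show ?thesis using True assms by (simp add: content_cball_vec mult.commute mult.left_commute)
    qed simp
  qed simp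
  also have "\<dots> = p * ?w * ((R powr (?d - p) - a powr (?d - p)) / (?d - p))"
    using assms by (subst powr_integral_Icc(2)[symmetric]) auto
  finally have 1: "(LBINT r:{a..R}. p * r powr (- p - 1) * measure lborel (cball x r)) = p * ?w * ((R powr (?d - p) - a powr (?d - p)) / (?d - p))" .
  have 2: "r powr - p * measure lborel (cball x r) = ?w * r powr (?d - p)" if "r > 0" for r
    using that by (simp add: content_cball_vec powr_realpow[symmetric] powr_add[symmetric])
  have "set_lebesgue_integral lborel {y. a < dist y x \<and> dist y x \<le> R} (\<lambda>y. dist y x powr - p)
    = ?w * R powr (?d - p) - ?w * a powr (?d - p) + p * ?w * ((R powr (?d - p) - a powr (?d - p)) / (?d - p))"
    using layer_cake[of lborel, OF _ lborel_cball_fin assms(1,2,3), of x] assms 1 2[of a] 2[of R] by simp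
  also have "\<dots> = ?w * ?d / (?d - p) * (R powr (?d - p) - a powr (?d - p))"
    using assms by (simp add: divide_simps) (simp add: algebra_simps)
  finally show ?thesis .
qed

text \<open>The radius starts at 0, where the kernel is singular, so the value is computed in
  \<open>ennreal\<close>; the radial density \<open>r powr (d - p - 1)\<close> is integrable at 0
  because \<open>p < d\<close>.\<close>

lemma lborel_ball_nn:
  assumes "0 \<le> R" "0 < p" "p < real CARD('d)"
  shows "(\<integral>\<^sup>+y. ennreal (dist y (x::real^'d::finite) powr - p) * indicator (cball x R) y \<partial>lborel)
    = ennreal (vd TYPE('d) * real CARD('d) / (real CARD('d) - p) * R powr (real CARD('d) - p))"
proof -
  let ?w = "vd TYPE('d)" and ?d = "real CARD('d)"
  have w: "?w \<ge> 0" by simp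
  have m: "emeasure lborel {y. 0 < dist y x \<and> dist y x \<le> r} = ennreal (?w * r powr ?d)" if "r \<ge> 0" for r
    using annulus_measure[of lborel, OF _ lborel_cball_fin, of 0 r x] that
    by (cases "r = 0") (auto simp: content_cball_vec powr_realpow[symmetric])
  have e: "r powr (- p - 1) * r powr ?d = r powr ((?d - p) - 1)" for r :: real
    by (simp add: powr_add[symmetric] algebra_simps)
  have "(\<integral>\<^sup>+y. ennreal (dist y x powr - p) * indicator (cball x R) y \<partial>lborel) =
    (\<integral>\<^sup>+y. ennreal (dist y x powr - p) * indicator {y. 0 < dist y x \<and> dist y x \<le> R} y \<partial>lborel)"
    using assms by (intro nn_integral_cong) (auto simp: indicator_def dist_commute)
  also have "\<dots> = ennreal (R powr - p) * emeasure lborel {y. 0 < dist y x \<and> dist y x \<le> R}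
     + (\<integral>\<^sup>+r. ennreal (p * r powr (- p - 1)) * indicator {0..R} r * emeasure lborel {y. 0 < dist y x \<and> dist y x \<le> r} \<partial>lborel)"
    using lborel_cball_fin assms by (intro layer_cake_nn) auto
  also have "(\<integral>\<^sup>+r. ennreal (p * r powr (- p - 1)) * indicator {0..R} r * emeasure lborel {y. 0 < dist y x \<and> dist y x \<le> r} \<partial>lborel)
    = (\<integral>\<^sup>+r. ennreal (p * ?w * r powr ((?d - p) - 1)) * indicator {0..R} r \<partial>lborel)"
    using assms e by (intro nn_integral_cong) (auto simp: m[simplified] indicator_def ennreal_mult[symmetric] mult.commute mult.left_commute)
  also have "\<dots> = ennreal (p * ?w * (R powr (?d - p) / (?d - p)))"
  proof (rule nn_integral_has_integral_lebesgue')
    show "((\<lambda>r. p * ?w * r powr ((?d - p) - 1)) has_integral p * ?w * (R powr (?d - p) / (?d - p))) {0..R}"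
      using has_integral_mult_right[OF has_integral_powr_from_0[of "?d - p - 1" R], of "p * ?w"] assms by simp
  qed (use assms in auto)
  also have "ennreal (R powr - p) * emeasure lborel {y. 0 < dist y x \<and> dist y x \<le> R} = ennreal (?w * R powr (?d - p))"
    using assms by (simp add: m[simplified] ennreal_mult[symmetric] powr_add[symmetric] mult.left_commute)
  also have "ennreal (?w * R powr (?d - p)) + ennreal (p * ?w * (R powr (?d - p) / (?d - p)))
     = ennreal (?w * R powr (?d - p) + p * ?w * (R powr (?d - p) / (?d - p)))"
    using assms by (intro ennreal_plus[symmetric]) auto
  also have "?w * R powr (?d - p) + p * ?w * (R powr (?d - p) / (?d - p)) = ?w * ?d / (?d - p) * R powr (?d - p)"
    using assms by (simp add: divide_simps) (simp add: algebra_simps)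
  finally show ?thesis .
qed

lemma lborel_unit_ball:
  assumes "0 < p" "p < real CARD('d)"
  shows "set_lebesgue_integral lborel (cball (0::real^'d::finite) 1) (\<lambda>y. norm y powr - p) = vd TYPE('d) * real CARD('d) / (real CARD('d) - p)"
proof -
  have "set_lebesgue_integral lborel (cball (0::real^'d::finite) 1) (\<lambda>y. norm y powr - p) =
    enn2real (\<integral>\<^sup>+y. ennreal (indicator (cball 0 1) y *\<^sub>R norm (y::real^'d) powr - p) \<partial>lborel)"
    unfolding set_lebesgue_integral_def
  proof (rule integral_eq_nn_integral)
    have [measurable]: "cball (0::real^'d) 1 \<in> sets borel" by simp
    have "(\<lambda>y::real^'d. indicat_real (cball 0 1) y *\<^sub>R norm y powr - p) \<in> borel_measurable borel" by measurable
    then show "(\<lambda>y::real^'d. indicat_real (cball 0 1) y *\<^sub>R norm y powr - p) \<in> borel_measurable lborel" by simp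
  qed auto
  also have "(\<integral>\<^sup>+y. ennreal (indicator (cball 0 1) y *\<^sub>R norm (y::real^'d) powr - p) \<partial>lborel) =
     (\<integral>\<^sup>+y. ennreal (dist y (0::real^'d) powr - p) * indicator (cball 0 1) y \<partial>lborel)"
    by (intro nn_integral_cong) (auto simp: indicator_def)
  also have "\<dots> = ennreal (vd TYPE('d) * real CARD('d) / (real CARD('d) - p))"
    using lborel_ball_nn[of 1 p "0::real^'d"] assms by simp
  finally show ?thesis using assms by simp
qed

text \<open>For \<open>a = 1\<close> this is the expression whose limit in \<open>R\<close> occurs
  in \<open>Vbar\<close>.\<close>

definition Vfar :: "real \<Rightarrow> (real^'d::finite) measure \<Rightarrow> real^'d \<Rightarrow> real \<Rightarrow> real \<Rightarrow> real" where
  "Vfar p \<mu> x a R = set_lebesgue_integral \<mu> {y. a < dist y x \<and> dist y x \<le> R} (\<lambda>y. dist y x powr - p)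
     - set_lebesgue_integral lborel {y. a < dist y x \<and> dist y x \<le> R} (\<lambda>y. dist y x powr - p)"

text \<open>After integration by parts the two measures enter only through the discrepancy
  \<open>D r\<close>. It is of order \<open>r powr q\<close> with \<open>q < p\<close>, so the
  boundary term at \<open>R\<close> vanishes and the density
  \<open>p * r powr (- p - 1) * D r\<close> is integrable. Thus the limit in \<open>Vbar\<close>,
  which \<open>Lim\<close> by itself does not guarantee, exists.\<close>

lemma far_limit:
  fixes \<mu> :: "(real^'d::finite) measure" and x :: "real^'d"
  assumes sets: "sets \<mu> = sets borel" and fin: "\<And>x r. emeasure \<mu> (cball x r) < \<infinity>"
    and p: "0 < p" "p < real CARD('d)" and q: "0 < q" "q < p" and \<rho>: "1 \<le> \<rho>" and A: "0 \<le> A"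
    and disc: "\<And>r. \<rho> \<le> r \<Longrightarrow> \<bar>measure \<mu> (cball x r) - vd TYPE('d) * r ^ CARD('d)\<bar> \<le> A * r powr q"
  shows "\<exists>T. \<bar>T\<bar> \<le> A * p / (p - q) * \<rho> powr (q - p) \<and>
    ((\<lambda>R. Vfar p \<mu> x 1 R) \<longlongrightarrow> Vfar p \<mu> x 1 \<rho> + (- (\<rho> powr - p * (measure \<mu> (cball x \<rho>) - vd TYPE('d) * \<rho> ^ CARD('d))) + T)) at_top"
proof -
  let ?w = "vd TYPE('d)" and ?d = "real CARD('d)"
  define D where "D r = measure \<mu> (cball x r) - ?w * r ^ CARD('d)" for r
  have Dm [measurable]: "D \<in> borel_measurable borel"
    unfolding D_def using measure_cball_measurable[OF sets fin] by measurable
  let ?k = "\<lambda>y. dist y x powr - p"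
  let ?F = "\<lambda>a R. set_lebesgue_integral \<mu> {y. a < dist y x \<and> dist y x \<le> R} ?k - set_lebesgue_integral lborel {y. a < dist y x \<and> dist y x \<le> R} ?k"
  have FD: "?F a R = R powr - p * D R - a powr - p * D a + (LBINT r:{a..R}. p * r powr (- p - 1) * D r)" if "0 < a" "a \<le> R" for a R
  proof -
    have "(LBINT r:{a..R}. p * r powr (- p - 1) * D r) = (LBINT r:{a..R}. p * r powr (- p - 1) * measure \<mu> (cball x r)) - (LBINT r:{a..R}. p * r powr (- p - 1) * measure lborel (cball x r))"
      using that
      by (subst set_integral_diff(2)[symmetric, OF layer_integrable[OF sets fin that(1) p(1)] layer_integrable[of lborel, OF _ lborel_cball_fin that(1) p(1)]])
        (auto simp: set_lebesgue_integral_def D_def content_cball_vec right_diff_distrib indicator_def intro!: Bochner_Integration.integral_cong)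
    then show ?thesis
      using layer_cake[OF sets fin that p(1), of x] layer_cake[of lborel, OF _ lborel_cball_fin that p(1), of x] that
      by (simp add: D_def content_cball_vec algebra_simps)
  qed
  define f where "f r = p * r powr (- p - 1) * D r" for r
  have fb: "\<bar>f r\<bar> \<le> p * A * r powr ((q - p) - 1)" if "\<rho> \<le> r" for r
  proof -
    have "\<bar>f r\<bar> = p * r powr (- p - 1) * \<bar>D r\<bar>" using p by (simp add: f_def abs_mult)
    also have "\<dots> \<le> p * r powr (- p - 1) * (A * r powr q)" using disc[OF that] p by (intro mult_left_mono) (auto simp: D_def)
    also have "\<dots> = p * A * r powr ((q - p) - 1)" by (simp add: powr_add[symmetric] algebra_simps)
    finally show ?thesis .
  qed
  have hi: "((\<lambda>r. r powr ((q - p) - 1)) has_integral - (\<rho> powr (q - p)) / (q - p)) {\<rho>..}"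
    using has_integral_powr_to_inf[of "q - p - 1" \<rho>] q \<rho> by simp
  have nn: "(\<integral>\<^sup>+r. ennreal (p * A * r powr ((q - p) - 1)) * indicator {\<rho>..} r \<partial>lborel) = ennreal (p * A * (- (\<rho> powr (q - p)) / (q - p)))"
    by (rule nn_integral_has_integral_lebesgue'[OF _ has_integral_mult_right[OF hi]]) (use p A in auto)
  have bi: "integrable lborel (\<lambda>r. indicator {\<rho>..} r *\<^sub>R (p * A * r powr ((q - p) - 1)))"
    "(LBINT r:{\<rho>..}. p * A * r powr ((q - p) - 1)) = p * A * (- (\<rho> powr (q - p)) / (q - p))"
  proof -
    have e: "ennreal (indicator {\<rho>..} r *\<^sub>R (p * A * r powr ((q - p) - 1))) = ennreal (p * A * r powr ((q - p) - 1)) * indicator {\<rho>..} r" for r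
      by (auto simp: indicator_def)
    have c: "p * A * (- (\<rho> powr (q - p)) / (q - p)) \<ge> 0" using p q A by (intro mult_nonneg_nonneg divide_nonpos_neg) auto
    have "has_bochner_integral lborel (\<lambda>r. indicator {\<rho>..} r *\<^sub>R (p * A * r powr ((q - p) - 1))) (p * A * (- (\<rho> powr (q - p)) / (q - p)))"
      using nn c p A unfolding e[symmetric] by (intro has_bochner_integral_nn_integral) (auto simp: indicator_def)
    then show "integrable lborel (\<lambda>r. indicator {\<rho>..} r *\<^sub>R (p * A * r powr ((q - p) - 1)))"
      "(LBINT r:{\<rho>..}. p * A * r powr ((q - p) - 1)) = p * A * (- (\<rho> powr (q - p)) / (q - p))"
      unfolding has_bochner_integral_iff set_lebesgue_integral_def by blast+
  qed
  have fi: "set_integrable lborel {\<rho>..} f"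
    unfolding set_integrable_def
    by (rule Bochner_Integration.integrable_bound[OF bi(1)]) (use fb p A in \<open>auto simp: indicator_def f_def\<close>)
  define T where "T = (LBINT r:{\<rho>..}. f r)"
  have T: "\<bar>T\<bar> \<le> A * p / (p - q) * \<rho> powr (q - p)"
  proof -
    have "\<bar>T\<bar> \<le> (LBINT r:{\<rho>..}. p * A * r powr ((q - p) - 1))"
      unfolding T_def set_lebesgue_integral_def real_norm_def[symmetric]
      by (rule Bochner_Integration.integral_norm_bound_integral) (use fi bi(1) fb in \<open>auto simp: set_integrable_def indicator_def\<close>)
    also have "\<dots> = A * p / (p - q) * \<rho> powr (q - p)" unfolding bi(2) using q by (simp add: field_simps)
    finally show ?thesis .
  qed
  have lim: "((\<lambda>R. ?F \<rho> R) \<longlongrightarrow> - (\<rho> powr - p * D \<rho>) + T) at_top"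
  proof -
    have l1: "((\<lambda>R. LBINT r:{\<rho>..R}. f r) \<longlongrightarrow> T) at_top"
      unfolding T_def by (rule tendsto_set_lebesgue_integral_at_top[OF _ fi]) auto
    have l2: "((\<lambda>R. R powr - p * D R) \<longlongrightarrow> 0) at_top"
    proof (rule Lim_null_comparison)
      show "\<forall>\<^sub>F R in at_top. norm (R powr - p * D R) \<le> A * R powr (q - p)"
        using eventually_ge_at_top[of \<rho>]
      proof eventually_elim
        case (elim R)
        have "norm (R powr - p * D R) = R powr - p * \<bar>D R\<bar>" by (simp add: abs_mult)
        also have "\<dots> \<le> R powr - p * (A * R powr q)" using disc[OF elim] by (intro mult_left_mono) (auto simp: D_def)
        also have "\<dots> = A * R powr (q - p)" by (simp add: powr_add[symmetric] algebra_simps)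
        finally show ?case .
      qed
      show "((\<lambda>R. A * R powr (q - p)) \<longlongrightarrow> 0) at_top"
        by (rule tendsto_mult_right_zero) (use q in real_asymp)
    qed
    have "((\<lambda>R. R powr - p * D R - \<rho> powr - p * D \<rho> + (LBINT r:{\<rho>..R}. f r)) \<longlongrightarrow> 0 - (\<rho> powr - p * D \<rho>) + T) at_top"
      by (intro tendsto_intros l1 l2)
    then show ?thesis
    proof (rule Lim_transform_eventually[THEN tendsto_eq_rhs])
      show "\<forall>\<^sub>F R in at_top. R powr - p * D R - \<rho> powr - p * D \<rho> + (LBINT r:{\<rho>..R}. f r) = ?F \<rho> R"
        using eventually_ge_at_top[of \<rho>] by eventually_elim (use FD \<rho> in \<open>auto simp: f_def[abs_def]\<close>)
    qed simp
  qed
  have split: "set_lebesgue_integral \<nu> {y. 1 < dist y x \<and> dist y x \<le> R} ?k =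
     set_lebesgue_integral \<nu> {y. 1 < dist y x \<and> dist y x \<le> \<rho>} ?k + set_lebesgue_integral \<nu> {y. \<rho> < dist y x \<and> dist y x \<le> R} ?k"
    if "\<rho> \<le> R" "sets \<nu> = sets borel" "\<And>x r. emeasure \<nu> (cball x r) < \<infinity>" for R and \<nu> :: "(real^'d) measure"
  proof -
    have "{y. 1 < dist y x \<and> dist y x \<le> R} = {y. 1 < dist y x \<and> dist y x \<le> \<rho>} \<union> {y. \<rho> < dist y x \<and> dist y x \<le> R}"
      using \<rho> that by auto
    then show ?thesis using \<rho> p by (simp only:) (intro set_integral_Un kernel_integrable that; auto)
  qed
  have "((\<lambda>R. ?F 1 R) \<longlongrightarrow> ?F 1 \<rho> + (- (\<rho> powr - p * D \<rho>) + T)) at_top"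
  proof (rule Lim_transform_eventually)
    show "((\<lambda>R. ?F 1 \<rho> + ?F \<rho> R) \<longlongrightarrow> ?F 1 \<rho> + (- (\<rho> powr - p * D \<rho>) + T)) at_top"
      by (intro tendsto_add tendsto_const lim)
    show "\<forall>\<^sub>F R in at_top. ?F 1 \<rho> + ?F \<rho> R = ?F 1 R"
      using eventually_ge_at_top[of \<rho>]
    proof eventually_elim
      case (elim R)
      show ?case using split[OF elim sets fin] split[OF elim _ lborel_cball_fin] by simp
    qed
  qed
  with T show ?thesis unfolding Vfar_def D_def by blast
qed

text \<open>\<open>W\<close> is the integral over \<open>cball x \<rho>\<close> of the truncated
  kernel \<open>dist y x powr - p - \<rho> powr - p\<close> against \<mu>, minus its Lebesgue
  integral. Since the truncated kernel vanishes on the sphere, the boundary term of the integration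
  by parts is absorbed and only the tail integral remains as an error.\<close>

lemma Vbar_repr:
  fixes \<mu> :: "(real^'d::finite) measure" and x :: "real^'d"
  assumes sets: "sets \<mu> = sets borel" and fin: "\<And>x r. emeasure \<mu> (cball x r) < \<infinity>"
    and p: "0 < p" "p < real CARD('d)" and q: "0 < q" "q < p" and \<rho>: "1 \<le> \<rho>" and A: "0 \<le> A"
    and disc: "\<And>r. \<rho> \<le> r \<Longrightarrow> \<bar>measure \<mu> (cball x r) - vd TYPE('d) * r ^ CARD('d)\<bar> \<le> A * r powr q"
    and near: "set_integrable \<mu> (cball x 1) (\<lambda>y. dist y x powr - p)"
  defines "W \<equiv> Vnear p \<mu> \<rho> x - \<rho> powr - p * measure \<mu> (cball x \<rho>) - vd TYPE('d) * p / (real CARD('d) - p) * \<rho> powr (real CARD('d) - p)"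
  shows "\<bar>Vbar p \<mu> x - W\<bar> \<le> A * p / (p - q) * \<rho> powr (q - p)"
proof -
  let ?w = "vd TYPE('d)" and ?d = "real CARD('d)"
  let ?k = "\<lambda>y. dist y x powr - p"
  define D where "D r = measure \<mu> (cball x r) - ?w * r ^ CARD('d)" for r
  obtain T where T: "\<bar>T\<bar> \<le> A * p / (p - q) * \<rho> powr (q - p)"
    and lim: "((\<lambda>R. Vfar p \<mu> x 1 R) \<longlongrightarrow> Vfar p \<mu> x 1 \<rho> + (- (\<rho> powr - p * D \<rho>) + T)) at_top"
    using far_limit[OF sets fin p q \<rho> A disc] unfolding D_def by blast
  have nearsplit: "Vnear p \<mu> R x = Vnear p \<mu> 1 x + set_lebesgue_integral \<mu> {y. 1 < dist y x \<and> dist y x \<le> R} ?k" if "1 \<le> R" for R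
  proof -
    have "cball x R = cball x 1 \<union> {y. 1 < dist y x \<and> dist y x \<le> R}" using that by (auto simp: dist_commute)
    then show ?thesis using p unfolding Vnear_def
      by (simp only:) (intro set_integral_Un kernel_integrable sets fin near; auto simp: dist_commute)
  qed
  have "Lim at_top (\<lambda>R. Vfar p \<mu> x 1 R) = Vfar p \<mu> x 1 \<rho> + (- (\<rho> powr - p * D \<rho>) + T)" using lim by (intro tendsto_Lim) auto
  then have V: "Vbar p \<mu> x = Vnear p \<mu> 1 x - ?w * ?d / (?d - p) + (Vfar p \<mu> x 1 \<rho> + (- (\<rho> powr - p * D \<rho>) + T))"
    unfolding Vbar_def Vnear_def Vfar_def[abs_def] using lborel_unit_ball[OF p] by simp
  have la: "set_lebesgue_integral lborel {y. 1 < dist y x \<and> dist y x \<le> R} ?k = ?w * ?d / (?d - p) * (R powr (?d - p) - 1)" if "1 \<le> R" for R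
    using lborel_annulus[of 1 R p x] that p by simp
  have "Vbar p \<mu> x = W + T"
  proof -
    have e: "\<rho> powr - p * \<rho> ^ CARD('d) = \<rho> powr (?d - p)" using \<rho> by (simp add: powr_realpow[symmetric] powr_add[symmetric])
    have "Vbar p \<mu> x = Vnear p \<mu> \<rho> x - ?w * ?d / (?d - p) * \<rho> powr (?d - p) - \<rho> powr - p * D \<rho> + T"
      unfolding V Vfar_def nearsplit[OF \<rho>] la[OF \<rho>] by (simp add: right_diff_distrib)
    also have "\<rho> powr - p * D \<rho> = \<rho> powr - p * measure \<mu> (cball x \<rho>) - ?w * \<rho> powr (?d - p)"
      by (simp add: D_def right_diff_distrib mult.left_commute e)
    also have "Vnear p \<mu> \<rho> x - ?w * ?d / (?d - p) * \<rho> powr (?d - p) - (\<rho> powr - p * measure \<mu> (cball x \<rho>) - ?w * \<rho> powr (?d - p)) = W"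
      unfolding W_def using p by (simp add: divide_simps) (simp add: algebra_simps)
    finally show ?thesis .
  qed
  then show "\<bar>Vbar p \<mu> x - W\<bar> \<le> A * p / (p - q) * \<rho> powr (q - p)" using T by simp
qed

section \<open>The variational constant\<close>

text \<open>Right end points bound the integral of a decreasing function from below, left end points
  from above. A start at \<open>k * \<delta>\<close> with \<open>k > 0\<close> keeps away from the
  singularity of the kernel at volume 0.\<close>

lemma riemann_sum_antimono:
  fixes f :: "real \<Rightarrow> real"
  assumes c: "continuous_on {real k * \<delta>..real n * \<delta>} f" and kn: "k \<le> n" and d: "0 \<le> \<delta>"
    and mono: "\<And>x y. real k * \<delta> \<le> x \<Longrightarrow> x \<le> y \<Longrightarrow> y \<le> real n * \<delta> \<Longrightarrow> f y \<le> f x"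
  shows "(\<Sum>l=Suc k..n. \<delta> * f (real l * \<delta>)) \<le> integral {real k * \<delta>..real n * \<delta>} f"
    and "integral {real k * \<delta>..real n * \<delta>} f \<le> (\<Sum>l=k..<n. \<delta> * f (real l * \<delta>))"
proof -
  have "(\<Sum>l=Suc k..n. \<delta> * f (real l * \<delta>)) \<le> integral {real k * \<delta>..real n * \<delta>} f \<and>
    integral {real k * \<delta>..real n * \<delta>} f \<le> (\<Sum>l=k..<n. \<delta> * f (real l * \<delta>))"
    using kn c mono
  proof (induction n rule: dec_induct)
    case base
    then show ?case by simp
  next
    case (step n)
    let ?a = "real k * \<delta>" and ?b = "real n * \<delta>" and ?c = "real (Suc n) * \<delta>"
    have ab: "?a \<le> ?b" "?b \<le> ?c" using step(1) d by (auto intro: mult_right_mono)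
    have ci: "f integrable_on {?a..?c}" using step.prems(1) by (intro integrable_continuous_interval)
    have c1: "continuous_on {?a..?b} f" using step.prems(1) ab by (rule_tac continuous_on_subset) auto
    have ci2: "f integrable_on {?b..?c}" using step.prems(1) ab by (intro integrable_continuous_interval) (auto intro: continuous_on_subset)
    have IH: "(\<Sum>l=Suc k..n. \<delta> * f (real l * \<delta>)) \<le> integral {?a..?b} f \<and> integral {?a..?b} f \<le> (\<Sum>l=k..<n. \<delta> * f (real l * \<delta>))"
      using c1 step.prems(2) ab by (intro step.IH) auto
    have split: "integral {?a..?c} f = integral {?a..?b} f + integral {?b..?c} f"
      by (rule Henstock_Kurzweil_Integration.integral_combine[symmetric, OF ab ci])
    have len: "?c - ?b = \<delta>" by (simp add: algebra_simps)
    have lo: "\<delta> * f ?c \<le> integral {?b..?c} f"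
    proof -
      have "integral {?b..?c} (\<lambda>_. f ?c) \<le> integral {?b..?c} f"
        using step.prems(2) ab by (intro integral_le ci2) auto
      then show ?thesis using ab len by simp
    qed
    have up: "integral {?b..?c} f \<le> \<delta> * f ?b"
    proof -
      have "integral {?b..?c} f \<le> integral {?b..?c} (\<lambda>_. f ?b)"
        using step.prems(2) ab by (intro integral_le ci2) auto
      then show ?thesis using ab len by simp
    qed
    show ?case using IH split lo up step(1) by simp
  qed
  then show "(\<Sum>l=Suc k..n. \<delta> * f (real l * \<delta>)) \<le> integral {real k * \<delta>..real n * \<delta>} f"
    "integral {real k * \<delta>..real n * \<delta>} f \<le> (\<Sum>l=k..<n. \<delta> * f (real l * \<delta>))" by auto
qed

text \<open>\<open>exp (- h) - 1 + h\<close> is the logarithm of the Laplace transform of a centred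
  Poisson variable per unit of mean, and \<open>1 - exp (- h) - h * exp (- h)\<close> is the entropy
  \<open>1 - c + c * ln c\<close> at \<open>c = exp (- h)\<close>. Both are quadratic for small
  \<open>h\<close>; with \<open>h = s * v powr - be\<close> this makes them integrable at infinity
  because \<open>be > 1/2\<close>.\<close>

lemma phi_bounds:
  fixes h :: real assumes "0 \<le> h"
  shows "0 \<le> exp (- h) - 1 + h" "exp (- h) - 1 + h \<le> h\<^sup>2"
    "0 \<le> 1 - exp (- h) - h * exp (- h)" "1 - exp (- h) - h * exp (- h) \<le> h\<^sup>2"
    "0 \<le> 1 - exp (- h)" "1 - exp (- h) \<le> h"
proof -
  have e: "1 - h \<le> exp (- h)" using exp_ge_add_one_self[of "-h"] by simp
  then show "0 \<le> exp (- h) - 1 + h" "1 - exp (- h) \<le> h" by auto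
  show "0 \<le> 1 - exp (- h)" using assms by simp
  have "exp (- h) * (1 + h) \<le> exp (- h) * exp h" by (intro mult_left_mono) auto
  then have e2: "exp (- h) * (1 + h) \<le> 1" by (simp add: exp_minus)
  then show "0 \<le> 1 - exp (- h) - h * exp (- h)" by (simp add: algebra_simps)
  have "(1 + h) * (1 - h) \<le> (1 + h) * exp (- h)" using e assms by (intro mult_left_mono) auto
  then show "1 - exp (- h) - h * exp (- h) \<le> h\<^sup>2" by (simp add: algebra_simps power2_eq_square)
  have "exp (- h) \<le> 1 / (1 + h)" using e2 assms by (simp add: field_simps)
  also have "\<dots> \<le> 1 - h + h\<^sup>2" using assms by (simp add: field_simps power2_eq_square)
  finally show "exp (- h) - 1 + h \<le> h\<^sup>2" by simp
qed

lemma phi_mono: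
  fixes h k :: real assumes "0 \<le> h" "h \<le> k"
  shows "exp (- h) - 1 + h \<le> exp (- k) - 1 + k"
    and "1 - exp (- h) - h * exp (- h) \<le> 1 - exp (- k) - k * exp (- k)"
proof -
  show "exp (- h) - 1 + h \<le> exp (- k) - 1 + k"
  proof (rule DERIV_nonneg_imp_nondecreasing[OF assms(2)])
    fix x :: real assume "h \<le> x" "x \<le> k"
    then show "\<exists>y. DERIV (\<lambda>x. exp (- x) - 1 + x) x :> y \<and> 0 \<le> y"
      using assms by (intro exI[of _ "1 - exp (- x)"]) (auto intro!: derivative_eq_intros)
  qed
  show "1 - exp (- h) - h * exp (- h) \<le> 1 - exp (- k) - k * exp (- k)"
  proof (rule DERIV_nonneg_imp_nondecreasing[OF assms(2)])
    fix x :: real assume "h \<le> x" "x \<le> k"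
    then show "\<exists>y. DERIV (\<lambda>x. 1 - exp (- x) - x * exp (- x)) x :> y \<and> 0 \<le> y"
      using assms by (intro exI[of _ "x * exp (- x)"]) (auto intro!: derivative_eq_intros)
  qed
qed

section \<open>Integrals of the optimal profile in the volume variable\<close>

locale rate_calculus =
  fixes be s :: real
  assumes be: "1/2 < be" "be < 1" and s: "0 < s"
begin

abbreviation "h v \<equiv> s * v powr - be"
abbreviation "G2 \<equiv> Gamma (2 - 1 / be)"
text \<open>The lower incomplete Gamma function at \<open>2 - 1 / be\<close>, a positive number
  since \<open>be > 1/2\<close>.\<close>

definition "gint u = integral {0..u} (\<lambda>t. t powr (1 - 1/be) / exp t)"
text \<open>The integral of \<open>be * (h v)\<^sup>2 * exp (- h v)\<close> over
  \<open>{a..b}\<close> after the substitution \<open>t = h v\<close>; the factor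
  \<open>s powr (1 / be)\<close> stems from the change of variable.\<close>

definition "J a b = s powr (1 / be) * (gint (h a) - gint (h b))"

lemma G2_integral: "((\<lambda>t. t powr (1 - 1/be) / exp t) has_integral G2) {0..}"
proof -
  have "0 < 2 - 1/be" using be by (simp add: field_simps)
  from Gamma_integral_real[OF this] show ?thesis by simp
qed

lemma G2_pos: "G2 > 0"
  using be by (intro Gamma_real_pos) (simp add: field_simps)

lemma g_integrable: "0 \<le> u \<Longrightarrow> (\<lambda>t. t powr (1 - 1/be) / exp t) integrable_on {0..u}"
  using G2_integral by (intro integrable_on_subinterval[of _ "{0..}"]) (auto simp: integrable_on_def)

lemma gint_le: "0 \<le> u \<Longrightarrow> gint u \<le> G2"
proof -
  assume "0 \<le> u"
  then have "gint u \<le> integral {0..} (\<lambda>t. t powr (1 - 1/be) / exp t)"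
    unfolding gint_def using G2_integral
    by (intro integral_subset_le g_integrable) (auto simp: integrable_on_def)
  then show ?thesis using G2_integral by (simp add: integral_unique)
qed

lemma gint_nonneg: "0 \<le> gint u"
  unfolding gint_def by (cases "0 \<le> u") (auto intro!: integral_nonneg g_integrable)

lemma gint_deriv: "0 < u \<Longrightarrow> (gint has_real_derivative u powr (1 - 1/be) / exp u) (at u)"
proof -
  assume u: "0 < u"
  let ?g = "\<lambda>t. t powr (1 - 1/be) / exp t :: real"
  have "((\<lambda>x. integral {0..x} ?g) has_vector_derivative ?g u) (at u within {0..u+1} - {})"
  proof (rule integral_has_vector_derivative_continuous_at)
    have "isCont ?g u" using u by (auto intro!: continuous_intros)
    then show "continuous (at u within {0..u+1} - {}) ?g" by (rule continuous_at_imp_continuous_at_within)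
  qed (use u g_integrable in auto)
  moreover have "at u within {0..u+1} - {} = at u" using u by (simp add: at_within_Icc_at)
  ultimately show ?thesis unfolding has_real_derivative_iff_has_vector_derivative gint_def[abs_def] by simp
qed

lemma gint_at_0: "(gint \<longlongrightarrow> 0) (at_right 0)"
proof -
  have "continuous_on {0..1} gint" unfolding gint_def[abs_def]
    by (rule indefinite_integral_continuous_1) (rule g_integrable, simp)
  then have "(gint \<longlongrightarrow> gint 0) (at 0 within {0..1})" by (simp add: continuous_on_def)
  then show ?thesis by (simp add: gint_def at_within_Icc_at_right)
qed

lemma gint_at_top: "(gint \<longlongrightarrow> G2) at_top"
proof -
  let ?g = "\<lambda>t. t powr (1 - 1/be) / exp t :: real"
  have nn: "(\<integral>\<^sup>+x. ennreal (indicator {0..} x *\<^sub>R ?g x) \<partial>lborel) = ennreal G2"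
    using nn_integral_has_integral_lebesgue'[OF _ G2_integral] by (simp add: indicator_mult_ennreal mult.commute)
  have hb: "has_bochner_integral lborel (\<lambda>x. indicator {0..} x *\<^sub>R ?g x) G2"
    using nn G2_pos by (intro has_bochner_integral_nn_integral) (auto simp: indicator_def)
  then have si: "set_integrable lborel {0..} ?g" "(LBINT x:{0..}. ?g x) = G2"
    by (auto simp: has_bochner_integral_iff set_integrable_def set_lebesgue_integral_def)
  have "((\<lambda>b. LBINT x:{0..b}. ?g x) \<longlongrightarrow> G2) at_top"
    using tendsto_set_lebesgue_integral_at_top[OF _ si(1)] si(2) by simp
  moreover have "(LBINT x:{0..b}. ?g x) = gint b" for b
    unfolding gint_def by (rule set_borel_integral_eq_integral(2)) (rule set_integrable_subset[OF si(1)]; auto)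
  ultimately show ?thesis by simp
qed

lemma h_pos: "0 < v \<Longrightarrow> 0 < h v" using s by simp

lemma h_deriv: "0 < v \<Longrightarrow> (h has_real_derivative - (be * h v / v)) (at v)"
  by (auto intro!: derivative_eq_intros simp: powr_diff field_simps)

lemma J_bounds: "0 < a \<Longrightarrow> a \<le> b \<Longrightarrow> J a b \<le> s powr (1/be) * G2"
  unfolding J_def using gint_le[of "h a"] gint_nonneg[of "h b"] h_pos[of a] by (intro mult_left_mono) auto

lemma J_integral:
  assumes "0 < a" "a \<le> b"
  shows "((\<lambda>v. be * (h v)\<^sup>2 * exp (- h v)) has_integral J a b) {a..b}"
proof -
  have "((\<lambda>v. be * (h v)\<^sup>2 * exp (- h v)) has_integral (- (s powr (1/be)) * gint (h b)) - (- (s powr (1/be)) * gint (h a))) {a..b}"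
  proof (rule fundamental_theorem_of_calculus[OF assms(2)])
    fix v assume v: "v \<in> {a..b}"
    then have v0: "0 < v" using assms by simp
    have "((\<lambda>v. - (s powr (1/be)) * gint (h v)) has_real_derivative - (s powr (1/be)) * ((h v) powr (1 - 1/be) / exp (h v) * (- (be * h v / v)))) (at v)"
      by (intro DERIV_cmult DERIV_chain2[OF gint_deriv h_deriv] h_pos v0)
    moreover have "- (s powr (1/be)) * ((h v) powr (1 - 1/be) / exp (h v) * (- (be * h v / v))) = be * (h v)\<^sup>2 * exp (- h v)"
    proof -
      have "(h v) powr (1 - 1/be) = h v * (h v) powr (- (1/be))"
        using powr_mult_base[OF less_imp_le[OF h_pos[OF v0]], of "- (1/be)"] by simp
      also have "(h v) powr (- (1/be)) = s powr (- (1/be)) * v" using be v0 s by (simp add: powr_mult powr_powr)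
      finally have "s powr (1/be) * (h v) powr (1 - 1/be) = h v * v" using s by (simp add: powr_minus field_simps)
      then have "- (s powr (1/be)) * ((h v) powr (1 - 1/be) / exp (h v) * (- (be * h v / v))) = (h v * v) * (be * h v / v) / exp (h v)"
        by (simp add: field_simps)
      also have "\<dots> = be * (h v)\<^sup>2 * exp (- h v)" using v0 by (simp add: power2_eq_square exp_minus field_simps)
      finally show ?thesis .
    qed
    ultimately show "((\<lambda>v. - (s powr (1/be)) * gint (h v)) has_vector_derivative be * (h v)\<^sup>2 * exp (- h v)) (at v within {a..b})"
      by (simp add: has_real_derivative_iff_has_vector_derivative has_vector_derivative_at_within)
  qed
  then show ?thesis by (simp add: J_def algebra_simps)
qed

lemma FTC_real:
  assumes "a \<le> b" "\<And>v. a \<le> v \<Longrightarrow> v \<le> b \<Longrightarrow> (F has_real_derivative f v) (at v)"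
  shows "(f has_integral F b - F a) {a..b}"
  by (rule fundamental_theorem_of_calculus[OF assms(1)])
    (use assms in \<open>auto simp: has_real_derivative_iff_has_vector_derivative intro: has_vector_derivative_at_within\<close>)

text \<open>Since \<open>h v\<close> has logarithmic derivative \<open>- be / v\<close>, the
  derivative of \<open>v\<close> times the integrand is the integrand minus
  \<open>be * (h v)\<^sup>2 * exp (- h v)\<close>, whose integral is \<open>J\<close>. The next two
  integrals are found by the same device and end in \<open>J\<close> as well.\<close>

lemma psi_integral:
  assumes "0 < a" "a \<le> b"
  shows "((\<lambda>v. 1 - exp (- h v) - h v * exp (- h v)) has_integral
     b * (1 - exp (- h b) - h b * exp (- h b)) - a * (1 - exp (- h a) - h a * exp (- h a)) + J a b) {a..b}"
proof -
  have "((\<lambda>v. (1 - exp (- h v) - h v * exp (- h v)) - be * (h v)\<^sup>2 * exp (- h v)) has_integral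
     b * (1 - exp (- h b) - h b * exp (- h b)) - a * (1 - exp (- h a) - h a * exp (- h a))) {a..b}"
  proof (rule FTC_real[OF assms(2)])
    fix v assume "a \<le> v" "v \<le> b"
    then have v: "0 < v" using assms by simp
    define k where "k = h v"
    have "((\<lambda>v. v * (1 - exp (- h v) - h v * exp (- h v))) has_real_derivative
      (1 - exp (- k) - k * exp (- k)) + v * (k * exp (- k) * (- (be * k / v)))) (at v)"
      unfolding k_def using v by (auto intro!: derivative_eq_intros h_deriv simp: powr_diff[of v "- be" 1] field_simps)
    moreover have "(1 - exp (- k) - k * exp (- k)) + v * (k * exp (- k) * (- (be * k / v))) = (1 - exp (- k) - k * exp (- k)) - be * k\<^sup>2 * exp (- k)"
      using v by (simp add: power2_eq_square)
    ultimately show "((\<lambda>v. v * (1 - exp (- h v) - h v * exp (- h v))) has_real_derivative (1 - exp (- h v) - h v * exp (- h v)) - be * (h v)\<^sup>2 * exp (- h v)) (at v)"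
      unfolding k_def by simp
  qed
  from has_integral_add[OF this J_integral[OF assms]] show ?thesis by simp
qed

lemma he_integral:
  assumes "0 < a" "a \<le> b"
  shows "((\<lambda>v. h v * (1 - exp (- h v))) has_integral
     (b * (h b * (1 - exp (- h b))) - a * (h a * (1 - exp (- h a))) + J a b) / (1 - be)) {a..b}"
proof -
  have "((\<lambda>v. (1 - be) * (h v * (1 - exp (- h v))) - be * (h v)\<^sup>2 * exp (- h v)) has_integral
     b * (h b * (1 - exp (- h b))) - a * (h a * (1 - exp (- h a)))) {a..b}"
  proof (rule FTC_real[OF assms(2)])
    fix v assume "a \<le> v" "v \<le> b"
    then have v: "0 < v" using assms by simp
    define k where "k = h v"
    have "((\<lambda>v. v * (h v * (1 - exp (- h v)))) has_real_derivative
      k * (1 - exp (- k)) + v * ((1 - exp (- k) + k * exp (- k)) * (- (be * k / v)))) (at v)"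
      unfolding k_def using v by (auto intro!: derivative_eq_intros h_deriv simp: powr_diff[of v "- be" 1] field_simps)
    moreover have "k * (1 - exp (- k)) + v * ((1 - exp (- k) + k * exp (- k)) * (- (be * k / v))) = (1 - be) * (k * (1 - exp (- k))) - be * k\<^sup>2 * exp (- k)"
      using v by (simp add: power2_eq_square algebra_simps)
    ultimately show "((\<lambda>v. v * (h v * (1 - exp (- h v)))) has_real_derivative (1 - be) * (h v * (1 - exp (- h v))) - be * (h v)\<^sup>2 * exp (- h v)) (at v)"
      unfolding k_def by simp
  qed
  from has_integral_add[OF this J_integral[OF assms]]
  have "((\<lambda>v. (1 - be) * (h v * (1 - exp (- h v)))) has_integral
     b * (h b * (1 - exp (- h b))) - a * (h a * (1 - exp (- h a))) + J a b) {a..b}" by simp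
  from has_integral_mult_right[OF this, of "1 / (1 - be)"] show ?thesis using be by simp
qed

lemma phi_integral:
  assumes "0 < a" "a \<le> b"
  shows "((\<lambda>v. exp (- h v) - 1 + h v) has_integral
     b * (exp (- h b) - 1 + h b) - a * (exp (- h a) - 1 + h a) +
     be * ((b * (h b * (1 - exp (- h b))) - a * (h a * (1 - exp (- h a))) + J a b) / (1 - be))) {a..b}"
proof -
  have "((\<lambda>v. (exp (- h v) - 1 + h v) - be * (h v * (1 - exp (- h v)))) has_integral
     b * (exp (- h b) - 1 + h b) - a * (exp (- h a) - 1 + h a)) {a..b}"
  proof (rule FTC_real[OF assms(2)])
    fix v assume "a \<le> v" "v \<le> b"
    then have v: "0 < v" using assms by simp
    define k where "k = h v"
    have "((\<lambda>v. v * (exp (- h v) - 1 + h v)) has_real_derivative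
      (exp (- k) - 1 + k) + v * ((1 - exp (- k)) * (- (be * k / v)))) (at v)"
      unfolding k_def using v by (auto intro!: derivative_eq_intros h_deriv simp: powr_diff[of v "- be" 1] field_simps)
    moreover have "(exp (- k) - 1 + k) + v * ((1 - exp (- k)) * (- (be * k / v))) = (exp (- k) - 1 + k) - be * (k * (1 - exp (- k)))"
      using v by simp
    ultimately show "((\<lambda>v. v * (exp (- h v) - 1 + h v)) has_real_derivative (exp (- h v) - 1 + h v) - be * (h v * (1 - exp (- h v)))) (at v)"
      unfolding k_def by simp
  qed
  from has_integral_add[OF this has_integral_mult_right[OF he_integral[OF assms], of be]] show ?thesis by simp
qed

text \<open>For \<open>a\<close> tending to 0 the value becomes
  \<open>be * K powr (1 - be) / (1 - be)\<close>, the compensator of the truncated kernel in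
  rescaled units.\<close>

lemma kernel_integral:
  assumes "0 < a" "a \<le> K"
  shows "((\<lambda>v. v powr - be - K powr - be) has_integral
    be * K powr (1 - be) / (1 - be) - (a powr (1 - be) / (1 - be) - K powr - be * a)) {a..K}"
proof -
  have "((\<lambda>v. v powr - be - K powr - be) has_integral
    (K powr (1 - be) / (1 - be) - K powr - be * K) - (a powr (1 - be) / (1 - be) - K powr - be * a)) {a..K}"
    by (rule FTC_real[OF assms(2)]) (use assms be in \<open>auto intro!: derivative_eq_intros\<close>)
  moreover have "K powr (1 - be) / (1 - be) - K powr - be * K = be * K powr (1 - be) / (1 - be)"
  proof -
    have "K powr - be * K = K powr (1 - be)" using assms by (simp add: powr_diff powr_minus field_simps)
    then show ?thesis using be by (simp add: field_simps)
  qed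
  ultimately show ?thesis by simp
qed

text \<open>This bounds the boundary terms at \<open>b\<close> of the integrations by parts; it
  tends to 0 for large \<open>b\<close> because \<open>2 * be > 1\<close>.\<close>

lemma bh_le: "0 < b \<Longrightarrow> b * (h b)\<^sup>2 = s\<^sup>2 * b powr (1 - 2 * be)"
proof -
  assume b: "0 < b"
  have "(b powr - be)\<^sup>2 = b powr (- 2 * be)" using b by (simp add: power2_eq_square powr_add[symmetric])
  then show ?thesis using b by (simp add: power_mult_distrib powr_diff powr_minus field_simps)
qed

lemma psi_integral_le:
  assumes "0 < a" "a \<le> b"
  shows "integral {a..b} (\<lambda>v. 1 - exp (- h v) - h v * exp (- h v)) \<le> s\<^sup>2 * b powr (1 - 2 * be) + s powr (1/be) * G2"
proof -
  have "b * (1 - exp (- h b) - h b * exp (- h b)) \<le> b * (h b)\<^sup>2"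
    using assms phi_bounds(4)[of "h b"] h_pos[of b] by (intro mult_left_mono) auto
  moreover have "0 \<le> a * (1 - exp (- h a) - h a * exp (- h a))"
    using assms phi_bounds(3)[of "h a"] h_pos[of a] by (intro mult_nonneg_nonneg) auto
  ultimately show ?thesis
    using integral_unique[OF psi_integral[OF assms]] J_bounds[OF assms] bh_le[of b] assms by simp
qed

lemma phi_integral_le:
  assumes "0 < a" "a \<le> b"
  shows "integral {a..b} (\<lambda>v. exp (- h v) - 1 + h v) \<le> (s\<^sup>2 * b powr (1 - 2 * be) + be * s powr (1/be) * G2) / (1 - be)"
proof -
  have 1: "b * (exp (- h b) - 1 + h b) \<le> b * (h b)\<^sup>2"
    using assms phi_bounds(2)[of "h b"] h_pos[of b] by (intro mult_left_mono) auto
  have 2: "0 \<le> a * (exp (- h a) - 1 + h a)"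
    using assms phi_bounds(1)[of "h a"] h_pos[of a] by (intro mult_nonneg_nonneg) auto
  have 3: "b * (h b * (1 - exp (- h b))) \<le> b * (h b)\<^sup>2"
    unfolding power2_eq_square using assms phi_bounds(6)[of "h b"] h_pos[of b] by (intro mult_left_mono) auto
  have 4: "0 \<le> a * (h a * (1 - exp (- h a)))"
    using assms s phi_bounds(5)[of "h a"] h_pos[of a] by (intro mult_nonneg_nonneg) auto
  have "integral {a..b} (\<lambda>v. exp (- h v) - 1 + h v) \<le> b * (h b)\<^sup>2 + be * ((b * (h b)\<^sup>2 + s powr (1/be) * G2) / (1 - be))"
    unfolding integral_unique[OF phi_integral[OF assms]] using be 1 2 3 4 J_bounds[OF assms]
    by (intro add_mono mult_left_mono divide_right_mono) auto
  also have "\<dots> = (b * (h b)\<^sup>2 + be * s powr (1/be) * G2) / (1 - be)" using be by (simp add: field_simps)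
  finally show ?thesis using assms by (simp add: bh_le)
qed

text \<open>Up to the factor \<open>1 / s\<close> the main part is the integral of
  \<open>h v * (1 - exp (- h v))\<close>. Subtracting the level \<open>K powr - be\<close> from the
  kernel costs no more than order \<open>K powr (1 - 2 * be)\<close>.\<close>

lemma gain_integral_ge:
  assumes "0 < a" "a \<le> K"
  shows "integral {a..K} (\<lambda>v. (1 - exp (- h v)) * (v powr - be - K powr - be))
    \<ge> (J a K - s * a powr (1 - be)) / (s * (1 - be)) - s * K powr (1 - 2 * be) / (1 - be)"
proof -
  have K: "0 < K" using assms by simp
  have c: "continuous_on {a..K} (\<lambda>v. 1 - exp (- h v))" "continuous_on {a..K} h"
    using assms by (auto intro!: continuous_intros)
  have i: "(\<lambda>v. 1 - exp (- h v)) integrable_on {a..K}" "h integrable_on {a..K}"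
    using c by (auto intro!: integrable_continuous_interval)
  have hI: "(h has_integral s * ((K powr (1 - be) - a powr (1 - be)) / (1 - be))) {a..K}"
  proof -
    have "((\<lambda>v. v powr - be) has_integral K powr (1 - be) / (1 - be) - a powr (1 - be) / (1 - be)) {a..K}"
      by (rule FTC_real[OF assms(2)]) (use assms be in \<open>auto intro!: derivative_eq_intros\<close>)
    from has_integral_mult_right[OF this, of s] show ?thesis by (simp add: diff_divide_distrib)
  qed
  have "integral {a..K} (\<lambda>v. 1 - exp (- h v)) \<le> integral {a..K} h"
    using assms h_pos phi_bounds(6) by (intro integral_le i) (auto simp: less_imp_le)
  also have "\<dots> \<le> s * (K powr (1 - be) / (1 - be))"
    unfolding integral_unique[OF hI] using s be by (intro mult_left_mono divide_right_mono) auto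
  finally have 1: "integral {a..K} (\<lambda>v. 1 - exp (- h v)) \<le> s * K powr (1 - be) / (1 - be)" by simp
  have e: "(\<lambda>v. (1 - exp (- h v)) * (v powr - be - K powr - be)) =
     (\<lambda>v. 1 / s * (h v * (1 - exp (- h v))) - K powr - be * (1 - exp (- h v)))"
    using s by (auto simp: algebra_simps)
  have "integral {a..K} (\<lambda>v. (1 - exp (- h v)) * (v powr - be - K powr - be)) =
     1 / s * ((K * (h K * (1 - exp (- h K))) - a * (h a * (1 - exp (- h a))) + J a K) / (1 - be))
     - K powr - be * integral {a..K} (\<lambda>v. 1 - exp (- h v))"
    unfolding e by (intro integral_unique has_integral_diff has_integral_mult_right he_integral[OF assms] integrable_integral i)
  also have "\<dots> \<ge> 1 / s * ((0 - a * (h a * 1) + J a K) / (1 - be)) - K powr - be * (s * K powr (1 - be) / (1 - be))"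
    using assms s be 1 phi_bounds(5)[OF less_imp_le[OF h_pos[OF K]]] h_pos[OF K] h_pos[of a] K
    by (intro diff_mono mult_left_mono divide_right_mono add_right_mono) auto
  also have "a * (h a * 1) = s * a powr (1 - be)" using assms powr_mult_base[of a "- be"] by (simp add: mult.left_commute)
  also have "K powr - be * (s * K powr (1 - be) / (1 - be)) = s * K powr (1 - 2 * be) / (1 - be)"
    by (simp add: powr_add[symmetric] mult.left_commute)
  finally show ?thesis by simp
qed

text \<open>The left side is the Chernoff exponent per unit of \<open>n\<close>, before the level is
  subtracted. Truncating the kernel only helps, as \<open>exp (- h) - 1 + h\<close> increases with
  \<open>h\<close>; leaving out the innermost cells costs the first term on the right.\<close>

lemma rate_upper_sum:
  assumes K: "0 < K" and m: "3 \<le> m"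
  defines "\<delta> \<equiv> K / real m"
  shows "s * (be * K powr (1 - be) / (1 - be)) + \<delta> * (\<Sum>j=3..m. exp (- s * ((real j * \<delta>) powr - be - K powr - be)) - 1)
     \<le> s * (3 * \<delta>) powr (1 - be) / (1 - be) + (s\<^sup>2 * K powr (1 - 2 * be) + be * s powr (1/be) * G2) / (1 - be)"
proof -
  let ?k = "\<lambda>v. v powr - be - K powr - be"
  let ?g = "\<lambda>v. exp (- s * ?k v) - 1"
  have d: "0 < \<delta>" "real m * \<delta> = K" using K m by (auto simp: \<delta>_def)
  have le: "3 * \<delta> \<le> K" using m d by (metis mult_right_mono of_nat_le_iff of_nat_numeral less_imp_le)
  have k0: "0 \<le> ?k v" if "0 < v" "v \<le> K" for v using that be by (auto intro: powr_mono2')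
  have cg: "continuous_on {3 * \<delta>..K} ?g" using d by (auto intro!: continuous_intros)
  have "(\<Sum>j=3..<m. \<delta> * ?g (real j * \<delta>)) \<le> integral {3 * \<delta>..K} ?g"
  proof -
    have "integral {real 3 * \<delta>..real m * \<delta>} (\<lambda>v. - ?g v) \<le> (\<Sum>j=3..<m. \<delta> * (- ?g (real j * \<delta>)))"
    proof (rule riemann_sum_antimono(2))
      fix x y assume "real 3 * \<delta> \<le> x" "x \<le> y" "y \<le> real m * \<delta>"
      then have "y powr - be \<le> x powr - be" using d be by (intro powr_mono2') auto
      then show "- ?g y \<le> - ?g x" using s by simp
    qed (use d m in \<open>auto intro!: continuous_intros\<close>)
    then show ?thesis unfolding Henstock_Kurzweil_Integration.integral_neg mult_minus_right sum_negf d by simp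
  qed
  moreover have "(\<Sum>j=3..m. \<delta> * ?g (real j * \<delta>)) = (\<Sum>j=3..<m. \<delta> * ?g (real j * \<delta>))"
  proof -
    have "{3..m} = insert m {3..<m}" using m by auto
    then show ?thesis using d by simp
  qed
  moreover have "integral {3 * \<delta>..K} ?g \<le> integral {3 * \<delta>..K} (\<lambda>v. (exp (- h v) - 1 + h v) - s * ?k v)"
  proof (rule integral_le)
    show "?g integrable_on {3 * \<delta>..K}" by (rule integrable_continuous_interval[OF cg])
    show "(\<lambda>v. (exp (- h v) - 1 + h v) - s * ?k v) integrable_on {3 * \<delta>..K}"
      using d by (auto intro!: integrable_continuous_interval continuous_intros)
    fix v assume v: "v \<in> {3 * \<delta>..K}"
    then have "exp (- (s * ?k v)) - 1 + s * ?k v \<le> exp (- h v) - 1 + h v"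
      using k0[of v] d s by (intro phi_mono(1)) (auto intro!: mult_nonneg_nonneg mult_left_mono)
    then show "?g v \<le> (exp (- h v) - 1 + h v) - s * ?k v" by simp
  qed
  moreover have "integral {3 * \<delta>..K} (\<lambda>v. (exp (- h v) - 1 + h v) - s * ?k v) =
     integral {3 * \<delta>..K} (\<lambda>v. exp (- h v) - 1 + h v) - s * (be * K powr (1 - be) / (1 - be) - ((3 * \<delta>) powr (1 - be) / (1 - be) - K powr - be * (3 * \<delta>)))"
    using d le
    by (intro integral_unique has_integral_diff integrable_integral has_integral_mult_right kernel_integral)
      (auto intro!: integrable_continuous_interval continuous_intros)
  moreover have "integral {3 * \<delta>..K} (\<lambda>v. exp (- h v) - 1 + h v) \<le> (s\<^sup>2 * K powr (1 - 2 * be) + be * s powr (1/be) * G2) / (1 - be)"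
    using d le by (intro phi_integral_le) auto
  moreover have "s * (K powr - be * (3 * \<delta>)) \<ge> 0" using s d by simp
  moreover have "s * (be * K powr (1 - be) / (1 - be) - ((3 * \<delta>) powr (1 - be) / (1 - be) - K powr - be * (3 * \<delta>))) = s * (be * K powr (1 - be) / (1 - be)) - s * ((3 * \<delta>) powr (1 - be) / (1 - be)) + s * (K powr - be * (3 * \<delta>))"
    by (simp only: right_diff_distrib)
  moreover have "s * ((3 * \<delta>) powr (1 - be) / (1 - be)) = s * (3 * \<delta>) powr (1 - be) / (1 - be)" by simp
  moreover have "sA + S1 \<le> sB + U" if "S0 \<le> I0" "S1 = S0" "I0 \<le> I1" "I1 = I2 - X" "I2 \<le> U" "0 \<le> sC" "X = sA - sB' + sC" "sB' = sB"
    for S0 S1 I0 I1 I2 X U sA sB sB' sC :: real using that by linarith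
  ultimately show ?thesis unfolding sum_distrib_left by blast
qed

text \<open>The entropy density of the profile \<open>exp (- h v)\<close> decreases in
  \<open>v\<close>, so its sum over right end points is at most its integral from \<delta> to
  \<open>K\<close>.\<close>

lemma rate_lower_cost:
  assumes K: "0 < K" and m: "3 \<le> m"
  defines "\<delta> \<equiv> K / real m"
  shows "\<delta> * (\<Sum>l=2..<m. 1 - exp (- h (real l * \<delta>)) - h (real l * \<delta>) * exp (- h (real l * \<delta>)))
     \<le> s\<^sup>2 * K powr (1 - 2 * be) + s powr (1/be) * G2"
proof -
  let ?f = "\<lambda>v. 1 - exp (- h v) - h v * exp (- h v)"
  have d: "0 < \<delta>" "real m * \<delta> = K" "\<delta> \<le> K" using K m by (auto simp: \<delta>_def field_simps)
  have "(\<Sum>l=Suc 1..m. \<delta> * ?f (real l * \<delta>)) \<le> integral {real 1 * \<delta>..real m * \<delta>} ?f"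
  proof (rule riemann_sum_antimono(1))
    fix x y assume xy: "real 1 * \<delta> \<le> x" "x \<le> y" "y \<le> real m * \<delta>"
    then have "y powr - be \<le> x powr - be" using d be by (intro powr_mono2') auto
    then show "?f y \<le> ?f x" using s xy d by (intro phi_mono(2)) auto
  qed (use d m in \<open>auto intro!: continuous_intros\<close>)
  also have "\<dots> \<le> s\<^sup>2 * K powr (1 - 2 * be) + s powr (1/be) * G2"
    using d psi_integral_le[of \<delta> K] by simp
  finally have "(\<Sum>l=Suc 1..m. \<delta> * ?f (real l * \<delta>)) \<le> s\<^sup>2 * K powr (1 - 2 * be) + s powr (1/be) * G2" .
  moreover have "(\<Sum>l=2..<m. \<delta> * ?f (real l * \<delta>)) \<le> (\<Sum>l=Suc 1..m. \<delta> * ?f (real l * \<delta>))"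
    using d s phi_bounds(3)[OF less_imp_le[OF h_pos]] by (intro sum_mono2) (auto intro!: mult_nonneg_nonneg)
  ultimately show ?thesis by (simp add: sum_distrib_left)
qed

text \<open>Writing \<open>exp (- h) = 1 - (1 - exp (- h))\<close> splits the sum: the full kernel
  sum is at most the compensator, and what is missing is the gain. The two parts are compared with
  integrals in opposite directions.\<close>

lemma rate_lower_gain:
  assumes K: "0 < K" and m: "3 \<le> m"
  defines "\<delta> \<equiv> K / real m"
  shows "\<delta> * (\<Sum>l=2..<m. exp (- h (real l * \<delta>)) * ((real l * \<delta>) powr - be - K powr - be)) - be * K powr (1 - be) / (1 - be)
     \<le> - ((J (2 * \<delta>) K - s * (2 * \<delta>) powr (1 - be)) / (s * (1 - be)) - s * K powr (1 - 2 * be) / (1 - be))"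
proof -
  let ?k = "\<lambda>v. v powr - be - K powr - be"
  have d: "0 < \<delta>" "real m * \<delta> = K" "\<delta> \<le> K" using K m by (auto simp: \<delta>_def field_simps)
  have le: "2 * \<delta> \<le> K" using m d mult_right_mono[of 2 "real m" \<delta>] by simp
  have k0: "0 \<le> ?k v" if "0 < v" "v \<le> K" for v using that be by (auto intro: powr_mono2')
  have 1: "(\<Sum>l=Suc 1..m. \<delta> * ?k (real l * \<delta>)) \<le> integral {real 1 * \<delta>..real m * \<delta>} ?k"
  proof (rule riemann_sum_antimono(1))
    fix x y assume xy: "real 1 * \<delta> \<le> x" "x \<le> y" "y \<le> real m * \<delta>"
    then show "?k y \<le> ?k x" using d be by (auto intro: powr_mono2')
  qed (use d m in \<open>auto intro!: continuous_intros\<close>)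
  have "integral {real 1 * \<delta>..real m * \<delta>} ?k = be * K powr (1 - be) / (1 - be) - (\<delta> powr (1 - be) / (1 - be) - K powr - be * \<delta>)"
    using integral_unique[OF kernel_integral[of \<delta> K]] d by simp
  also have "\<dots> \<le> be * K powr (1 - be) / (1 - be)"
  proof -
    have "K powr - be * \<delta> \<le> \<delta> powr - be * \<delta>" using d be by (intro mult_right_mono powr_mono2') auto
    also have "\<dots> = \<delta> powr (1 - be)" using powr_mult_base[of \<delta> "-be"] d by (simp add: mult.commute)
    also have "\<dots> \<le> \<delta> powr (1 - be) / (1 - be)" using be by (simp add: field_simps)
    finally show ?thesis by simp
  qed
  finally have 2: "(\<Sum>l=2..<m. \<delta> * ?k (real l * \<delta>)) \<le> be * K powr (1 - be) / (1 - be)"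
  proof -
    assume "integral {real 1 * \<delta>..real m * \<delta>} ?k \<le> be * K powr (1 - be) / (1 - be)"
    moreover have "{Suc 1..m} = insert m {2..<m}" using m by auto
    ultimately show ?thesis using 1 d by simp
  qed
  have 3: "integral {real 2 * \<delta>..real m * \<delta>} (\<lambda>v. (1 - exp (- h v)) * ?k v) \<le> (\<Sum>l=2..<m. \<delta> * ((1 - exp (- h (real l * \<delta>))) * ?k (real l * \<delta>)))"
  proof (rule riemann_sum_antimono(2))
    fix x y assume xy: "real 2 * \<delta> \<le> x" "x \<le> y" "y \<le> real m * \<delta>"
    then have p: "y powr - be \<le> x powr - be" "0 < x" using d be by (auto intro: powr_mono2')
    have "0 \<le> ?k y" using xy d p by (intro k0) auto
    moreover have "0 \<le> 1 - exp (- h x)" using phi_bounds(5)[OF less_imp_le[OF h_pos[OF p(2)]]] .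
    moreover have "1 - exp (- h y) \<le> 1 - exp (- h x)" using p s by simp
    ultimately show "(1 - exp (- h y)) * ?k y \<le> (1 - exp (- h x)) * ?k x" using p by (intro mult_mono) auto
  qed (use d m in \<open>auto intro!: continuous_intros\<close>)
  have "(J (2 * \<delta>) K - s * (2 * \<delta>) powr (1 - be)) / (s * (1 - be)) - s * K powr (1 - 2 * be) / (1 - be)
     \<le> (\<Sum>l=2..<m. \<delta> * ((1 - exp (- h (real l * \<delta>))) * ?k (real l * \<delta>)))"
    using gain_integral_ge[of "2 * \<delta>" K] le d 3 by simp
  moreover have "(\<Sum>l=2..<m. \<delta> * ((1 - exp (- h (real l * \<delta>))) * ?k (real l * \<delta>))) =
     (\<Sum>l=2..<m. \<delta> * ?k (real l * \<delta>)) - \<delta> * (\<Sum>l=2..<m. exp (- h (real l * \<delta>)) * ?k (real l * \<delta>))"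
    by (simp add: sum_subtractf[symmetric] sum_distrib_left algebra_simps)
  ultimately show ?thesis using 2 by linarith
qed

end

text \<open>Continuum limit of the Chernoff exponent. A level \<open>a\<close> above the value of
  the entropy problem with budget \<open>dd\<close> leaves a slack \<open>e\<close>; half of it
  absorbs the boundary terms at large \<open>K\<close>, the other half the mesh error at large
  \<open>m\<close>.\<close>

lemma rate_upper:
  fixes be a dd :: real
  assumes be: "1/2 < be" "be < 1" and dd: "0 < dd"
  assumes a: "dd / (1 - be) * (Gamma (2 - 1/be) / dd) powr be < a"
  shows "\<exists>s>0. \<forall>\<^sub>F K in at_top. \<forall>\<^sub>F m in sequentially.
    s * (be * K powr (1 - be) / (1 - be) - a) + K / real m * (\<Sum>j=3..m. exp (- s * ((real j * (K / real m)) powr - be - K powr - be)) - 1) < - dd"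
proof -
  let ?G = "Gamma (2 - 1/be)"
  have G: "?G > 0" using be by (intro Gamma_real_pos) (simp add: field_simps)
  \<comment> \<open>Solves \<open>s powr (1 / be) * ?G = dd\<close>, that is, the entropy cost of
    the profile equals the budget.\<close>
  define s where "s = (dd / ?G) powr be"
  have s: "s > 0" using dd G by (simp add: s_def)
  interpret rate_calculus be s by unfold_locales (use be s in auto)
  have sG: "s powr (1/be) * ?G = dd" using be dd G by (simp add: s_def powr_powr)
  have sa: "s * (dd / (1 - be) * (?G / dd) powr be) = dd / (1 - be)"
  proof -
    have "s * (?G / dd) powr be = 1" using dd G unfolding s_def by (simp add: powr_mult[symmetric])
    then show ?thesis by (simp add: mult.left_commute)
  qed
  define e where "e = s * a - dd / (1 - be)"
  have e: "e > 0" using mult_strict_left_mono[OF a s] unfolding sa e_def by simp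
  have "((\<lambda>K::real. s\<^sup>2 * K powr (1 - 2 * be) / (1 - be)) \<longlongrightarrow> 0) at_top"
    using be by real_asymp
  then have ev: "\<forall>\<^sub>F K in at_top. s\<^sup>2 * K powr (1 - 2 * be) / (1 - be) < e / 2"
    by (rule order_tendstoD) (use e in simp)
  have "\<forall>\<^sub>F K in at_top. \<forall>\<^sub>F m in sequentially.
    s * (be * K powr (1 - be) / (1 - be) - a) + K / real m * (\<Sum>j=3..m. exp (- s * ((real j * (K / real m)) powr - be - K powr - be)) - 1) < - dd"
    using ev eventually_gt_at_top[of 0]
  proof eventually_elim
    case (elim K)
    have "((\<lambda>m. s * (3 * (K / real m)) powr (1 - be) / (1 - be)) \<longlonglongrightarrow> 0)"
      using be elim(2) s by real_asymp
    then have "\<forall>\<^sub>F m in sequentially. s * (3 * (K / real m)) powr (1 - be) / (1 - be) < e / 2"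
      by (rule order_tendstoD) (use e in simp)
    then show ?case using eventually_ge_at_top[of 3]
    proof eventually_elim
      case (elim m)
      have "(s\<^sup>2 * K powr (1 - 2 * be) + be * s powr (1/be) * ?G) / (1 - be) = s\<^sup>2 * K powr (1 - 2 * be) / (1 - be) + be * dd / (1 - be)"
        using sG by (simp add: add_divide_distrib mult.assoc)
      moreover have "be * dd / (1 - be) - dd / (1 - be) = - dd"
      proof -
        have "be * dd / (1 - be) - dd / (1 - be) = (be * dd - dd) / (1 - be)" by (simp add: diff_divide_distrib)
        also have "\<dots> = - dd" using be by (simp add: divide_eq_eq algebra_simps)
        finally show ?thesis .
      qed
      moreover have "s * (be * K powr (1 - be) / (1 - be) - a) = s * (be * K powr (1 - be) / (1 - be)) - s * a" by (rule right_diff_distrib)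
      moreover have "P + y < - D" if "v = w + z" "z - c = - D" "P = x - sa" "x + y \<le> u + v" "u < e / 2" "w < e / 2" "e = sa - c"
        for P y D v w z c x sa u :: real using that by linarith
      ultimately show ?case using rate_upper_sum[OF \<open>0 < K\<close> elim(2)] elim(1) \<open>s\<^sup>2 * K powr (1 - 2 * be) / (1 - be) < e / 2\<close> e_def
        by blast
    qed
  qed
  then show ?thesis using s by blast
qed

text \<open>Cost and gain of a discretised profile. The summand \<open>3 * (K / m)\<close> is the
  price, per unit of \<open>n\<close>, of emptying the three innermost cells.\<close>

lemma rate_lower:
  fixes be a dd :: real
  assumes be: "1/2 < be" "be < 1" and dd: "0 < dd"
  assumes a: "a < dd / (1 - be) * (Gamma (2 - 1/be) / dd) powr be"
  shows "\<exists>s>0. \<forall>\<^sub>F K in at_top. \<forall>\<^sub>F m in sequentially.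
    3 * (K / real m) + K / real m * (\<Sum>l=2..<m. 1 - exp (- (s * (real l * (K / real m)) powr - be)) - s * (real l * (K / real m)) powr - be * exp (- (s * (real l * (K / real m)) powr - be))) < dd
    \<and> K / real m * (\<Sum>l=2..<m. exp (- (s * (real l * (K / real m)) powr - be)) * ((real l * (K / real m)) powr - be - K powr - be)) - be * K powr (1 - be) / (1 - be) < - a"
proof -
  let ?G = "Gamma (2 - 1/be)"
  have G: "?G > 0" using be by (intro Gamma_real_pos) (simp add: field_simps)
  define s0 where "s0 = (dd / ?G) powr be"
  have s0: "s0 > 0" using dd G by (simp add: s0_def)
  have sG: "s0 powr (1/be) * ?G = dd" using be dd G by (simp add: s0_def powr_powr)
  have sa: "s0 * (dd / (1 - be) * (?G / dd) powr be) = dd / (1 - be)"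
  proof -
    have "s0 * (?G / dd) powr be = 1" using dd G unfolding s0_def by (simp add: powr_mult[symmetric])
    then show ?thesis by (simp add: mult.left_commute)
  qed
  have "a < s0 powr (1/be) * ?G / (s0 * (1 - be))"
  proof -
    have "s0 * a < dd / (1 - be)" using mult_strict_left_mono[OF a s0] unfolding sa .
    then show ?thesis using s0 be sG by (simp add: field_simps)
  qed
  \<comment> \<open>At \<open>s0\<close> the cost equals \<open>dd\<close> exactly. A slightly
    smaller \<open>s\<close> makes it strictly smaller, and by continuity the gain stays above
    \<open>a\<close>.\<close>
  moreover have "((\<lambda>s. s powr (1/be) * ?G / (s * (1 - be))) \<longlongrightarrow> s0 powr (1/be) * ?G / (s0 * (1 - be))) (at_left s0)"
    using s0 be by (intro tendsto_intros) auto
  ultimately have "\<forall>\<^sub>F s in at_left s0. a < s powr (1/be) * ?G / (s * (1 - be))" by (rule order_tendstoD(1)[rotated])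
  moreover have "\<forall>\<^sub>F s in at_left s0. s \<in> {0<..<s0}" using s0 by (rule eventually_at_left_real)
  ultimately have "\<forall>\<^sub>F s in at_left s0. a < s powr (1/be) * ?G / (s * (1 - be)) \<and> s \<in> {0<..<s0}" by (rule eventually_conj)
  then obtain s where s1: "a < s powr (1/be) * ?G / (s * (1 - be))" and ss: "0 < s" "s < s0"
    by (auto dest!: eventually_happens)
  interpret rate_calculus be s by unfold_locales (use be ss in auto)
  have "s powr (1/be) < s0 powr (1/be)" using ss be by (intro powr_less_mono2) auto
  from mult_strict_right_mono[OF this G] have sd: "s powr (1/be) * ?G < dd" unfolding sG .
  have t1: "((\<lambda>K::real. s\<^sup>2 * K powr (1 - 2 * be)) \<longlongrightarrow> 0) at_top" using be by real_asymp
  have t2: "((\<lambda>K. gint (s * K powr - be)) \<longlongrightarrow> 0) at_top"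
  proof (rule filterlim_compose[OF gint_at_0])
    show "LIM K at_top. s * K powr - be :> at_right 0" using s be by real_asymp
  qed
  have t3: "((\<lambda>K. s powr (1/be) * (?G - gint (s * K powr - be)) / (s * (1 - be)) - s * K powr (1 - 2 * be) / (1 - be)) \<longlongrightarrow>
     s powr (1/be) * (?G - 0) / (s * (1 - be)) - 0) at_top"
  proof (intro tendsto_diff tendsto_divide tendsto_mult tendsto_const t2)
    show "((\<lambda>K. s * K powr (1 - 2 * be) / (1 - be)) \<longlongrightarrow> 0) at_top" using be by real_asymp
  qed (use s be in auto)
  have e1: "\<forall>\<^sub>F K in at_top. s\<^sup>2 * K powr (1 - 2 * be) < dd - s powr (1/be) * ?G"
    using t1 by (rule order_tendstoD) (use sd in simp)
  have e2: "\<forall>\<^sub>F K in at_top. a < s powr (1/be) * (?G - gint (s * K powr - be)) / (s * (1 - be)) - s * K powr (1 - 2 * be) / (1 - be)"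
    using t3 by (rule order_tendstoD) (use s1 in simp)
  have "\<forall>\<^sub>F K in at_top. \<forall>\<^sub>F m in sequentially.
    3 * (K / real m) + K / real m * (\<Sum>l=2..<m. 1 - exp (- h (real l * (K / real m))) - h (real l * (K / real m)) * exp (- h (real l * (K / real m)))) < dd
    \<and> K / real m * (\<Sum>l=2..<m. exp (- h (real l * (K / real m))) * ((real l * (K / real m)) powr - be - K powr - be)) - be * K powr (1 - be) / (1 - be) < - a"
    using e1 e2 eventually_gt_at_top[of 0]
  proof eventually_elim
    case (elim K)
    have f1: "(\<lambda>m. 3 * (K / real m)) \<longlonglongrightarrow> 0" by real_asymp
    have f2: "(\<lambda>m. gint (s * (2 * (K / real m)) powr - be)) \<longlonglongrightarrow> ?G"
    proof (rule filterlim_compose[OF gint_at_top])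
      show "LIM m sequentially. s * (2 * (K / real m)) powr - be :> at_top" using s be elim(3) by real_asymp
    qed
    have f3: "(\<lambda>m. (J (2 * (K / real m)) K - s * (2 * (K / real m)) powr (1 - be)) / (s * (1 - be)) - s * K powr (1 - 2 * be) / (1 - be)) \<longlonglongrightarrow>
       (s powr (1/be) * (?G - gint (s * K powr - be)) - 0) / (s * (1 - be)) - s * K powr (1 - 2 * be) / (1 - be)"
      unfolding J_def
    proof (intro tendsto_diff tendsto_divide tendsto_mult tendsto_const f2)
      show "(\<lambda>m. s * (2 * (K / real m)) powr (1 - be)) \<longlonglongrightarrow> 0" using be elim(3) s by real_asymp
    qed (use s be in auto)
    have g1: "\<forall>\<^sub>F m in sequentially. 3 * (K / real m) < dd - s powr (1/be) * ?G - s\<^sup>2 * K powr (1 - 2 * be)"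
      using f1 by (rule order_tendstoD) (use elim in simp)
    have g2: "\<forall>\<^sub>F m in sequentially. a < (J (2 * (K / real m)) K - s * (2 * (K / real m)) powr (1 - be)) / (s * (1 - be)) - s * K powr (1 - 2 * be) / (1 - be)"
      using f3 by (rule order_tendstoD) (use elim in simp)
    show ?case using g1 g2 eventually_ge_at_top[of 3]
    proof eventually_elim
      case (elim m)
      show ?case using rate_lower_cost[OF \<open>0 < K\<close> elim(3)] rate_lower_gain[OF \<open>0 < K\<close> elim(3)] elim by linarith
    qed
  qed
  then show ?thesis using s by blast
qed

section \<open>Radial cells\<close>

text \<open>The kernel is infinite at the centre, whereas \<open>0 powr - p = 0\<close> hides an atom at \<open>x\<close> from \<open>Vbar\<close>.
  Finiteness of \<open>nearE\<close> excludes both atoms and divergence, and it holds at almost every point.\<close>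

definition nearE :: "real \<Rightarrow> (real^'d::finite) measure \<Rightarrow> real^'d \<Rightarrow> ennreal" where
  "nearE p \<mu> x = (\<integral>\<^sup>+y. (if y = x then \<infinity> else ennreal (dist y x powr - p)) * indicator (cball x 1) y \<partial>\<mu>)"

text \<open>The integrand of \<open>nearE\<close> is infinite at \<open>x\<close>, so finiteness
  forces the mass of \<open>{x}\<close> to vanish; away from \<open>x\<close> it is the kernel of
  \<open>Vbar\<close>.\<close>

lemma nearE_finite:
  fixes \<mu> :: "(real^'d::finite) measure"
  assumes [measurable_cong]: "sets \<mu> = sets borel" and n: "nearE p \<mu> x < \<infinity>"
  shows "set_integrable \<mu> (cball x 1) (\<lambda>y. dist y x powr - p)" "emeasure \<mu> {x} = 0"
    "ennreal (Vnear p \<mu> 1 x) = nearE p \<mu> x"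
proof -
  have [measurable]: "cball x 1 \<in> sets borel" by simp
  let ?k = "\<lambda>y. (if y = x then \<infinity> else ennreal (dist y x powr - p)) * indicator (cball x 1) y"
  have km [measurable]: "?k \<in> borel_measurable \<mu>" by measurable
  have "AE y in \<mu>. ?k y \<noteq> \<infinity>" using n by (intro nn_integral_PInf_AE) (auto simp: nearE_def)
  then have ne: "AE y in \<mu>. y \<noteq> x" by eventually_elim auto
  have "{x} \<in> null_sets \<mu>" using ne by (subst (asm) AE_iff_null) (auto simp: sets_eq_imp_space_eq[OF assms(1)])
  then show "emeasure \<mu> {x} = 0" by auto
  have m: "(\<lambda>y. indicat_real (cball x 1) y *\<^sub>R dist y x powr - p) \<in> borel_measurable \<mu>" by measurable
  have eq: "(\<integral>\<^sup>+y. ennreal (indicat_real (cball x 1) y *\<^sub>R dist y x powr - p) \<partial>\<mu>) = nearE p \<mu> x"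
    unfolding nearE_def by (rule nn_integral_cong_AE) (use ne in eventually_elim, auto simp: indicator_def)
  show si: "set_integrable \<mu> (cball x 1) (\<lambda>y. dist y x powr - p)"
    unfolding set_integrable_def by (rule integrableI_nonneg[OF m]) (use eq n in \<open>auto simp: less_top\<close>)
  show "ennreal (Vnear p \<mu> 1 x) = nearE p \<mu> x"
    unfolding Vnear_def set_lebesgue_integral_def eq[symmetric]
    by (rule nn_integral_eq_integral[symmetric]) (use si in \<open>auto simp: set_integrable_def\<close>)
qed

lemma nearE_vacant:
  fixes \<mu> :: "(real^'d::finite) measure"
  assumes [measurable_cong]: "sets \<mu> = sets borel" and "emeasure \<mu> (cball x 2) = 0" "dist z x \<le> 1"
  shows "nearE p \<mu> z = 0"
proof -
  have "cball z 1 \<subseteq> cball x 2"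
  proof
    fix y assume "y \<in> cball z 1" then show "y \<in> cball x 2"
      using assms(3) dist_triangle[of x y z] by (simp add: dist_commute)
  qed
  then have "emeasure \<mu> (cball z 1) \<le> 0" using emeasure_mono[of "cball z 1" "cball x 2" \<mu>] assms by simp
  then have "cball z 1 \<in> null_sets \<mu>" by (auto simp: assms(1))
  then have "AE y in \<mu>. y \<notin> cball z 1" by (rule AE_not_in)
  then have "nearE p \<mu> z = (\<integral>\<^sup>+y. 0 \<partial>\<mu>)" unfolding nearE_def by (intro nn_integral_cong_AE) (auto elim!: eventually_mono simp: indicator_def)
  then show ?thesis by simp
qed

text \<open>The radius of a ball of volume \<open>v * n\<close>.\<close>

definition rad :: "'d::finite itself \<Rightarrow> real \<Rightarrow> real \<Rightarrow> real" where
  "rad T n v = (v * n / vd T) powr (1 / real CARD('d))"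

lemma rad_nonneg [simp]: "0 \<le> rad T n v" by (simp add: rad_def)

lemma rad_0 [simp]: "rad T n 0 = 0" by (simp add: rad_def)

lemma rad_mono: "0 \<le> v \<Longrightarrow> v \<le> v' \<Longrightarrow> 0 \<le> n \<Longrightarrow> rad T n v \<le> rad T n v'"
  unfolding rad_def by (intro powr_mono2 divide_right_mono mult_right_mono) auto

lemma rad_vol:
  assumes "0 \<le> v" "0 \<le> n" shows "vd TYPE('d::finite) * rad TYPE('d) n v ^ CARD('d) = v * n"
proof (cases "v * n = 0")
  case False
  then have pos: "v * n / vd TYPE('d) > 0" using assms by (auto intro!: divide_pos_pos mult_pos_pos)
  have "(a powr (1 / real CARD('d))) ^ CARD('d) = a" if "a > 0" for a :: real
    using that by (subst powr_realpow[symmetric]) (auto simp: powr_powr)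
  from this[OF pos] have "rad TYPE('d) n v ^ CARD('d) = v * n / vd TYPE('d)"
    unfolding rad_def .
  moreover have "vd TYPE('d) \<noteq> 0" by (rule order.strict_implies_not_eq[symmetric]) simp
  ultimately show ?thesis by simp
qed (auto simp: rad_def)

lemma rad_powr:
  assumes "0 < v" "0 < n"
  shows "rad TYPE('d::finite) n v powr - p = v powr - (p / real CARD('d)) * (n / vd TYPE('d)) powr - (p / real CARD('d))"
  unfolding rad_def by (simp add: powr_powr powr_mult[symmetric])

text \<open>Radii belonging to fixed multiples of the volume \<open>n\<close> separate like
  \<open>n powr (1 / d)\<close>. Moving the centre by at most 1 therefore shifts a point by at most
  one cell, and centres need to be tested on a grid of unit scale only.\<close>

lemma rad_gap:
  assumes "0 \<le> v" "v < v'" shows "\<forall>\<^sub>F n in sequentially. rad TYPE('d::finite) (real n) v + 1 \<le> rad TYPE('d) (real n) v'"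
proof -
  let ?w = "vd TYPE('d)" and ?e = "1 / real CARD('d)"
  have w: "?w > 0" by simp
  have "filterlim (\<lambda>n. ((v' / ?w) powr ?e - (v / ?w) powr ?e) * real n powr ?e) at_top sequentially"
  proof -
    have "(v / ?w) powr ?e < (v' / ?w) powr ?e" using assms w by (intro powr_less_mono2) (auto simp: divide_strict_right_mono)
    moreover have "?e > 0" by simp
    ultimately show ?thesis by real_asymp
  qed
  then have "\<forall>\<^sub>F n in sequentially. 1 \<le> ((v' / ?w) powr ?e - (v / ?w) powr ?e) * real n powr ?e"
    unfolding filterlim_at_top by blast
  then show ?thesis
  proof eventually_elim
    case (elim n)
    have "rad TYPE('d) (real n) u = (u / ?w) powr ?e * real n powr ?e" for u
      unfolding rad_def powr_mult[symmetric] by simp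
    then show ?case using elim by (simp add: left_diff_distrib)
  qed
qed

text \<open>The mesh is uniform in volume, so that all counts have the same mean. The case
  \<open>i = 0\<close> keeps the centre in the innermost cell, since \<open>cball x 0\<close> is
  \<open>{x}\<close> rather than empty.\<close>

definition cell :: "real \<Rightarrow> real \<Rightarrow> real^'d::finite \<Rightarrow> nat \<Rightarrow> (real^'d) set" where
  "cell n \<delta> x i = cball x (rad TYPE('d) n (real (i + 1) * \<delta>)) - (if i = 0 then {} else cball x (rad TYPE('d) n (real i * \<delta>)))"

lemma cell_sets [measurable]: "cell n \<delta> x i \<in> sets borel" and bounded_cell: "bounded (cell n \<delta> x i)"
  unfolding cell_def by (auto intro: bounded_subset[OF bounded_cball])

lemma cell_subset: "0 \<le> n \<Longrightarrow> 0 \<le> \<delta> \<Longrightarrow> i \<le> m \<Longrightarrow> cell n \<delta> x i \<subseteq> cball (x::real^'d::finite) (rad TYPE('d) n (real (m + 1) * \<delta>))"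
  unfolding cell_def by (intro order_trans[OF Diff_subset] subset_cball rad_mono mult_right_mono) auto

lemma cell_measure:
  assumes "0 \<le> n" "0 \<le> \<delta>" shows "measure lborel (cell n \<delta> (x::real^'d::finite) i) = \<delta> * n"
proof (cases "i = 0")
  case True then show ?thesis using assms by (simp add: cell_def content_cball_vec rad_vol)
next
  case False
  have sub: "cball x (rad TYPE('d) n (real i * \<delta>)) \<subseteq> cball x (rad TYPE('d) n (real (i + 1) * \<delta>))"
    using assms by (intro subset_cball rad_mono mult_right_mono) auto
  have "measure lborel (cell n \<delta> x i) = measure lborel (cball x (rad TYPE('d) n (real (i + 1) * \<delta>))) - measure lborel (cball x (rad TYPE('d) n (real i * \<delta>)))"
    unfolding cell_def using False lborel_cball_fin[of x] sub by (simp add: measure_Diff less_top)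
  then show ?thesis using assms False by (simp add: content_cball_vec rad_vol algebra_simps)
qed

lemma cell_disjoint:
  assumes "0 \<le> n" "0 \<le> \<delta>" "i < j" shows "cell n \<delta> (x::real^'d::finite) i \<inter> cell n \<delta> x j = {}"
proof -
  have "cell n \<delta> x i \<subseteq> cball x (rad TYPE('d) n (real j * \<delta>))"
    using cell_subset[OF assms(1,2), of i "j - 1" x] assms(3) by simp
  then show ?thesis using assms(3) by (auto simp: cell_def)
qed

lemma disjoint_cells: "0 \<le> n \<Longrightarrow> 0 \<le> \<delta> \<Longrightarrow> disjoint_family (cell n \<delta> (x::real^'d::finite))"
  unfolding disjoint_family_on_def
  by (metis cell_disjoint inf_commute linorder_neqE_nat)

text \<open>The constants of \<open>Vbar_repr\<close> at radius \<open>rad n K\<close>, in units of \<open>n\<close> times the kernel at volume \<open>n\<close>.\<close>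

lemma scaled_constants:
  fixes p q K :: real and n :: nat
  assumes p: "0 < p" "p < real CARD('d::finite)" and q: "0 < q" "q < p" and n: "0 < n" and K: "0 < K"
  defines "be \<equiv> p / real CARD('d)" and "w \<equiv> vd TYPE('d)"
  shows "w * p / (real CARD('d) - p) * rad TYPE('d) n K powr (real CARD('d) - p) = real n * (real n / w) powr - be * (be * K powr (1 - be) / (1 - be))"
    and "real n powr (1 - q / real CARD('d)) * p / (p - q) * rad TYPE('d) n K powr (q - p)
       = real n * (real n / w) powr - be * (p / (p - q) * w powr - (q / real CARD('d)) * K powr - ((p - q) / real CARD('d)))"
proof -
  let ?d = "real CARD('d)"
  have w: "w > 0" and d: "?d > 0" by (auto simp: w_def)
  have nw: "real n / w > 0" using n w by simp
  have rp: "rad TYPE('d) n K powr e = K powr (e / ?d) * (real n / w) powr (e / ?d)" for e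
    unfolding rad_def w_def by (simp add: powr_powr powr_mult[symmetric])
  have "w * p / (?d - p) * rad TYPE('d) n K powr (?d - p) = w * (p / (?d - p)) * K powr (1 - be) * (real n / w) powr (1 - be)"
    unfolding rp be_def using d by (simp add: diff_divide_distrib)
  also have "(real n / w) powr (1 - be) = real n / w * (real n / w) powr - be"
    using powr_mult_base[of "real n / w" "- be"] nw by simp
  also have "p / (?d - p) = be / (1 - be)" using d p by (simp add: be_def field_simps)
  finally show "w * p / (?d - p) * rad TYPE('d) n K powr (?d - p) = real n * (real n / w) powr - be * (be * K powr (1 - be) / (1 - be))"
    using w by simp
  have "(real n / w) powr ((q - p) / ?d) = (real n / w) powr (q / ?d) * (real n / w) powr - be"
    by (simp add: be_def powr_add[symmetric] diff_divide_distrib)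
  also have "(real n / w) powr (q / ?d) = real n powr (q / ?d) * w powr - (q / ?d)"
    using w by (simp add: powr_divide powr_minus field_simps)
  finally have e: "(real n / w) powr ((q - p) / ?d) = real n powr (q / ?d) * w powr - (q / ?d) * (real n / w) powr - be" .
  have f: "real n powr (1 - q / ?d) * real n powr (q / ?d) = real n" using n by (simp add: powr_add[symmetric])
  have "real n powr (1 - q / ?d) * p / (p - q) * rad TYPE('d) n K powr (q - p) =
    (real n powr (1 - q / ?d) * real n powr (q / ?d)) * (real n / w) powr - be * (p / (p - q) * w powr - (q / ?d) * K powr ((q - p) / ?d))"
    unfolding rp e by simp
  then show "real n powr (1 - q / ?d) * p / (p - q) * rad TYPE('d) n K powr (q - p)
       = real n * (real n / w) powr - be * (p / (p - q) * w powr - (q / ?d) * K powr - ((p - q) / ?d))"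
    unfolding f minus_divide_left minus_diff_eq by simp
qed

text \<open>The cells are centred at a grid point \<open>x\<close>, the potential is evaluated at a
  nearby \<open>z\<close>. The kernel at the radius of a ball of volume \<open>n\<close> is
  \<open>sc\<close>, so \<open>n * sc\<close> is the natural unit of the potential. In this unit
  \<open>err\<close> is the discrepancy error; it tends to 0 for large \<open>K\<close> because
  \<open>q < p\<close>.\<close>

locale cell_setting =
  fixes \<mu> :: "(real^'d::finite) measure" and p q K :: real and n m :: nat and x z :: "real^'d"
    and be sc err \<delta> :: real and ra :: "nat \<Rightarrow> real" and ker :: "real^'d \<Rightarrow> real"
  assumes sets_mu: "sets \<mu> = sets borel" and fin: "\<And>x r. emeasure \<mu> (cball x r) < \<infinity>"
    and p: "0 < p" "p < real CARD('d)" and q: "0 < q" "q < p" and n: "0 < n" and K: "0 < K" and m: "3 \<le> m"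
    and gap: "\<And>i. i \<le> m \<Longrightarrow> ra i + 1 \<le> ra (Suc i)"
    and disc: "\<And>r. rad TYPE('d) (real n) K \<le> r \<Longrightarrow> \<bar>measure \<mu> (cball z r) - vd TYPE('d) * r ^ CARD('d)\<bar> \<le> real n powr (1 - q / real CARD('d)) * r powr q"
    and zx: "dist z x \<le> 1"
    and be_def: "be = p / real CARD('d)" and delta_def: "\<delta> = K / real m"
    and sc_def: "sc = (real n / vd TYPE('d)) powr - be"
    and err_def: "err = p / (p - q) * vd TYPE('d) powr - (q / real CARD('d)) * K powr - ((p - q) / real CARD('d))"
    and ra_def: "ra = (\<lambda>i. rad TYPE('d) (real n) (real i * \<delta>))"
    and ker_def: "ker = (\<lambda>y. indicat_real (cball z (ra m)) y * (dist y z powr - p - ra m powr - p))"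
begin

lemma mdelta: "real m * \<delta> = K" "0 < \<delta>" using m K by (auto simp: delta_def)

lemma ra_mono: "i \<le> j \<Longrightarrow> ra i \<le> ra j"
  unfolding ra_def using mdelta by (intro rad_mono mult_right_mono) auto

lemma ra_ge1: "1 \<le> i \<Longrightarrow> 1 \<le> ra i"
  using ra_mono[of 1 i] gap[of 0] by (simp add: ra_def)

lemma ra_powr: "0 < i \<Longrightarrow> ra i powr - p = sc * (real i * \<delta>) powr - be"
  using rad_powr[of "real i * \<delta>" "real n" p, where 'd='d] n mdelta by (simp add: ra_def sc_def be_def)

text \<open>\<open>Vbar_repr\<close> at the radius \<open>ra m\<close>, where \<open>ker\<close>
  vanishes; the subtracted constant is the Lebesgue integral of \<open>ker\<close>.\<close>

lemma Vbar_cells: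
  assumes good: "nearE p \<mu> z < \<infinity>"
  shows "\<bar>Vbar p \<mu> z - ((\<integral>y. ker y \<partial>\<mu>) - real n * sc * (be * K powr (1 - be) / (1 - be)))\<bar> \<le> real n * sc * err"
    and "integrable \<mu> (\<lambda>y. ker y)"
proof -
  have r1: "1 \<le> ra m" using m by (intro ra_ge1) auto
  have rK: "ra m = rad TYPE('d) (real n) K" by (simp only: mdelta ra_def)
  note si = nearE_finite(1)[OF sets_mu good]
  have "cball z (ra m) = cball z 1 \<union> {y. 1 < dist y z \<and> dist y z \<le> ra m}" using r1 by (auto simp: dist_commute)
  moreover have "set_integrable \<mu> (cball z 1 \<union> {y. 1 < dist y z \<and> dist y z \<le> ra m}) (\<lambda>y. dist y z powr - p)"
    by (rule set_integrable_Un[OF si kernel_integrable[OF sets_mu fin _ p(1)]])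
      (auto simp: sets_mu)
  ultimately have si2: "set_integrable \<mu> (cball z (ra m)) (\<lambda>y. dist y z powr - p)" by simp
  have si3: "set_integrable \<mu> (cball z (ra m)) (\<lambda>y. ra m powr - p)"
    unfolding set_integrable_def using fin[of z "ra m"] sets_mu by auto
  show "integrable \<mu> (\<lambda>y. ker y)"
    using set_integral_diff(1)[OF si2 si3] by (simp add: set_integrable_def ker_def)
  have "(\<integral>y. ker y \<partial>\<mu>) = Vnear p \<mu> (ra m) z - set_lebesgue_integral \<mu> (cball z (ra m)) (\<lambda>y. ra m powr - p)"
    using set_integral_diff(2)[OF si2 si3] by (simp add: set_lebesgue_integral_def Vnear_def ker_def)
  also have "set_lebesgue_integral \<mu> (cball z (ra m)) (\<lambda>y. ra m powr - p) = ra m powr - p * measure \<mu> (cball z (ra m))"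
    using sets_mu fin[of z "ra m"] by (simp add: set_lebesgue_integral_def mult.commute)
  finally have I: "(\<integral>y. ker y \<partial>\<mu>) = Vnear p \<mu> (ra m) z - ra m powr - p * measure \<mu> (cball z (ra m))" .
  have "\<bar>Vbar p \<mu> z - (Vnear p \<mu> (ra m) z - ra m powr - p * measure \<mu> (cball z (ra m)) - vd TYPE('d) * p / (real CARD('d) - p) * ra m powr (real CARD('d) - p))\<bar>
    \<le> real n powr (1 - q / real CARD('d)) * p / (p - q) * ra m powr (q - p)"
    by (rule Vbar_repr[OF sets_mu fin p q r1 _ _ si]) (use disc rK in auto)
  then show "\<bar>Vbar p \<mu> z - ((\<integral>y. ker y \<partial>\<mu>) - real n * sc * (be * K powr (1 - be) / (1 - be)))\<bar> \<le> real n * sc * err"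
    unfolding I rK scaled_constants[OF p q n K] be_def sc_def err_def .
qed

text \<open>A point of cell \<open>j - 2\<close> is within \<open>ra (j - 1)\<close> of
  \<open>x\<close>, hence within \<open>ra j\<close> of \<open>z\<close>, and contributes at least
  the kernel at \<open>ra j\<close>. All remaining points contribute non-negative amounts; an atom
  at \<open>z\<close>, where \<open>0 powr - p = 0\<close> would make \<open>ker\<close> negative,
  is excluded by \<open>nearE\<close>.\<close>

lemma Vbar_lower:
  assumes good: "nearE p \<mu> z < \<infinity>"
    and ev: "(\<Sum>j=3..m. ((real j * \<delta>) powr - be - K powr - be) * measure \<mu> (cell n \<delta> x (j - 2))) \<ge> real n * (be * K powr (1 - be) / (1 - be) - a)"
  shows "- Vbar p \<mu> z \<le> real n * sc * (a + err)"
proof -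
  have m0: "m > 0" using m by simp
  have finc: "emeasure \<mu> (cell n \<delta> x i) < \<infinity>" for i
    by (rule le_less_trans[OF emeasure_mono[OF cell_subset[of "real n" \<delta> i i x]] fin]) (use mdelta sets_mu in auto)
  define c where "c j = ra j powr - p - ra m powr - p" for j
  have c: "c j = sc * ((real j * \<delta>) powr - be - K powr - be)" if "0 < j" for j
    unfolding c_def ra_powr[OF that] ra_powr[OF m0] mdelta by (simp add: right_diff_distrib)
  have "(\<Sum>j=3..m. c j * measure \<mu> (cell n \<delta> x (j - 2))) = (\<integral>y. (\<Sum>j=3..m. c j * indicat_real (cell n \<delta> x (j - 2)) y) \<partial>\<mu>)"
    using finc sets_mu by (subst Bochner_Integration.integral_sum) auto
  also have "\<dots> \<le> (\<integral>y. ker y \<partial>\<mu>)"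
  proof (rule integral_mono_AE)
    show "integrable \<mu> (\<lambda>y. \<Sum>j=3..m. c j * indicat_real (cell n \<delta> x (j - 2)) y)"
      using finc sets_mu by (intro Bochner_Integration.integrable_sum integrable_mult_right integrable_real_indicator) auto
    show "integrable \<mu> (\<lambda>y. ker y)" by (rule Vbar_cells(2)[OF good])
    have "{z} \<in> null_sets \<mu>" using nearE_finite(2)[OF sets_mu good] sets_mu by auto
    then have "AE y in \<mu>. y \<notin> {z}" by (rule AE_not_in)
    then show "AE y in \<mu>. (\<Sum>j=3..m. c j * indicat_real (cell n \<delta> x (j - 2)) y) \<le> ker y"
    proof eventually_elim
      fix y assume "y \<notin> {z}"
      then have yz: "0 < dist y z" by simp
      have ker0: "0 \<le> ker y" using yz p by (auto simp: ker_def indicator_def dist_commute intro!: powr_mono2')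
      show "(\<Sum>j=3..m. c j * indicat_real (cell n \<delta> x (j - 2)) y) \<le> ker y"
      proof (cases "\<exists>j\<in>{3..m}. y \<in> cell n \<delta> x (j - 2)")
        case True
        then obtain j where j: "j \<in> {3..m}" "y \<in> cell n \<delta> x (j - 2)" by blast
        have "c i * indicat_real (cell n \<delta> x (i - 2)) y = 0" if "i \<in> {3..m} - {j}" for i
        proof -
          have "i - 2 \<noteq> j - 2" using that j by auto
          then have "cell n \<delta> x (i - 2) \<inter> cell n \<delta> x (j - 2) = {}"
            using disjoint_cells[of "real n" \<delta> x] mdelta by (simp add: disjoint_family_on_def)
          then show ?thesis using j by (auto simp: indicator_def)
        qed
        then have "(\<Sum>i=3..m. c i * indicat_real (cell n \<delta> x (i - 2)) y) = c j"
        proof -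
          assume z: "\<And>i. i \<in> {3..m} - {j} \<Longrightarrow> c i * indicat_real (cell n \<delta> x (i - 2)) y = 0"
          have "(\<Sum>i=3..m. c i * indicat_real (cell n \<delta> x (i - 2)) y) = (\<Sum>i\<in>{3..m}. if i = j then c j else 0)"
            using z j by (intro sum.cong) auto
          then show ?thesis using j by simp
        qed
        also have "\<dots> \<le> ker y"
        proof -
          have "dist y x \<le> ra (j - 1)" using j by (auto simp: cell_def dist_commute ra_def)
          moreover have "j - 1 \<le> m" "Suc (j - 1) = j" using j by auto
          then have "ra (j - 1) + 1 \<le> ra j" using gap[of "j - 1"] by simp
          ultimately have "dist y z \<le> ra j" using zx dist_triangle[of y z x] by (simp add: dist_commute)
          moreover have "ra j \<le> ra m" using j by (intro ra_mono) auto
          ultimately show ?thesis using yz p by (auto simp: ker_def c_def indicator_def dist_commute intro!: powr_mono2')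
        qed
        finally show ?thesis .
      next
        case False
        then have "(\<Sum>i=3..m. c i * indicat_real (cell n \<delta> x (i - 2)) y) = 0" by (intro sum.neutral) auto
        then show ?thesis using ker0 by simp
      qed
    qed
  qed
  finally have "(\<integral>y. ker y \<partial>\<mu>) \<ge> sc * (\<Sum>j=3..m. ((real j * \<delta>) powr - be - K powr - be) * measure \<mu> (cell n \<delta> x (j - 2)))"
    by (simp add: c sum_distrib_left mult.assoc)
  also have "sc * (\<Sum>j=3..m. ((real j * \<delta>) powr - be - K powr - be) * measure \<mu> (cell n \<delta> x (j - 2))) \<ge> sc * (real n * (be * K powr (1 - be) / (1 - be) - a))"
    using ev by (intro mult_left_mono) (auto simp: sc_def)
  finally have "sc * (real n * (be * K powr (1 - be) / (1 - be) - a)) \<le> (\<integral>y. ker y \<partial>\<mu>)" .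
  moreover have "sc * (real n * (be * K powr (1 - be) / (1 - be) - a)) = real n * sc * (be * K powr (1 - be) / (1 - be)) - real n * sc * a"
    by (simp only: right_diff_distrib mult.commute mult.left_commute)
  moreover have "real n * sc * (a + err) = real n * sc * a + real n * sc * err" by (rule distrib_left)
  ultimately show ?thesis using Vbar_cells(1)[OF good] by linarith
qed

text \<open>A point of cell \<open>i\<close> is farther than \<open>ra i\<close> from
  \<open>x\<close>, hence at least \<open>ra (i - 1)\<close> away from \<open>z\<close>. Near the
  centre this gives no useful bound on the kernel, and there the cells have to be empty.\<close>

lemma Vbar_upper:
  assumes vac: "\<And>i. i \<le> 2 \<Longrightarrow> emeasure \<mu> (cell n \<delta> x i) = 0"
    and good: "nearE p \<mu> z < \<infinity>"
    and ev: "\<And>i. i \<in> {3..m} \<Longrightarrow> measure \<mu> (cell n \<delta> x i) \<le> cc (i - 1) * (\<delta> * real n)"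
  shows "Vbar p \<mu> z \<le> real n * sc * (\<delta> * (\<Sum>l=2..<m. cc l * ((real l * \<delta>) powr - be - K powr - be)) - be * K powr (1 - be) / (1 - be) + err)"
proof -
  have m0: "m > 0" using m by simp
  have finc: "emeasure \<mu> (cell n \<delta> x i) < \<infinity>" for i
    by (rule le_less_trans[OF emeasure_mono[OF cell_subset[of "real n" \<delta> i i x]] fin]) (use mdelta sets_mu in auto)
  define c where "c j = ra j powr - p - ra m powr - p" for j
  have c: "c j = sc * ((real j * \<delta>) powr - be - K powr - be)" if "0 < j" for j
    unfolding c_def ra_powr[OF that] ra_powr[OF m0] mdelta by (simp add: right_diff_distrib)
  have c0: "0 \<le> c j" if "0 < j" "j \<le> m" for j
    unfolding c_def using that p ra_ge1[of j] ra_mono[of j m] by (simp add: powr_mono2')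
  have "(\<integral>y. ker y \<partial>\<mu>) \<le> (\<integral>y. (\<Sum>i=3..m. c (i - 1) * indicat_real (cell n \<delta> x i) y) \<partial>\<mu>)"
  proof (rule integral_mono_AE)
    show "integrable \<mu> (\<lambda>y. \<Sum>i=3..m. c (i - 1) * indicat_real (cell n \<delta> x i) y)"
      using finc sets_mu by (intro Bochner_Integration.integrable_sum integrable_mult_right integrable_real_indicator) auto
    show "integrable \<mu> (\<lambda>y. ker y)" by (rule Vbar_cells(2)[OF good])
    have nul: "cell n \<delta> x i \<in> null_sets \<mu>" if "i \<le> 2" for i using vac[OF that] sets_mu by auto
    have "AE y in \<mu>. y \<notin> cell n \<delta> x 0" "AE y in \<mu>. y \<notin> cell n \<delta> x 1" "AE y in \<mu>. y \<notin> cell n \<delta> x 2"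
      by (intro AE_not_in nul; simp)+
    then show "AE y in \<mu>. ker y \<le> (\<Sum>i=3..m. c (i - 1) * indicat_real (cell n \<delta> x i) y)"
    proof eventually_elim
      fix y assume ny: "y \<notin> cell n \<delta> x 0" "y \<notin> cell n \<delta> x 1" "y \<notin> cell n \<delta> x 2"
      have s0: "0 \<le> (\<Sum>i=3..m. c (i - 1) * indicat_real (cell n \<delta> x i) y)"
        using c0 by (intro sum_nonneg mult_nonneg_nonneg) auto
      show "ker y \<le> (\<Sum>i=3..m. c (i - 1) * indicat_real (cell n \<delta> x i) y)"
      proof (cases "y \<in> cball z (ra m)")
        case True
        then have "dist y x \<le> ra m + 1" using zx dist_triangle[of y x z] by (simp add: dist_commute)
        also have "\<dots> \<le> ra (Suc m)" using gap[of m] by simp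
        finally have dm: "dist y x \<le> ra (Suc m)" .
        \<comment> \<open>The index of the cell containing \<open>y\<close>. The gap at
          \<open>m\<close> ensures \<open>i \<le> m\<close>, although \<open>y\<close> is only known
          to lie within \<open>ra m\<close> of \<open>z\<close>, not of \<open>x\<close>.\<close>
        define i where "i = (LEAST i. dist y x \<le> ra (Suc i))"
        have i1: "dist y x \<le> ra (Suc i)" unfolding i_def using dm by (rule LeastI)
        have im: "i \<le> m" unfolding i_def using dm by (rule Least_le)
        have i2: "ra i < dist y x" if "0 < i"
          using not_less_Least[of "i - 1" "\<lambda>i. dist y x \<le> ra (Suc i)"] that unfolding i_def[symmetric] by (simp add: not_le)
        have yi: "y \<in> cell n \<delta> x i" using i1 i2 by (auto simp: cell_def dist_commute ra_def)
        have i3: "3 \<le> i"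
        proof (rule ccontr)
          assume "\<not> 3 \<le> i" then have "i = 0 \<or> i = 1 \<or> i = 2" by auto
          then show False using yi ny by auto
        qed
        have "ra (i - 1) + 1 \<le> ra i" using gap[of "i - 1"] i3 im by simp
        moreover have "dist y x \<le> dist y z + 1" using zx dist_triangle[of y x z] by simp
        ultimately have "ra (i - 1) \<le> dist y z" using i2 i3 by simp
        moreover have "1 \<le> ra (i - 1)" using i3 by (intro ra_ge1) auto
        ultimately have "ker y \<le> c (i - 1)" using True p by (auto simp: c_def ker_def intro!: powr_mono2')
        also have "\<dots> = c (i - 1) * indicat_real (cell n \<delta> x i) y" using yi by simp
        also have "\<dots> \<le> (\<Sum>i=3..m. c (i - 1) * indicat_real (cell n \<delta> x i) y)"
          using i3 im c0 by (intro member_le_sum) auto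
        finally show ?thesis .
      qed (use s0 in \<open>auto simp: ker_def\<close>)
    qed
  qed
  also have "\<dots> = (\<Sum>i=3..m. c (i - 1) * measure \<mu> (cell n \<delta> x i))"
    using finc sets_mu by (subst Bochner_Integration.integral_sum) auto
  also have "\<dots> \<le> (\<Sum>i=3..m. c (i - 1) * (cc (i - 1) * (\<delta> * real n)))"
    using ev c0 by (intro sum_mono mult_left_mono) auto
  also have "\<dots> = (\<Sum>l=2..<m. c l * (cc l * (\<delta> * real n)))"
    by (rule sum.reindex_bij_witness[of _ Suc "\<lambda>i. i - 1"]) (use m in auto)
  also have "\<dots> = real n * sc * (\<delta> * (\<Sum>l=2..<m. cc l * ((real l * \<delta>) powr - be - K powr - be)))"
    unfolding sum_distrib_left by (intro sum.cong refl) (simp add: c)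
  finally have I: "(\<integral>y. ker y \<partial>\<mu>) \<le> real n * sc * (\<delta> * (\<Sum>l=2..<m. cc l * ((real l * \<delta>) powr - be - K powr - be)))" .
  have "real n * sc * (\<delta> * (\<Sum>l=2..<m. cc l * ((real l * \<delta>) powr - be - K powr - be)) - be * K powr (1 - be) / (1 - be) + err)
    = real n * sc * (\<delta> * (\<Sum>l=2..<m. cc l * ((real l * \<delta>) powr - be - K powr - be))) - real n * sc * (be * K powr (1 - be) / (1 - be)) + real n * sc * err"
    by (simp only: distrib_left right_diff_distrib)
  then show ?thesis using I Vbar_cells(1)[OF good] by linarith
qed

end

section \<open>Maximum of the potential over large balls\<close>

text \<open>There are \<open>g\<close> independent blocks of \<open>r\<close> independent trials.
  The pair of block and trial is coded as \<open>k * r + i\<close>, because independence of the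
  point process is given for families indexed by natural numbers. The estimate is
  \<open>(1 - \<pi>) ^ g \<le> exp (- \<pi> * g)\<close>.\<close>

lemma (in prob_space) no_success_bound:
  fixes X :: "nat \<Rightarrow> 'a \<Rightarrow> ennreal"
  assumes ind: "indep_vars (\<lambda>_. borel) X {..<g * r}" and r: "0 < r" and pi: "0 \<le> \<pi>"
    and succ: "\<And>k. k < g \<Longrightarrow> \<pi> \<le> (\<Prod>i<r. prob {\<omega>\<in>space M. X (k * r + i) \<omega> \<le> t i})"
  shows "prob {\<omega>\<in>space M. \<forall>k<g. \<exists>i<r. \<not> X (k * r + i) \<omega> \<le> t i} \<le> exp (- \<pi> * real g)"
proof (cases "g = 0")
  case False
  have rv: "random_variable borel (X j)" if "j < g * r" for j
    using ind that unfolding indep_vars_def by auto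
  have idx: "k * r + i < g * r" if "k < g" "i < r" for k i
  proof -
    have "k * r + i < Suc k * r" using that by simp
    also have "\<dots> \<le> g * r" using that by (intro mult_le_mono1) auto
    finally show ?thesis .
  qed
  define K where "K k = {k * r..<k * r + r}" for k
  have Ksub: "K j \<subseteq> {..<g * r}" if "j < g" for j
  proof
    fix u assume u: "u \<in> K j"
    have "u < Suc j * r" using u by (simp add: K_def)
    also have "\<dots> \<le> g * r" using that by (intro mult_le_mono1) auto
    finally show "u \<in> {..<g * r}" by simp
  qed
  define Y where "Y k \<omega> = restrict (\<lambda>j. X j \<omega>) (K k)" for k \<omega>
  define A where "A k = {f\<in>space (PiM (K k) (\<lambda>_. borel :: ennreal measure)). \<exists>i<r. \<not> f (k * r + i) \<le> t i}" for k
  have indY: "indep_vars (\<lambda>k. PiM (K k) (\<lambda>_. borel)) Y {..<g}"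
    unfolding Y_def
  proof (rule indep_vars_restrict[OF ind])
    show "K j \<subseteq> {..<g * r}" if "j \<in> {..<g}" for j
      using Ksub that by simp
    show "disjoint_family_on K {..<g}"
      unfolding disjoint_family_on_def
    proof (intro ballI impI equals0I)
      fix a b u assume ab: "a \<noteq> b" and u: "u \<in> K a \<inter> K b"
      have "u div r = a" using u r by (intro div_nat_eqI) (simp_all add: K_def mult.commute)
      moreover have "u div r = b" using u r by (intro div_nat_eqI) (simp_all add: K_def mult.commute)
      ultimately show False using ab by simp
    qed
  qed
  have As: "A k \<in> sets (PiM (K k) (\<lambda>_. borel))" for k
  proof -
    have m: "(\<lambda>f. f (k * r + i)) \<in> borel_measurable (PiM (K k) (\<lambda>_. borel :: ennreal measure))" if "i < r" for i
      by (rule measurable_component_singleton) (use that in \<open>auto simp: K_def\<close>)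
    have "A k = (\<Union>i\<in>{..<r}. {f\<in>space (PiM (K k) (\<lambda>_. borel :: ennreal measure)). \<not> f (k * r + i) \<le> t i})"
      unfolding A_def by auto
    also have "\<dots> \<in> sets (PiM (K k) (\<lambda>_. borel))"
    proof (intro sets.finite_UN)
      fix i assume "i \<in> {..<r}"
      then have [measurable]: "(\<lambda>f. f (k * r + i)) \<in> borel_measurable (PiM (K k) (\<lambda>_. borel :: ennreal measure))" using m by simp
      show "{f\<in>space (PiM (K k) (\<lambda>_. borel :: ennreal measure)). \<not> f (k * r + i) \<le> t i} \<in> sets (PiM (K k) (\<lambda>_. borel))" by measurable
    qed simp
    finally show ?thesis .
  qed
  have vimage: "Y k -` A k \<inter> space M = {\<omega>\<in>space M. \<exists>i<r. \<not> X (k * r + i) \<omega> \<le> t i}" if "k < g" for k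
    by (auto simp: Y_def A_def K_def space_PiM)
  have one: "prob (Y k -` A k \<inter> space M) \<le> exp (- \<pi>)" if k: "k < g" for k
  proof -
    have all: "prob {\<omega>\<in>space M. \<forall>i<r. X (k * r + i) \<omega> \<le> t i} = (\<Prod>i<r. prob {\<omega>\<in>space M. X (k * r + i) \<omega> \<le> t i})"
    proof -
      have "indep_vars (\<lambda>_. borel) X (K k)"
        by (rule indep_vars_subset[OF ind]) (rule Ksub[OF k])
      then have "prob (\<Inter>j\<in>K k. X j -` {..t (j - k * r)} \<inter> space M) = (\<Prod>j\<in>K k. prob (X j -` {..t (j - k * r)} \<inter> space M))"
        by (rule indep_varsD_finite) (use r in \<open>auto simp: K_def\<close>)
      also have "(\<Inter>j\<in>K k. X j -` {..t (j - k * r)} \<inter> space M) = {\<omega>\<in>space M. \<forall>i<r. X (k * r + i) \<omega> \<le> t i}"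
      proof -
        have "(\<forall>j\<in>K k. X j \<omega> \<le> t (j - k * r)) \<longleftrightarrow> (\<forall>i<r. X (k * r + i) \<omega> \<le> t i)" for \<omega>
        proof safe
          fix i assume *: "\<forall>j\<in>K k. X j \<omega> \<le> t (j - k * r)" and "i < r"
          then have "k * r + i \<in> K k" by (simp add: K_def)
          from bspec[OF * this] show "X (k * r + i) \<omega> \<le> t i" by simp
        next
          fix j assume *: "\<forall>i<r. X (k * r + i) \<omega> \<le> t i" and "j \<in> K k"
          then have "j - k * r < r" "k * r + (j - k * r) = j" by (auto simp: K_def)
          then show "X j \<omega> \<le> t (j - k * r)" using *[rule_format, of "j - k * r"] by simp
        qed
        moreover have "K k \<noteq> {}" using r by (auto simp: K_def)
        moreover have "(\<Inter>j\<in>K k. X j -` {..t (j - k * r)} \<inter> space M) = {\<omega>\<in>space M. \<forall>j\<in>K k. X j \<omega> \<le> t (j - k * r)}"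
          using \<open>K k \<noteq> {}\<close> by blast
        ultimately show ?thesis by simp
      qed
      also have "(\<Prod>j\<in>K k. prob (X j -` {..t (j - k * r)} \<inter> space M)) = (\<Prod>i<r. prob (X (k * r + i) -` {..t i} \<inter> space M))"
        unfolding K_def by (rule prod.reindex_bij_witness[of _ "\<lambda>i. k * r + i" "\<lambda>j. j - k * r"]) auto
      also have "\<dots> = (\<Prod>i<r. prob {\<omega>\<in>space M. X (k * r + i) \<omega> \<le> t i})"
        by (intro prod.cong refl arg_cong[where f=prob]) auto
      finally show ?thesis .
    qed
    have eq: "{\<omega>\<in>space M. \<exists>i<r. \<not> X (k * r + i) \<omega> \<le> t i} = space M - {\<omega>\<in>space M. \<forall>i<r. X (k * r + i) \<omega> \<le> t i}" by auto
    have ev: "{\<omega>\<in>space M. \<forall>i\<in>{..<r}. X (k * r + i) \<omega> \<le> t i} \<in> events"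
    proof (rule sets.sets_Collect_finite_All)
      fix i assume "i \<in> {..<r}"
      then have [measurable]: "random_variable borel (X (k * r + i))" using rv idx k by simp
      show "{\<omega>\<in>space M. X (k * r + i) \<omega> \<le> t i} \<in> events" by measurable
    qed simp
    have ev': "{\<omega>\<in>space M. \<forall>i<r. X (k * r + i) \<omega> \<le> t i} \<in> events"
      using ev by (simp only: Ball_def lessThan_iff)
    have "prob (Y k -` A k \<inter> space M) = 1 - prob {\<omega>\<in>space M. \<forall>i<r. X (k * r + i) \<omega> \<le> t i}"
      unfolding vimage[OF k] by (subst eq) (rule prob_compl[OF ev'])
    also have "\<dots> \<le> 1 - \<pi>" using succ[OF k] all by simp
    also have "\<dots> \<le> exp (- \<pi>)" using exp_ge_add_one_self[of "- \<pi>"] by simp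
    finally show ?thesis .
  qed
  have "{\<omega>\<in>space M. \<forall>k<g. \<exists>i<r. \<not> X (k * r + i) \<omega> \<le> t i} = (\<Inter>k\<in>{..<g}. Y k -` A k \<inter> space M)"
  proof -
    have "(\<Inter>k\<in>{..<g}. Y k -` A k \<inter> space M) = (\<Inter>k\<in>{..<g}. {\<omega>\<in>space M. \<exists>i<r. \<not> X (k * r + i) \<omega> \<le> t i})"
      by (intro INF_cong refl vimage) simp
    then show ?thesis using False by (simp only:) blast
  qed
  also have "prob \<dots> = (\<Prod>k<g. prob (Y k -` A k \<inter> space M))"
    by (rule indep_varsD_finite[OF indY]) (use False As in auto)
  also have "\<dots> \<le> (\<Prod>k<g. exp (- \<pi>))" using one by (intro prod_mono) auto
  also have "\<dots> = exp (- \<pi> * real g)" by (simp add: exp_of_nat_mult[symmetric] mult.commute)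
  finally show ?thesis .
qed simp

text \<open>The event contains the single value \<open>k = \<lfloor>exp (- h) * L\<rfloor>\<close>.
  Its point mass yields the entropy cost by Stirling's bound, with a correction
  \<open>2 + h + ln (L + 1)\<close> that is negligible when \<open>L\<close> is a multiple of
  \<open>n\<close>.\<close>

lemma (in prob_space) poisson_var_lower:
  assumes X: "poisson_var M X L" and L: "0 < L" and h: "0 \<le> h"
  shows "exp (- (L * (1 - exp (- h) - h * exp (- h))) - (2 + h) - ln (L + 1)) \<le> prob {\<omega>\<in>space M. X \<omega> \<le> ennreal (exp (- h) * L)}"
proof -
  note [measurable] = poisson_varD[OF X]
  define c where "c = exp (- h) * L"
  define k where "k = nat \<lfloor>c\<rfloor>"
  have c: "0 < c" "c \<le> L" "ln c = ln L - h" using L h by (auto simp: c_def ln_mult)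
  have k: "real k \<le> c" "c < real k + 1" using c unfolding k_def by linarith+
  have c1: "0 < 1 + 1 / c" using c by (simp add: add_pos_pos)
  have "c * (1 + 1 / c) = c + 1" using c by (simp add: field_simps)
  then have "ln (real k + 1) \<le> ln (c * (1 + 1 / c))" using k c by simp
  also have "\<dots> = ln c + ln (1 + 1 / c)" using c c1 by (intro ln_mult_pos) auto
  also have "ln (1 + 1 / c) \<le> 1 / c" using c by (intro ln_add_one_self_le_self) auto
  finally have l1: "ln (real k + 1) \<le> ln L - h + 1 / c" using c by simp
  have l2: "ln (real k + 1) \<le> ln (L + 1)" using k c by simp
  have "real k * (ln (real k + 1)) \<le> real k * (ln L - h + 1 / c)" using l1 by (intro mult_left_mono) auto
  also have "\<dots> = real k * (ln L - h) + real k / c" by (simp add: distrib_left)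
  also have "real k / c \<le> 1" using k c by simp
  finally have l3: "real k * ln (real k + 1) \<le> real k * (ln L - h) + 1" by simp
  have l4: "(c - 1) * (1 + h) \<le> real k * (1 + h)" using k h by (intro mult_right_mono) auto
  have "- (L * (1 - exp (- h) - h * exp (- h))) - (2 + h) - ln (L + 1) = - L + (c - 1) * (1 + h) - 1 - ln (L + 1)"
    by (simp add: c_def algebra_simps)
  also have "\<dots> \<le> - L + real k * ln L + real k - (real k + 1) * ln (real k + 1)"
    using l2 l3 l4 by (simp add: algebra_simps)
  finally have "exp (- (L * (1 - exp (- h) - h * exp (- h))) - (2 + h) - ln (L + 1)) \<le> exp (- L + real k * ln L + real k - (real k + 1) * ln (real k + 1))"
    by simp
  also have "\<dots> = exp (- L) * L ^ k / ((real k + 1) ^ Suc k * exp (- real k))"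
  proof -
    have "exp (real k * ln L) = L ^ k" using L by (simp add: exp_of_nat_mult)
    moreover have "exp ((real k + 1) * ln (real k + 1)) = (real k + 1) ^ Suc k"
    proof -
      have "(real k + 1) * ln (real k + 1) = real (Suc k) * ln (real k + 1)" by simp
      then show ?thesis by (simp only: exp_of_nat_mult) (simp add: exp_ln)
    qed
    ultimately show ?thesis by (simp add: exp_add exp_diff exp_minus field_simps)
  qed
  also have "\<dots> \<le> exp (- L) * L ^ k / fact k"
    using fact_le_pow[of k] L by (intro divide_left_mono) (auto simp: add.commute)
  also have "\<dots> = prob {\<omega>\<in>space M. X \<omega> = of_nat k}" using X by (simp add: poisson_var_def)
  also have "\<dots> \<le> prob {\<omega>\<in>space M. X \<omega> \<le> ennreal (exp (- h) * L)}"
  proof (rule finite_measure_mono)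
    show "{\<omega>\<in>space M. X \<omega> = of_nat k} \<subseteq> {\<omega>\<in>space M. X \<omega> \<le> ennreal (exp (- h) * L)}"
      using k by (auto simp: c_def ennreal_of_nat_eq_real_of_nat intro!: ennreal_leI)
  qed measurable
  finally show ?thesis .
qed

lemma prm_indep:
  fixes N :: "'w \<Rightarrow> (real^'d::finite) measure" and I :: "nat set"
  assumes "poisson_random_measure P N" "finite I" "\<And>i. i \<in> I \<Longrightarrow> A i \<in> sets borel" "\<And>i. i \<in> I \<Longrightarrow> bounded (A i)" "disjoint_family_on A I"
  shows "prob_space.indep_vars P (\<lambda>_. borel) (\<lambda>i \<omega>. emeasure (N \<omega>) (A i)) I"
proof -
  have "\<forall>(I::nat set) (A :: nat \<Rightarrow> (real^'d) set). finite I \<longrightarrow>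
        (\<forall>i\<in>I. A i \<in> sets borel \<and> bounded (A i)) \<longrightarrow> disjoint_family_on A I \<longrightarrow>
        prob_space.indep_vars P (\<lambda>_. borel) (\<lambda>i \<omega>. emeasure (N \<omega>) (A i)) I"
    using assms(1) unfolding poisson_random_measure_def by (elim conjE)
  then show ?thesis using assms(2-) by simp
qed

lemma prm_indep_cells:
  fixes N :: "'w \<Rightarrow> (real^'d::finite) measure"
  assumes prm: "poisson_random_measure P N" and "finite I" "0 \<le> n" "0 \<le> \<delta>"
  shows "prob_space.indep_vars P (\<lambda>_. borel) (\<lambda>i \<omega>. emeasure (N \<omega>) (cell n \<delta> x i)) I"
proof -
  have "disjoint_family_on (cell n \<delta> x) I"
    using disjoint_cells[of n \<delta> x] assms by (auto simp: disjoint_family_on_def)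
  then show ?thesis by (intro prm_indep[OF prm assms(2)] cell_sets bounded_cell)
qed

lemma cell_poisson_var:
  fixes N :: "'w \<Rightarrow> (real^'d::finite) measure"
  assumes prm: "poisson_random_measure P N" and "0 \<le> n" "0 \<le> \<delta>"
  shows "poisson_var P (\<lambda>\<omega>. emeasure (N \<omega>) (cell n \<delta> x i)) (\<delta> * n)"
  using prm_poisson_var[OF prm cell_sets bounded_cell, of n \<delta> x i] cell_measure[OF assms(2,3), of x i] by simp

lemma prod_ennreal_exp: "finite I \<Longrightarrow> (\<Prod>i\<in>I. ennreal (exp (f i))) = ennreal (exp (\<Sum>i\<in>I. f i))"
  by (simp add: prod_ennreal exp_sum)

lemma cells_chernoff:
  fixes N :: "'w \<Rightarrow> (real^'d::finite) measure"
  assumes prm: "poisson_random_measure P N" and I: "finite I" and n: "0 \<le> n" and d: "0 \<le> \<delta>" and s: "0 \<le> s"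
  shows "{\<omega>\<in>space P. (\<Sum>i\<in>I. \<kappa> i * measure (N \<omega>) (cell n \<delta> x i)) \<le> b} \<in> sets P"
    and "measure P {\<omega>\<in>space P. (\<Sum>i\<in>I. \<kappa> i * measure (N \<omega>) (cell n \<delta> x i)) \<le> b}
      \<le> exp (s * b + \<delta> * n * (\<Sum>i\<in>I. exp (- s * \<kappa> i) - 1))"
proof -
  interpret prob_space P by (rule prm_prob_space[OF prm])
  let ?X = "\<lambda>i \<omega>. emeasure (N \<omega>) (cell n \<delta> x i)"
  note pv = cell_poisson_var[OF prm n d, of x]
  have [measurable]: "?X i \<in> borel_measurable P" for i by (rule poisson_varD[OF pv])
  have m: "(\<lambda>\<omega>. \<Sum>i\<in>I. \<kappa> i * measure (N \<omega>) (cell n \<delta> x i)) \<in> borel_measurable P"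
    unfolding measure_def by measurable
  then show ev: "{\<omega>\<in>space P. (\<Sum>i\<in>I. \<kappa> i * measure (N \<omega>) (cell n \<delta> x i)) \<le> b} \<in> sets P" by measurable
  have "(\<integral>\<^sup>+\<omega>. ennreal (exp (- s * (\<Sum>i\<in>I. \<kappa> i * measure (N \<omega>) (cell n \<delta> x i)))) \<partial>P)
     = (\<integral>\<^sup>+\<omega>. (\<Prod>i\<in>I. ennreal (exp ((- s * \<kappa> i) * enn2real (?X i \<omega>)))) \<partial>P)"
    by (intro nn_integral_cong) (simp add: prod_ennreal_exp[OF I] sum_distrib_left measure_def mult.assoc sum_negf)
  also have "\<dots> = (\<Prod>i\<in>I. \<integral>\<^sup>+\<omega>. ennreal (exp ((- s * \<kappa> i) * enn2real (?X i \<omega>))) \<partial>P)"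
  proof (rule indep_vars_nn_integral[OF I])
    show "indep_vars (\<lambda>_. borel) (\<lambda>i \<omega>. ennreal (exp ((- s * \<kappa> i) * enn2real (?X i \<omega>)))) I"
      by (rule indep_vars_compose2[OF prm_indep_cells[OF prm I n d]]) measurable
  qed simp
  also have "\<dots> = (\<Prod>i\<in>I. ennreal (exp (\<delta> * n * (exp (- s * \<kappa> i) - 1))))"
    using n d by (intro prod.cong refl poisson_var_laplace[OF pv]) auto
  also have "\<dots> = ennreal (exp (\<delta> * n * (\<Sum>i\<in>I. exp (- s * \<kappa> i) - 1)))"
    by (simp add: prod_ennreal_exp[OF I] sum_distrib_left)
  finally have lap: "(\<integral>\<^sup>+\<omega>. ennreal (exp (- s * (\<Sum>i\<in>I. \<kappa> i * measure (N \<omega>) (cell n \<delta> x i)))) \<partial>P)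
     = ennreal (exp (\<delta> * n * (\<Sum>i\<in>I. exp (- s * \<kappa> i) - 1)))" .
  have "prob {\<omega>\<in>space P. (\<Sum>i\<in>I. \<kappa> i * measure (N \<omega>) (cell n \<delta> x i)) \<le> b}
     \<le> exp (\<delta> * n * (\<Sum>i\<in>I. exp (- s * \<kappa> i) - 1)) * exp (- (- s * b))"
  proof (rule markov_exp[OF _ ev])
    show "(\<lambda>\<omega>. - s * (\<Sum>i\<in>I. \<kappa> i * measure (N \<omega>) (cell n \<delta> x i))) \<in> borel_measurable P" using m by measurable
    show "AE \<omega> in P. (\<Sum>i\<in>I. \<kappa> i * measure (N \<omega>) (cell n \<delta> x i)) \<le> b \<longrightarrow> - s * b \<le> - s * (\<Sum>i\<in>I. \<kappa> i * measure (N \<omega>) (cell n \<delta> x i))"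
      using s by (auto intro!: AE_I2 mult_left_mono)
  qed (use lap in auto)
  then show "prob {\<omega>\<in>space P. (\<Sum>i\<in>I. \<kappa> i * measure (N \<omega>) (cell n \<delta> x i)) \<le> b}
      \<le> exp (s * b + \<delta> * n * (\<Sum>i\<in>I. exp (- s * \<kappa> i) - 1))"
    by (simp add: exp_add mult.commute)
qed

section \<open>Upper bound for the maximum of the negative potential\<close>

lemma rad_gap_all:
  assumes "0 < \<delta>"
  shows "\<forall>\<^sub>F n in sequentially. \<forall>i\<in>{..m::nat}. rad TYPE('d::finite) (real n) (real i * \<delta>) + 1 \<le> rad TYPE('d) (real n) (real (Suc i) * \<delta>)"
  using assms by (subst eventually_ball_finite_distrib) (auto intro!: rad_gap)

lemma rad_large:
  assumes w: "(K / vd TYPE('d::finite)) powr (1 / real CARD('d)) \<ge> c"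
  shows "c * real n powr (1 / real CARD('d)) \<le> rad TYPE('d) (real n) K"
proof -
  have "rad TYPE('d) (real n) K = (K / vd TYPE('d)) powr (1 / real CARD('d)) * real n powr (1 / real CARD('d))"
    unfolding rad_def powr_mult[symmetric] by simp
  then show ?thesis using w by (simp add: mult_right_mono)
qed

text \<open>Large \<open>K\<close> serves two purposes: the outer radius reaches the range of the
  discrepancy bound, and the discrepancy error falls below \<open>e\<close>.\<close>

lemma eventually_large_K:
  fixes p q c e :: real
  assumes q: "q < p" "0 < q" and e: "0 < e"
  shows "\<forall>\<^sub>F K in at_top. 0 < K \<and> c \<le> (K / vd TYPE('d::finite)) powr (1 / real CARD('d))
     \<and> p / (p - q) * vd TYPE('d) powr - (q / real CARD('d)) * K powr - ((p - q) / real CARD('d)) < e"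
proof -
  have w: "vd TYPE('d) > 0" by simp
  have d: "1 / real CARD('d) > 0" "(p - q) / real CARD('d) > 0" using q by auto
  have "filterlim (\<lambda>K::real. (K / vd TYPE('d)) powr (1 / real CARD('d))) at_top at_top"
  proof -
    have "filterlim (\<lambda>K::real. (K / v) powr e) at_top at_top" if "v > 0" "e > 0" for v e :: real
      using that by real_asymp
    then show ?thesis using w d(1) by blast
  qed
  then have 1: "\<forall>\<^sub>F K in at_top. c \<le> (K / vd TYPE('d)) powr (1 / real CARD('d))" unfolding filterlim_at_top by blast
  have "((\<lambda>K. p / (p - q) * vd TYPE('d) powr - (q / real CARD('d)) * K powr - ((p - q) / real CARD('d))) \<longlongrightarrow> 0) at_top"
    by (rule tendsto_mult_right_zero) (use d(2) in real_asymp)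
  then have 2: "\<forall>\<^sub>F K in at_top. p / (p - q) * vd TYPE('d) powr - (q / real CARD('d)) * K powr - ((p - q) / real CARD('d)) < e"
    by (rule order_tendstoD) (use e in simp)
  show ?thesis using 1 2 eventually_gt_at_top[of 0] by eventually_elim simp
qed

lemma summable_exp_neg: "0 < e \<Longrightarrow> summable (\<lambda>n. C * exp (- e * real n))"
proof -
  assume "0 < e"
  then have "summable (\<lambda>n. exp (- e) ^ n)" by (intro summable_geometric) simp
  then have "summable (\<lambda>n. exp (- e * real n))" by (simp only: exp_of_nat2_mult)
  then show ?thesis by (rule summable_mult)
qed

text \<open>Union bound over a grid of at most \<open>(5 * d * exp n) ^ d\<close> centres, each of
  which is bad with probability at most \<open>exp (n * L)\<close>, where \<open>L < - d\<close>.
  Every \<open>z\<close> is within distance 1 of a centre, a displacement that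
  \<open>cell_setting\<close> tolerates.\<close>

lemma sup_AE:
  fixes N :: "'w \<Rightarrow> (real^'d::finite) measure" and p a' be :: real
  assumes prm: "poisson_random_measure P N" and p: "real CARD('d) / 2 < p" "p < real CARD('d)"
    and be_def: "be = p / real CARD('d)"
    and a': "real CARD('d) / (1 - be) * (Gamma (2 - 1 / be) / real CARD('d)) powr be < a'"
  shows "AE \<omega> in P. \<forall>\<^sub>F n in sequentially. \<forall>z\<in>cball 0 (exp (real n)). nearE p (N \<omega>) z < \<infinity> \<longrightarrow>
    - Vbar p (N \<omega>) z \<le> real n * (real n / vd TYPE('d)) powr - be * a'"
proof -
  interpret prob_space P by (rule prm_prob_space[OF prm])
  define dr where "dr = real CARD('d)"
  have dr: "dr \<ge> 1" by (simp add: dr_def Suc_leI)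
  \<comment> \<open>Any exponent strictly between \<open>d / 2\<close> and \<open>p\<close> would
    do: above \<open>d / 2\<close> for the discrepancy bound, below \<open>p\<close> for the
    convergence of the tail integral.\<close>
  define q where "q = (dr / 2 + p) / 2"
  have q: "dr / 2 < q" "q < p" "0 < q" "q < dr" using p dr by (auto simp: q_def dr_def)
  have p0: "0 < p" using p dr by (auto simp: dr_def)
  have be: "1/2 < be" "be < 1" using p dr by (auto simp: be_def dr_def field_simps)
  define A where "A = dr / (1 - be) * (Gamma (2 - 1 / be) / dr) powr be"
  \<comment> \<open>Half of the distance from \<open>A\<close> to \<open>a'\<close> makes the
    Chernoff exponent strictly better than needed, the other half covers the discrepancy
    error.\<close>
  define a where "a = (A + a') / 2"
  have "A < a'" using a' unfolding A_def dr_def .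
  then have a: "A < a" "a < a'" by (auto simp: a_def)
  obtain s where s: "s > 0" and rate: "\<forall>\<^sub>F K in at_top. \<forall>\<^sub>F m in sequentially.
    s * (be * K powr (1 - be) / (1 - be) - a) + K / real m * (\<Sum>j=3..m. exp (- s * ((real j * (K / real m)) powr - be - K powr - be)) - 1) < - dr"
    using rate_upper[OF be, of dr a] dr a by (auto simp: A_def)
  obtain Kd where Kd: "Kd \<ge> 1" and disc: "AE \<omega> in P. \<forall>\<^sub>F n in sequentially. \<forall>x\<in>cball 0 (exp (real n)). \<forall>r\<ge>Kd * real n powr (1 / real CARD('d)).
    \<bar>measure (N \<omega>) (cball x r) - vd TYPE('d) * r ^ CARD('d)\<bar> \<le> r powr q * real n powr (1 - q / real CARD('d))"
    using discrepancy_AE[OF prm, of q] q by (auto simp: dr_def)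
  have "\<forall>\<^sub>F K in at_top. (\<forall>\<^sub>F m in sequentially.
    s * (be * K powr (1 - be) / (1 - be) - a) + K / real m * (\<Sum>j=3..m. exp (- s * ((real j * (K / real m)) powr - be - K powr - be)) - 1) < - dr) \<and>
    (0 < K \<and> Kd \<le> (K / vd TYPE('d)) powr (1 / real CARD('d)) \<and> p / (p - q) * vd TYPE('d) powr - (q / real CARD('d)) * K powr - ((p - q) / real CARD('d)) < a' - a)"
    by (rule eventually_conj[OF rate eventually_large_K]) (use q a in auto)
  from eventually_happens'[OF trivial_limit_at_top_linorder this] obtain K where K: "0 < K" "Kd \<le> (K / vd TYPE('d)) powr (1 / real CARD('d))"
     "p / (p - q) * vd TYPE('d) powr - (q / real CARD('d)) * K powr - ((p - q) / real CARD('d)) < a' - a"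
    and rate2: "\<forall>\<^sub>F m in sequentially. s * (be * K powr (1 - be) / (1 - be) - a) + K / real m * (\<Sum>j=3..m. exp (- s * ((real j * (K / real m)) powr - be - K powr - be)) - 1) < - dr"
    by (elim exE conjE) (rule that; assumption)
  obtain m where m: "3 \<le> m" and rate3: "s * (be * K powr (1 - be) / (1 - be) - a) + K / real m * (\<Sum>j=3..m. exp (- s * ((real j * (K / real m)) powr - be - K powr - be)) - 1) < - dr"
    using eventually_happens[OF eventually_conj[OF rate2 eventually_ge_at_top[of 3]]] by auto
  define \<delta> where "\<delta> = K / real m"
  have d0: "0 < \<delta>" using K m by (simp add: \<delta>_def)
  define \<kappa> where "\<kappa> j = (real j * \<delta>) powr - be - K powr - be" for j
  define b where "b n = real n * (be * K powr (1 - be) / (1 - be) - a)" for n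
  define L where "L = s * (be * K powr (1 - be) / (1 - be) - a) + \<delta> * (\<Sum>j=3..m. exp (- s * \<kappa> j) - 1)"
  have L: "L < - dr" using rate3 unfolding L_def \<kappa>_def \<delta>_def .
  define bad where "bad n x = {\<omega>\<in>space P. (\<Sum>i\<in>{1..m-2}. \<kappa> (i + 2) * measure (N \<omega>) (cell (real n) \<delta> x i)) \<le> b n}" for n x
  have shift: "(\<Sum>j=3..m. f j (j - 2)) = (\<Sum>i\<in>{1..m-2}. f (i + 2) i)" for f :: "nat \<Rightarrow> nat \<Rightarrow> real"
    by (rule sum.reindex_bij_witness[of _ "\<lambda>i. i + 2" "\<lambda>j. j - 2"]) (use m in \<open>auto intro!: arg_cong2[where f=f]\<close>)
  have bad: "bad n x \<in> sets P" "measure P (bad n x) \<le> exp (real n * L)" for n x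
  proof -
    note ch = cells_chernoff[OF prm _ _ less_imp_le[OF d0] less_imp_le[OF s], of "{1..m-2}" "real n" "\<lambda>i. \<kappa> (i + 2)" x "b n"]
    show "bad n x \<in> sets P" unfolding bad_def by (rule ch(1)) auto
    have "measure P (bad n x) \<le> exp (s * b n + \<delta> * real n * (\<Sum>i\<in>{1..m-2}. exp (- s * \<kappa> (i + 2)) - 1))"
      unfolding bad_def by (rule ch(2)) auto
    also have "(\<Sum>i\<in>{1..m-2}. exp (- s * \<kappa> (i + 2)) - 1) = (\<Sum>j=3..m. exp (- s * \<kappa> j) - 1)"
      by (rule shift[symmetric])
    also have "s * b n + \<delta> * real n * (\<Sum>j=3..m. exp (- s * \<kappa> j) - 1) = real n * L"
      unfolding b_def L_def distrib_left by (simp only: mult.commute mult.left_commute)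
    finally show "measure P (bad n x) \<le> exp (real n * L)" .
  qed
  define M where "M n = nat \<lceil>exp (real n) * dr\<rceil>" for n :: nat
  define BB where "BB n = (\<Union>x\<in>grid (1 / dr) (M n). bad n x)" for n
  have BB: "BB n \<in> sets P" "measure P (BB n) \<le> (5 * dr) ^ CARD('d) * exp (- (- L - dr) * real n)" for n
  proof -
    show "BB n \<in> sets P" unfolding BB_def by (intro sets.finite_UN finite_grid bad)
    have "measure P (BB n) \<le> (\<Sum>x\<in>(grid (1 / dr) (M n) :: (real^'d) set). measure P (bad n x))"
      unfolding BB_def by (intro measure_UNION_le finite_grid bad)
    also have "\<dots> \<le> (\<Sum>x\<in>(grid (1 / dr) (M n) :: (real^'d) set). exp (real n * L))"
      by (intro sum_mono bad)
    also have "\<dots> = real (card (grid (1 / dr) (M n) :: (real^'d) set)) * exp (real n * L)" by simp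
    also have "\<dots> \<le> ((5 * dr) * exp (real n)) ^ CARD('d) * exp (real n * L)"
    proof (rule mult_right_mono)
      have e1: "exp (real n) * dr \<ge> 1 * 1" using dr by (intro mult_mono) auto
      have "real (card (grid (1 / dr) (M n) :: (real^'d) set)) \<le> real ((2 * M n + 1) ^ CARD('d))"
        by (rule of_nat_mono[OF card_grid])
      also have "\<dots> = (real (2 * M n + 1)) ^ CARD('d)" by simp
      also have "\<dots> \<le> ((5 * dr) * exp (real n)) ^ CARD('d)"
      proof (rule power_mono)
        have "real (M n) \<le> exp (real n) * dr + 1" using e1 unfolding M_def by linarith
        moreover have "(5 * dr) * exp (real n) = 5 * (exp (real n) * dr)" by simp
        moreover have "real (2 * M n + 1) = 2 * real (M n) + 1" by simp
        ultimately show "real (2 * M n + 1) \<le> (5 * dr) * exp (real n)" using e1 by linarith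
      qed simp
      finally show "real (card (grid (1 / dr) (M n) :: (real^'d) set)) \<le> ((5 * dr) * exp (real n)) ^ CARD('d)" .
    qed simp
    also have "\<dots> = (5 * dr) ^ CARD('d) * (exp (real n) ^ CARD('d) * exp (real n * L))" by (simp add: power_mult_distrib)
    also have "exp (real n) ^ CARD('d) = exp (dr * real n)" unfolding dr_def by (rule exp_of_nat_mult[symmetric])
    also have "exp (dr * real n) * exp (real n * L) = exp (- (- L - dr) * real n)"
      by (simp add: exp_add[symmetric] algebra_simps)
    finally show "measure P (BB n) \<le> (5 * dr) ^ CARD('d) * exp (- (- L - dr) * real n)" .
  qed
  have "AE \<omega> in P. eventually (\<lambda>n. \<omega> \<in> space P - BB n) sequentially"
  proof (rule borel_cantelli_AE1)
    show "summable (\<lambda>n. measure P (BB n))"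
      by (rule summable_comparison_test'[OF summable_exp_neg[of "- L - dr" "(5 * dr) ^ CARD('d)"], of 0]) (use L BB in auto)
  qed (use BB in \<open>auto simp: emeasure_eq_measure\<close>)
  then show ?thesis
    using disc prm_ball_finite[OF prm] AE_space
  proof eventually_elim
    case (elim \<omega>)
    have sets: "sets (N \<omega>) = sets borel" by (rule prm_sets[OF prm elim(4)])
    have fin: "emeasure (N \<omega>) (cball x r) < \<infinity>" for x r using elim(3) by blast
    show ?case using elim(1) elim(2) rad_gap_all[OF d0, of m, where 'd='d] eventually_gt_at_top[of 0]
    proof eventually_elim
      case (elim n)
      show ?case
      proof (intro ballI impI)
        fix z :: "real^'d" assume z: "z \<in> cball 0 (exp (real n))" and good: "nearE p (N \<omega>) z < \<infinity>"
        have "norm z \<le> 1 / dr * real (M n)"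
        proof -
          have "norm z \<le> 1 / dr * (exp (real n) * dr)" using z dr by simp
          also have "\<dots> \<le> 1 / dr * real (M n)" unfolding M_def using dr by (intro mult_left_mono real_nat_ceiling_ge) auto
          finally show ?thesis .
        qed
        then obtain x :: "real^'d" where x: "x \<in> grid (1 / dr) (M n)" "dist z x \<le> real CARD('d) * (1 / dr)"
          using grid_cover[of "1 / dr" z "M n"] dr by auto
        have zx: "dist z x \<le> 1" using x(2) dr by (simp add: dr_def)
        have "\<omega> \<notin> bad n x" using elim(1) x(1) by (auto simp: BB_def)
        then have nb: "b n \<le> (\<Sum>j=3..m. \<kappa> j * measure (N \<omega>) (cell (real n) \<delta> x (j - 2)))"
          using elim(1) shift[of "\<lambda>j i. \<kappa> j * measure (N \<omega>) (cell (real n) \<delta> x i)"] by (auto simp: bad_def not_le intro: less_imp_le)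
        interpret cs: cell_setting "N \<omega>" p q K n m x z be "(real n / vd TYPE('d)) powr - be"
          "p / (p - q) * vd TYPE('d) powr - (q / real CARD('d)) * K powr - ((p - q) / real CARD('d))" \<delta>
          "\<lambda>i. rad TYPE('d) (real n) (real i * \<delta>)"
          "\<lambda>y. indicat_real (cball z (rad TYPE('d) (real n) (real m * \<delta>))) y * (dist y z powr - p - rad TYPE('d) (real n) (real m * \<delta>) powr - p)"
        proof unfold_locales
          fix r assume "rad TYPE('d) (real n) K \<le> r"
          then have "Kd * real n powr (1 / real CARD('d)) \<le> r" using rad_large[OF K(2), of n] by linarith
          then show "\<bar>measure (N \<omega>) (cball z r) - vd TYPE('d) * r ^ CARD('d)\<bar> \<le> real n powr (1 - q / real CARD('d)) * r powr q"
            using elim(2) z by (simp add: mult.commute)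
        qed (use sets fin p0 p q K m elim zx be_def \<delta>_def in auto)
        have "- Vbar p (N \<omega>) z \<le> real n * (real n / vd TYPE('d)) powr - be * (a + p / (p - q) * vd TYPE('d) powr - (q / real CARD('d)) * K powr - ((p - q) / real CARD('d)))"
          by (rule cs.Vbar_lower[OF good]) (use nb in \<open>simp add: b_def \<kappa>_def\<close>)
        also have "\<dots> \<le> real n * (real n / vd TYPE('d)) powr - be * a'"
          using K(3) by (intro mult_left_mono) auto
        finally show "- Vbar p (N \<omega>) z \<le> real n * (real n / vd TYPE('d)) powr - be * a'" .
      qed
    qed
  qed
qed

section \<open>Existence of a peak through independent trials\<close>

lemma card_grid_eq:
  assumes "0 < e" shows "card (grid e m :: (real^'d::finite) set) = (2 * m + 1) ^ CARD('d)"
proof -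
  have "inj_on (\<lambda>k. (\<chi> i. e * of_int (k i)) :: real^'d) (UNIV \<rightarrow>\<^sub>E {- int m..int m})"
    using assms by (auto simp: inj_on_def vec_eq_iff fun_eq_iff)
  then have "card (grid e m :: (real^'d) set) = card ((UNIV::'d set) \<rightarrow>\<^sub>E {- int m..int m})"
    unfolding grid_def by (rule card_image)
  then show ?thesis by (simp add: card_funcsetE nat_add_distrib nat_mult_distrib)
qed

lemma grid_separated:
  fixes x y :: "real^'d::finite"
  assumes "0 < e" "x \<in> grid e m" "y \<in> grid e m" "x \<noteq> y" shows "e \<le> dist x y"
proof -
  obtain k l :: "'d \<Rightarrow> int" where k: "x = (\<chi> i. e * of_int (k i))" and l: "y = (\<chi> i. e * of_int (l i))"
    using assms(2,3) unfolding grid_def by blast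
  have "k \<noteq> l" using assms(4) k l by auto
  then obtain i where i: "k i \<noteq> l i" by (auto simp: fun_eq_iff)
  then have "1 \<le> \<bar>k i - l i\<bar>" by simp
  then have "1 \<le> \<bar>real_of_int (k i) - real_of_int (l i)\<bar>" by linarith
  then have "e * 1 \<le> e * \<bar>real_of_int (k i) - real_of_int (l i)\<bar>" using assms(1) by (intro mult_left_mono) auto
  also have "\<dots> = \<bar>(x - y) $ i\<bar>" using assms(1) by (simp add: k l abs_mult right_diff_distrib[symmetric])
  also have "\<dots> \<le> dist x y" unfolding dist_norm by (rule component_le_norm_cart)
  finally show ?thesis by simp
qed

lemma grid_norm:
  assumes "0 < e" "(x::real^'d::finite) \<in> grid e m" shows "norm x \<le> real CARD('d) * (e * real m)"
proof (rule norm_le_card_max)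
  fix i
  obtain k :: "'d \<Rightarrow> int" where k: "k \<in> UNIV \<rightarrow>\<^sub>E {- int m..int m}" "x = (\<chi> i. e * of_int (k i))"
    using assms(2) unfolding grid_def by blast
  have "k i \<in> {- int m..int m}" using k(1) by auto
  then have "\<bar>real_of_int (k i)\<bar> \<le> real m" by auto
  then show "\<bar>x $ i\<bar> \<le> e * real m" using assms(1) by (simp add: k abs_mult)
qed

text \<open>Around distinct points of a grid of mesh exceeding twice the outer radius the cells are disjoint,
  hence the local configurations are independent trials.\<close>

lemma no_success_grid:
  fixes N :: "'w \<Rightarrow> (real^'d::finite) measure" and T :: "nat \<Rightarrow> ennreal" and M r :: nat and e \<pi> \<delta> n :: real
  assumes prm: "poisson_random_measure P N" and n: "0 \<le> n" and d: "0 \<le> \<delta>" and r: "0 < r"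
    and e: "2 * rad TYPE('d) n (real r * \<delta>) < e" and e0: "0 < e"
    and pi: "0 \<le> \<pi>" and succ: "\<And>x::real^'d. \<pi> \<le> (\<Prod>i<r. measure P {\<omega>\<in>space P. emeasure (N \<omega>) (cell n \<delta> x i) \<le> T i})"
  defines "F \<equiv> {\<omega>\<in>space P. \<forall>x\<in>grid e M. \<exists>i<r. \<not> emeasure (N \<omega>) (cell n \<delta> x i) \<le> T i}"
  shows "F \<in> sets P" "measure P F \<le> exp (- \<pi> * real ((2 * M + 1) ^ CARD('d)))"
proof -
  interpret prob_space P by (rule prm_prob_space[OF prm])
  have mC: "(\<lambda>\<omega>. emeasure (N \<omega>) (cell n \<delta> x i)) \<in> borel_measurable P" for x i
    by (rule poisson_varD[OF cell_poisson_var[OF prm n d]])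
  have "{\<omega>\<in>space P. \<forall>x\<in>grid e M. \<exists>i\<in>{..<r}. \<not> emeasure (N \<omega>) (cell n \<delta> x i) \<le> T i} \<in> sets P"
  proof (intro sets.sets_Collect_finite_All sets.sets_Collect_finite_Ex finite_grid finite_lessThan)
    fix x i
    note [measurable] = mC[of x i]
    show "{\<omega>\<in>space P. \<not> emeasure (N \<omega>) (cell n \<delta> x i) \<le> T i} \<in> sets P" by measurable
  qed
  then show "F \<in> sets P" unfolding F_def by (simp only: Bex_def lessThan_iff)
  define g where "g = card (grid e M :: (real^'d) set)"
  obtain f where f: "bij_betw f {..<g} (grid e M :: (real^'d) set)"
    using ex_bij_betw_nat_finite[OF finite_grid[of e M, where 'd='d]] by (auto simp: g_def atLeast0LessThan)
  define X where "X j \<omega> = emeasure (N \<omega>) (cell n \<delta> (f (j div r)) (j mod r))" for j \<omega>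
  have Xki: "X (k * r + i) = (\<lambda>\<omega>. emeasure (N \<omega>) (cell n \<delta> (f k) i))" if "i < r" for k i
    using that by (simp add: X_def[abs_def])
  have disj: "disjoint_family_on (\<lambda>j. cell n \<delta> (f (j div r)) (j mod r)) {..<g * r}"
    unfolding disjoint_family_on_def
  proof (intro ballI impI)
    fix u v assume u: "u \<in> {..<g * r}" and v: "v \<in> {..<g * r}" and uv: "u \<noteq> v"
    show "cell n \<delta> (f (u div r)) (u mod r) \<inter> cell n \<delta> (f (v div r)) (v mod r) = {}"
    proof (cases "u div r = v div r")
      case True
      then have "u mod r \<noteq> v mod r" using uv by (metis div_mult_mod_eq)
      then show ?thesis using True disjoint_cells[OF n d, of "f (v div r)"] by (simp add: disjoint_family_on_def)
    next
      case False
      have ug: "u div r < g" "v div r < g" using u v r by (auto simp: less_mult_imp_div_less)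
      then have in_g: "f (u div r) \<in> grid e M" "f (v div r) \<in> grid e M" and ne: "f (u div r) \<noteq> f (v div r)"
        using f False by (auto simp: bij_betw_def inj_on_def)
      have far: "e \<le> dist (f (u div r)) (f (v div r))" by (rule grid_separated[OF e0 in_g ne])
      have sub: "cell n \<delta> (f w) (l mod r) \<subseteq> cball (f w) (rad TYPE('d) n (real r * \<delta>))" for w l
        using cell_subset[OF n d, of "l mod r" "r - 1" "f w"] r by (simp add: less_Suc_eq_le[symmetric])
      show ?thesis
      proof (rule equals0I)
        fix y assume "y \<in> cell n \<delta> (f (u div r)) (u mod r) \<inter> cell n \<delta> (f (v div r)) (v mod r)"
        then have "y \<in> cball (f (u div r)) (rad TYPE('d) n (real r * \<delta>))" "y \<in> cball (f (v div r)) (rad TYPE('d) n (real r * \<delta>))"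
          using sub by blast+
        then show False using far e dist_triangle2[of "f (u div r)" "f (v div r)" y] by simp
      qed
    qed
  qed
  have ind: "indep_vars (\<lambda>_. borel) X {..<g * r}"
    unfolding X_def[abs_def] by (rule prm_indep[OF prm _ cell_sets bounded_cell disj]) simp
  have "measure P {\<omega>\<in>space P. \<forall>k<g. \<exists>i<r. \<not> X (k * r + i) \<omega> \<le> T i} \<le> exp (- \<pi> * real g)"
    by (rule no_success_bound[OF ind r pi]) (use succ in \<open>simp add: Xki\<close>)
  also have "{\<omega>\<in>space P. \<forall>k<g. \<exists>i<r. \<not> X (k * r + i) \<omega> \<le> T i} = F"
  proof -
    have g: "grid e M = f ` {..<g}" using f by (simp add: bij_betw_def)
    have "(\<exists>i<r. \<not> X (k * r + i) \<omega> \<le> T i) \<longleftrightarrow> (\<exists>i<r. \<not> emeasure (N \<omega>) (cell n \<delta> (f k) i) \<le> T i)" for k \<omega>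
      by (rule ex_cong1) (auto simp: Xki)
    then show ?thesis unfolding F_def g by auto
  qed
  finally show "measure P F \<le> exp (- \<pi> * real ((2 * M + 1) ^ CARD('d)))"
    by (simp add: g_def card_grid_eq[OF e0])
qed

text \<open>A given centre has the desired shell counts with probability about
  \<open>exp (- n * cost)\<close>, and of order \<open>exp (d * n) / n\<close> disjoint
  neighbourhoods are available. As \<open>cost < d\<close>, the probability that none succeeds is
  summable. The potential is low on the whole unit ball around a successful centre, since the cells
  tolerate a unit displacement.\<close>

lemma peak_AE:
  fixes N :: "'w \<Rightarrow> (real^'d::finite) measure" and p a' be :: real
  assumes prm: "poisson_random_measure P N" and p: "real CARD('d) / 2 < p" "p < real CARD('d)"
    and be_def: "be = p / real CARD('d)"
    and a': "a' < real CARD('d) / (1 - be) * (Gamma (2 - 1 / be) / real CARD('d)) powr be"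
  shows "AE \<omega> in P. \<forall>\<^sub>F n in sequentially. \<exists>x\<in>cball 0 (exp (real n)). emeasure (N \<omega>) (cball x 2) = 0 \<and>
    (\<forall>z\<in>cball x 1. Vbar p (N \<omega>) z \<le> - (real n * (real n / vd TYPE('d)) powr - be * a'))"
proof -
  interpret prob_space P by (rule prm_prob_space[OF prm])
  define dr where "dr = real CARD('d)"
  have dr: "dr \<ge> 1" by (simp add: dr_def Suc_leI)
  define q where "q = (dr / 2 + p) / 2"
  have q: "dr / 2 < q" "q < p" "0 < q" "q < dr" using p dr by (auto simp: q_def dr_def)
  have p0: "0 < p" using p dr by (auto simp: dr_def)
  have be: "1/2 < be" "be < 1" using p dr by (auto simp: be_def dr_def field_simps)
  define A where "A = dr / (1 - be) * (Gamma (2 - 1 / be) / dr) powr be"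
  define a where "a = (A + a') / 2"
  have "a' < A" using a' unfolding A_def dr_def .
  then have a: "a < A" "a' < a" by (auto simp: a_def)
  define psi where "psi h = 1 - exp (- h) - h * exp (- h)" for h :: real
  obtain s where s: "s > 0" and rate: "\<forall>\<^sub>F K in at_top. \<forall>\<^sub>F m in sequentially.
    3 * (K / real m) + K / real m * (\<Sum>l=2..<m. psi (s * (real l * (K / real m)) powr - be)) < dr
    \<and> K / real m * (\<Sum>l=2..<m. exp (- (s * (real l * (K / real m)) powr - be)) * ((real l * (K / real m)) powr - be - K powr - be)) - be * K powr (1 - be) / (1 - be) < - a"
    using rate_lower[OF be, of dr a] dr a unfolding psi_def A_def by auto
  obtain Kd where Kd: "Kd \<ge> 1" and disc: "AE \<omega> in P. \<forall>\<^sub>F n in sequentially. \<forall>x\<in>cball 0 (exp (real n)). \<forall>r\<ge>Kd * real n powr (1 / real CARD('d)).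
    \<bar>measure (N \<omega>) (cball x r) - vd TYPE('d) * r ^ CARD('d)\<bar> \<le> r powr q * real n powr (1 - q / real CARD('d))"
    using discrepancy_AE[OF prm, of q] q by (auto simp: dr_def)
  note evK = eventually_large_K[OF q(2,3), of "a - a'" Kd, where 'd='d]
  have "\<forall>\<^sub>F K in at_top. (\<forall>\<^sub>F m in sequentially.
    3 * (K / real m) + K / real m * (\<Sum>l=2..<m. psi (s * (real l * (K / real m)) powr - be)) < dr
    \<and> K / real m * (\<Sum>l=2..<m. exp (- (s * (real l * (K / real m)) powr - be)) * ((real l * (K / real m)) powr - be - K powr - be)) - be * K powr (1 - be) / (1 - be) < - a) \<and>
    (0 < K \<and> Kd \<le> (K / vd TYPE('d)) powr (1 / real CARD('d)) \<and> p / (p - q) * vd TYPE('d) powr - (q / real CARD('d)) * K powr - ((p - q) / real CARD('d)) < a - a')"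
    by (rule eventually_conj[OF rate evK]) (use a in auto)
  from eventually_happens'[OF trivial_limit_at_top_linorder this] obtain K where K: "0 < K" "Kd \<le> (K / vd TYPE('d)) powr (1 / real CARD('d))"
     "p / (p - q) * vd TYPE('d) powr - (q / real CARD('d)) * K powr - ((p - q) / real CARD('d)) < a - a'"
    and rate2: "\<forall>\<^sub>F m in sequentially. 3 * (K / real m) + K / real m * (\<Sum>l=2..<m. psi (s * (real l * (K / real m)) powr - be)) < dr
    \<and> K / real m * (\<Sum>l=2..<m. exp (- (s * (real l * (K / real m)) powr - be)) * ((real l * (K / real m)) powr - be - K powr - be)) - be * K powr (1 - be) / (1 - be) < - a"
    by (elim exE conjE) (rule that; assumption)
  obtain m where m: "3 \<le> m" and rate3: "3 * (K / real m) + K / real m * (\<Sum>l=2..<m. psi (s * (real l * (K / real m)) powr - be)) < dr"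
    "K / real m * (\<Sum>l=2..<m. exp (- (s * (real l * (K / real m)) powr - be)) * ((real l * (K / real m)) powr - be - K powr - be)) - be * K powr (1 - be) / (1 - be) < - a"
    using eventually_happens[OF eventually_conj[OF rate2 eventually_ge_at_top[of 3]]] by auto
  define \<delta> where "\<delta> = K / real m"
  have d0: "0 < \<delta>" using K m by (simp add: \<delta>_def)
  define hh where "hh l = s * (real l * \<delta>) powr - be" for l :: nat
  have hh0: "0 \<le> hh l" for l using s by (simp add: hh_def)
  define cost where "cost = 3 * \<delta> + \<delta> * (\<Sum>l=2..<m. psi (hh l))"
  have cost: "cost < dr" using rate3(1) unfolding cost_def hh_def \<delta>_def .
  have gain: "\<delta> * (\<Sum>l=2..<m. exp (- hh l) * ((real l * \<delta>) powr - be - K powr - be)) - be * K powr (1 - be) / (1 - be) < - a"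
    using rate3(2) unfolding hh_def \<delta>_def .
  \<comment> \<open>Thresholds for the counts: 0 in the three innermost cells, and for cell
    \<open>i\<close> its mean times the profile at volume \<open>(i - 1) * \<delta>\<close>, in
    agreement with the index shift in \<open>Vbar_upper\<close>.\<close>
  define T where "T n i = (if i \<le> 2 then 0 else ennreal (exp (- hh (i - 1)) * (\<delta> * real n)))" for n i :: nat
  define C where "C = (\<Sum>l=2..<m. 2 + hh l)"
  \<comment> \<open>A lower bound for the success probability: \<open>cost\<close> collects the
    entropy, while \<open>C\<close> and the logarithm collect the corrections of
    \<open>poisson_var_lower\<close>.\<close>
  define \<pi> where "\<pi> n = exp (- (real n * cost) - C - real m * ln (\<delta> * real n + 1))" for n :: nat
  define ee where "ee n i = (if i \<le> 2 then - (\<delta> * real n) else - (\<delta> * real n * psi (hh (i - 1))) - (2 + hh (i - 1)) - ln (\<delta> * real n + 1))" for n i :: nat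
  have shift: "(\<Sum>i=3..m. f (i - 1)) = (\<Sum>l=2..<m. f l)" for f :: "nat \<Rightarrow> real"
    by (rule sum.reindex_bij_witness[of _ Suc "\<lambda>i. i - 1"]) (use m in auto)
  have sumee: "- (real n * cost) - C - real m * ln (\<delta> * real n + 1) \<le> (\<Sum>i<Suc m. ee n i)" for n
  proof -
    have "{..<Suc m} = {0,1,2} \<union> {3..m}" using m by auto
    then have "(\<Sum>i<Suc m. ee n i) = (\<Sum>i\<in>{0,1,2}. ee n i) + (\<Sum>i=3..m. ee n i)"
      by (simp only:) (rule sum.union_disjoint; auto)
    also have "(\<Sum>i\<in>{0,1,2}. ee n i) = - (3 * (\<delta> * real n))" by (simp add: ee_def)
    also have "(\<Sum>i=3..m. ee n i) = (\<Sum>i=3..m. (\<lambda>l. - (\<delta> * real n * psi (hh l)) - (2 + hh l) - ln (\<delta> * real n + 1)) (i - 1))"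
      by (intro sum.cong) (auto simp: ee_def)
    also have "\<dots> = (\<Sum>l=2..<m. - (\<delta> * real n * psi (hh l)) - (2 + hh l) - ln (\<delta> * real n + 1))"
      by (rule shift)
    also have "\<dots> = - (\<delta> * real n * (\<Sum>l=2..<m. psi (hh l))) - C - real (m - 2) * ln (\<delta> * real n + 1)"
      by (simp add: sum_subtractf sum_negf sum_distrib_left C_def)
    also have "- (3 * (\<delta> * real n)) + \<dots> = - (real n * cost) - C - real (m - 2) * ln (\<delta> * real n + 1)"
      unfolding cost_def by (simp add: algebra_simps)
    finally have e: "(\<Sum>i<Suc m. ee n i) = - (real n * cost) - C - real (m - 2) * ln (\<delta> * real n + 1)" .
    have "real (m - 2) * ln (\<delta> * real n + 1) \<le> real m * ln (\<delta> * real n + 1)"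
      using d0 by (intro mult_right_mono ln_ge_zero) auto
    with e show ?thesis by simp
  qed
  have succ: "\<pi> n \<le> (\<Prod>i<Suc m. measure P {\<omega>\<in>space P. emeasure (N \<omega>) (cell (real n) \<delta> x i) \<le> T n i})" if n: "0 < n" for n x
  proof -
    have pv: "poisson_var P (\<lambda>\<omega>. emeasure (N \<omega>) (cell (real n) \<delta> x i)) (\<delta> * real n)" for i
      by (rule cell_poisson_var[OF prm]) (use d0 in auto)
    have dn: "0 < \<delta> * real n" using d0 n by simp
    have one: "exp (ee n i) \<le> measure P {\<omega>\<in>space P. emeasure (N \<omega>) (cell (real n) \<delta> x i) \<le> T n i}" for i
    proof (cases "i \<le> 2")
      case True
      have "measure P {\<omega>\<in>space P. emeasure (N \<omega>) (cell (real n) \<delta> x i) = of_nat 0} = exp (- (\<delta> * real n)) * (\<delta> * real n) ^ 0 / fact 0"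
        using pv[of i] unfolding poisson_var_def by blast
      then show ?thesis using True by (simp add: ee_def T_def)
    next
      case False
      then show ?thesis using poisson_var_lower[OF pv[of i] dn hh0[of "i - 1"]] by (simp add: ee_def T_def psi_def)
    qed
    have "\<pi> n \<le> exp (\<Sum>i<Suc m. ee n i)" unfolding \<pi>_def using sumee[of n] by simp
    also have "\<dots> = (\<Prod>i<Suc m. exp (ee n i))" by (rule exp_sum) simp
    also have "\<dots> \<le> (\<Prod>i<Suc m. measure P {\<omega>\<in>space P. emeasure (N \<omega>) (cell (real n) \<delta> x i) \<le> T n i})"
      using one by (intro prod_mono) auto
    finally show ?thesis .
  qed
  define R where "R n = rad TYPE('d) (real n) (real (Suc m) * \<delta>)" for n :: nat
  \<comment> \<open>A mesh larger than the diameter of the outermost ball, so that different grid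
    points see disjoint cells.\<close>
  define e where "e n = 2 * R n + 1" for n
  \<comment> \<open>Keeps the grid inside the ball of radius \<open>exp n / 2\<close>; the rest of
    \<open>exp n\<close> leaves room for the unit balls around the centres.\<close>
  define M where "M n = nat \<lfloor>exp (real n) / (2 * dr * e n)\<rfloor>" for n
  define F where "F n = {\<omega>\<in>space P. \<forall>x\<in>grid (e n) (M n). \<exists>i<Suc m. \<not> emeasure (N \<omega>) (cell (real n) \<delta> x i) \<le> T n i}" for n
  have e1: "1 \<le> e n" for n by (simp add: e_def R_def)
  have F: "F n \<in> sets P" "measure P (F n) \<le> exp (- \<pi> n * real ((2 * M n + 1) ^ CARD('d)))" if "0 < n" for n
  proof -
    have f1: "2 * rad TYPE('d) (real n) (real (Suc m) * \<delta>) < e n" by (simp add: e_def R_def)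
    have f2: "0 < e n" using e1[of n] by linarith
    have f3: "0 \<le> \<pi> n" by (simp add: \<pi>_def)
    note ns = no_success_grid[OF prm of_nat_0_le_iff less_imp_le[OF d0] zero_less_Suc f1 f2 f3 succ[OF that]]
    show "F n \<in> sets P" unfolding F_def by (rule ns(1))
    show "measure P (F n) \<le> exp (- \<pi> n * real ((2 * M n + 1) ^ CARD('d)))" unfolding F_def by (rule ns(2))
  qed
  \<comment> \<open>By the volume formula for \<open>R n\<close>, the grid has at least
    \<open>c1 * exp (dr * n) / n\<close> points.\<close>
  define c1 where "c1 = vd TYPE('d) / ((6 * dr) ^ CARD('d) * (real (Suc m) * \<delta>))"
  have c1: "0 < c1" unfolding c1_def using dr d0 by (intro divide_pos_pos mult_pos_pos) auto
  have lim: "filterlim (\<lambda>n. c1 * exp ((dr - cost) * real n - C - real m * ln (\<delta> * real n + 1)) / real n - real n) at_top sequentially"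
  proof -
    have "filterlim (\<lambda>n. c1 * exp (g * real n - C - real m * ln (\<delta> * real n + 1)) / real n - real n) at_top sequentially" if "g > 0" for g
      using that c1 d0 m by real_asymp
    then show ?thesis using cost by simp
  qed
  have many: "\<forall>\<^sub>F n in sequentially. real n \<le> \<pi> n * real ((2 * M n + 1) ^ CARD('d))"
    using lim[unfolded filterlim_at_top, rule_format, of 0] eventually_gt_at_top[of 0] rad_gap_all[OF d0, of m, where 'd='d]
  proof eventually_elim
    case (elim n)
    have "rad TYPE('d) (real n) (real m * \<delta>) + 1 \<le> R n" using elim(3) by (auto simp: R_def)
    then have R1: "1 \<le> R n" using rad_nonneg[of "TYPE('d)" "real n" "real m * \<delta>"] by linarith
    have Rv: "R n ^ CARD('d) = real (Suc m) * \<delta> * real n / vd TYPE('d)"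
    proof -
      have v: "y = x / w" if "w * y = x" "0 < w" for w x y :: real using that by (simp add: field_simps)
      have "vd TYPE('d) * R n ^ CARD('d) = real (Suc m) * \<delta> * real n"
        unfolding R_def using d0 by (intro rad_vol) auto
      then show ?thesis by (rule v) simp
    qed
    have "c1 * exp (dr * real n) / real n = exp (real n) ^ CARD('d) / ((6 * dr) ^ CARD('d) * R n ^ CARD('d))"
      unfolding c1_def Rv dr_def exp_of_nat_mult by (simp add: mult.commute mult.left_commute)
    also have "\<dots> = (exp (real n) / (6 * dr * R n)) ^ CARD('d)" by (simp add: power_divide power_mult_distrib)
    also have "\<dots> \<le> (real (2 * M n + 1)) ^ CARD('d)"
    proof (rule power_mono)
      have "exp (real n) / (6 * dr * R n) \<le> exp (real n) / (2 * dr * e n)"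
        using R1 dr e1[of n] by (intro divide_left_mono) (auto simp: e_def mult_left_mono)
      also have "\<dots> \<le> real (M n) + 1" unfolding M_def by linarith
      finally show "exp (real n) / (6 * dr * R n) \<le> real (2 * M n + 1)" by simp
    qed (use R1 dr in auto)
    finally have g: "c1 * exp (dr * real n) / real n \<le> real ((2 * M n + 1) ^ CARD('d))" by simp
    have "real n \<le> c1 * exp ((dr - cost) * real n - C - real m * ln (\<delta> * real n + 1)) / real n" using elim(1) by simp
    also have "(dr - cost) * real n - C - real m * ln (\<delta> * real n + 1) = dr * real n + (- (real n * cost) - C - real m * ln (\<delta> * real n + 1))"
      by (simp add: algebra_simps)
    also have "c1 * exp (dr * real n + (- (real n * cost) - C - real m * ln (\<delta> * real n + 1))) / real n = \<pi> n * (c1 * exp (dr * real n) / real n)"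
      unfolding \<pi>_def by (subst exp_add) simp
    also have "\<dots> \<le> \<pi> n * real ((2 * M n + 1) ^ CARD('d))" using g by (intro mult_left_mono) (auto simp: \<pi>_def)
    finally show ?case .
  qed
  define F' where "F' n = (if 0 < n then F n else {})" for n
  have F's: "F' n \<in> sets P" for n using F(1) by (auto simp: F'_def)
  have "AE \<omega> in P. eventually (\<lambda>n. \<omega> \<in> space P - F' n) sequentially"
  proof (rule borel_cantelli_AE1)
    show "summable (\<lambda>n. measure P (F' n))"
    proof (rule summable_comparison_test_ev)
      show "\<forall>\<^sub>F n in sequentially. norm (measure P (F' n)) \<le> 1 * exp (- 1 * real n)"
        using many eventually_gt_at_top[of 0]
      proof eventually_elim
        case (elim n)
        have "measure P (F' n) \<le> exp (- \<pi> n * real ((2 * M n + 1) ^ CARD('d)))" using F(2)[OF elim(2)] elim(2) by (simp add: F'_def)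
        also have "\<dots> \<le> exp (- 1 * real n)" using elim(1) by simp
        finally show ?case by simp
      qed
      show "summable (\<lambda>n. 1 * exp (- 1 * real n))" by (rule summable_exp_neg) simp
    qed
  qed (use F's in \<open>auto simp: emeasure_eq_measure\<close>)
  then show ?thesis
    using disc prm_ball_finite[OF prm] AE_space
  proof eventually_elim
    case (elim \<omega>)
    have sets: "sets (N \<omega>) = sets borel" by (rule prm_sets[OF prm elim(4)])
    have fin: "emeasure (N \<omega>) (cball x r) < \<infinity>" for x r using elim(3) by blast
    show ?case using elim(1) elim(2) rad_gap_all[OF d0, of m, where 'd='d] eventually_gt_at_top[of 0]
    proof eventually_elim
      case (elim n)
      have "\<omega> \<notin> F n" "\<omega> \<in> space P" using elim(1,4) by (auto simp: F'_def)
      then obtain x :: "real^'d" where x: "x \<in> grid (e n) (M n)" and xs: "\<And>i. i < Suc m \<Longrightarrow> emeasure (N \<omega>) (cell (real n) \<delta> x i) \<le> T n i"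
        unfolding F_def by blast
      have exp2: "2 \<le> exp (real n)" using exp_ge_add_one_self[of "real n"] elim(4) by linarith
      have "norm x \<le> real CARD('d) * (e n * real (M n))" using e1[of n] x by (intro grid_norm) auto
      also have "\<dots> \<le> dr * (e n * (exp (real n) / (2 * dr * e n)))"
        unfolding M_def dr_def[symmetric] using dr e1[of n] by (intro mult_left_mono of_nat_floor) auto
      also have "\<dots> = exp (real n) / 2" using dr e1[of n] by (simp add: field_simps)
      finally have nx: "norm x \<le> exp (real n) / 2" .
      have z3: "emeasure (N \<omega>) (cell (real n) \<delta> x i) = 0" if "i \<le> 2" for i
        using xs[of i] that m by (simp add: T_def)
      have r3: "2 \<le> rad TYPE('d) (real n) (real 3 * \<delta>)"
      proof -
        have g: "\<And>i. i \<le> m \<Longrightarrow> rad TYPE('d) (real n) (real i * \<delta>) + 1 \<le> rad TYPE('d) (real n) (real (Suc i) * \<delta>)" using elim(3) by simp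
        have "rad TYPE('d) (real n) \<delta> + 1 \<le> rad TYPE('d) (real n) (2 * \<delta>)" using g[of 1] m by simp
        moreover have "rad TYPE('d) (real n) (2 * \<delta>) + 1 \<le> rad TYPE('d) (real n) (3 * \<delta>)" using g[of 2] m by simp
        moreover have "0 \<le> rad TYPE('d) (real n) \<delta>" by (rule rad_nonneg)
        ultimately have "2 \<le> rad TYPE('d) (real n) (3 * \<delta>)" by linarith
        then show ?thesis by simp
      qed
      have "cball x 2 \<subseteq> cell (real n) \<delta> x 0 \<union> cell (real n) \<delta> x 1 \<union> cell (real n) \<delta> x 2"
        using r3 by (auto simp: cell_def)
      then have "emeasure (N \<omega>) (cball x 2) \<le> emeasure (N \<omega>) (cell (real n) \<delta> x 0 \<union> cell (real n) \<delta> x 1 \<union> cell (real n) \<delta> x 2)"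
        by (rule emeasure_mono) (simp add: sets)
      also have "\<dots> \<le> 0"
        using emeasure_subadditive[of "cell (real n) \<delta> x 0 \<union> cell (real n) \<delta> x 1" "N \<omega>" "cell (real n) \<delta> x 2"]
          emeasure_subadditive[of "cell (real n) \<delta> x 0" "N \<omega>" "cell (real n) \<delta> x 1"] z3[of 0] z3[of 1] z3[of 2] sets by simp
      finally have vac: "emeasure (N \<omega>) (cball x 2) = 0" by simp
      have V: "Vbar p (N \<omega>) z \<le> - (real n * (real n / vd TYPE('d)) powr - be * a')" if z: "z \<in> cball x 1" for z
      proof -
        have zx: "dist z x \<le> 1" using z by (simp add: dist_commute)
        have "norm z \<le> norm x + 1" using zx norm_triangle_ineq[of x "z - x"] by (simp add: dist_norm)
        then have zn: "z \<in> cball 0 (exp (real n))" using nx exp2 by simp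
        have good: "nearE p (N \<omega>) z < \<infinity>" using nearE_vacant[OF sets vac zx, of p] by simp
        interpret cs: cell_setting "N \<omega>" p q K n m x z be "(real n / vd TYPE('d)) powr - be"
          "p / (p - q) * vd TYPE('d) powr - (q / real CARD('d)) * K powr - ((p - q) / real CARD('d))" \<delta>
          "\<lambda>i. rad TYPE('d) (real n) (real i * \<delta>)"
          "\<lambda>y. indicat_real (cball z (rad TYPE('d) (real n) (real m * \<delta>))) y * (dist y z powr - p - rad TYPE('d) (real n) (real m * \<delta>) powr - p)"
        proof unfold_locales
          fix r assume "rad TYPE('d) (real n) K \<le> r"
          then have "Kd * real n powr (1 / real CARD('d)) \<le> r" using rad_large[OF K(2), of n] by linarith
          then show "\<bar>measure (N \<omega>) (cball z r) - vd TYPE('d) * r ^ CARD('d)\<bar> \<le> real n powr (1 - q / real CARD('d)) * r powr q"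
            using elim(2) zn by (simp add: mult.commute)
        qed (use sets fin p0 p q K m elim zx be_def \<delta>_def in auto)
        have "Vbar p (N \<omega>) z \<le> real n * (real n / vd TYPE('d)) powr - be *
          (\<delta> * (\<Sum>l=2..<m. exp (- hh l) * ((real l * \<delta>) powr - be - K powr - be)) - be * K powr (1 - be) / (1 - be) + p / (p - q) * vd TYPE('d) powr - (q / real CARD('d)) * K powr - ((p - q) / real CARD('d)))"
        proof (rule cs.Vbar_upper[OF z3 good])
          fix i assume i: "i \<in> {3..m}"
          have "emeasure (N \<omega>) (cell (real n) \<delta> x i) \<le> ennreal (exp (- hh (i - 1)) * (\<delta> * real n))"
            using xs[of i] i by (simp add: T_def)
          then show "measure (N \<omega>) (cell (real n) \<delta> x i) \<le> exp (- hh (i - 1)) * (\<delta> * real n)"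
            unfolding measure_def using d0 by (intro enn2real_leI) auto
        qed
        also have "\<dots> \<le> real n * (real n / vd TYPE('d)) powr - be * (- a')"
          using gain K(3) by (intro mult_left_mono) auto
        finally show ?thesis by simp
      qed
      have "x \<in> cball 0 (exp (real n))" using nx exp2 by simp
      then show ?case using vac V by blast
    qed
  qed
qed

section \<open>Regularity of the environment\<close>

context
  fixes \<mu> :: "(real^'d::finite) measure"
  assumes sets_mu [measurable_cong]: "sets \<mu> = sets borel" and fin: "\<And>x r. emeasure \<mu> (cball x r) < \<infinity>"
begin

lemma nearE_measurable [measurable]: "nearE p \<mu> \<in> borel_measurable borel"
proof -
  interpret sigma_finite_measure \<mu> by (rule locally_finite_sigma_finite[OF sets_mu fin])
  have "nearE p \<mu> = (\<lambda>x. \<integral>\<^sup>+y. (if y = x then \<infinity> else ennreal (dist y x powr - p)) * indicator {y. dist x y \<le> 1} y \<partial>\<mu>)"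
    unfolding nearE_def[abs_def] by (simp add: cball_def)
  also have "\<dots> \<in> borel_measurable borel" by measurable
  finally show ?thesis .
qed

lemma Vnear_measurable [measurable]: "Vnear p \<mu> r \<in> borel_measurable borel"
proof -
  interpret sigma_finite_measure \<mu> by (rule locally_finite_sigma_finite[OF sets_mu fin])
  have "Vnear p \<mu> r = (\<lambda>x. \<integral>y. indicat_real {y. dist x y \<le> r} y *\<^sub>R dist y x powr - p \<partial>\<mu>)"
    unfolding Vnear_def[abs_def] set_lebesgue_integral_def by (simp add: cball_def)
  also have "\<dots> \<in> borel_measurable borel" by measurable
  finally show ?thesis .
qed

lemma Vfar_measurable [measurable]: "(\<lambda>x. Vfar p \<mu> x a R) \<in> borel_measurable borel"
proof -
  interpret sigma_finite_measure \<mu> by (rule locally_finite_sigma_finite[OF sets_mu fin])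
  have "(\<lambda>x. set_lebesgue_integral \<mu> {y. a < dist y x \<and> dist y x \<le> R} (\<lambda>y. dist y x powr - p)) \<in> borel_measurable borel"
    unfolding set_lebesgue_integral_def by measurable
  moreover have "(\<lambda>x. set_lebesgue_integral lborel {y::real^'d. a < dist y x \<and> dist y x \<le> R} (\<lambda>y. dist y x powr - p)) \<in> borel_measurable borel"
    unfolding set_lebesgue_integral_def by measurable
  ultimately show ?thesis unfolding Vfar_def by measurable
qed

text \<open>Averaging over \<open>z\<close> turns the contribution of each point \<open>y\<close>
  into an integral of the kernel over a unit ball, finite since \<open>p < d\<close>. This replaces
  the pointwise bound that does not exist. The infinite value on the diagonal is a null event in
  \<open>z\<close>.\<close>

lemma nearE_average:
  assumes p: "0 < p" "p < real CARD('d)"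
  shows "(\<integral>\<^sup>+z. nearE p \<mu> z * indicator (cball x 1) z \<partial>lborel) \<le> ennreal (vd TYPE('d) * real CARD('d) / (real CARD('d) - p)) * emeasure \<mu> (cball x 2)"
proof -
  interpret sigma_finite_measure \<mu> by (rule locally_finite_sigma_finite[OF sets_mu fin])
  interpret pair_sigma_finite \<mu> lborel ..
  let ?k = "\<lambda>y z. (if y = z then \<infinity> else ennreal (dist y z powr - p)) * indicator {y. dist z y \<le> 1} y"
  have "(\<integral>\<^sup>+z. nearE p \<mu> z * indicator (cball x 1) z \<partial>lborel) = (\<integral>\<^sup>+z. (\<integral>\<^sup>+y. ?k y z * indicator {z. dist x z \<le> 1} z \<partial>\<mu>) \<partial>lborel)"
    unfolding nearE_def cball_def by (intro nn_integral_cong nn_integral_multc[symmetric]) measurable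
  also have "\<dots> = (\<integral>\<^sup>+y. (\<integral>\<^sup>+z. ?k y z * indicator {z. dist x z \<le> 1} z \<partial>lborel) \<partial>\<mu>)"
    by (rule Fubini') measurable
  also have "\<dots> \<le> (\<integral>\<^sup>+y. ennreal (vd TYPE('d) * real CARD('d) / (real CARD('d) - p)) * indicator (cball x 2) y \<partial>\<mu>)"
  proof (rule nn_integral_mono)
    fix y :: "real^'d"
    show "(\<integral>\<^sup>+z. ?k y z * indicator {z. dist x z \<le> 1} z \<partial>lborel) \<le> ennreal (vd TYPE('d) * real CARD('d) / (real CARD('d) - p)) * indicator (cball x 2) y"
    proof (cases "dist x y \<le> 2")
      case True
      have ne: "AE z in lborel. z \<noteq> y" by (rule AE_lborel_singleton)
      have "(\<integral>\<^sup>+z. ?k y z * indicator {z. dist x z \<le> 1} z \<partial>lborel) \<le> (\<integral>\<^sup>+z. ennreal (dist z y powr - p) * indicator (cball y 1) z \<partial>lborel)"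
      proof (rule nn_integral_mono_AE)
        show "AE z in lborel. ?k y z * indicator {z. dist x z \<le> 1} z \<le> ennreal (dist z y powr - p) * indicator (cball y 1) z"
          using ne by eventually_elim (auto simp: indicator_def dist_commute)
      qed
      also have "\<dots> = ennreal (vd TYPE('d) * real CARD('d) / (real CARD('d) - p))"
        using lborel_ball_nn[of 1 p y] p by simp
      finally show ?thesis using True by simp
    next
      case False
      have k0: "?k y z * indicator {z. dist x z \<le> 1} z = 0" for z
        using False dist_triangle[of x y z] by (auto simp: indicator_def)
      show ?thesis unfolding k0 by simp
    qed
  qed
  also have "\<dots> = ennreal (vd TYPE('d) * real CARD('d) / (real CARD('d) - p)) * emeasure \<mu> (cball x 2)"
    by (rule nn_integral_cmult_indicator) (simp add: sets_mu)
  finally show ?thesis .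
qed

end

text \<open>The almost sure order of growth of counts in balls of fixed radius and of the regular
  part of the potential; the summand 1 makes it bounded below, so constants can be absorbed.\<close>

definition lg :: "'a::real_normed_vector \<Rightarrow> real" where "lg z = 1 + ln (1 + norm z)"

lemma lg_ge1: "1 \<le> lg z" by (simp add: lg_def)

lemma lg_measurable [measurable]: "(lg :: 'a::euclidean_space \<Rightarrow> real) \<in> borel_measurable borel"
  unfolding lg_def[abs_def] by measurable

text \<open>Collects what the Brownian estimates have to know about a fixed environment, so that
  they involve the law of the path alone. The bound on \<open>Vbar\<close> is demanded only where
  \<open>nearE\<close> is finite: elsewhere the singular integral may fail to exist and take a
  default value.\<close>

definition regular_env :: "real \<Rightarrow> real \<Rightarrow> (real^'d::finite) measure \<Rightarrow> bool" where
  "regular_env p C \<mu> \<longleftrightarrow> sets \<mu> = sets borel \<and> (\<forall>x r. emeasure \<mu> (cball x r) < \<infinity>) \<and> 0 \<le> C \<and>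
     Vbar p \<mu> \<in> borel_measurable borel \<and>
     (\<forall>z. nearE p \<mu> z < \<infinity> \<longrightarrow> \<bar>Vbar p \<mu> z\<bar> \<le> Vnear p \<mu> 1 z + C * lg z) \<and>
     (\<forall>x. measure \<mu> (cball x 2) \<le> C * lg x)"

lemma powr_le_one: "1 \<le> x \<Longrightarrow> e \<le> 0 \<Longrightarrow> x powr e \<le> (1::real)"
  using powr_mono[of e 0 x] by simp

lemma regular_env_AE:
  fixes N :: "'w \<Rightarrow> (real^'d::finite) measure" and p :: real
  assumes prm: "poisson_random_measure P N" and p: "real CARD('d) / 2 < p" "p < real CARD('d)"
  shows "AE \<omega> in P. \<exists>C. regular_env p C (N \<omega>)"
proof -
  let ?w = "vd TYPE('d)"
  define dr where "dr = real CARD('d)"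
  have dr: "dr \<ge> 1" by (simp add: dr_def Suc_leI)
  have w0: "0 \<le> ?w" by simp
  define q where "q = (dr / 2 + p) / 2"
  have q: "dr / 2 < q" "q < p" "0 < q" "q < dr" using p dr by (auto simp: q_def dr_def)
  have p0: "0 < p" "p < real CARD('d)" using p dr by (auto simp: dr_def)
  obtain Kd where Kd: "Kd \<ge> 1" and disc: "AE \<omega> in P. \<forall>\<^sub>F n in sequentially. \<forall>x\<in>cball 0 (exp (real n)). \<forall>r\<ge>Kd * real n powr (1 / real CARD('d)).
    \<bar>measure (N \<omega>) (cball x r) - ?w * r ^ CARD('d)\<bar> \<le> r powr q * real n powr (1 - q / real CARD('d))"
    using discrepancy_AE[OF prm, of q] q by (auto simp: dr_def)
  define K where "K = Kd + 1"
  show ?thesis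
    using disc prm_ball_finite[OF prm] AE_space
  proof eventually_elim
    case (elim \<omega>)
    let ?\<mu> = "N \<omega>"
    have sets: "sets ?\<mu> = sets borel" by (rule prm_sets[OF prm elim(3)])
    have fin: "emeasure ?\<mu> (cball x r) < \<infinity>" for x r using elim(2) by blast
    obtain n1 where n1: "\<And>n. n \<ge> n1 \<Longrightarrow> \<forall>x\<in>cball 0 (exp (real n)). \<forall>r\<ge>Kd * real n powr (1 / real CARD('d)).
      \<bar>measure ?\<mu> (cball x r) - ?w * r ^ CARD('d)\<bar> \<le> r powr q * real n powr (1 - q / real CARD('d))"
      using elim(1) unfolding eventually_sequentially by blast
    \<comment> \<open>The scale at which \<open>z\<close> enters the controlled ball, raised to at
      least \<open>Suc n1\<close> so that the discrepancy bound, valid only eventually in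
      \<open>n\<close>, is available at every \<open>z\<close>.\<close>
    define sn where "sn z = max (Suc n1) (nat \<lceil>ln (1 + norm z)\<rceil>)" for z :: "real^'d"
    define rh where "rh z = K * real (sn z) powr (1 / dr)" for z
    define A where "A z = real (sn z) powr (1 - q / dr)" for z
    have sn: "real (sn z) \<ge> 1" "real (sn z) \<le> (real n1 + 2) * lg z" "norm z \<le> exp (real (sn z))" for z
    proof -
      show "real (sn z) \<ge> 1" by (simp add: sn_def)
      have l0: "0 \<le> ln (1 + norm z)" by simp
      have "real (sn z) \<le> (real n1 + 1) + (ln (1 + norm z) + 1)" unfolding sn_def using l0 by linarith
      also have "\<dots> \<le> (real n1 + 2) * lg z" using l0 unfolding lg_def distrib_left by (simp add: mult_le_cancel_right1 algebra_simps)
      finally show "real (sn z) \<le> (real n1 + 2) * lg z" .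
      have "1 + norm z = exp (ln (1 + norm z))" by (simp add: add_pos_nonneg)
      also have "\<dots> \<le> exp (real (sn z))" unfolding exp_le_cancel_iff sn_def by linarith
      finally show "norm z \<le> exp (real (sn z))" by simp
    qed
    have rh1: "2 \<le> rh z" for z
    proof -
      have "1 \<le> real (sn z) powr (1 / dr)" using sn[of z] dr by (intro ge_one_powr_ge_zero) auto
      then have "2 * 1 \<le> K * real (sn z) powr (1 / dr)" using Kd by (intro mult_mono) (auto simp: K_def)
      then show ?thesis by (simp add: rh_def)
    qed
    have D: "\<bar>measure ?\<mu> (cball z r) - ?w * r ^ CARD('d)\<bar> \<le> A z * r powr q" if "rh z \<le> r" for z r
    proof -
      have "Kd * real (sn z) powr (1 / real CARD('d)) \<le> rh z" unfolding rh_def dr_def K_def by (simp add: mult_right_mono)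
      with that have "Kd * real (sn z) powr (1 / real CARD('d)) \<le> r" by linarith
      then show ?thesis using n1[of "sn z"] sn(3)[of z] by (simp add: sn_def A_def dr_def mult.commute)
    qed
    have A0: "0 \<le> A z" for z by (simp add: A_def)
    define C0 where "C0 = ?w * K ^ CARD('d) + K powr q"
    have rhd: "rh z powr dr = K powr dr * real (sn z)" for z
    proof -
      have "(real (sn z) powr (1 / dr)) powr dr = real (sn z)" using dr by (simp add: powr_powr)
      then show ?thesis unfolding rh_def powr_mult by simp
    qed
    have K1: "K \<ge> 1" using Kd by (simp add: K_def)
    have M: "measure ?\<mu> (cball z (rh z)) \<le> C0 * real (sn z)" for z
    proof -
      have "rh z ^ CARD('d) = K ^ CARD('d) * real (sn z)"
        using rhd[of z] rh1[of z] K1 by (simp add: dr_def powr_realpow)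
      moreover have "A z * rh z powr q = K powr q * real (sn z)"
      proof -
        have "rh z powr q = K powr q * real (sn z) powr (q / dr)" unfolding rh_def powr_mult by (simp add: powr_powr)
        moreover have "real (sn z) powr (1 - q / dr) * real (sn z) powr (q / dr) = real (sn z)"
          using sn(1)[of z] by (simp add: powr_add[symmetric])
        ultimately show ?thesis unfolding A_def by (simp add: mult.left_commute)
      qed
      ultimately show ?thesis using D[of z "rh z"] by (simp add: C0_def algebra_simps abs_le_iff)
    qed
    define C1 where "C1 = C0 + C0 + ?w * p / (dr - p) * K powr dr + p / (p - q)"
    have C0: "0 \<le> C0" using K1 w0 by (simp add: C0_def)
    have C1: "0 \<le> C1" "C0 \<le> C1" using C0 p q w0 unfolding C1_def by (auto simp: dr_def)
    have bound: "\<bar>Vbar p ?\<mu> z\<bar> \<le> Vnear p ?\<mu> 1 z + C1 * real (sn z)" if good: "nearE p ?\<mu> z < \<infinity>" for z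
    proof -
      note si = nearE_finite(1)[OF sets good]
      have r1: "1 \<le> rh z" using rh1[of z] by simp
      have s1: "1 \<le> real (sn z)" by (rule sn)
      define W where "W = Vnear p ?\<mu> (rh z) z - rh z powr - p * measure ?\<mu> (cball z (rh z)) - ?w * p / (real CARD('d) - p) * rh z powr (real CARD('d) - p)"
      have VW: "\<bar>Vbar p ?\<mu> z - W\<bar> \<le> A z * p / (p - q) * rh z powr (q - p)"
        unfolding W_def by (rule Vbar_repr[OF sets fin p0 q(3,2) r1 A0 D si])
      have e1: "A z * p / (p - q) * rh z powr (q - p) \<le> p / (p - q) * real (sn z)"
      proof -
        have "A z \<le> real (sn z) powr 1" unfolding A_def using s1 q dr by (intro powr_mono) auto
        then have "A z * rh z powr (q - p) \<le> real (sn z) * 1"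
          using powr_le_one[OF r1, of "q - p"] q s1 by (intro mult_mono) auto
        then have "p / (p - q) * (A z * rh z powr (q - p)) \<le> p / (p - q) * real (sn z)" using p0 q by (intro mult_left_mono) auto
        then show ?thesis by (simp add: mult.left_commute mult.commute)
      qed
      have k0: "set_integrable ?\<mu> {y. 1 < dist y z \<and> dist y z \<le> rh z} (\<lambda>y. dist y z powr - p)"
        by (rule kernel_integrable[OF sets fin _ p0(1)]) simp
      have "cball z (rh z) = cball z 1 \<union> {y. 1 < dist y z \<and> dist y z \<le> rh z}" using r1 by (auto simp: dist_commute)
      then have ns: "Vnear p ?\<mu> (rh z) z = Vnear p ?\<mu> 1 z + set_lebesgue_integral ?\<mu> {y. 1 < dist y z \<and> dist y z \<le> rh z} (\<lambda>y. dist y z powr - p)"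
        unfolding Vnear_def by (simp only:) (intro set_integral_Un k0 si; auto simp: dist_commute)
      have f0: "0 \<le> set_lebesgue_integral ?\<mu> {y. 1 < dist y z \<and> dist y z \<le> rh z} (\<lambda>y. dist y z powr - p)"
        by (rule set_integral_nonneg) simp
      have f1: "set_lebesgue_integral ?\<mu> {y. 1 < dist y z \<and> dist y z \<le> rh z} (\<lambda>y. dist y z powr - p) \<le> C0 * real (sn z)"
      proof -
        have "set_lebesgue_integral ?\<mu> {y. 1 < dist y z \<and> dist y z \<le> rh z} (\<lambda>y. dist y z powr - p) \<le> (\<integral>y. indicat_real (cball z (rh z)) y \<partial>?\<mu>)"
          unfolding set_lebesgue_integral_def
        proof (rule integral_mono)
          show "integrable ?\<mu> (indicat_real (cball z (rh z)))" using fin[of z "rh z"] sets by simp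
          fix y show "indicat_real {y. 1 < dist y z \<and> dist y z \<le> rh z} y *\<^sub>R dist y z powr - p \<le> indicat_real (cball z (rh z)) y"
            using p0 powr_le_one[of "dist y z" "- p"] by (auto simp: indicator_def dist_commute)
        qed (use k0 in \<open>simp add: set_integrable_def\<close>)
        also have "\<dots> = measure ?\<mu> (cball z (rh z))" using sets by simp
        finally show ?thesis using M[of z] by linarith
      qed
      have g1: "0 \<le> rh z powr - p * measure ?\<mu> (cball z (rh z))" "rh z powr - p * measure ?\<mu> (cball z (rh z)) \<le> C0 * real (sn z)"
      proof -
        have "rh z powr - p \<le> 1" using powr_le_one[OF r1, of "- p"] p0 by simp
        then have "rh z powr - p * measure ?\<mu> (cball z (rh z)) \<le> 1 * measure ?\<mu> (cball z (rh z))" by (intro mult_right_mono) auto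
        then show "rh z powr - p * measure ?\<mu> (cball z (rh z)) \<le> C0 * real (sn z)" using M[of z] by linarith
      qed simp
      have h1: "0 \<le> ?w * p / (real CARD('d) - p) * rh z powr (real CARD('d) - p)" "?w * p / (real CARD('d) - p) * rh z powr (real CARD('d) - p) \<le> ?w * p / (dr - p) * K powr dr * real (sn z)"
      proof -
        have c: "0 \<le> ?w * p / (real CARD('d) - p)" using p0 w0 by simp
        then show "0 \<le> ?w * p / (real CARD('d) - p) * rh z powr (real CARD('d) - p)" by (rule mult_nonneg_nonneg) simp
        have "rh z powr (real CARD('d) - p) \<le> rh z powr dr" using r1 p0 by (intro powr_mono) (auto simp: dr_def)
        then have "rh z powr (real CARD('d) - p) \<le> K powr dr * real (sn z)" unfolding rhd .
        from mult_left_mono[OF this c] show "?w * p / (real CARD('d) - p) * rh z powr (real CARD('d) - p) \<le> ?w * p / (dr - p) * K powr dr * real (sn z)"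
          by (simp add: dr_def mult.assoc)
      qed
      have n0: "0 \<le> Vnear p ?\<mu> 1 z" unfolding Vnear_def by (rule set_integral_nonneg) simp
      have C1e: "C1 * real (sn z) = C0 * real (sn z) + C0 * real (sn z) + ?w * p / (dr - p) * K powr dr * real (sn z) + p / (p - q) * real (sn z)"
        unfolding C1_def by (simp only: distrib_right)
      have fin: "\<bar>v\<bar> \<le> n + t" if "\<bar>v - u\<bar> \<le> e" "e \<le> zz" "u = nr - g - h" "nr = n + f" "0 \<le> f" "f \<le> x" "0 \<le> g" "g \<le> x" "0 \<le> h" "h \<le> y" "0 \<le> n"
        "t = x + x + y + zz" for v u e zz nr g h n f x y t :: real using that by linarith
      show ?thesis by (rule fin[OF VW e1 W_def ns f0 f1 g1 h1 n0 C1e])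
    qed
    define C where "C = C1 * (real n1 + 2)"
    have Cle: "C1 * real (sn z) \<le> C * lg z" for z
      using mult_left_mono[OF sn(2)[of z] C1(1)] by (simp add: C_def mult.assoc)
    have vm: "Vbar p ?\<mu> \<in> borel_measurable borel"
    proof -
      \<comment> \<open>As the limit over real \<open>R\<close> exists by \<open>far_limit\<close>,
        it may be taken along integers, where it preserves measurability.\<close>
      have "(\<lambda>x. lim (\<lambda>k. Vfar p ?\<mu> x 1 (real k))) \<in> borel_measurable borel"
        using Vfar_measurable[OF sets fin] by (intro borel_measurable_lim_metric)
      moreover have "Lim at_top (\<lambda>R. Vfar p ?\<mu> x 1 R) = lim (\<lambda>k. Vfar p ?\<mu> x 1 (real k))" for x
      proof -
        have r1: "1 \<le> rh x" using rh1[of x] by simp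
        obtain T where T: "((\<lambda>R. Vfar p ?\<mu> x 1 R) \<longlongrightarrow> T) at_top"
          using far_limit[OF sets fin p0 q(3,2) r1 A0 D] by blast
        then have "(\<lambda>k. Vfar p ?\<mu> x 1 (real k)) \<longlonglongrightarrow> T" by (rule filterlim_compose[OF _ filterlim_real_sequentially])
        then show ?thesis using T by (simp add: limI tendsto_Lim)
      qed
      moreover have "Vbar p ?\<mu> = (\<lambda>x. Vnear p ?\<mu> 1 x - set_lebesgue_integral lborel (cball (0::real^'d) 1) (\<lambda>y. norm y powr (- p)) + Lim at_top (\<lambda>R. Vfar p ?\<mu> x 1 R))"
        by (simp add: fun_eq_iff Vbar_def Vnear_def Vfar_def)
      ultimately show ?thesis using Vnear_measurable[OF sets fin, of p 1] by simp
    qed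
    have "regular_env p C ?\<mu>"
      unfolding regular_env_def
    proof (intro conjI allI impI sets fin vm)
      show "0 \<le> C" using C1 by (simp add: C_def)
      show "\<bar>Vbar p ?\<mu> z\<bar> \<le> Vnear p ?\<mu> 1 z + C * lg z" if "nearE p ?\<mu> z < \<infinity>" for z
        using bound[OF that] Cle[of z] by linarith
      show "measure ?\<mu> (cball x 2) \<le> C * lg x" for x
      proof -
        have "measure ?\<mu> (cball x 2) \<le> measure ?\<mu> (cball x (rh x))" by (rule measure_cball_mono[OF sets fin rh1])
        also have "\<dots> \<le> C0 * real (sn x)" by (rule M)
        also have "\<dots> \<le> C1 * real (sn x)" using C1 by (intro mult_right_mono) auto
        finally show ?thesis using Cle[of x] by linarith
      qed
    qed
    then show "\<exists>C. regular_env p C ?\<mu>" ..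
  qed
qed

text \<open>The counts in shrinking balls around 0 are natural numbers converging to the mass of
  \<open>{0}\<close>, which is 0, so they vanish from some radius on. Brownian motion starts at 0
  without any smoothing, and near its starting point averaged bounds are of no use.\<close>

lemma vacant_origin_AE:
  fixes N :: "'w \<Rightarrow> (real^'d::finite) measure"
  assumes prm: "poisson_random_measure P N"
  shows "AE \<omega> in P. \<exists>r>0. emeasure (N \<omega>) (cball 0 r) = 0"
proof -
  interpret prob_space P by (rule prm_prob_space[OF prm])
  have pv: "poisson_var P (\<lambda>\<omega>. emeasure (N \<omega>) (cball 0 (1 / real (Suc k)))) (measure lborel (cball (0::real^'d) (1 / real (Suc k))))" for k
    by (rule prm_poisson_var[OF prm]) auto
  have pv0: "poisson_var P (\<lambda>\<omega>. emeasure (N \<omega>) {0::real^'d}) 0"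
    using prm_poisson_var[OF prm, of "{0}"] by simp
  note [measurable] = poisson_varD[OF pv0]
  have "prob {\<omega>\<in>space P. emeasure (N \<omega>) {0::real^'d} = of_nat 0} = exp (- 0) * 0 ^ 0 / fact 0"
    using pv0 unfolding poisson_var_def by blast
  then have "prob {\<omega>\<in>space P. emeasure (N \<omega>) {0::real^'d} = 0} = 1" by simp
  then have z: "AE \<omega> in P. emeasure (N \<omega>) {0::real^'d} = 0"
    by (subst (asm) prob_Collect_eq_1) auto
  have "AE \<omega> in P. \<forall>k::nat. emeasure (N \<omega>) (cball (0::real^'d) (1 / real (Suc k))) \<in> range of_nat"
    unfolding AE_all_countable using poisson_var_AE_nat[OF pv] by blast
  then show ?thesis using z prm_ball_finite[OF prm] AE_space
  proof eventually_elim
    case (elim \<omega>)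
    have sets: "sets (N \<omega>) = sets borel" by (rule prm_sets[OF prm elim(4)])
    have "(\<lambda>k. emeasure (N \<omega>) (cball (0::real^'d) (1 / real (Suc k)))) \<longlonglongrightarrow> emeasure (N \<omega>) (\<Inter>k. cball 0 (1 / real (Suc k)))"
    proof (rule Lim_emeasure_decseq)
      show "decseq (\<lambda>k. cball (0::real^'d) (1 / real (Suc k)))"
        by (intro decseq_SucI subset_cball) (simp add: field_simps)
    qed (use sets elim(3) in \<open>auto simp: less_top[symmetric]\<close>)
    also have "(\<Inter>k. cball (0::real^'d) (1 / real (Suc k))) = {0}"
    proof safe
      fix x :: "real^'d" assume x: "x \<in> (\<Inter>k. cball 0 (1 / real (Suc k)))"
      have "norm x \<le> 0"
      proof (rule LIMSEQ_le_const)
        show "(\<lambda>k. 1 / real (Suc k)) \<longlonglongrightarrow> 0" by real_asymp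
        show "\<exists>N. \<forall>n\<ge>N. norm x \<le> 1 / real (Suc n)" using x by auto
      qed
      then show "x = 0" by simp
    qed auto
    finally have "(\<lambda>k. emeasure (N \<omega>) (cball (0::real^'d) (1 / real (Suc k)))) \<longlonglongrightarrow> 0" using elim(2) by simp
    then have "\<forall>\<^sub>F k in sequentially. emeasure (N \<omega>) (cball (0::real^'d) (1 / real (Suc k))) < 1" by (rule order_tendstoD) simp
    then obtain k where k: "emeasure (N \<omega>) (cball (0::real^'d) (1 / real (Suc k))) < 1" by (auto simp: eventually_sequentially)
    obtain j :: nat where j: "emeasure (N \<omega>) (cball (0::real^'d) (1 / real (Suc k))) = of_nat j" using elim(1) by blast
    with k have "j = 0" by (cases j) (auto simp: not_less)
    then have "emeasure (N \<omega>) (cball (0::real^'d) (1 / real (Suc k))) = 0" using j by simp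
    then show ?case by (intro exI[of _ "1 / real (Suc k)"]) simp
  qed
qed

section \<open>Brownian motion and the upper bound\<close>

definition heat :: "real \<Rightarrow> real^'d::finite \<Rightarrow> real" where
  "heat \<sigma> x = (2 * pi * \<sigma>) powr (- real CARD('d) / 2) * exp (- (norm x)\<^sup>2 / (2 * \<sigma>))"

lemma heat_measurable [measurable]: "(heat \<sigma> :: real^'d::finite \<Rightarrow> real) \<in> borel_measurable borel"
  unfolding heat_def[abs_def] by measurable

lemma heat_nonneg [simp]: "0 \<le> heat \<sigma> x" by (simp add: heat_def)

lemma heat_minus [simp]: "heat \<sigma> (- x) = heat \<sigma> x" by (simp add: heat_def)

text \<open>Integrability over a unit ball gives finiteness almost everywhere in it, and countably
  many unit balls cover the space.\<close>

lemma AE_nearE_finite: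
  fixes \<mu> :: "(real^'d::finite) measure"
  assumes sets: "sets \<mu> = sets borel" and fin: "\<And>x r. emeasure \<mu> (cball x r) < \<infinity>" and p: "0 < p" "p < real CARD('d)"
  shows "AE z in lborel. nearE p \<mu> z < \<infinity>"
proof -
  have loc: "AE z in lborel. z \<in> cball x 1 \<longrightarrow> nearE p \<mu> z < \<infinity>" for x :: "real^'d"
  proof -
    have [measurable]: "cball x 1 \<in> sets borel" by simp
    note [measurable] = nearE_measurable[OF sets fin, of p]
    have "(\<integral>\<^sup>+z. nearE p \<mu> z * indicator (cball x 1) z \<partial>lborel) < \<infinity>"
      by (rule le_less_trans[OF nearE_average[OF sets fin p]]) (use fin[of x 2] in \<open>simp add: ennreal_mult_less_top\<close>)
    then have "AE z in lborel. nearE p \<mu> z * indicator (cball x 1) z \<noteq> \<infinity>"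
      by (intro nn_integral_PInf_AE) auto
    then show ?thesis by eventually_elim (auto simp: indicator_def less_top)
  qed
  have "AE z in lborel. \<forall>m::nat. \<forall>x\<in>(grid (1 / real CARD('d)) m :: (real^'d) set). z \<in> cball x 1 \<longrightarrow> nearE p \<mu> z < \<infinity>"
    unfolding AE_all_countable using loc by (intro allI AE_finite_allI finite_grid)
  then show ?thesis
  proof eventually_elim
    case (elim z)
    obtain m :: nat where "real CARD('d) * norm z \<le> real m" using real_arch_simple by blast
    then have "norm z \<le> 1 / real CARD('d) * real m" by (simp add: field_simps)
    then obtain x :: "real^'d" where "x \<in> grid (1 / real CARD('d)) m" "dist z x \<le> real CARD('d) * (1 / real CARD('d))"
      using grid_cover[of "1 / real CARD('d)" z m] by auto
    then show ?case using elim by (auto simp: dist_commute)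
  qed
qed

text \<open>Jensen's inequality obtained by integrating the tangent of \<open>exp\<close> at the
  value \<open>I\<close> of the integral.\<close>

lemma jensen_exp_average:
  fixes f :: "real \<Rightarrow> real"
  assumes c: "continuous_on {0..t} f" and t: "0 < t"
  shows "ennreal (exp (LBINT s:{0..t}. f s)) \<le> ennreal (1 / t) * (\<integral>\<^sup>+s. ennreal (exp (t * f s)) * indicator {0..t} s \<partial>lborel)"
proof -
  define I where "I = (LBINT s:{0..t}. f s)"
  have i1: "set_integrable lborel {0..t} f"
    unfolding set_integrable_def by (rule borel_integrable_compact) (use c in auto)
  have i2: "set_integrable lborel {0..t} (\<lambda>s. exp (t * f s))"
    unfolding set_integrable_def by (rule borel_integrable_compact) (use c in \<open>auto intro!: continuous_intros\<close>)
  have i3: "set_integrable lborel {0..t} (\<lambda>s. exp I * (1 - I))"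
    unfolding set_integrable_def by (rule borel_integrable_compact) auto
  have i4: "set_integrable lborel {0..t} (\<lambda>s. exp I * (t * f s))"
    using i1 by (intro set_integrable_mult_right)
  have "exp I * (1 - I) + exp I * (t * f s) \<le> exp (t * f s)" for s
  proof -
    have "exp I * (1 + (t * f s - I)) \<le> exp I * exp (t * f s - I)" by (intro mult_left_mono exp_ge_add_one_self) auto
    then show ?thesis by (simp add: exp_add[symmetric] algebra_simps)
  qed
  then have "(LBINT s:{0..t}. exp I * (1 - I) + exp I * (t * f s)) \<le> (LBINT s:{0..t}. exp (t * f s))"
    by (intro set_integral_mono set_integral_add i2 i3 i4)
  also have "(LBINT s:{0..t}. exp I * (1 - I) + exp I * (t * f s)) = t * exp I"
  proof -
    have "(LBINT s:{0..t}. c) = t * c" for c :: real using t by (simp add: set_lebesgue_integral_def)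
    moreover have "(LBINT s:{0..t}. exp I * (t * f s)) = exp I * (t * I)" by (simp add: I_def)
    ultimately show ?thesis unfolding set_integral_add(2)[OF i3 i4] by (simp add: algebra_simps)
  qed
  finally have "exp I \<le> (1 / t) * (LBINT s:{0..t}. exp (t * f s))" using t by (simp add: field_simps)
  then have "ennreal (exp I) \<le> ennreal ((1 / t) * (LBINT s:{0..t}. exp (t * f s)))" by (rule ennreal_leI)
  also have "\<dots> = ennreal (1 / t) * ennreal (LBINT s:{0..t}. exp (t * f s))"
    using t by (intro ennreal_mult set_integral_nonneg) auto
  also have "ennreal (LBINT s:{0..t}. exp (t * f s)) = (\<integral>\<^sup>+s. ennreal (exp (t * f s)) * indicator {0..t} s \<partial>lborel)"
  proof -
    have "(\<integral>\<^sup>+s. ennreal (indicat_real {0..t} s *\<^sub>R exp (t * f s)) \<partial>lborel) = ennreal (LBINT s:{0..t}. exp (t * f s))"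
      unfolding set_lebesgue_integral_def by (rule nn_integral_eq_integral) (use i2 in \<open>auto simp: set_integrable_def\<close>)
    moreover have "(\<integral>\<^sup>+s. ennreal (indicat_real {0..t} s *\<^sub>R exp (t * f s)) \<partial>lborel) = (\<integral>\<^sup>+s. ennreal (exp (t * f s)) * indicator {0..t} s \<partial>lborel)"
      by (intro nn_integral_cong) (auto simp: indicator_def)
    ultimately show ?thesis by simp
  qed
  finally show ?thesis by (simp add: I_def)
qed

section \<open>Brownian paths: joint measurability, marginals and occupation times\<close>

locale bm =
  fixes W :: "'v measure" and B :: "'v \<Rightarrow> real \<Rightarrow> real^'d::finite"
  assumes bm: "brownian_motion W B"
begin

sublocale prob_space W using bm by (simp add: brownian_motion_def)

lemma B_0: "w \<in> space W \<Longrightarrow> B w 0 = 0" and B_cont: "w \<in> space W \<Longrightarrow> continuous_on {0..} (B w)"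
  using bm by (simp_all add: brownian_motion_def)

lemma B_distr: "0 \<le> s \<Longrightarrow> s < t \<Longrightarrow> distributed W lborel (\<lambda>w. B w t - B w s) (\<lambda>x. ennreal (heat (t - s) x))"
  using bm by (simp add: brownian_motion_def heat_def)

lemma B_meas: "0 \<le> t \<Longrightarrow> (\<lambda>w. B w t) \<in> borel_measurable W"
proof (cases "t = 0")
  case True
  have "(\<lambda>w. B w 0) \<in> borel_measurable W \<longleftrightarrow> (\<lambda>w. 0 :: real^'d) \<in> borel_measurable W"
    by (rule measurable_cong) (simp add: B_0)
  then show ?thesis using True by simp
next
  case False
  moreover assume "0 \<le> t"
  ultimately have "(\<lambda>w. B w t - B w 0) \<in> measurable W lborel"
    using distributed_measurable[OF B_distr[of 0 t]] by simp
  then have "(\<lambda>w. B w t - B w 0) \<in> borel_measurable W" by simp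
  moreover have "(\<lambda>w. B w t - B w 0) \<in> borel_measurable W \<longleftrightarrow> (\<lambda>w. B w t) \<in> borel_measurable W"
    by (rule measurable_cong) (simp add: B_0)
  ultimately show ?thesis by simp
qed

text \<open>Paths are continuous on \<open>{0..}\<close> only, so time is clipped by
  \<open>max 0\<close>. Rounding time to multiples of \<open>1 / Suc k\<close> gives countably many
  measurable pieces that converge by continuity.\<close>

lemma B_joint [measurable]: "(\<lambda>(w, s). B w (max 0 s)) \<in> borel_measurable (W \<Otimes>\<^sub>M borel)"
proof (rule borel_measurable_LIMSEQ_metric[where f="\<lambda>k x. B (fst x) (max 0 (real_of_int \<lfloor>real (Suc k) * snd x\<rfloor> / real (Suc k)))"])
  fix k :: nat
  have "(\<lambda>x. (\<lambda>i x. B (fst x) (max 0 (real_of_int i / real (Suc k)))) (\<lfloor>real (Suc k) * snd x\<rfloor>) x) \<in> borel_measurable (W \<Otimes>\<^sub>M borel)"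
  proof (rule measurable_compose_countable[where f="\<lambda>i x. B (fst x) (max 0 (real_of_int i / real (Suc k)))" and g="\<lambda>x. \<lfloor>real (Suc k) * snd x\<rfloor>"])
    fix i :: int
    show "(\<lambda>x. B (fst x) (max 0 (real_of_int i / real (Suc k)))) \<in> borel_measurable (W \<Otimes>\<^sub>M borel)"
      by (rule measurable_compose[OF measurable_fst B_meas]) simp
  qed measurable
  then show "(\<lambda>x. B (fst x) (max 0 (real_of_int \<lfloor>real (Suc k) * snd x\<rfloor> / real (Suc k)))) \<in> borel_measurable (W \<Otimes>\<^sub>M borel)" by simp
next
  fix x assume x: "x \<in> space (W \<Otimes>\<^sub>M (borel :: real measure))"
  obtain w s where ws: "x = (w, s)" by (cases x)
  have w: "w \<in> space W" using x ws by (simp add: space_pair_measure)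
  have c: "continuous_on {0..} (B w)" by (rule B_cont[OF w])
  have l: "(\<lambda>k. max 0 (real_of_int \<lfloor>real (Suc k) * s\<rfloor> / real (Suc k))) \<longlonglongrightarrow> max 0 s"
  proof (intro tendsto_max tendsto_const)
    show "(\<lambda>k. real_of_int \<lfloor>real (Suc k) * s\<rfloor> / real (Suc k)) \<longlonglongrightarrow> s"
    proof (rule tendsto_sandwich)
      show "\<forall>\<^sub>F k in sequentially. s - 1 / real (Suc k) \<le> real_of_int \<lfloor>real (Suc k) * s\<rfloor> / real (Suc k)"
      proof (intro always_eventually allI)
        fix k :: nat
        have "real (Suc k) * s - 1 \<le> real_of_int \<lfloor>real (Suc k) * s\<rfloor>" by linarith
        then have "(real (Suc k) * s - 1) / real (Suc k) \<le> real_of_int \<lfloor>real (Suc k) * s\<rfloor> / real (Suc k)" by (intro divide_right_mono) auto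
        then show "s - 1 / real (Suc k) \<le> real_of_int \<lfloor>real (Suc k) * s\<rfloor> / real (Suc k)" by (simp add: diff_divide_distrib del: of_nat_Suc)
      qed
      show "\<forall>\<^sub>F k in sequentially. real_of_int \<lfloor>real (Suc k) * s\<rfloor> / real (Suc k) \<le> s"
      proof (intro always_eventually allI)
        fix k :: nat
        have "real_of_int \<lfloor>real (Suc k) * s\<rfloor> / real (Suc k) \<le> (real (Suc k) * s) / real (Suc k)" by (intro divide_right_mono) auto
        then show "real_of_int \<lfloor>real (Suc k) * s\<rfloor> / real (Suc k) \<le> s" by (simp del: of_nat_Suc)
      qed
      show "(\<lambda>k. s - 1 / real (Suc k)) \<longlonglongrightarrow> s" by real_asymp
    qed simp
  qed
  have "(\<lambda>k. B w (max 0 (real_of_int \<lfloor>real (Suc k) * s\<rfloor> / real (Suc k)))) \<longlonglongrightarrow> B w (max 0 s)"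
    by (rule continuous_on_tendsto_compose[OF c l]) auto
  then show "(\<lambda>k. B (fst x) (max 0 (real_of_int \<lfloor>real (Suc k) * snd x\<rfloor> / real (Suc k)))) \<longlonglongrightarrow> (case x of (w, s) \<Rightarrow> B w (max 0 s))"
    by (simp add: ws)
qed

lemma B_compose_meas [measurable]:
  "f \<in> borel_measurable borel \<Longrightarrow> (\<lambda>x. f (B (fst x) (max 0 (snd x)))) \<in> borel_measurable (W \<Otimes>\<^sub>M borel)"
  using measurable_compose[OF B_joint, of f] by (simp add: case_prod_beta')

lemma B_nn:
  assumes "0 < t" "f \<in> borel_measurable borel"
  shows "(\<integral>\<^sup>+w. f (B w t) \<partial>W) = (\<integral>\<^sup>+x. ennreal (heat t x) * f x \<partial>lborel)"
proof -
  have "(\<integral>\<^sup>+w. f (B w t) \<partial>W) = (\<integral>\<^sup>+w. f (B w t - B w 0) \<partial>W)" by (intro nn_integral_cong) (simp add: B_0)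
  also have "\<dots> = (\<integral>\<^sup>+x. ennreal (heat t x) * f x \<partial>lborel)"
    using distributed_nn_integral[OF B_distr[of 0 t], of f] assms by simp
  finally show ?thesis .
qed

lemma heat_integral:
  assumes "0 < \<sigma>" shows "(\<integral>\<^sup>+x. ennreal (heat \<sigma> (x::real^'d)) \<partial>lborel) = 1"
  using B_nn[OF assms, of "\<lambda>_. 1"] emeasure_space_1 by simp

text \<open>The exponential turns the Gaussian of variance \<open>s\<close> into
  \<open>(4/3) powr (d / 2)\<close> times the one of variance \<open>4 * s / 3\<close>; the constant
  is then rounded up.\<close>

lemma gauss_exp:
  assumes "0 < s" "s \<le> t"
  shows "(\<integral>\<^sup>+w. ennreal (exp ((norm (B w s))\<^sup>2 / (8 * t))) \<partial>W) \<le> ennreal (2 ^ CARD('d))"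
proof -
  let ?d = "real CARD('d)"
  have "(\<integral>\<^sup>+w. ennreal (exp ((norm (B w s))\<^sup>2 / (8 * t))) \<partial>W) = (\<integral>\<^sup>+x. ennreal (heat s (x::real^'d)) * ennreal (exp ((norm x)\<^sup>2 / (8 * t))) \<partial>lborel)"
    by (rule B_nn) (use assms in auto)
  also have "\<dots> \<le> (\<integral>\<^sup>+x. ennreal ((4/3) powr (?d / 2)) * ennreal (heat (4 * s / 3) (x::real^'d)) \<partial>lborel)"
  proof (rule nn_integral_mono)
    fix x :: "real^'d"
    have "heat s x * exp ((norm x)\<^sup>2 / (8 * t)) \<le> heat s x * exp ((norm x)\<^sup>2 / (8 * s))"
      using assms by (intro mult_left_mono) (auto intro!: divide_left_mono)
    also have "\<dots> = (2 * pi * s) powr (- ?d / 2) * exp (- (norm x)\<^sup>2 / (2 * (4 * s / 3)))"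
    proof -
      have "- (norm x)\<^sup>2 / (2 * s) + (norm x)\<^sup>2 / (8 * s) = - (norm x)\<^sup>2 / (2 * (4 * s / 3))" using assms by (simp add: field_simps)
      then show ?thesis unfolding heat_def by (simp add: mult.assoc exp_add[symmetric])
    qed
    also have "(2 * pi * s) powr (- ?d / 2) = (4/3) powr (?d / 2) * (2 * pi * (4 * s / 3)) powr (- ?d / 2)"
    proof -
      have "(2 * pi * (4 * s / 3)) powr (- ?d / 2) = (4/3) powr (- ?d / 2) * (2 * pi * s) powr (- ?d / 2)"
        unfolding powr_mult[symmetric] by (simp add: mult.commute mult.left_commute)
      moreover have "(4/3) powr (?d / 2) * (4/3) powr (- ?d / 2) = (1::real)" by (simp add: powr_add[symmetric])
      ultimately show ?thesis by (simp add: mult.assoc[symmetric])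
    qed
    finally have "heat s x * exp ((norm x)\<^sup>2 / (8 * t)) \<le> (4/3) powr (?d / 2) * heat (4 * s / 3) x" by (simp add: heat_def)
    then show "ennreal (heat s x) * ennreal (exp ((norm x)\<^sup>2 / (8 * t))) \<le> ennreal ((4/3) powr (?d / 2)) * ennreal (heat (4 * s / 3) x)"
      by (simp add: ennreal_mult[symmetric] ennreal_leI)
  qed
  also have "\<dots> = ennreal ((4/3) powr (?d / 2))"
    using assms heat_integral[of "4 * s / 3"] by (subst nn_integral_cmult) auto
  also have "\<dots> \<le> ennreal (2 ^ CARD('d))"
  proof (rule ennreal_leI)
    have "(4/3) powr (?d / 2) \<le> 2 powr (?d / 2)" by (intro powr_mono2) auto
    also have "\<dots> \<le> 2 powr ?d" by (intro powr_mono) auto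
    finally show "(4/3) powr (?d / 2) \<le> 2 ^ CARD('d)" by (simp add: powr_realpow)
  qed
  finally show ?thesis .
qed

lemma B_occupation:
  assumes [measurable]: "f \<in> borel_measurable borel"
  shows "(\<integral>\<^sup>+w. (\<integral>\<^sup>+s. f (B w s) * indicator {0..t} s \<partial>lborel) \<partial>W) = (\<integral>\<^sup>+s. (\<integral>\<^sup>+w. f (B w s) \<partial>W) * indicator {0..t} s \<partial>lborel)"
proof -
  interpret L: pair_sigma_finite W lborel ..
  have "(\<integral>\<^sup>+w. (\<integral>\<^sup>+s. f (B w s) * indicator {0..t} s \<partial>lborel) \<partial>W) = (\<integral>\<^sup>+w. (\<integral>\<^sup>+s. f (B w (max 0 s)) * indicator {0..t} s \<partial>lborel) \<partial>W)"
    by (intro nn_integral_cong) (auto simp: indicator_def max_def)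
  also have "\<dots> = (\<integral>\<^sup>+s. (\<integral>\<^sup>+w. f (B w (max 0 s)) * indicator {0..t} s \<partial>W) \<partial>lborel)"
  proof (rule L.Fubini'[symmetric])
    have "(\<lambda>x. f (B (fst x) (max 0 (snd x))) * indicator {0..t} (snd x)) \<in> borel_measurable (W \<Otimes>\<^sub>M borel)" by measurable
    then show "(\<lambda>(w, s). f (B w (max 0 s)) * indicator {0..t} s) \<in> borel_measurable (W \<Otimes>\<^sub>M lborel)"
      by (simp add: case_prod_beta' cong: measurable_cong_sets)
  qed
  also have "\<dots> = (\<integral>\<^sup>+s. (\<integral>\<^sup>+w. f (B w s) \<partial>W) * indicator {0..t} s \<partial>lborel)"
    by (intro nn_integral_cong) (auto simp: indicator_def max_def)
  finally show ?thesis .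
qed

lemma B_section_meas: "f \<in> borel_measurable borel \<Longrightarrow> w \<in> space W \<Longrightarrow> (\<lambda>s. indicator {0..t} s *\<^sub>R (f (B w s) :: real)) \<in> borel_measurable borel"
proof -
  assume f: "f \<in> borel_measurable borel" and w: "w \<in> space W"
  have "(\<lambda>s. f (B w (max 0 s))) \<in> borel_measurable borel"
    using measurable_compose[OF measurable_Pair1'[OF w] measurable_compose[OF B_joint f]] by simp
  then have "(\<lambda>s. indicator {0..t} s *\<^sub>R f (B w (max 0 s))) \<in> borel_measurable borel" by measurable
  also have "(\<lambda>s. indicator {0..t} s *\<^sub>R f (B w (max 0 s))) = (\<lambda>s. indicator {0..t} s *\<^sub>R f (B w s))"
    by (auto simp: indicator_def max_def fun_eq_iff)
  finally show ?thesis .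
qed

text \<open>Marginals at positive times have densities, so by Fubini a Lebesgue null set is occupied
  only during a null set of times.\<close>

lemma AE_path:
  assumes Z: "AE z in lborel. Q z" and [measurable]: "{z. \<not> Q z} \<in> sets borel"
  shows "AE w in W. AE s in lborel. s \<in> {0..t} \<longrightarrow> Q (B w s)"
proof -
  have "(\<integral>\<^sup>+w. indicator {z. \<not> Q z} (B w s) \<partial>W) = 0" if "0 < s" for s
  proof -
    have "(\<integral>\<^sup>+w. indicator {z. \<not> Q z} (B w s) \<partial>W) = (\<integral>\<^sup>+x. ennreal (heat s x) * indicator {z. \<not> Q z} x \<partial>lborel)"
      by (rule B_nn[OF that]) measurable
    also have "\<dots> = (\<integral>\<^sup>+x. 0 \<partial>(lborel :: (real^'d) measure))"
    proof (rule nn_integral_cong_AE)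
      show "AE x in lborel. ennreal (heat s x) * indicator {z. \<not> Q z} x = 0" using Z by eventually_elim simp
    qed
    finally show ?thesis by simp
  qed note P0 = this
  have "(\<integral>\<^sup>+s. (\<integral>\<^sup>+w. indicator {z. \<not> Q z} (B w s) \<partial>W) * indicator {0..t} s \<partial>lborel) = (\<integral>\<^sup>+s. 0 \<partial>(lborel::real measure))"
  proof (rule nn_integral_cong_AE)
    show "AE s in lborel. (\<integral>\<^sup>+w. indicator {z. \<not> Q z} (B w s) \<partial>W) * indicator {0..t} s = 0"
      using AE_lborel_singleton[of "0::real"]
    proof eventually_elim
      case (elim s)
      show ?case by (cases "0 < s") (use P0[of s] elim in auto)
    qed
  qed
  then have z: "(\<integral>\<^sup>+w. (\<integral>\<^sup>+s. indicator {z. \<not> Q z} (B w s) * indicator {0..t} s \<partial>lborel) \<partial>W) = 0"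
    by (subst B_occupation) auto
  have m: "(\<lambda>x. (indicator {z. \<not> Q z} (B (fst x) (max 0 (snd x))) :: ennreal) * indicator {0..t} (snd x)) \<in> borel_measurable (W \<Otimes>\<^sub>M borel)"
    by measurable
  have eq: "(indicator {z. \<not> Q z} (B w s) :: ennreal) * indicator {0..t} s = indicator {z. \<not> Q z} (B w (max 0 s)) * indicator {0..t} s" for w s
    by (auto simp: indicator_def max_def)
  have m1: "(\<lambda>w. \<integral>\<^sup>+s. indicator {z. \<not> Q z} (B w s) * indicator {0..t} s \<partial>lborel) \<in> borel_measurable W"
    unfolding eq by (rule lborel.borel_measurable_nn_integral) (use m in \<open>simp add: case_prod_beta' cong: measurable_cong_sets\<close>)
  have "AE w in W. (\<integral>\<^sup>+s. indicator {z. \<not> Q z} (B w s) * indicator {0..t} s \<partial>lborel) = 0"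
    using z by (subst (asm) nn_integral_0_iff_AE[OF m1])
  then show ?thesis using AE_space
  proof eventually_elim
    case (elim w)
    have "(\<lambda>s. (indicator {z. \<not> Q z} (B w s) :: ennreal) * indicator {0..t} s) \<in> borel_measurable lborel"
      unfolding eq using measurable_compose[OF measurable_Pair1'[OF elim(2)] m] by simp
    from elim(1)[unfolded nn_integral_0_iff_AE[OF this]] show ?case
      by eventually_elim (auto simp: indicator_def split: if_splits)
  qed
qed

text \<open>The envelope \<open>mt\<close> of \<open>- Vbar\<close> is constant up to a radius of
  order \<open>t powr (1 + \<eta>)\<close> and grows like a power of the logarithm beyond. In the
  outer region \<open>t * \<theta> * mt z\<close> is at most
  \<open>(norm z)\<^sup>2 / (8 * t)\<close>, whose exponential moment is bounded by
  \<open>2 ^ d\<close>. Being continuous, \<open>mt\<close> can be put into Jensen's inequality,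
  unlike \<open>Vbar\<close>.\<close>

lemma upper_quenched:
  fixes \<mu> :: "(real^'d) measure" and p \<theta> b be \<eta> C :: real
  assumes env: "regular_env p C \<mu>" and p: "0 < p" "p < real CARD('d)" and th: "0 < \<theta>" and b: "0 \<le> b" and be: "0 < be" "be < 1" and eta: "0 < \<eta>"
    and sup: "\<forall>\<^sub>F n in sequentially. \<forall>z\<in>cball 0 (exp (real n)). nearE p \<mu> z < \<infinity> \<longrightarrow> - Vbar p \<mu> z \<le> b * real n powr (1 - be)"
  shows "\<forall>\<^sub>F t in at_top. quenched_moment W B p \<theta> \<mu> t \<le> ennreal (exp (\<theta> * t * b * ((1 + \<eta>) * ln t + 1) powr (1 - be)) + 2 ^ CARD('d))"
proof -
  have sets: "sets \<mu> = sets borel" and fin: "\<And>x r. emeasure \<mu> (cball x r) < \<infinity>" and Vm [measurable]: "Vbar p \<mu> \<in> borel_measurable borel"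
    using env by (auto simp: regular_env_def)
  note [measurable] = nearE_measurable[OF sets fin, of p]
  obtain n1 where n1': "\<forall>n\<ge>n1. \<forall>z\<in>cball 0 (exp (real n)). nearE p \<mu> z < \<infinity> \<longrightarrow> - Vbar p \<mu> z \<le> b * real n powr (1 - be)"
    using sup unfolding eventually_sequentially by blast
  have n1: "- Vbar p \<mu> z \<le> b * real n powr (1 - be)" if "n \<ge> n1" "norm z \<le> exp (real n)" "nearE p \<mu> z < \<infinity>" for n z
    using n1' that by simp
  \<comment> \<open>The exponent to be used is \<open>2 / (1 + \<eta>) < 2\<close>: for
    \<open>r\<close> in the outer region
    \<open>t\<^sup>2 \<le> (1 + r) powr (2 / (1 + \<eta>))\<close>, which even with a logarithmic
    factor is negligible against \<open>r\<^sup>2\<close>.\<close>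
  have "((\<lambda>r. 8 * \<theta> * b * ((1 + r) powr e * (ln (1 + r) + 1)) / r\<^sup>2) \<longlongrightarrow> 0) at_top" if "e < 2" for e :: real
    using that by real_asymp
  then have "((\<lambda>r. 8 * \<theta> * b * ((1 + r) powr (2 / (1 + \<eta>)) * (ln (1 + r) + 1)) / r\<^sup>2) \<longlongrightarrow> 0) at_top"
    using eta by (simp add: field_simps)
  then have "\<forall>\<^sub>F r in at_top. 8 * \<theta> * b * ((1 + r) powr (2 / (1 + \<eta>)) * (ln (1 + r) + 1)) / r\<^sup>2 < 1"
    by (rule order_tendstoD) simp
  then obtain r1 where r1: "\<And>r. r \<ge> r1 \<Longrightarrow> 8 * \<theta> * b * ((1 + r) powr (2 / (1 + \<eta>)) * (ln (1 + r) + 1)) / r\<^sup>2 < 1"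
    by (auto simp: eventually_at_top_linorder)
  have "\<forall>\<^sub>F t in at_top. real n1 \<le> (1 + \<eta>) * ln t"
  proof -
    have "filterlim (\<lambda>t. (1 + \<eta>) * ln t) at_top at_top" using eta by real_asymp
    then show ?thesis unfolding filterlim_at_top by blast
  qed
  then show ?thesis using eventually_ge_at_top[of "1 + max 1 r1"]
  proof eventually_elim
    case (elim t)
    have t: "1 < t" "r1 \<le> t - 1" "0 < t" "1 \<le> t - 1" using elim(2) by auto
    define x where "x = (1 + \<eta>) * ln t"
    have x0: "0 \<le> x" using t eta by (simp add: x_def)
    define mt where "mt z = b * (max x (ln (1 + norm z)) + 1) powr (1 - be)" for z :: "real^'d"
    have mt0: "0 \<le> mt z" for z using b by (simp add: mt_def)
    have Vle: "- Vbar p \<mu> z \<le> mt z" if "nearE p \<mu> z < \<infinity>" for z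
    proof -
      define n where "n = nat \<lceil>max x (ln (1 + norm z))\<rceil>"
      have n: "max x (ln (1 + norm z)) \<le> real n" "real n \<le> max x (ln (1 + norm z)) + 1"
        unfolding n_def using x0 by linarith+
      have "real n1 \<le> real n" using elim(1) n(1) by (simp add: x_def)
      moreover have "norm z \<le> exp (real n)"
      proof -
        have "1 + norm z = exp (ln (1 + norm z))" by (simp add: add_pos_nonneg)
        also have "\<dots> \<le> exp (real n)" using n by simp
        finally show ?thesis by simp
      qed
      ultimately have "- Vbar p \<mu> z \<le> b * real n powr (1 - be)" using that by (intro n1) auto
      also have "\<dots> \<le> mt z" unfolding mt_def using n b be by (intro mult_left_mono powr_mono2) auto
      finally show ?thesis .
    qed
    have mtc: "continuous_on UNIV mt"
    proof -
      have nn: "norm z \<noteq> - 1" for z :: "real^'d" using norm_ge_zero[of z] by linarith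
      show ?thesis unfolding mt_def using x0 by (intro continuous_intros) (auto simp: add_eq_0_iff max_def nn)
    qed
    have mtm [measurable]: "mt \<in> borel_measurable borel" by (rule borel_measurable_continuous_onI[OF mtc])
    define Kb where "Kb = exp (\<theta> * t * b * (x + 1) powr (1 - be)) + 2 ^ CARD('d)"
    have expb: "exp (t * (\<theta> * mt z)) \<le> exp (\<theta> * t * b * (x + 1) powr (1 - be)) + exp ((norm z)\<^sup>2 / (8 * t))" for z
    proof (cases "ln (1 + norm z) \<le> x")
      case True
      then have "mt z = b * (x + 1) powr (1 - be)" by (simp add: mt_def)
      then have "t * (\<theta> * mt z) = \<theta> * t * b * (x + 1) powr (1 - be)" by simp
      then show ?thesis by (simp only:) simp
    next
      case False
      define r where "r = norm z"
      have lr: "x < ln (1 + r)" "0 \<le> r" using False by (auto simp: r_def)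
      have "exp x \<le> exp (ln (1 + r))" using lr by (simp del: exp_ln)
      then have e1: "t powr (1 + \<eta>) \<le> 1 + r" using lr t by (simp add: powr_def x_def add_nonneg_pos)
      have "t powr 1 \<le> t powr (1 + \<eta>)" using t eta by (intro powr_mono) auto
      then have r: "r1 \<le> r" "1 \<le> r" using e1 t by auto
      have "(t powr (1 + \<eta>)) powr (2 / (1 + \<eta>)) \<le> (1 + r) powr (2 / (1 + \<eta>))" using e1 eta by (intro powr_mono2) auto
      moreover have "(t powr (1 + \<eta>)) powr (2 / (1 + \<eta>)) = t\<^sup>2"
      proof -
        have "(1 + \<eta>) * (2 / (1 + \<eta>)) = 2" using eta by (simp add: field_simps)
        then show ?thesis unfolding powr_powr using t by (simp only:) (simp add: powr_numeral)
      qed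
      ultimately have t2: "t\<^sup>2 \<le> (1 + r) powr (2 / (1 + \<eta>))" by simp
      have l1: "1 \<le> ln (1 + r) + 1" using lr by simp
      have "mt z \<le> b * (ln (1 + r) + 1)"
      proof -
        have "(ln (1 + r) + 1) powr (1 - be) \<le> (ln (1 + r) + 1) powr 1" using l1 be by (intro powr_mono) auto
        then show ?thesis using False b l1 by (auto simp: mt_def r_def max_def intro!: mult_left_mono)
      qed
      then have "t * (\<theta> * mt z) \<le> t * (\<theta> * (b * (ln (1 + r) + 1)))" using t th by (intro mult_left_mono) auto
      also have "\<dots> \<le> r\<^sup>2 / (8 * t)"
      proof -
        have "8 * \<theta> * b * (t\<^sup>2 * (ln (1 + r) + 1)) \<le> 8 * \<theta> * b * ((1 + r) powr (2 / (1 + \<eta>)) * (ln (1 + r) + 1))"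
          using t2 th b l1 by (intro mult_left_mono mult_right_mono) auto
        also have "\<dots> \<le> r\<^sup>2" using r1[OF r(1)] r(2) by (simp add: divide_less_eq)
        finally have "8 * \<theta> * b * (t\<^sup>2 * (ln (1 + r) + 1)) \<le> r\<^sup>2" .
        then show ?thesis using t by (simp add: pos_le_divide_eq power2_eq_square mult.commute mult.left_commute)
      qed
      finally have "exp (t * (\<theta> * mt z)) \<le> exp ((norm z)\<^sup>2 / (8 * t))" by (simp add: r_def)
      then show ?thesis by (simp add: add_increasing)
    qed
    have goodAE: "AE w in W. AE s in lborel. s \<in> {0..t} \<longrightarrow> nearE p \<mu> (B w s) < \<infinity>"
      by (rule AE_path[OF AE_nearE_finite[OF sets fin p]]) measurable
    have "quenched_moment W B p \<theta> \<mu> t \<le> (\<integral>\<^sup>+w. ennreal (1 / t) * (\<integral>\<^sup>+s. ennreal (exp (t * (\<theta> * mt (B w s)))) * indicator {0..t} s \<partial>lborel) \<partial>W)"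
      unfolding quenched_moment_def
    proof (rule nn_integral_mono_AE)
      show "AE w in W. ennreal (exp (- \<theta> * (LBINT s:{0..t}. Vbar p \<mu> (B w s)))) \<le> ennreal (1 / t) * (\<integral>\<^sup>+s. ennreal (exp (t * (\<theta> * mt (B w s)))) * indicator {0..t} s \<partial>lborel)"
        using goodAE AE_space
      proof eventually_elim
        case (elim w)
        have cB: "continuous_on {0..t} (\<lambda>s. mt (B w s))"
          by (rule continuous_on_compose2[OF mtc continuous_on_subset[OF B_cont[OF elim(2)]]]) auto
        have im: "set_integrable lborel {0..t} (\<lambda>s. mt (B w s))"
          unfolding set_integrable_def by (rule borel_integrable_compact) (use cB in auto)
        have "- (LBINT s:{0..t}. Vbar p \<mu> (B w s)) \<le> (LBINT s:{0..t}. mt (B w s))"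
        proof (cases "set_integrable lborel {0..t} (\<lambda>s. Vbar p \<mu> (B w s))")
          case True
          have "(LBINT s:{0..t}. - Vbar p \<mu> (B w s)) \<le> (LBINT s:{0..t}. mt (B w s))"
            unfolding set_lebesgue_integral_def
          proof (rule integral_mono_AE)
            show "AE s in lborel. indicat_real {0..t} s *\<^sub>R - Vbar p \<mu> (B w s) \<le> indicat_real {0..t} s *\<^sub>R mt (B w s)"
              using elim(1) by eventually_elim (use Vle in \<open>auto simp: indicator_def\<close>)
          qed (use True im in \<open>auto simp: set_integrable_def\<close>)
          then show ?thesis by (simp add: set_lebesgue_integral_def)
        next
          case False
          \<comment> \<open>Without integrability along the path the Bochner integral has the value
            0, and the bound holds because \<open>mt\<close> is non-negative.\<close>
          then have "(LBINT s:{0..t}. Vbar p \<mu> (B w s)) = 0"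
            unfolding set_integrable_def set_lebesgue_integral_def by (rule not_integrable_integral_eq)
          then show ?thesis using set_integral_nonneg[of "{0..t}" "\<lambda>s. mt (B w s)" lborel] mt0 by simp
        qed
        then have "\<theta> * - (LBINT s:{0..t}. Vbar p \<mu> (B w s)) \<le> \<theta> * (LBINT s:{0..t}. mt (B w s))" using th by (intro mult_left_mono) auto
        also have "\<dots> = (LBINT s:{0..t}. \<theta> * mt (B w s))" by simp
        finally have "ennreal (exp (- \<theta> * (LBINT s:{0..t}. Vbar p \<mu> (B w s)))) \<le> ennreal (exp (LBINT s:{0..t}. \<theta> * mt (B w s)))"
          by (intro ennreal_leI) simp
        also have "\<dots> \<le> ennreal (1 / t) * (\<integral>\<^sup>+s. ennreal (exp (t * (\<theta> * mt (B w s)))) * indicator {0..t} s \<partial>lborel)"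
          by (rule jensen_exp_average) (use cB t in \<open>auto intro!: continuous_intros\<close>)
        finally show ?case .
      qed
    qed
    also have "\<dots> = ennreal (1 / t) * (\<integral>\<^sup>+w. (\<integral>\<^sup>+s. ennreal (exp (t * (\<theta> * mt (B w s)))) * indicator {0..t} s \<partial>lborel) \<partial>W)"
    proof (rule nn_integral_cmult)
      have m: "(\<lambda>x. ennreal (exp (t * (\<theta> * mt (B (fst x) (max 0 (snd x)))))) * indicator {0..t} (snd x)) \<in> borel_measurable (W \<Otimes>\<^sub>M borel)" by measurable
      have eq: "ennreal (exp (t * (\<theta> * mt (B w s)))) * indicator {0..t} s = ennreal (exp (t * (\<theta> * mt (B w (max 0 s))))) * indicator {0..t} s" for w s
        by (auto simp: indicator_def max_def)
      show "(\<lambda>w. \<integral>\<^sup>+s. ennreal (exp (t * (\<theta> * mt (B w s)))) * indicator {0..t} s \<partial>lborel) \<in> borel_measurable W"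
        unfolding eq by (rule lborel.borel_measurable_nn_integral) (use m in \<open>simp add: case_prod_beta' cong: measurable_cong_sets\<close>)
    qed
    also have "(\<integral>\<^sup>+w. (\<integral>\<^sup>+s. ennreal (exp (t * (\<theta> * mt (B w s)))) * indicator {0..t} s \<partial>lborel) \<partial>W)
      = (\<integral>\<^sup>+s. (\<integral>\<^sup>+w. ennreal (exp (t * (\<theta> * mt (B w s)))) \<partial>W) * indicator {0..t} s \<partial>lborel)"
      by (rule B_occupation) measurable
    also have "\<dots> \<le> (\<integral>\<^sup>+s. ennreal Kb * indicator {0..t} s \<partial>lborel)"
    proof (rule nn_integral_mono_AE)
      show "AE s in lborel. (\<integral>\<^sup>+w. ennreal (exp (t * (\<theta> * mt (B w s)))) \<partial>W) * indicator {0..t} s \<le> ennreal Kb * indicator {0..t} s"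
        using AE_lborel_singleton[of "0::real"]
      proof eventually_elim
        case (elim s)
        show ?case
        proof (cases "s \<in> {0..t}")
          case True
          then have s: "0 < s" "s \<le> t" using elim by auto
          have [measurable]: "(\<lambda>w. B w s) \<in> borel_measurable W" using s by (intro B_meas) auto
          have "(\<integral>\<^sup>+w. ennreal (exp (t * (\<theta> * mt (B w s)))) \<partial>W) \<le> (\<integral>\<^sup>+w. ennreal (exp (\<theta> * t * b * (x + 1) powr (1 - be))) + ennreal (exp ((norm (B w s))\<^sup>2 / (8 * t))) \<partial>W)"
            by (intro nn_integral_mono) (simp add: ennreal_plus[symmetric] expb ennreal_leI del: ennreal_plus)
          also have "\<dots> = ennreal (exp (\<theta> * t * b * (x + 1) powr (1 - be))) + (\<integral>\<^sup>+w. ennreal (exp ((norm (B w s))\<^sup>2 / (8 * t))) \<partial>W)"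
            using emeasure_space_1 by (subst nn_integral_add) auto
          also have "\<dots> \<le> ennreal (exp (\<theta> * t * b * (x + 1) powr (1 - be))) + ennreal (2 ^ CARD('d))"
            using gauss_exp[OF s] by (intro add_left_mono)
          also have "\<dots> = ennreal Kb" unfolding Kb_def by (rule ennreal_plus[symmetric]) auto
          finally show ?thesis using True by simp
        qed simp
      qed
    qed
    also have "\<dots> = ennreal Kb * ennreal t" using t by (simp add: nn_integral_cmult_indicator)
    finally have "quenched_moment W B p \<theta> \<mu> t \<le> ennreal (1 / t) * (ennreal Kb * ennreal t)" by (simp add: mult_left_mono)
    also have "\<dots> = ennreal (1 / t * (Kb * t))"
    proof -
      have "0 \<le> Kb" by (simp add: Kb_def)
      then show ?thesis using t by (simp only: ennreal_mult mult_nonneg_nonneg divide_nonneg_nonneg zero_le_one less_imp_le)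
    qed
    also have "1 / t * (Kb * t) = Kb" using t by simp
    finally show ?case unfolding Kb_def x_def .
  qed
qed

end

section \<open>Brownian motion tilted along a skeleton\<close>

text \<open>Allows the past to be frozen while the next increment is integrated out.\<close>

lemma (in prob_space) nn_integral_indep:
  assumes ind: "indep_var S X T Y" and H [measurable]: "H \<in> borel_measurable (S \<Otimes>\<^sub>M T)"
  shows "(\<integral>\<^sup>+w. H (X w, Y w) \<partial>M) = (\<integral>\<^sup>+w. (\<integral>\<^sup>+w'. H (X w, Y w') \<partial>M) \<partial>M)"
proof -
  have X [measurable]: "X \<in> measurable M S" and Y [measurable]: "Y \<in> measurable M T"
    and eq: "distr M S X \<Otimes>\<^sub>M distr M T Y = distr M (S \<Otimes>\<^sub>M T) (\<lambda>x. (X x, Y x))"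
    using ind unfolding indep_var_distribution_eq by auto
  interpret DX: prob_space "distr M S X" by (rule prob_space_distr) measurable
  interpret DY: prob_space "distr M T Y" by (rule prob_space_distr) measurable
  interpret DP: pair_prob_space "distr M S X" "distr M T Y" ..
  have "(\<integral>\<^sup>+w. H (X w, Y w) \<partial>M) = (\<integral>\<^sup>+z. H z \<partial>(distr M (S \<Otimes>\<^sub>M T) (\<lambda>x. (X x, Y x))))"
    by (subst nn_integral_distr) auto
  also have "\<dots> = (\<integral>\<^sup>+z. H z \<partial>(distr M S X \<Otimes>\<^sub>M distr M T Y))" by (simp only: eq)
  also have "\<dots> = (\<integral>\<^sup>+x. (\<integral>\<^sup>+y. H (x, y) \<partial>(distr M T Y)) \<partial>(distr M S X))"
    by (subst DY.nn_integral_fst[symmetric]) auto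
  also have "\<dots> = (\<integral>\<^sup>+w. (\<integral>\<^sup>+y. H (X w, y) \<partial>(distr M T Y)) \<partial>M)"
    by (subst nn_integral_distr) auto
  also have "\<dots> = (\<integral>\<^sup>+w. (\<integral>\<^sup>+w'. H (X w, Y w') \<partial>M) \<partial>M)"
  proof (rule nn_integral_cong)
    fix w assume "w \<in> space M"
    then have "X w \<in> space S" using measurable_space[OF X] by blast
    then have "(\<lambda>y. H (X w, y)) \<in> borel_measurable T" by measurable
    then show "(\<integral>\<^sup>+y. H (X w, y) \<partial>(distr M T Y)) = (\<integral>\<^sup>+w'. H (X w, Y w') \<partial>M)"
      by (subst nn_integral_distr) auto
  qed
  finally show ?thesis .
qed

section \<open>Markov property along a finite skeleton of times\<close>

definition kstep :: "real \<Rightarrow> (real^'d \<Rightarrow> real^'d \<Rightarrow> ennreal) \<Rightarrow> (real^'d \<Rightarrow> ennreal) \<Rightarrow> real^'d::finite \<Rightarrow> ennreal" where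
  "kstep \<sigma> \<Phi> f y = (\<integral>\<^sup>+x. ennreal (heat \<sigma> (x - y)) * (\<Phi> y x * f x) \<partial>lborel)"

text \<open>The recursion peels off the last step: \<open>f\<close> is a function of the final
  position, pulled back one step at a time towards the starting point.\<close>

primrec kiter :: "(nat \<Rightarrow> real) \<Rightarrow> (nat \<Rightarrow> real^'d \<Rightarrow> real^'d \<Rightarrow> ennreal) \<Rightarrow> nat \<Rightarrow> (real^'d::finite \<Rightarrow> ennreal) \<Rightarrow> real^'d \<Rightarrow> ennreal" where
  "kiter ts \<Phi> 0 f = f"
| "kiter ts \<Phi> (Suc l) f = kiter ts \<Phi> l (kstep (ts (Suc l) - ts l) (\<Phi> l) f)"

lemma kstep_measurable:
  assumes [measurable]: "(\<lambda>x. \<Phi> (fst x) (snd x)) \<in> borel_measurable (borel \<Otimes>\<^sub>M borel)" "f \<in> borel_measurable borel"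
  shows "kstep \<sigma> \<Phi> f \<in> borel_measurable borel"
proof -
  have m: "(\<lambda>z. ennreal (heat \<sigma> (snd z - fst z)) * (\<Phi> (fst z) (snd z) * f (snd z))) \<in> borel_measurable (borel \<Otimes>\<^sub>M borel)"
    by measurable
  show ?thesis unfolding kstep_def[abs_def]
    by (rule lborel.borel_measurable_nn_integral) (use m in \<open>simp add: case_prod_beta' cong: measurable_cong_sets\<close>)
qed

lemma heat_shift:
  assumes [measurable]: "F \<in> borel_measurable borel"
  shows "(\<integral>\<^sup>+x. ennreal (heat \<sigma> x) * F (y + x) \<partial>lborel) = (\<integral>\<^sup>+x. ennreal (heat \<sigma> (x - y)) * F (x :: real^'d::finite) \<partial>lborel)"
proof -
  have "(\<integral>\<^sup>+x. ennreal (heat \<sigma> (x - y)) * F x \<partial>lborel) = (\<integral>\<^sup>+x. ennreal (heat \<sigma> (x - y)) * F x \<partial>(distr lborel borel ((+) y)))"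
    by (simp only: lborel_distr_plus)
  also have "\<dots> = (\<integral>\<^sup>+x. ennreal (heat \<sigma> x) * F (y + x) \<partial>lborel)"
    by (subst nn_integral_distr) auto
  finally show ?thesis by simp
qed

context bm
begin

text \<open>As the path starts at 0, the first \<open>l\<close> increments determine all positions
  up to time \<open>ts l\<close>. They are independent of the last increment, and integrating the
  latter produces \<open>kstep\<close>.\<close>

lemma chain_step:
  fixes \<Phi> :: "nat \<Rightarrow> real^'d \<Rightarrow> real^'d \<Rightarrow> ennreal"
  assumes ts0: "ts 0 = 0" and ts: "\<And>i. i \<le> l \<Longrightarrow> ts i < ts (Suc i)"
    and Phi: "\<And>i. i \<le> l \<Longrightarrow> (\<lambda>x. \<Phi> i (fst x) (snd x)) \<in> borel_measurable (borel \<Otimes>\<^sub>M borel)"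
    and f [measurable]: "f \<in> borel_measurable borel"
  shows "(\<integral>\<^sup>+w. (\<Prod>i<Suc l. \<Phi> i (B w (ts i)) (B w (ts (Suc i)))) * f (B w (ts (Suc l))) \<partial>W)
    = (\<integral>\<^sup>+w. (\<Prod>i<l. \<Phi> i (B w (ts i)) (B w (ts (Suc i)))) * kstep (ts (Suc l) - ts l) (\<Phi> l) f (B w (ts l)) \<partial>W)"
proof -
  have tsp: "0 \<le> ts i" if "i \<le> Suc l" for i using that
  proof (induction i)
    case 0 then show ?case by (simp add: ts0)
  next
    case (Suc i) then show ?case using ts[of i] by simp
  qed
  define \<xi> where "\<xi> i w = B w (ts (Suc i)) - B w (ts i)" for i w
  define X where "X w = restrict (\<lambda>i. \<xi> i w) {..<l}" for w
  define Y where "Y w = restrict (\<lambda>i. \<xi> i w) {l}" for w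
  define pos where "pos v j = (\<Sum>i<j. v i)" for v :: "nat \<Rightarrow> real^'d" and j
  let ?S = "PiM {..<l} (\<lambda>_. borel :: (real^'d) measure)" and ?T = "PiM {l} (\<lambda>_. borel :: (real^'d) measure)"
  have iv: "indep_vars (\<lambda>_. borel) \<xi> {..<Suc l}"
  proof -
    have "\<forall>(n::nat) (ts :: nat \<Rightarrow> real). 0 \<le> ts 0 \<longrightarrow> (\<forall>i<n. ts i < ts (Suc i)) \<longrightarrow>
        indep_vars (\<lambda>_. borel) (\<lambda>i w. B w (ts (Suc i)) - B w (ts i)) {..<n}"
      using bm unfolding brownian_motion_def by (elim conjE)
    from this[rule_format, of ts "Suc l"] show ?thesis using ts ts0 unfolding \<xi>_def[abs_def] by simp
  qed
  have ind: "indep_var ?S X ?T Y"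
    unfolding X_def[abs_def] Y_def[abs_def] by (rule indep_var_restrict[OF iv]) auto
  have pB: "pos (X w) j = B w (ts j)" if "w \<in> space W" "j \<le> l" for w j
  proof -
    have "pos (X w) j = (\<Sum>i<j. B w (ts (Suc i)) - B w (ts i))"
      unfolding pos_def X_def \<xi>_def using that by (intro sum.cong) auto
    also have "\<dots> = B w (ts j) - B w (ts 0)" by (rule sum_lessThan_telescope)
    finally show ?thesis using that B_0 ts0 by simp
  qed
  define H where "H z = (\<Prod>i<l. \<Phi> i (pos (fst z) i) (pos (fst z) (Suc i))) *
     (\<Phi> l (pos (fst z) l) (pos (fst z) l + snd z l) * f (pos (fst z) l + snd z l))" for z
  have posm: "(\<lambda>z. pos (fst z) j) \<in> borel_measurable (?S \<Otimes>\<^sub>M ?T)" if "j \<le> l" for j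
    unfolding pos_def
  proof (rule borel_measurable_sum)
    fix i assume "i \<in> {..<j}"
    then have "i \<in> {..<l}" using that by auto
    then show "(\<lambda>z. fst z i) \<in> borel_measurable (?S \<Otimes>\<^sub>M ?T)"
      by (rule measurable_compose[OF measurable_fst measurable_component_singleton])
  qed
  have um [measurable]: "(\<lambda>z. snd z l) \<in> borel_measurable (?S \<Otimes>\<^sub>M ?T)"
    by (rule measurable_compose[OF measurable_snd measurable_component_singleton]) simp
  have Pm: "(\<lambda>z. \<Phi> i (g z) (k z)) \<in> borel_measurable (?S \<Otimes>\<^sub>M ?T)"
    if "i \<le> l" "g \<in> borel_measurable (?S \<Otimes>\<^sub>M ?T)" "k \<in> borel_measurable (?S \<Otimes>\<^sub>M ?T)" for i g k
    using measurable_compose[OF measurable_Pair[OF that(2,3)] Phi[OF that(1)]] by simp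
  have Hm: "H \<in> borel_measurable (?S \<Otimes>\<^sub>M ?T)"
    unfolding H_def[abs_def]
  proof (intro borel_measurable_times_ennreal borel_measurable_prod_ennreal)
    show "(\<lambda>z. \<Phi> i (pos (fst z) i) (pos (fst z) (Suc i))) \<in> borel_measurable (?S \<Otimes>\<^sub>M ?T)" if "i \<in> {..<l}" for i
      using that by (intro Pm posm) auto
    note [measurable] = posm[OF order_refl]
    show "(\<lambda>z. \<Phi> l (pos (fst z) l) (pos (fst z) l + snd z l)) \<in> borel_measurable (?S \<Otimes>\<^sub>M ?T)"
      by (intro Pm) measurable
    show "(\<lambda>z. f (pos (fst z) l + snd z l)) \<in> borel_measurable (?S \<Otimes>\<^sub>M ?T)" by measurable
  qed
  have Hval: "H (X w, Y w') = (\<Prod>i<l. \<Phi> i (B w (ts i)) (B w (ts (Suc i)))) *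
     (\<Phi> l (B w (ts l)) (B w (ts l) + \<xi> l w') * f (B w (ts l) + \<xi> l w'))" if "w \<in> space W" for w w'
  proof -
    have "(\<Prod>i<l. \<Phi> i (pos (X w) i) (pos (X w) (Suc i))) = (\<Prod>i<l. \<Phi> i (B w (ts i)) (B w (ts (Suc i))))"
      using that by (intro prod.cong) (auto simp: pB)
    then show ?thesis using that by (simp add: H_def pB Y_def)
  qed
  have "(\<integral>\<^sup>+w. (\<Prod>i<Suc l. \<Phi> i (B w (ts i)) (B w (ts (Suc i)))) * f (B w (ts (Suc l))) \<partial>W) = (\<integral>\<^sup>+w. H (X w, Y w) \<partial>W)"
    by (intro nn_integral_cong) (simp add: Hval \<xi>_def mult.assoc)
  also have "\<dots> = (\<integral>\<^sup>+w. (\<integral>\<^sup>+w'. H (X w, Y w') \<partial>W) \<partial>W)" by (rule nn_integral_indep[OF ind Hm])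
  also have "\<dots> = (\<integral>\<^sup>+w. (\<Prod>i<l. \<Phi> i (B w (ts i)) (B w (ts (Suc i)))) * kstep (ts (Suc l) - ts l) (\<Phi> l) f (B w (ts l)) \<partial>W)"
  proof (rule nn_integral_cong)
    fix w assume w: "w \<in> space W"
    let ?y = "B w (ts l)"
    have Fm: "(\<lambda>x. \<Phi> l ?y x * f x) \<in> borel_measurable borel"
      using measurable_compose[OF measurable_Pair1' Phi[OF order_refl], of ?y] by simp
    have dist: "distributed W lborel (\<xi> l) (\<lambda>x. ennreal (heat (ts (Suc l) - ts l) x))"
      unfolding \<xi>_def[abs_def] by (rule B_distr) (use tsp ts in auto)
    have xm: "\<xi> l \<in> borel_measurable W" using distributed_measurable[OF dist] by simp
    have F2: "(\<lambda>x. \<Phi> l ?y (?y + x) * f (?y + x)) \<in> borel_measurable borel"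
      by (rule measurable_compose[OF _ Fm]) simp
    have "(\<integral>\<^sup>+w'. H (X w, Y w') \<partial>W) = (\<Prod>i<l. \<Phi> i (B w (ts i)) (B w (ts (Suc i)))) * (\<integral>\<^sup>+w'. \<Phi> l ?y (?y + \<xi> l w') * f (?y + \<xi> l w') \<partial>W)"
      unfolding Hval[OF w] by (rule nn_integral_cmult) (rule measurable_compose[OF xm F2])
    also have "(\<integral>\<^sup>+w'. \<Phi> l ?y (?y + \<xi> l w') * f (?y + \<xi> l w') \<partial>W) = (\<integral>\<^sup>+x. ennreal (heat (ts (Suc l) - ts l) x) * (\<Phi> l ?y (?y + x) * f (?y + x)) \<partial>lborel)"
      using distributed_nn_integral[OF dist, of "\<lambda>x. \<Phi> l ?y (?y + x) * f (?y + x)"] F2 by simp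
    also have "\<dots> = kstep (ts (Suc l) - ts l) (\<Phi> l) f ?y"
      unfolding kstep_def by (rule heat_shift[OF Fm])
    finally show "(\<integral>\<^sup>+w'. H (X w, Y w') \<partial>W) = (\<Prod>i<l. \<Phi> i (B w (ts i)) (B w (ts (Suc i)))) * kstep (ts (Suc l) - ts l) (\<Phi> l) f ?y" .
  qed
  finally show ?thesis .
qed

lemma chain_all:
  fixes \<Phi> :: "nat \<Rightarrow> real^'d \<Rightarrow> real^'d \<Rightarrow> ennreal"
  assumes ts0: "ts 0 = 0" and ts: "\<And>i. i < l \<Longrightarrow> ts i < ts (Suc i)"
    and Phi: "\<And>i. i < l \<Longrightarrow> (\<lambda>x. \<Phi> i (fst x) (snd x)) \<in> borel_measurable (borel \<Otimes>\<^sub>M borel)"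
    and f: "f \<in> borel_measurable borel"
  shows "(\<integral>\<^sup>+w. (\<Prod>i<l. \<Phi> i (B w (ts i)) (B w (ts (Suc i)))) * f (B w (ts l)) \<partial>W) = kiter ts \<Phi> l f 0"
  using ts Phi f
proof (induction l arbitrary: f)
  case 0
  have "(\<integral>\<^sup>+w. f (B w 0) \<partial>W) = (\<integral>\<^sup>+w. f 0 \<partial>W)" by (intro nn_integral_cong) (simp add: B_0)
  then show ?case by (simp add: ts0 emeasure_space_1)
next
  case (Suc l)
  have "(\<integral>\<^sup>+w. (\<Prod>i<Suc l. \<Phi> i (B w (ts i)) (B w (ts (Suc i)))) * f (B w (ts (Suc l))) \<partial>W)
    = (\<integral>\<^sup>+w. (\<Prod>i<l. \<Phi> i (B w (ts i)) (B w (ts (Suc i)))) * kstep (ts (Suc l) - ts l) (\<Phi> l) f (B w (ts l)) \<partial>W)"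
    by (rule chain_step[where ts=ts and \<Phi>=\<Phi> and f=f and l=l]) (use ts0 Suc.prems in auto)
  also have "\<dots> = kiter ts \<Phi> l (kstep (ts (Suc l) - ts l) (\<Phi> l) f) 0"
    by (rule Suc.IH) (use Suc.prems in \<open>auto intro!: kstep_measurable\<close>)
  finally show ?case by simp
qed

lemma gauss_exp_shift:
  fixes z :: "real^'d"
  assumes "0 < v"
  shows "(\<integral>\<^sup>+y. ennreal (heat v (y - z)) * ennreal (exp ((norm (y - z))\<^sup>2 / (8 * v))) \<partial>lborel) \<le> ennreal (2 ^ CARD('d))"
proof -
  have "(\<integral>\<^sup>+y. ennreal (heat v (y - z)) * ennreal (exp ((norm (y - z))\<^sup>2 / (8 * v))) \<partial>lborel)
     = (\<integral>\<^sup>+x. ennreal (heat v x) * ennreal (exp ((norm (z + x - z))\<^sup>2 / (8 * v))) \<partial>(lborel :: (real^'d) measure))"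
    by (rule heat_shift[symmetric]) measurable
  also have "\<dots> = (\<integral>\<^sup>+w. ennreal (exp ((norm (B w v))\<^sup>2 / (8 * v))) \<partial>W)"
    by (subst B_nn[OF assms]) auto
  also have "\<dots> \<le> ennreal (2 ^ CARD('d))" by (rule gauss_exp) (use assms in auto)
  finally show ?thesis .
qed

end

section \<open>The law tilted along a skeleton of balls\<close>

lemma heat_pos: "0 < \<sigma> \<Longrightarrow> 0 < heat \<sigma> x" by (simp add: heat_def)

lemma heat_le: "0 < a \<Longrightarrow> a \<le> \<sigma> \<Longrightarrow> heat \<sigma> (x::real^'d::finite) \<le> (2 * pi * a) powr (- real CARD('d) / 2)"
proof -
  assume a: "0 < a" "a \<le> \<sigma>"
  have "heat \<sigma> x \<le> (2 * pi * \<sigma>) powr (- (real CARD('d) / 2))"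
    unfolding heat_def using a by (simp add: mult_left_le)
  also have "(2 * pi * \<sigma>) powr (- (real CARD('d) / 2)) \<le> (2 * pi * a) powr (- (real CARD('d) / 2))"
    using a by (intro powr_mono2') auto
  finally show ?thesis by simp
qed

lemma prod_lessThan_add: "(\<Prod>i<a + b. f i) = (\<Prod>i<a. f i) * (\<Prod>i<b. f (a + i) :: ennreal)" for a b :: nat
  by (induction b) (auto simp: mult.assoc)

text \<open>Under the density \<open>rho m\<close> the skeleton \<open>B 0, B h, \<dots>, B (m h)\<close> consists of independent points, uniform in the
  balls \<open>D j\<close>, while the law of the bridges in between is unchanged.\<close>

locale tilt = bm W B for W :: "'v measure" and B :: "'v \<Rightarrow> real \<Rightarrow> real^'d::finite" +
  fixes h :: real and x :: "nat \<Rightarrow> real^'d"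
  assumes h: "0 < h" "h \<le> 1" and x0: "x 0 = 0" and xstep: "\<And>j. dist (x (Suc j)) (x j) \<le> sqrt h"
begin

definition "vol = vd TYPE('d) * sqrt h ^ CARD('d)"
definition "D j = cball (x j) (sqrt h)"
definition "chi j y = ennreal (indicator (D j) y / vol)"
text \<open>Points of two successive balls are at distance at most \<open>3 * sqrt h\<close>, whence
  the factor \<open>exp (9 / 2)\<close>; \<open>C1 * h powr (d / 2)\<close> bounds
  \<open>1 / heat h\<close> on such pairs.\<close>

definition "C1 = (2 * pi) powr (real CARD('d) / 2) * exp (9 / 2)"
text \<open>The constant \<open>C1\<close> multiplied by that of the bound
  \<open>(pi * h) powr (- d / 2)\<close> for the heat kernel at times at least
  \<open>h / 2\<close>.\<close>

definition "C2 = C1 * pi powr (- real CARD('d) / 2)"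
text \<open>The reciprocal heat kernel cancels the Brownian transition density, and
  \<open>chi (Suc j)\<close> puts the uniform law in its place.\<close>

definition "Phi j y y' = indicator (D j) y * (chi (Suc j) y' * ennreal (1 / heat h (y' - y)))"
text \<open>A majorant, uniform over times up to \<open>h\<close>, of the heat kernel mass of a
  skeleton ball seen from a point at displacement \<open>z\<close> from its centre.\<close>

definition "wt z = ennreal (2 ^ (CARD('d) + 1) * exp (- (norm z)\<^sup>2 / (16 * h)))" for z :: "real^'d"
definition "rho m w = (\<Prod>j<m. Phi j (B w (real j * h)) (B w (real (Suc j) * h))) * indicator (D m) (B w (real m * h))"

lemma D_sets [measurable]: "D j \<in> sets borel" by (simp add: D_def)

lemma chi_measurable [measurable]: "chi j \<in> borel_measurable borel"
  unfolding chi_def[abs_def] by measurable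

lemma Phi_measurable [measurable]: "(\<lambda>z. Phi j (fst z) (snd z)) \<in> borel_measurable (borel \<Otimes>\<^sub>M borel)"
  unfolding Phi_def by measurable

lemma wt_measurable [measurable]: "wt \<in> borel_measurable borel"
  unfolding wt_def[abs_def] by measurable

lemma vol_pos: "0 < vol"
proof -
  have "0 < vd TYPE('d)" by simp
  then show ?thesis unfolding vol_def using h by (intro mult_pos_pos) auto
qed

lemma vol_eq: "vol = vd TYPE('d) * h powr (real CARD('d) / 2)"
  using h by (simp add: vol_def powr_half_sqrt[symmetric] powr_powr powr_realpow[symmetric])

lemma chi_integral: "(\<integral>\<^sup>+y. chi j y \<partial>lborel) = 1"
proof -
  have "(\<integral>\<^sup>+y. chi j y \<partial>lborel) = (\<integral>\<^sup>+y. ennreal (1 / vol) * indicator (D j) y \<partial>lborel)"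
    by (intro nn_integral_cong) (auto simp: chi_def indicator_def)
  also have "\<dots> = ennreal (1 / vol) * emeasure lborel (D j)" by (rule nn_integral_cmult_indicator) simp
  also have "emeasure lborel (D j) = ennreal vol"
    using h lborel_cball_fin[of "x j" "sqrt h"] by (simp add: D_def emeasure_eq_ennreal_measure content_cball_vec vol_def)
  finally show ?thesis using vol_pos by (simp add: ennreal_mult[symmetric])
qed

lemma chi_indicator: "chi j y * indicator (D j) y = chi j y"
  by (auto simp: chi_def indicator_def)

lemma inverse_gd_le:
  assumes "y \<in> D j" "y' \<in> D (Suc j)" shows "1 / heat h (y' - y) \<le> C1 * h powr (real CARD('d) / 2)"
proof -
  have "dist y' y \<le> dist y' (x (Suc j)) + dist (x (Suc j)) (x j) + dist (x j) y"
    using dist_triangle[of y' y "x (Suc j)"] dist_triangle[of "x (Suc j)" y "x j"] by linarith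
  also have "\<dots> \<le> 3 * sqrt h" using assms xstep[of j] by (simp add: D_def dist_commute)
  finally have "(norm (y' - y))\<^sup>2 \<le> (3 * sqrt h)\<^sup>2" by (intro power_mono) (auto simp: dist_norm)
  then have n: "(norm (y' - y))\<^sup>2 \<le> 9 * h" using h by (simp add: power_mult_distrib)
  have "1 / heat h (y' - y) = (2 * pi * h) powr (real CARD('d) / 2) * exp ((norm (y' - y))\<^sup>2 / (2 * h))"
    using h by (simp add: heat_def powr_minus exp_minus field_simps)
  also have "\<dots> \<le> (2 * pi * h) powr (real CARD('d) / 2) * exp (9 / 2)"
    using n h by (intro mult_left_mono) (auto simp: field_simps)
  also have "\<dots> = C1 * h powr (real CARD('d) / 2)" by (simp add: C1_def powr_mult)
  finally show ?thesis .
qed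

lemma C1_pos: "0 < C1" and C2_pos: "0 < C2" by (auto simp: C1_def C2_def)

lemma Phi_bound: "Phi j y y' \<le> indicator (D j) y * (ennreal (C1 * h powr (real CARD('d) / 2)) * chi (Suc j) y')"
proof (cases "y \<in> D j \<and> y' \<in> D (Suc j)")
  case True
  then show ?thesis using inverse_gd_le[of y j y'] by (simp add: Phi_def mult.commute mult_left_mono ennreal_leI)
next
  case False
  then show ?thesis by (auto simp: Phi_def chi_def indicator_def)
qed

lemma Phi_le: "Phi j y y' \<le> ennreal (C1 / vd TYPE('d))"
proof -
  have "Phi j y y' \<le> 1 * (ennreal (C1 * h powr (real CARD('d) / 2)) * ennreal (1 / vol))"
    by (rule order_trans[OF Phi_bound mult_mono[OF _ mult_left_mono]])
      (use vol_pos in \<open>auto simp: chi_def indicator_def\<close>)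
  also have "\<dots> = ennreal (C1 / vd TYPE('d))"
    using C1_pos vol_pos h by (simp add: ennreal_mult[symmetric] vol_eq)
  finally show ?thesis .
qed

text \<open>The factor \<open>h powr (d / 2)\<close> in the bound on \<open>1 / heat h\<close>
  cancels against the volume of a ball of radius \<open>sqrt h\<close>. This scaling is the reason
  for that radius: each step costs a factor independent of \<open>h\<close>.\<close>

lemma rho_le: "rho m w \<le> ennreal ((C1 / vd TYPE('d)) ^ m)"
proof -
  have v: "0 \<le> C1 / vd TYPE('d)" using C1_pos by simp
  have "rho m w \<le> (\<Prod>j<m. ennreal (C1 / vd TYPE('d))) * 1"
    unfolding rho_def using Phi_le by (intro mult_mono prod_mono_ennreal) (auto simp: indicator_def)
  then show ?thesis using v by (simp add: ennreal_power)
qed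

lemma kstep_Phi:
  assumes [measurable]: "F \<in> borel_measurable borel"
  shows "kstep h (Phi j) (\<lambda>y. indicator (D (Suc j)) y * F y) = (\<lambda>y. indicator (D j) y * (\<integral>\<^sup>+y'. chi (Suc j) y' * F y' \<partial>lborel))"
proof
  fix y
  have "kstep h (Phi j) (\<lambda>y. indicator (D (Suc j)) y * F y) y = (\<integral>\<^sup>+y'. indicator (D j) y * (chi (Suc j) y' * F y') \<partial>lborel)"
    unfolding kstep_def
  proof (rule nn_integral_cong)
    fix y'
    have g: "ennreal (heat h (y' - y)) * ennreal (1 / heat h (y' - y)) = 1"
      using heat_pos[OF h(1), of "y' - y"] by (simp add: ennreal_mult[symmetric])
    have "ennreal (heat h (y' - y)) * (Phi j y y' * (indicator (D (Suc j)) y' * F y'))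
      = (ennreal (heat h (y' - y)) * ennreal (1 / heat h (y' - y))) * (indicator (D j) y * ((chi (Suc j) y' * indicator (D (Suc j)) y') * F y'))"
      unfolding Phi_def by (simp only: mult.commute mult.left_commute mult.assoc)
    then show "ennreal (heat h (y' - y)) * (Phi j y y' * (indicator (D (Suc j)) y' * F y')) = indicator (D j) y * (chi (Suc j) y' * F y')"
      unfolding g chi_indicator by simp
  qed
  also have "\<dots> = indicator (D j) y * (\<integral>\<^sup>+y'. chi (Suc j) y' * F y' \<partial>lborel)"
    by (rule nn_integral_cmult) measurable
  finally show "kstep h (Phi j) (\<lambda>y. indicator (D (Suc j)) y * F y) y = indicator (D j) y * (\<integral>\<^sup>+y'. chi (Suc j) y' * F y' \<partial>lborel)" .
qed

lemma kstep_Phi_const: "kstep h (Phi j) (\<lambda>y. indicator (D (Suc j)) y * c) = (\<lambda>y. indicator (D j) y * c)"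
  using kstep_Phi[of "\<lambda>_. c" j] by (simp add: nn_integral_multc chi_integral)

lemma kiter_cong:
  "(\<And>i. i \<le> l \<Longrightarrow> ts i = ts' i) \<Longrightarrow> (\<And>i. i < l \<Longrightarrow> \<Phi> i = \<Phi>' i) \<Longrightarrow> kiter ts \<Phi> l f = kiter ts' \<Phi>' l f"
  by (induction l arbitrary: f) auto

text \<open>Every step integrates a uniform law to 1. For \<open>c = 1\<close> this shows that
  \<open>rho\<close> is a probability density.\<close>

lemma kiter_const: "kiter (\<lambda>i. real i * h) Phi l (\<lambda>y. indicator (D l) y * c) 0 = c"
proof (induction l)
  case 0 then show ?case using x0 h by (simp add: D_def)
next
  case (Suc l)
  have "real (Suc l) * h - real l * h = h" by (simp add: algebra_simps)
  then show ?case using Suc by (simp only: kiter.simps kstep_Phi_const)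
qed

lemma rho_integral: "(\<integral>\<^sup>+w. rho m w \<partial>W) = 1"
proof -
  have "(\<integral>\<^sup>+w. rho m w \<partial>W) = kiter (\<lambda>i. real i * h) Phi m (\<lambda>y. indicator (D m) y) 0"
    unfolding rho_def by (rule chain_all) (use h in auto)
  then show ?thesis using kiter_const[of m 1] by simp
qed

lemma rho_measurable: "rho m \<in> borel_measurable W"
proof -
  have b: "(\<lambda>w. B w (real j * h)) \<in> borel_measurable W" for j using h by (intro B_meas) auto
  have "(\<lambda>w. Phi j (B w (real j * h)) (B w (real (Suc j) * h))) \<in> borel_measurable W" for j
    using measurable_compose[OF measurable_Pair[OF b b] Phi_measurable] by (simp del: of_nat_Suc)
  moreover have "(\<lambda>w. indicator (D m) (B w (real m * h)) :: ennreal) \<in> borel_measurable W"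
    by (rule measurable_compose[OF b]) measurable
  ultimately show ?thesis unfolding rho_def[abs_def] by measurable
qed

text \<open>For \<open>y\<close> in \<open>D j\<close> the triangle inequality gives \<open>(norm (z
  - x j))\<^sup>2 \<le> 2 * (norm (y - z))\<^sup>2 + 2 * h\<close>. A quarter of the Gaussian
  exponent is spent on the decay in \<open>z\<close>, and \<open>gauss_exp_shift\<close> bounds what
  is left.\<close>

lemma wbound:
  assumes v: "0 < v" "v \<le> h"
  shows "(\<integral>\<^sup>+y. ennreal (heat v (y - z)) * indicator (D j) y \<partial>lborel) \<le> wt (z - x j)"
proof -
  have "(\<integral>\<^sup>+y. ennreal (heat v (y - z)) * indicator (D j) y \<partial>lborel)
    \<le> (\<integral>\<^sup>+y. (ennreal (heat v (y - z)) * ennreal (exp ((norm (y - z))\<^sup>2 / (8 * v)))) * ennreal (2 * exp (- (norm (z - x j))\<^sup>2 / (16 * h))) \<partial>lborel)"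
  proof (rule nn_integral_mono)
    fix y
    show "ennreal (heat v (y - z)) * indicator (D j) y \<le> (ennreal (heat v (y - z)) * ennreal (exp ((norm (y - z))\<^sup>2 / (8 * v)))) * ennreal (2 * exp (- (norm (z - x j))\<^sup>2 / (16 * h)))"
    proof (cases "y \<in> D j")
      case True
      then have "norm (y - x j) \<le> sqrt h" by (simp add: D_def dist_norm norm_minus_commute)
      then have a: "(norm (y - x j))\<^sup>2 \<le> h" using h power_mono[of "norm (y - x j)" "sqrt h" 2] by simp
      have "norm (z - x j) \<le> norm (y - z) + norm (y - x j)"
        using norm_triangle_ineq4[of "y - x j" "y - z"] by (simp add: algebra_simps)
      then have "(norm (z - x j))\<^sup>2 \<le> (norm (y - z) + norm (y - x j))\<^sup>2" by (intro power_mono) auto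
      also have "\<dots> \<le> 2 * (norm (y - z))\<^sup>2 + 2 * (norm (y - x j))\<^sup>2"
        using zero_le_power2[of "norm (y - z) - norm (y - x j)"] by (simp add: power2_eq_square algebra_simps)
      finally have b: "(norm (z - x j))\<^sup>2 / 2 - h \<le> (norm (y - z))\<^sup>2" using a by simp
      have "(norm (z - x j))\<^sup>2 / (16 * h) - 1 / 8 = ((norm (z - x j))\<^sup>2 / 2 - h) / (8 * h)" using h by (simp add: field_simps)
      also have "\<dots> \<le> (norm (y - z))\<^sup>2 / (8 * h)" using b h by (intro divide_right_mono) auto
      also have "\<dots> \<le> (norm (y - z))\<^sup>2 / (8 * v)" using v h by (intro divide_left_mono) auto
      finally have c: "0 \<le> (norm (y - z))\<^sup>2 / (8 * v) + (1/8 + - (norm (z - x j))\<^sup>2 / (16 * h))" by simp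
      have "1 \<le> exp ((norm (y - z))\<^sup>2 / (8 * v) + (1/8 + - (norm (z - x j))\<^sup>2 / (16 * h)))" using c by simp
      also have "\<dots> = exp ((norm (y - z))\<^sup>2 / (8 * v)) * (exp (1/8) * exp (- (norm (z - x j))\<^sup>2 / (16 * h)))" by (simp only: exp_add)
      also have "\<dots> \<le> exp ((norm (y - z))\<^sup>2 / (8 * v)) * (2 * exp (- (norm (z - x j))\<^sup>2 / (16 * h)))"
      proof (intro mult_left_mono mult_right_mono)
        have "exp (1/8::real) \<le> 1 + 1/8 + (1/8)\<^sup>2" by (rule exp_bound) auto
        also have "\<dots> \<le> 2" by (simp add: power2_eq_square)
        finally show "exp (1/8::real) \<le> 2" .
      qed auto
      finally have "heat v (y - z) * 1 \<le> heat v (y - z) * (exp ((norm (y - z))\<^sup>2 / (8 * v)) * (2 * exp (- (norm (z - x j))\<^sup>2 / (16 * h))))"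
        by (intro mult_left_mono) auto
      then have "ennreal (heat v (y - z)) \<le> ennreal (heat v (y - z) * (exp ((norm (y - z))\<^sup>2 / (8 * v)) * (2 * exp (- (norm (z - x j))\<^sup>2 / (16 * h)))))"
        by (intro ennreal_leI) simp
      then show ?thesis using True by (simp add: ennreal_mult mult.assoc)
    qed simp
  qed
  also have "\<dots> = (\<integral>\<^sup>+y. ennreal (heat v (y - z)) * ennreal (exp ((norm (y - z))\<^sup>2 / (8 * v))) \<partial>lborel) * ennreal (2 * exp (- (norm (z - x j))\<^sup>2 / (16 * h)))"
    by (rule nn_integral_multc) measurable
  also have "\<dots> \<le> ennreal (2 ^ CARD('d)) * ennreal (2 * exp (- (norm (z - x j))\<^sup>2 / (16 * h)))"
    by (rule mult_right_mono[OF gauss_exp_shift[OF v(1)]]) simp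
  also have "\<dots> = wt (z - x j)" unfolding wt_def by (subst ennreal_mult[symmetric]) (auto simp: mult.assoc)
  finally show ?thesis .
qed

lemma kiter_mono: "(\<And>y. f y \<le> f' y) \<Longrightarrow> kiter ts \<Phi> l f y \<le> kiter ts \<Phi> l f' y"
proof (induction l arbitrary: f f')
  case (Suc l)
  have "kstep \<sigma> (\<Phi> l) f y \<le> kstep \<sigma> (\<Phi> l) f' y" for \<sigma> y
    unfolding kstep_def using Suc.prems by (intro nn_integral_mono mult_left_mono) auto
  then show ?case using Suc.IH by simp
qed simp

text \<open>The factor \<open>1 / heat h (y' - y)\<close> in \<open>Phi k\<close> couples both ends
  of the interval into which a time is inserted, so the product is no longer a chain. Replacing it
  by its upper bound decouples the ends. The steps after \<open>Suc k\<close> integrate to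
  1.\<close>

lemma rho_inserted_time:
  assumes k: "k < m" and u: "0 < u" "u < h" and g [measurable]: "g \<in> borel_measurable borel"
  defines "r \<equiv> kstep (h - u) (\<lambda>_ y'. ennreal (C1 * h powr (real CARD('d) / 2)) * chi (Suc k) y') (indicator (D (Suc k)))"
  shows "(\<integral>\<^sup>+w. rho m w * g (B w (real k * h + u)) \<partial>W)
    \<le> kiter (\<lambda>i. real i * h) Phi k (\<lambda>y. indicator (D k) y * (\<integral>\<^sup>+z. ennreal (heat u (z - y)) * (g z * r z) \<partial>lborel)) 0"
proof -
  obtain q where m: "m = Suc k + q" using k less_iff_Suc_add by auto
  let ?c = "ennreal (C1 * h powr (real CARD('d) / 2))"
  \<comment> \<open>Index \<open>Suc k\<close> is the inserted time; all later indices are shifted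
    by one against the multiples of \<open>h\<close>.\<close>
  define ts where "ts i = (if i \<le> k then real i * h else if i = Suc k then real k * h + u else real (i - 1) * h)" for i
  define \<Phi> where "\<Phi> i = (if i < k then Phi i else if i = k then (\<lambda>y z. indicator (D k) y * g z)
    else if i = Suc k then (\<lambda>z y'. ?c * chi (Suc k) y') else Phi (i - 1))" for i
  have \<Phi>m: "(\<lambda>x. \<Phi> i (fst x) (snd x)) \<in> borel_measurable (borel \<Otimes>\<^sub>M borel)" for i
    unfolding \<Phi>_def by auto
  have tsm: "ts i < ts (Suc i)" for i
    unfolding ts_def using h u by (auto simp: algebra_simps of_nat_diff not_le less_Suc_eq)
  have rm [measurable]: "r \<in> borel_measurable borel"
    unfolding r_def by (rule kstep_measurable) measurable
  have le: "rho m w * g (B w (real k * h + u)) \<le> (\<Prod>i<Suc (Suc k) + q. \<Phi> i (B w (ts i)) (B w (ts (Suc i)))) * indicator (D m) (B w (ts (Suc (Suc k) + q)))" for w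
  proof -
    let ?a = "\<Prod>i<k. Phi i (B w (real i * h)) (B w (real (Suc i) * h))"
    let ?b = "\<Prod>i<q. Phi (Suc k + i) (B w (real (Suc k + i) * h)) (B w (real (Suc (Suc k + i)) * h))"
    let ?y = "B w (real k * h)" and ?y' = "B w (real (Suc k) * h)" and ?z = "B w (real k * h + u)"
    let ?i = "indicator (D m) (B w (real m * h)) :: ennreal"
    have e: "rho m w = ?a * Phi k ?y ?y' * ?b * ?i"
      unfolding rho_def m prod_lessThan_add prod.lessThan_Suc ..
    have e1: "(\<Prod>i<k. \<Phi> i (B w (ts i)) (B w (ts (Suc i)))) = ?a"
      by (intro prod.cong) (auto simp: \<Phi>_def ts_def)
    have e2: "(\<Prod>i<q. \<Phi> (Suc (Suc k) + i) (B w (ts (Suc (Suc k) + i))) (B w (ts (Suc (Suc (Suc k) + i))))) = ?b"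
      by (intro prod.cong) (auto simp: \<Phi>_def ts_def)
    have e3: "\<Phi> k (B w (ts k)) (B w (ts (Suc k))) = indicator (D k) ?y * g ?z"
      by (simp add: \<Phi>_def ts_def)
    have e4: "\<Phi> (Suc k) (B w (ts (Suc k))) (B w (ts (Suc (Suc k)))) = ?c * chi (Suc k) ?y'"
      by (simp add: \<Phi>_def ts_def)
    have e5: "ts (Suc (Suc k) + q) = real m * h" by (simp add: ts_def m)
    have ac: "(a * (j * c) * b * i) * z = (a * (j * z) * c) * b * i" for a j c b i z :: ennreal
      by (simp add: ac_simps)
    have "rho m w * g ?z \<le> (?a * (indicator (D k) ?y * (?c * chi (Suc k) ?y')) * ?b * ?i) * g ?z"
      unfolding e by (intro mult_right_mono mult_left_mono Phi_bound) auto
    also have "\<dots> = (?a * (indicator (D k) ?y * g ?z) * (?c * chi (Suc k) ?y')) * ?b * ?i" by (rule ac)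
    also have "\<dots> = (\<Prod>i<Suc (Suc k) + q. \<Phi> i (B w (ts i)) (B w (ts (Suc i)))) * indicator (D m) (B w (ts (Suc (Suc k) + q)))"
      unfolding prod_lessThan_add prod.lessThan_Suc e1 e2 e3 e4 e5 ..
    finally show ?thesis .
  qed
  have "(\<integral>\<^sup>+w. rho m w * g (B w (real k * h + u)) \<partial>W) \<le> (\<integral>\<^sup>+w. (\<Prod>i<Suc (Suc k) + q. \<Phi> i (B w (ts i)) (B w (ts (Suc i)))) * indicator (D m) (B w (ts (Suc (Suc k) + q))) \<partial>W)"
    by (intro nn_integral_mono le)
  also have "\<dots> = kiter ts \<Phi> (Suc (Suc k) + q) (indicator (D m)) 0"
    by (rule chain_all) (use tsm \<Phi>m in \<open>auto simp: ts_def\<close>)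
  also have "\<dots> = kiter ts \<Phi> (Suc (Suc k)) (indicator (D (Suc k))) 0"
    unfolding m
  proof (induction q)
    case (Suc q)
    have "ts (Suc (Suc (Suc k) + q)) - ts (Suc (Suc k) + q) = h" by (simp add: ts_def algebra_simps)
    moreover have "\<Phi> (Suc (Suc k) + q) = Phi (Suc k + q)" by (simp add: \<Phi>_def)
    moreover have "kstep h (Phi (Suc k + q)) (indicator (D (Suc (Suc k + q)))) = indicator (D (Suc k + q))"
      using kstep_Phi_const[of "Suc k + q" 1] by simp
    ultimately show ?case using Suc by (simp only: add_Suc_right kiter.simps)
  qed simp
  also have "\<dots> = kiter ts \<Phi> k (kstep u (\<lambda>y z. indicator (D k) y * g z) r) 0"
  proof -
    have "ts (Suc (Suc k)) - ts (Suc k) = h - u" "ts (Suc k) - ts k = u" by (simp_all add: ts_def algebra_simps)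
    moreover have "\<Phi> (Suc k) = (\<lambda>_ y'. ?c * chi (Suc k) y')" "\<Phi> k = (\<lambda>y z. indicator (D k) y * g z)" by (simp_all add: \<Phi>_def)
    ultimately show ?thesis by (simp only: kiter.simps r_def)
  qed
  also have "\<dots> = kiter (\<lambda>i. real i * h) Phi k (kstep u (\<lambda>y z. indicator (D k) y * g z) r) 0"
    by (rule fun_cong[OF kiter_cong]) (auto simp: ts_def \<Phi>_def)
  also have "kstep u (\<lambda>y z. indicator (D k) y * g z) r = (\<lambda>y. indicator (D k) y * (\<integral>\<^sup>+z. ennreal (heat u (z - y)) * (g z * r z) \<partial>lborel))"
  proof
    fix y
    have ac: "a * (j * c * b) = j * (a * (c * b))" for a j c b :: ennreal
      by (simp add: ac_simps)
    have "kstep u (\<lambda>y z. indicator (D k) y * g z) r y = (\<integral>\<^sup>+z. indicator (D k) y * (ennreal (heat u (z - y)) * (g z * r z)) \<partial>lborel)"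
      unfolding kstep_def by (intro nn_integral_cong) (rule ac)
    also have "\<dots> = indicator (D k) y * (\<integral>\<^sup>+z. ennreal (heat u (z - y)) * (g z * r z) \<partial>lborel)"
      by (rule nn_integral_cmult) measurable
    finally show "kstep u (\<lambda>y z. indicator (D k) y * g z) r y = indicator (D k) y * (\<integral>\<^sup>+z. ennreal (heat u (z - y)) * (g z * r z) \<partial>lborel)" .
  qed
  finally show ?thesis .
qed

lemma C2_vol: "C1 * h powr (real CARD('d) / 2) * (pi * h) powr (- (real CARD('d) / 2)) = C2"
  "C1 / vd TYPE('d) * (pi * h) powr (- (real CARD('d) / 2)) = C2 / vol"
proof -
  have p: "(pi * h) powr (- (real CARD('d) / 2)) = pi powr (- (real CARD('d) / 2)) * h powr (- (real CARD('d) / 2))"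
    by (rule powr_mult)
  have q: "h powr (real CARD('d) / 2) * h powr (- (real CARD('d) / 2)) = 1" using h by (simp add: powr_add[symmetric])
  have C2: "C2 = C1 * pi powr (- (real CARD('d) / 2))" by (simp add: C2_def)
  show "C1 * h powr (real CARD('d) / 2) * (pi * h) powr (- (real CARD('d) / 2)) = C2"
  proof -
    have ac: "c * a * (e * b) = c * e" if "a * b = 1" for a b c e :: real using that by (simp add: ac_simps)
    show ?thesis unfolding p C2 by (rule ac[OF q])
  qed
  have v: "h powr (- (real CARD('d) / 2)) = inverse (h powr (real CARD('d) / 2))" by (rule powr_minus)
  show "C1 / vd TYPE('d) * (pi * h) powr (- (real CARD('d) / 2)) = C2 / vol"
  proof -
    have ac: "c / v * (e * inverse b) = c * e / (v * b)" for c v e b :: real by (simp add: divide_inverse)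
    show ?thesis unfolding p C2 vol_eq v by (rule ac)
  qed
qed

text \<open>One of \<open>u\<close> and \<open>h - u\<close> is at least \<open>h / 2\<close>, and
  over that piece the heat kernel is at most \<open>(pi * h) powr (- d / 2)\<close>. Over the other
  piece the starting or final point is uniform in a ball, which gives \<open>wt\<close>. Only for
  \<open>k = 0\<close> and small \<open>u\<close> is there no such averaging, because the start is
  the single point 0; this produces the extra term.\<close>

lemma rho_occupation:
  assumes k: "k < m" and u: "0 < u" "u < h" and g [measurable]: "g \<in> borel_measurable borel"
  shows "(\<integral>\<^sup>+w. rho m w * g (B w (real k * h + u)) \<partial>W)
    \<le> ennreal (C2 / vol) * ((\<integral>\<^sup>+z. g z * wt (z - x k) \<partial>lborel) + (\<integral>\<^sup>+z. g z * wt (z - x (Suc k)) \<partial>lborel))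
      + (if k = 0 then ennreal C2 * (\<integral>\<^sup>+z. ennreal (heat u z) * g z \<partial>lborel) else 0)"
proof -
  let ?c = "ennreal (C1 * h powr (real CARD('d) / 2))"
  define a where "a = (pi * h) powr (- (real CARD('d) / 2))"
  define r where "r = kstep (h - u) (\<lambda>_ y'. ?c * chi (Suc k) y') (indicator (D (Suc k)))"
  define G where "G y = (\<integral>\<^sup>+z. ennreal (heat u (z - y)) * (g z * r z) \<partial>lborel)" for y
  have a0: "0 \<le> a" by (simp add: a_def)
  have gda: "heat v z \<le> a" if "h / 2 \<le> v" for v and z :: "real^'d"
    using heat_le[of "h / 2" v z] that h by (simp add: a_def mult.commute)
  have rm [measurable]: "r \<in> borel_measurable borel"
    unfolding r_def by (rule kstep_measurable) measurable
  have main: "(\<integral>\<^sup>+w. rho m w * g (B w (real k * h + u)) \<partial>W) \<le> kiter (\<lambda>i. real i * h) Phi k (\<lambda>y. indicator (D k) y * G y) 0"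
    unfolding G_def r_def by (rule rho_inserted_time[OF k u g])
  have req: "r z = (\<integral>\<^sup>+y'. ennreal (heat (h - u) (y' - z)) * (?c * chi (Suc k) y') \<partial>lborel)" for z
    unfolding r_def kstep_def by (simp only: mult.assoc chi_indicator)
  show ?thesis
  proof (cases "u \<le> h / 2")
    case True
    have rle: "r z \<le> ennreal C2" for z
    proof -
      have "r z \<le> (\<integral>\<^sup>+y'. ennreal a * (?c * chi (Suc k) y') \<partial>lborel)"
        unfolding req using gda[of "h - u"] True by (intro nn_integral_mono mult_right_mono ennreal_leI) auto
      also have "\<dots> = ennreal a * ?c"
        by (simp add: nn_integral_cmult chi_integral)
      also have "\<dots> = ennreal C2"
        using C2_vol(1) C1_pos a0 by (simp add: ennreal_mult[symmetric] a_def mult.commute)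
      finally show ?thesis .
    qed
    have Gle: "G y \<le> ennreal C2 * (\<integral>\<^sup>+z. ennreal (heat u (z - y)) * g z \<partial>lborel)" for y
    proof -
      have "G y \<le> (\<integral>\<^sup>+z. ennreal C2 * (ennreal (heat u (z - y)) * g z) \<partial>lborel)"
        unfolding G_def
      proof (rule nn_integral_mono)
        fix z
        have "ennreal (heat u (z - y)) * (g z * r z) \<le> ennreal (heat u (z - y)) * (g z * ennreal C2)"
          by (intro mult_left_mono rle) auto
        then show "ennreal (heat u (z - y)) * (g z * r z) \<le> ennreal C2 * (ennreal (heat u (z - y)) * g z)"
          by (simp only: mult.assoc mult.commute mult.left_commute)
      qed
      also have "\<dots> = ennreal C2 * (\<integral>\<^sup>+z. ennreal (heat u (z - y)) * g z \<partial>lborel)" by (rule nn_integral_cmult) measurable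
      finally show ?thesis .
    qed
    show ?thesis
    proof (cases k)
      case 0
      have "(\<integral>\<^sup>+w. rho m w * g (B w (real k * h + u)) \<partial>W) \<le> ennreal C2 * (\<integral>\<^sup>+z. ennreal (heat u (z - 0)) * g z \<partial>lborel)"
        by (rule order_trans[OF main]) (use Gle[of 0] x0 h in \<open>simp add: 0 D_def\<close>)
      also have "\<dots> \<le> ennreal (C2 / vol) * ((\<integral>\<^sup>+z. g z * wt (z - x k) \<partial>lborel) + (\<integral>\<^sup>+z. g z * wt (z - x (Suc k)) \<partial>lborel))
          + (if k = 0 then ennreal C2 * (\<integral>\<^sup>+z. ennreal (heat u z) * g z \<partial>lborel) else 0)"
        unfolding 0 diff_zero if_P[OF refl] by (rule add_increasing) auto
      finally show ?thesis .
    next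
      case (Suc j)
      have Gm [measurable]: "G \<in> borel_measurable borel"
      proof -
        have "(\<lambda>x. ennreal (heat u (snd x - fst x)) * (g (snd x) * r (snd x))) \<in> borel_measurable (borel \<Otimes>\<^sub>M borel)" by measurable
        then show ?thesis unfolding G_def[abs_def]
          by (intro lborel.borel_measurable_nn_integral) (simp add: case_prod_beta' cong: measurable_cong_sets)
      qed
      have d: "real (Suc j) * h - real j * h = h" by (simp add: algebra_simps)
      have "(\<integral>\<^sup>+w. rho m w * g (B w (real k * h + u)) \<partial>W) \<le> (\<integral>\<^sup>+y. chi k y * G y \<partial>lborel)"
        using main unfolding Suc kiter.simps d kstep_Phi[OF Gm] kiter_const .
      also have "\<dots> \<le> (\<integral>\<^sup>+y. (\<integral>\<^sup>+z. ennreal (C2 / vol) * (g z * (ennreal (heat u (y - z)) * indicator (D k) y)) \<partial>lborel) \<partial>lborel)"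
      proof (rule nn_integral_mono)
        fix y
        have "chi k y * G y \<le> chi k y * (ennreal C2 * (\<integral>\<^sup>+z. ennreal (heat u (z - y)) * g z \<partial>lborel))"
          by (intro mult_left_mono Gle) auto
        also have "\<dots> = (chi k y * ennreal C2) * (\<integral>\<^sup>+z. ennreal (heat u (z - y)) * g z \<partial>lborel)" by (simp add: mult.assoc)
        also have "chi k y * ennreal C2 = ennreal (C2 / vol) * indicator (D k) y"
          using C2_pos vol_pos by (auto simp: chi_def indicator_def ennreal_mult[symmetric])
        also have "ennreal (C2 / vol) * indicator (D k) y * (\<integral>\<^sup>+z. ennreal (heat u (z - y)) * g z \<partial>lborel)
          = (\<integral>\<^sup>+z. ennreal (C2 / vol) * indicator (D k) y * (ennreal (heat u (z - y)) * g z) \<partial>lborel)"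
          by (rule nn_integral_cmult[symmetric]) measurable
        also have "\<dots> = (\<integral>\<^sup>+z. ennreal (C2 / vol) * (g z * (ennreal (heat u (y - z)) * indicator (D k) y)) \<partial>lborel)"
        proof (rule nn_integral_cong)
          fix z
          have "heat u (z - y) = heat u (y - z)" using heat_minus[of u "y - z"] by simp
          then show "ennreal (C2 / vol) * indicator (D k) y * (ennreal (heat u (z - y)) * g z) = ennreal (C2 / vol) * (g z * (ennreal (heat u (y - z)) * indicator (D k) y))"
            by (simp only: mult.assoc mult.commute mult.left_commute)
        qed
        finally show "chi k y * G y \<le> (\<integral>\<^sup>+z. ennreal (C2 / vol) * (g z * (ennreal (heat u (y - z)) * indicator (D k) y)) \<partial>lborel)" .
      qed
      also have "\<dots> = (\<integral>\<^sup>+z. (\<integral>\<^sup>+y. ennreal (C2 / vol) * (g z * (ennreal (heat u (y - z)) * indicator (D k) y)) \<partial>lborel) \<partial>lborel)"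
      proof -
        have "(\<lambda>x. ennreal (C2 / vol) * (g (fst x) * (ennreal (heat u (snd x - fst x)) * indicator (D k) (snd x)))) \<in> borel_measurable (borel \<Otimes>\<^sub>M borel)"
          by measurable
        then show ?thesis
          by (intro lborel_pair.Fubini') (simp add: case_prod_beta' cong: measurable_cong_sets)
      qed
      also have "\<dots> \<le> (\<integral>\<^sup>+z. ennreal (C2 / vol) * (g z * wt (z - x k)) \<partial>lborel)"
      proof (rule nn_integral_mono)
        fix z
        have "(\<integral>\<^sup>+y. ennreal (C2 / vol) * (g z * (ennreal (heat u (y - z)) * indicator (D k) y)) \<partial>lborel)
          = ennreal (C2 / vol) * (g z * (\<integral>\<^sup>+y. ennreal (heat u (y - z)) * indicator (D k) y \<partial>lborel))"
          by (simp add: nn_integral_cmult)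
        also have "\<dots> \<le> ennreal (C2 / vol) * (g z * wt (z - x k))"
          using u by (intro mult_left_mono wbound) auto
        finally show "(\<integral>\<^sup>+y. ennreal (C2 / vol) * (g z * (ennreal (heat u (y - z)) * indicator (D k) y)) \<partial>lborel) \<le> ennreal (C2 / vol) * (g z * wt (z - x k))" .
      qed
      also have "\<dots> = ennreal (C2 / vol) * (\<integral>\<^sup>+z. g z * wt (z - x k) \<partial>lborel)"
        by (rule nn_integral_cmult) measurable
      also have "\<dots> \<le> ennreal (C2 / vol) * ((\<integral>\<^sup>+z. g z * wt (z - x k) \<partial>lborel) + (\<integral>\<^sup>+z. g z * wt (z - x (Suc k)) \<partial>lborel))"
        by (intro mult_left_mono) auto
      finally show ?thesis using Suc by simp
    qed
  next
    case False
    have rle: "r z \<le> ennreal (C1 / vd TYPE('d)) * wt (z - x (Suc k))" for z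
    proof -
      have "r z = (\<integral>\<^sup>+y'. ennreal (C1 / vd TYPE('d)) * (ennreal (heat (h - u) (y' - z)) * indicator (D (Suc k)) y') \<partial>lborel)"
        unfolding req
      proof (rule nn_integral_cong)
        fix y'
        have "?c * chi (Suc k) y' = ennreal (C1 / vd TYPE('d)) * indicator (D (Suc k)) y'"
          using C1_pos vol_pos h by (auto simp: chi_def indicator_def ennreal_mult[symmetric] vol_eq)
        then show "ennreal (heat (h - u) (y' - z)) * (?c * chi (Suc k) y') = ennreal (C1 / vd TYPE('d)) * (ennreal (heat (h - u) (y' - z)) * indicator (D (Suc k)) y')"
          by (simp add: mult.left_commute)
      qed
      also have "\<dots> = ennreal (C1 / vd TYPE('d)) * (\<integral>\<^sup>+y'. ennreal (heat (h - u) (y' - z)) * indicator (D (Suc k)) y' \<partial>lborel)"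
        by (rule nn_integral_cmult) measurable
      also have "\<dots> \<le> ennreal (C1 / vd TYPE('d)) * wt (z - x (Suc k))"
        using u by (intro mult_left_mono wbound) auto
      finally show ?thesis .
    qed
    have Gle: "G y \<le> ennreal (C2 / vol) * (\<integral>\<^sup>+z. g z * wt (z - x (Suc k)) \<partial>lborel)" for y
    proof -
      have "G y \<le> (\<integral>\<^sup>+z. ennreal (C2 / vol) * (g z * wt (z - x (Suc k))) \<partial>lborel)"
        unfolding G_def
      proof (rule nn_integral_mono)
        fix z
        have "ennreal (heat u (z - y)) * (g z * r z) \<le> ennreal a * (g z * (ennreal (C1 / vd TYPE('d)) * wt (z - x (Suc k))))"
          using gda[of u] False by (intro mult_mono rle ennreal_leI mult_left_mono) auto
        also have "\<dots> = (ennreal a * ennreal (C1 / vd TYPE('d))) * (g z * wt (z - x (Suc k)))"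
          by (simp only: mult.assoc mult.commute mult.left_commute)
        also have "ennreal a * ennreal (C1 / vd TYPE('d)) = ennreal (C2 / vol)"
          using C2_vol(2) C1_pos a0 by (simp add: ennreal_mult[symmetric] a_def mult.commute)
        finally show "ennreal (heat u (z - y)) * (g z * r z) \<le> ennreal (C2 / vol) * (g z * wt (z - x (Suc k)))" .
      qed
      also have "\<dots> = ennreal (C2 / vol) * (\<integral>\<^sup>+z. g z * wt (z - x (Suc k)) \<partial>lborel)"
        by (rule nn_integral_cmult) measurable
      finally show ?thesis .
    qed
    have "(\<integral>\<^sup>+w. rho m w * g (B w (real k * h + u)) \<partial>W) \<le> kiter (\<lambda>i. real i * h) Phi k (\<lambda>y. indicator (D k) y * (ennreal (C2 / vol) * (\<integral>\<^sup>+z. g z * wt (z - x (Suc k)) \<partial>lborel))) 0"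
    proof (rule order_trans[OF main], rule kiter_mono)
      fix y show "indicator (D k) y * G y \<le> indicator (D k) y * (ennreal (C2 / vol) * (\<integral>\<^sup>+z. g z * wt (z - x (Suc k)) \<partial>lborel))"
        by (rule mult_left_mono[OF Gle]) simp
    qed
    also have "\<dots> = ennreal (C2 / vol) * (\<integral>\<^sup>+z. g z * wt (z - x (Suc k)) \<partial>lborel)" by (rule kiter_const)
    also have "\<dots> \<le> ennreal (C2 / vol) * ((\<integral>\<^sup>+z. g z * wt (z - x k) \<partial>lborel) + (\<integral>\<^sup>+z. g z * wt (z - x (Suc k)) \<partial>lborel))"
      by (intro mult_left_mono) auto
    also have "\<dots> \<le> ennreal (C2 / vol) * ((\<integral>\<^sup>+z. g z * wt (z - x k) \<partial>lborel) + (\<integral>\<^sup>+z. g z * wt (z - x (Suc k)) \<partial>lborel))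
      + (if k = 0 then ennreal C2 * (\<integral>\<^sup>+z. ennreal (heat u z) * g z \<partial>lborel) else 0)"
      by (rule add_increasing2) auto
    finally show ?thesis .
  qed
qed

end

section \<open>The lower bound\<close>

text \<open>Dominates the modulus of \<open>Vbar\<close> where \<open>nearE\<close> is finite and is
  infinite elsewhere. As an \<open>ennreal\<close> it can be averaged without any integrability
  condition.\<close>

definition envU :: "real \<Rightarrow> real \<Rightarrow> (real^'d::finite) measure \<Rightarrow> real^'d \<Rightarrow> ennreal" where
  "envU p C \<mu> z = nearE p \<mu> z + ennreal (C * lg z)"

text \<open>Slow variation: a displacement \<open>r\<close> costs at most a factor
  \<open>1 + r\<close>, which Gaussian weights absorb.\<close>

lemma lg_add_le: "lg (y :: 'a::real_normed_vector) \<le> lg x * (1 + norm (y - x))"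
proof -
  have "norm y \<le> norm x + norm (y - x)" using norm_triangle_sub[of y x] by simp
  moreover have "0 \<le> norm x * norm (y - x)" by simp
  moreover have "(1 + norm x) * (1 + norm (y - x)) = 1 + norm x + norm (y - x) + norm x * norm (y - x)" by (simp add: algebra_simps)
  ultimately have "1 + norm y \<le> (1 + norm x) * (1 + norm (y - x))" by linarith
  then have "ln (1 + norm y) \<le> ln ((1 + norm x) * (1 + norm (y - x)))" by (simp add: add_pos_nonneg)
  also have "\<dots> = ln (1 + norm x) + ln (1 + norm (y - x))" by (intro ln_mult_pos) (auto simp: add_pos_nonneg)
  also have "\<dots> \<le> ln (1 + norm x) + norm (y - x)" by (simp add: ln_add_one_self_le_self)
  finally have "lg y \<le> lg x + 1 * norm (y - x)" by (simp add: lg_def)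
  also have "\<dots> \<le> lg x + lg x * norm (y - x)" by (intro add_left_mono mult_right_mono lg_ge1) simp
  finally show ?thesis by (simp add: algebra_simps)
qed

lemma lg_mono: "norm y \<le> norm x \<Longrightarrow> lg y \<le> lg x"
  by (simp add: lg_def add_pos_nonneg)

lemma regular_envD:
  assumes "regular_env p C \<mu>"
  shows "sets \<mu> = sets borel" "emeasure \<mu> (cball x r) < \<infinity>" "0 \<le> C" "Vbar p \<mu> \<in> borel_measurable borel"
    "nearE p \<mu> z < \<infinity> \<Longrightarrow> \<bar>Vbar p \<mu> z\<bar> \<le> Vnear p \<mu> 1 z + C * lg z" "measure \<mu> (cball x 2) \<le> C * lg x"
  using assms by (auto simp: regular_env_def)

lemma envU_measurable: "regular_env p C \<mu> \<Longrightarrow> envU p C \<mu> \<in> borel_measurable borel"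
proof -
  assume env: "regular_env p C \<mu>"
  note [measurable] = nearE_measurable[OF regular_envD(1,2)[OF env], of p]
  show ?thesis unfolding envU_def[abs_def] by measurable
qed

lemma Vbar_le_envU:
  assumes env: "regular_env p C \<mu>" and n: "nearE p \<mu> z < \<infinity>"
  shows "ennreal \<bar>Vbar p \<mu> z\<bar> \<le> envU p C \<mu> z"
proof -
  have "ennreal \<bar>Vbar p \<mu> z\<bar> \<le> ennreal (Vnear p \<mu> 1 z + C * lg z)"
    by (intro ennreal_leI regular_envD(5)[OF env n])
  also have "\<dots> = ennreal (Vnear p \<mu> 1 z) + ennreal (C * lg z)"
  proof (rule ennreal_plus)
    show "0 \<le> Vnear p \<mu> 1 z" unfolding Vnear_def by (rule set_integral_nonneg) simp
    show "0 \<le> C * lg z" using regular_envD(3)[OF env] lg_ge1[of z] by simp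
  qed
  also have "ennreal (Vnear p \<mu> 1 z) = nearE p \<mu> z" by (rule nearE_finite(3)[OF regular_envD(1)[OF env] n])
  finally show ?thesis by (simp add: envU_def)
qed

section \<open>Averages of the environment over unit balls and Gaussian weights\<close>

lemma envU_ball:
  fixes \<mu> :: "(real^'d::finite) measure"
  assumes env: "regular_env p C \<mu>" and p: "0 < p" "p < real CARD('d)"
  shows "\<exists>K\<ge>0. \<forall>y. (\<integral>\<^sup>+z. envU p C \<mu> z * indicator (cball y 1) z \<partial>lborel) \<le> ennreal (K * lg y)"
proof -
  define a where "a = vd TYPE('d) * real CARD('d) / (real CARD('d) - p)"
  define K where "K = a * C + C * 2 * vd TYPE('d)"
  have a0: "0 \<le> a" using p by (simp add: a_def)
  have C0: "0 \<le> C" by (rule regular_envD(3)[OF env])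
  have K0: "0 \<le> K" using a0 C0 by (simp add: K_def)
  note [measurable] = nearE_measurable[OF regular_envD(1,2)[OF env], of p]
  have "(\<integral>\<^sup>+z. envU p C \<mu> z * indicator (cball y 1) z \<partial>lborel) \<le> ennreal (K * lg y)" for y
  proof -
    have [measurable]: "cball y 1 \<in> sets borel" by simp
    have l1: "1 \<le> lg y" by (rule lg_ge1)
    have lz: "lg z \<le> 2 * lg y" if "z \<in> cball y 1" for z
    proof -
      have "lg z \<le> lg y * (1 + norm (z - y))" by (rule lg_add_le)
      also have "\<dots> \<le> lg y * 2" using that l1 by (intro mult_left_mono) (auto simp: dist_norm norm_minus_commute)
      finally show ?thesis by simp
    qed
    have "(\<integral>\<^sup>+z. envU p C \<mu> z * indicator (cball y 1) z \<partial>lborel)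
      \<le> (\<integral>\<^sup>+z. nearE p \<mu> z * indicator (cball y 1) z + ennreal (C * (2 * lg y)) * indicator (cball y 1) z \<partial>lborel)"
      using lz C0 by (intro nn_integral_mono) (auto simp: envU_def indicator_def intro!: add_left_mono ennreal_leI mult_left_mono)
    also have "\<dots> = (\<integral>\<^sup>+z. nearE p \<mu> z * indicator (cball y 1) z \<partial>lborel) + ennreal (C * (2 * lg y)) * emeasure lborel (cball y 1)"
      by (subst nn_integral_add) (auto simp: nn_integral_cmult_indicator)
    also have "\<dots> \<le> ennreal a * emeasure \<mu> (cball y 2) + ennreal (C * (2 * lg y)) * emeasure lborel (cball y 1)"
      unfolding a_def by (intro add_right_mono nearE_average regular_envD(1,2)[OF env] p)
    also have "emeasure \<mu> (cball y 2) = ennreal (measure \<mu> (cball y 2))"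
      using regular_envD(2)[OF env, of y 2] by (intro emeasure_eq_ennreal_measure) auto
    also have "emeasure lborel (cball y 1) = ennreal (vd TYPE('d))"
      using lborel_cball_fin[of y 1] by (simp add: emeasure_eq_ennreal_measure content_cball_vec)
    also have "ennreal a * ennreal (measure \<mu> (cball y 2)) + ennreal (C * (2 * lg y)) * ennreal (vd TYPE('d))
      \<le> ennreal a * ennreal (C * lg y) + ennreal (C * (2 * lg y)) * ennreal (vd TYPE('d))"
      by (intro add_right_mono mult_left_mono ennreal_leI regular_envD(6)[OF env]) auto
    also have "\<dots> = ennreal (a * (C * lg y) + C * (2 * lg y) * vd TYPE('d))"
      using a0 C0 l1 by (simp add: ennreal_mult ennreal_plus)
    also have "a * (C * lg y) + C * (2 * lg y) * vd TYPE('d) = K * lg y" by (simp add: K_def algebra_simps)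
    finally show ?thesis .
  qed
  with K0 show ?thesis by blast
qed

lemma linear_le_exp_square: "1 + r \<le> 33 * exp (r\<^sup>2 / 128)" for r :: real
proof -
  have "0 \<le> 2 * (r / 16 - 4)\<^sup>2" by simp
  then have "r \<le> 32 + r\<^sup>2 / 128" by (simp add: power2_eq_square algebra_simps)
  moreover have "1 + r\<^sup>2 / 128 \<le> exp (r\<^sup>2 / 128)" by (rule exp_ge_add_one_self)
  moreover have "0 \<le> r\<^sup>2 / 128" by simp
  moreover have "1 + a \<le> 33 * e" if "a \<le> 32 + b" "1 + b \<le> e" "0 \<le> b" for a b e :: real using that by linarith
  ultimately show ?thesis by blast
qed

context bm
begin

lemma gauss_integral:
  assumes "0 < \<sigma>"
  shows "(\<integral>\<^sup>+z. ennreal (exp (- (norm (z - x))\<^sup>2 / (2 * \<sigma>))) \<partial>(lborel :: (real^'d) measure)) = ennreal ((2 * pi * \<sigma>) powr (real CARD('d) / 2))"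
proof -
  let ?c = "(2 * pi * \<sigma>) powr (real CARD('d) / 2)"
  have "(\<integral>\<^sup>+z. ennreal (exp (- (norm (z - x))\<^sup>2 / (2 * \<sigma>))) \<partial>(lborel :: (real^'d) measure))
     = (\<integral>\<^sup>+z. ennreal (heat \<sigma> (z - x)) * ennreal ?c \<partial>(lborel :: (real^'d) measure))"
  proof (rule nn_integral_cong)
    fix z
    have "(2 * pi * \<sigma>) powr (- (real CARD('d) / 2)) * ?c = 1" using assms by (simp add: powr_add[symmetric])
    then have "heat \<sigma> (z - x) * ?c = exp (- (norm (z - x))\<^sup>2 / (2 * \<sigma>))" by (simp add: heat_def)
    then show "ennreal (exp (- (norm (z - x))\<^sup>2 / (2 * \<sigma>))) = ennreal (heat \<sigma> (z - x)) * ennreal ?c"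
      by (simp add: ennreal_mult[symmetric])
  qed
  also have "\<dots> = (\<integral>\<^sup>+z. ennreal (heat \<sigma> z) * ennreal ?c \<partial>(lborel :: (real^'d) measure))"
    using heat_shift[of "\<lambda>_. ennreal ?c" \<sigma> x] by simp
  also have "\<dots> = ennreal ?c" using heat_integral[OF assms] by (simp add: nn_integral_multc)
  finally show ?thesis .
qed

text \<open>The bound over unit balls is transferred by smoothing: the weight at \<open>z\<close> is
  at most twice a wider Gaussian at any \<open>y\<close> within distance 1, and averaging over such
  \<open>y\<close> leaves integrals of \<open>envU\<close> over unit balls. The growth factor from
  \<open>lg_add_le\<close> then takes half of the remaining exponent.\<close>

lemma env_int:
  fixes \<mu> :: "(real^'d) measure"
  assumes env: "regular_env p C \<mu>" and p: "0 < p" "p < real CARD('d)"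
  shows "\<exists>K\<ge>0. \<forall>x. (\<integral>\<^sup>+z. envU p C \<mu> z * ennreal (exp (- (norm (z - x))\<^sup>2 / 32)) \<partial>lborel) \<le> ennreal (K * lg x)"
proof -
  obtain K0 where K0: "K0 \<ge> 0" "\<And>y. (\<integral>\<^sup>+z. envU p C \<mu> z * indicator (cball y 1) z \<partial>lborel) \<le> ennreal (K0 * lg y)"
    using envU_ball[OF env p] by blast
  note [measurable] = envU_measurable[OF env]
  define G where "G = (2 * pi * 64) powr (real CARD('d) / 2)"
  define v where "v = vd TYPE('d)"
  have v: "0 < v" by (simp add: v_def)
  define K where "K = 2 / v * (K0 * 33 * G)"
  have Kp: "0 \<le> K" using K0 v by (simp add: K_def G_def)
  have "(\<integral>\<^sup>+z. envU p C \<mu> z * ennreal (exp (- (norm (z - x))\<^sup>2 / 32)) \<partial>lborel) \<le> ennreal (K * lg x)" for x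
  proof -
    let ?\<phi> = "\<lambda>z. exp (- (norm (z - x))\<^sup>2 / 32)" and ?\<psi> = "\<lambda>y. exp (- (norm (y - x))\<^sup>2 / 64)"
    have sm: "?\<phi> z \<le> 2 * ?\<psi> y" if "norm (z - y) \<le> 1" for y z
    proof -
      have "norm (y - x) \<le> norm (z - x) + norm (z - y)"
        using norm_triangle_ineq4[of "z - x" "z - y"] by simp
      then have "(norm (y - x))\<^sup>2 \<le> (norm (z - x) + 1)\<^sup>2" using that by (intro power_mono) auto
      also have "\<dots> \<le> 2 * (norm (z - x))\<^sup>2 + 2"
        using zero_le_power2[of "norm (z - x) - 1"] by (simp add: power2_eq_square algebra_simps)
      finally have "- (norm (z - x))\<^sup>2 / 32 \<le> 1 / 32 + - (norm (y - x))\<^sup>2 / 64" by simp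
      then have "?\<phi> z \<le> exp (1 / 32 + - (norm (y - x))\<^sup>2 / 64)" by (subst exp_le_cancel_iff)
      also have "\<dots> = exp (1 / 32) * ?\<psi> y" by (rule exp_add)
      also have "\<dots> \<le> 2 * ?\<psi> y"
      proof (intro mult_right_mono)
        have "exp (1/32::real) \<le> 1 + 1/32 + (1/32)\<^sup>2" by (rule exp_bound) auto
        also have "\<dots> \<le> 2" by (simp add: power2_eq_square)
        finally show "exp (1/32::real) \<le> 2" .
      qed simp
      finally show ?thesis .
    qed
    have cb: "emeasure lborel (cball z 1) = ennreal (v)" for z :: "real^'d"
      using lborel_cball_fin[of z 1] by (simp add: emeasure_eq_ennreal_measure content_cball_vec v_def)
    have "ennreal (v) * (\<integral>\<^sup>+z. envU p C \<mu> z * ennreal (?\<phi> z) \<partial>lborel)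
      = (\<integral>\<^sup>+z. ennreal (v) * (envU p C \<mu> z * ennreal (?\<phi> z)) \<partial>lborel)"
      by (rule nn_integral_cmult[symmetric]) measurable
    also have "\<dots> = (\<integral>\<^sup>+z. (\<integral>\<^sup>+y. envU p C \<mu> z * ennreal (?\<phi> z) * indicator {y. dist z y \<le> 1} y \<partial>lborel) \<partial>lborel)"
    proof (rule nn_integral_cong)
      fix z
      have "(\<integral>\<^sup>+y. envU p C \<mu> z * ennreal (?\<phi> z) * indicator {y. dist z y \<le> 1} y \<partial>lborel) = envU p C \<mu> z * ennreal (?\<phi> z) * emeasure lborel (cball z 1)"
        unfolding cball_def[symmetric] by (rule nn_integral_cmult_indicator) simp
      then show "ennreal (v) * (envU p C \<mu> z * ennreal (?\<phi> z)) = (\<integral>\<^sup>+y. envU p C \<mu> z * ennreal (?\<phi> z) * indicator {y. dist z y \<le> 1} y \<partial>lborel)"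
        unfolding cb by (simp add: mult.commute)
    qed
    also have "\<dots> = (\<integral>\<^sup>+y. (\<integral>\<^sup>+z. envU p C \<mu> z * ennreal (?\<phi> z) * indicator {y. dist z y \<le> 1} y \<partial>lborel) \<partial>lborel)"
    proof -
      have "(\<lambda>q. envU p C \<mu> (fst q) * ennreal (?\<phi> (fst q)) * indicator {y. dist (fst q) y \<le> 1} (snd q)) \<in> borel_measurable (borel \<Otimes>\<^sub>M borel)"
        by measurable
      then show ?thesis
        by (intro lborel_pair.Fubini') (simp add: case_prod_beta' cong: measurable_cong_sets)
    qed
    also have "\<dots> \<le> (\<integral>\<^sup>+y. ennreal (2 * ?\<psi> y * (K0 * lg y)) \<partial>lborel)"
    proof (rule nn_integral_mono)
      fix y :: "real^'d"
      have [measurable]: "cball y 1 \<in> sets borel" by simp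
      have "(\<integral>\<^sup>+z. envU p C \<mu> z * ennreal (?\<phi> z) * indicator {y. dist z y \<le> 1} y \<partial>lborel)
        \<le> (\<integral>\<^sup>+z. ennreal (2 * ?\<psi> y) * (envU p C \<mu> z * indicator (cball y 1) z) \<partial>lborel)"
      proof (rule nn_integral_mono)
        fix z
        show "envU p C \<mu> z * ennreal (?\<phi> z) * indicator {y. dist z y \<le> 1} y \<le> ennreal (2 * ?\<psi> y) * (envU p C \<mu> z * indicator (cball y 1) z)"
        proof (cases "dist z y \<le> 1")
          case True
          have "envU p C \<mu> z * ennreal (?\<phi> z) \<le> envU p C \<mu> z * ennreal (2 * ?\<psi> y)"
            using sm[of z y] True by (intro mult_left_mono ennreal_leI) (auto simp: dist_norm)
          then show ?thesis using True by (simp add: dist_commute mult.commute)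
        qed simp
      qed
      also have "\<dots> = ennreal (2 * ?\<psi> y) * (\<integral>\<^sup>+z. envU p C \<mu> z * indicator (cball y 1) z \<partial>lborel)"
        by (rule nn_integral_cmult) measurable
      also have "\<dots> \<le> ennreal (2 * ?\<psi> y) * ennreal (K0 * lg y)" by (intro mult_left_mono K0) auto
      also have "\<dots> = ennreal (2 * ?\<psi> y * (K0 * lg y))" by (rule ennreal_mult[symmetric]) (use K0 lg_ge1[of y] in auto)
      finally show "(\<integral>\<^sup>+z. envU p C \<mu> z * ennreal (?\<phi> z) * indicator {y. dist z y \<le> 1} y \<partial>lborel) \<le> ennreal (2 * ?\<psi> y * (K0 * lg y))" .
    qed
    also have "\<dots> \<le> (\<integral>\<^sup>+y. ennreal (2 * (K0 * 33 * lg x)) * ennreal (exp (- (norm (y - x))\<^sup>2 / (2 * 64))) \<partial>(lborel :: (real^'d) measure))"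
    proof (rule nn_integral_mono)
      fix y
      let ?r = "norm (y - x)"
      have e: "- ?r\<^sup>2 / 64 + ?r\<^sup>2 / 128 = - ?r\<^sup>2 / (2 * 64)" by simp
      have "lg y \<le> lg x * (33 * exp (?r\<^sup>2 / 128))"
        using lg_add_le[of y x] mult_left_mono[OF linear_le_exp_square[of ?r], of "lg x"] lg_ge1[of x] by linarith
      then have "2 * ?\<psi> y * (K0 * lg y) \<le> 2 * ?\<psi> y * (K0 * (lg x * (33 * exp (?r\<^sup>2 / 128))))"
        using K0 by (intro mult_left_mono) auto
      also have "\<dots> = 2 * (K0 * 33 * lg x) * (exp (- ?r\<^sup>2 / 64) * exp (?r\<^sup>2 / 128))" by simp
      also have "\<dots> = 2 * (K0 * 33 * lg x) * exp (- ?r\<^sup>2 / (2 * 64))" by (simp only: exp_add[symmetric] e)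
      finally show "ennreal (2 * ?\<psi> y * (K0 * lg y)) \<le> ennreal (2 * (K0 * 33 * lg x)) * ennreal (exp (- ?r\<^sup>2 / (2 * 64)))"
        using K0 lg_ge1[of x] by (subst ennreal_mult[symmetric]) (auto intro!: ennreal_leI)
    qed
    also have "\<dots> = ennreal (2 * (K0 * 33 * lg x)) * (\<integral>\<^sup>+y. ennreal (exp (- (norm (y - x))\<^sup>2 / (2 * 64))) \<partial>(lborel :: (real^'d) measure))"
      by (rule nn_integral_cmult) measurable
    also have "\<dots> = ennreal (2 * (K0 * 33 * lg x)) * ennreal G"
      unfolding G_def by (subst gauss_integral) auto
    also have "\<dots> = ennreal (v * (K * lg x))"
    proof -
      have "2 * (K0 * 33 * lg x) * G = v * (K * lg x)" using v by (simp add: K_def)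
      moreover have "0 \<le> 2 * (K0 * 33 * lg x)" "0 \<le> G" using K0 lg_ge1[of x] by (auto simp: G_def)
      ultimately show ?thesis by (simp only: ennreal_mult[symmetric])
    qed
    also have "\<dots> = ennreal (v) * ennreal (K * lg x)"
      using v Kp lg_ge1[of x] by (intro ennreal_mult) auto
    finally have le: "ennreal v * (\<integral>\<^sup>+z. envU p C \<mu> z * ennreal (?\<phi> z) \<partial>lborel) \<le> ennreal v * ennreal (K * lg x)" .
    have "ennreal v \<noteq> 0" "ennreal v \<noteq> \<top>" using v by auto
    from ennreal_mult_le_mult_iff[OF this] le show ?thesis by blast
  qed
  with Kp show ?thesis by blast
qed

text \<open>As \<open>s\<close> tends to 0 the heat kernel concentrates at 0, where vacancy makes
  \<open>envU\<close> bounded. Away from 0 it is dominated by a fixed Gaussian uniformly in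
  \<open>s\<close>, because \<open>exp (- a / s)\<close> beats
  \<open>s powr (- d / 2)\<close>.\<close>

lemma env_int0:
  fixes \<mu> :: "(real^'d) measure"
  assumes env: "regular_env p C \<mu>" and p: "0 < p" "p < real CARD('d)"
    and r: "0 < r" "emeasure \<mu> (cball 0 r) = 0"
  shows "\<exists>K\<ge>0. \<forall>s. 0 < s \<longrightarrow> s \<le> 1 \<longrightarrow> (\<integral>\<^sup>+z. ennreal (heat s z) * envU p C \<mu> z \<partial>lborel) \<le> ennreal K"
proof -
  obtain K1 where K1: "K1 \<ge> 0" "\<And>x. (\<integral>\<^sup>+z. envU p C \<mu> z * ennreal (exp (- (norm (z - x))\<^sup>2 / 32)) \<partial>lborel) \<le> ennreal (K1 * lg x)"
    using env_int[OF env p] by blast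
  note [measurable] = envU_measurable[OF env]
  note sets [measurable_cong] = regular_envD(1)[OF env]
  have C0: "0 \<le> C" by (rule regular_envD(3)[OF env])
  \<comment> \<open>Since \<open>2 * q \<le> r\<close>, the ball of radius \<open>q\<close> around
    any \<open>z\<close> with \<open>norm z \<le> q\<close> is vacant; \<open>q \<le> 1\<close>
    keeps the points counted by \<open>nearE\<close> within distance 2 of 0.\<close>
  define q where "q = min (r / 2) 1"
  have q: "0 < q" "q \<le> 1" "q \<le> r / 2" using r by (auto simp: q_def)
  define k where "k = real CARD('d)"
  have k: "1 \<le> k" by (simp add: k_def Suc_leI)
  define a where "a = q\<^sup>2 / 4"
  have a: "0 < a" using q by (simp add: a_def)
  define b where "b = (2 * pi) powr (- (k / 2)) * (k / a) ^ CARD('d)"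
  have b0: "0 \<le> b" using a k by (simp add: b_def)
  define M where "M = q powr - p * C + C * 2"
  have M0: "0 \<le> M" using C0 by (simp add: M_def)
  have near: "envU p C \<mu> z \<le> ennreal M" if "norm z \<le> q" for z
  proof -
    have "emeasure \<mu> (cball z q) \<le> emeasure \<mu> (cball 0 r)"
    proof (rule emeasure_mono)
      show "cball z q \<subseteq> cball 0 r"
      proof
        fix y assume "y \<in> cball z q"
        then have "dist 0 y \<le> r" using dist_triangle[of 0 y z] that q by (simp add: dist_commute)
        then show "y \<in> cball 0 r" by simp
      qed
    qed (simp add: sets)
    then have z0: "emeasure \<mu> (cball z q) = 0" using r by simp
    have "nearE p \<mu> z \<le> (\<integral>\<^sup>+y. ennreal (q powr - p) * indicator (cball 0 2) y \<partial>\<mu>)"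
      unfolding nearE_def
    proof (rule nn_integral_mono_AE)
      have "AE y in \<mu>. y \<notin> cball z q" using z0 by (intro AE_not_in) (auto simp: null_sets_def sets)
      then show "AE y in \<mu>. (if y = z then \<infinity> else ennreal (dist y z powr - p)) * indicator (cball z 1) y \<le> ennreal (q powr - p) * indicator (cball 0 2) y"
      proof eventually_elim
        case (elim y)
        then have "q < dist y z" by (simp add: dist_commute)
        moreover have "norm y \<le> 2" if "dist z y \<le> 1"
          using that \<open>norm z \<le> q\<close> q norm_triangle_sub[of y z] by (simp add: dist_norm norm_minus_commute)
        ultimately show ?case using q p by (auto simp: indicator_def intro!: ennreal_leI powr_mono2')
      qed
    qed
    also have "\<dots> = ennreal (q powr - p) * emeasure \<mu> (cball 0 2)"
      by (rule nn_integral_cmult_indicator) (simp add: sets)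
    also have "emeasure \<mu> (cball 0 2) = ennreal (measure \<mu> (cball 0 2))"
      using regular_envD(2)[OF env, of 0 2] by (intro emeasure_eq_ennreal_measure) auto
    also have "\<dots> \<le> ennreal C" using regular_envD(6)[OF env, of 0] by (intro ennreal_leI) (simp add: lg_def)
    finally have n: "nearE p \<mu> z \<le> ennreal (q powr - p) * ennreal C" by (simp add: mult_left_mono)
    have "lg z \<le> lg (0::real^'d) * (1 + norm (z - 0))" by (rule lg_add_le)
    also have "\<dots> \<le> 2" using that q by (simp add: lg_def)
    finally have "ennreal (C * lg z) \<le> ennreal (C * 2)" using C0 by (intro ennreal_leI mult_left_mono) auto
    then have "envU p C \<mu> z \<le> ennreal (q powr - p) * ennreal C + ennreal (C * 2)"
      unfolding envU_def using n by (intro add_mono)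
    also have "\<dots> = ennreal M" using C0 by (simp add: M_def ennreal_mult ennreal_plus)
    finally show ?thesis .
  qed
  have far: "heat s z \<le> b * exp (- (norm (z - 0))\<^sup>2 / 32)" if s: "0 < s" "s \<le> 1" and "q < norm z" for s and z :: "real^'d"
  proof -
    let ?n = "(norm z)\<^sup>2"
    have "q\<^sup>2 \<le> ?n" using that q by (intro power_mono) auto
    then have n: "a \<le> ?n / 4" by (simp add: a_def)
    have "- ?n / (2 * s) \<le> - a / s + - ?n / 32"
    proof -
      have "?n / 4 / 1 \<le> ?n / 4 / s" using s by (intro divide_left_mono) auto
      moreover have "a / s \<le> ?n / 4 / s" using n s by (intro divide_right_mono) auto
      moreover have "?n / (2 * s) = ?n / 4 / s + ?n / 4 / s" using s by (simp add: field_simps)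
      moreover have "0 \<le> ?n" by simp
      moreover have "- (u :: real) \<le> - v + - n / 32" if "n / 4 / 1 \<le> x" "v \<le> x" "u = x + x" "0 \<le> n" for u v n x using that by linarith
      ultimately have "- (?n / (2 * s)) \<le> - (a / s) + - ?n / 32" by blast
      then show ?thesis by simp
    qed
    then have e: "exp (- ?n / (2 * s)) \<le> exp (- a / s) * exp (- ?n / 32)" by (subst exp_add[symmetric]) (subst exp_le_cancel_iff)
    have "(2 * pi * s) powr (- (k / 2)) * exp (- a / s) \<le> b"
    proof -
      have "(a / s / k) ^ CARD('d) \<le> exp (a / s / k) ^ CARD('d)"
      proof (rule power_mono)
        show "a / s / k \<le> exp (a / s / k)" using exp_ge_add_one_self[of "a / s / k"] by linarith
      qed (use a s k in simp)
      also have "\<dots> = exp (a / s)" using k by (simp add: exp_of_nat_mult[symmetric] k_def)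
      finally have "(a / s / k) ^ CARD('d) \<le> exp (a / s)" .
      then have x: "(a / k) ^ CARD('d) \<le> exp (a / s) * s ^ CARD('d)"
      proof -
        have "(a / k) ^ CARD('d) = (a / s / k) ^ CARD('d) * s ^ CARD('d)" using s by (simp add: power_mult_distrib[symmetric])
        then show ?thesis using \<open>(a / s / k) ^ CARD('d) \<le> exp (a / s)\<close> s by simp
      qed
      have "s powr (- (k / 2)) \<le> s powr (- k)" using powr_mono'[of "- k" "- (k/2)" s] s k by simp
      also have "\<dots> = inverse (s ^ CARD('d))" using s by (simp add: powr_minus k_def powr_realpow)
      finally have "s powr (- (k / 2)) * exp (- a / s) \<le> inverse (s ^ CARD('d)) * exp (- a / s)" by (intro mult_right_mono) auto
      also have "\<dots> = inverse (exp (a / s) * s ^ CARD('d))" by (simp add: exp_minus)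
      also have "\<dots> \<le> inverse ((a / k) ^ CARD('d))" using x a k by (intro le_imp_inverse_le) auto
      also have "\<dots> = (k / a) ^ CARD('d)" by (simp add: power_inverse[symmetric])
      finally show ?thesis unfolding b_def powr_mult by (simp add: mult.assoc mult_left_mono)
    qed
    then have "(2 * pi * s) powr (- (k / 2)) * exp (- a / s) * exp (- ?n / 32) \<le> b * exp (- ?n / 32)" by (intro mult_right_mono) auto
    moreover have "heat s z \<le> (2 * pi * s) powr (- (k / 2)) * (exp (- a / s) * exp (- ?n / 32))"
      using mult_left_mono[OF e, of "(2 * pi * s) powr (- (k / 2))"] by (simp add: heat_def k_def)
    ultimately show ?thesis unfolding diff_zero by (simp only: mult.assoc)
  qed
  have "(\<integral>\<^sup>+z. ennreal (heat s z) * envU p C \<mu> z \<partial>lborel) \<le> ennreal (M + b * (K1 * lg (0::real^'d)))" if s: "0 < s" "s \<le> 1" for s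
  proof -
    have "(\<integral>\<^sup>+z. ennreal (heat s z) * envU p C \<mu> z \<partial>lborel)
      \<le> (\<integral>\<^sup>+z. ennreal M * ennreal (heat s z) + ennreal b * (envU p C \<mu> z * ennreal (exp (- (norm (z - 0))\<^sup>2 / 32))) \<partial>lborel)"
    proof (rule nn_integral_mono)
      fix z :: "real^'d"
      show "ennreal (heat s z) * envU p C \<mu> z \<le> ennreal M * ennreal (heat s z) + ennreal b * (envU p C \<mu> z * ennreal (exp (- (norm (z - 0))\<^sup>2 / 32)))"
      proof (cases "norm z \<le> q")
        case True
        have "ennreal (heat s z) * envU p C \<mu> z \<le> ennreal (heat s z) * ennreal M" by (intro mult_left_mono near True) auto
        also have "\<dots> = ennreal M * ennreal (heat s z)" by (rule mult.commute)
        finally show ?thesis by (rule add_increasing2[rotated]) simp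
      next
        case False
        then have "ennreal (heat s z) \<le> ennreal (b * exp (- (norm (z - 0))\<^sup>2 / 32))" using far[OF s, of z] by (intro ennreal_leI) auto
        then have "ennreal (heat s z) * envU p C \<mu> z \<le> ennreal (b * exp (- (norm (z - 0))\<^sup>2 / 32)) * envU p C \<mu> z" by (rule mult_right_mono) simp
        also have "\<dots> = ennreal b * (envU p C \<mu> z * ennreal (exp (- (norm (z - 0))\<^sup>2 / 32)))"
          using b0 by (simp add: ennreal_mult mult.assoc mult.left_commute mult.commute)
        finally show ?thesis by (rule add_increasing[rotated]) simp
      qed
    qed
    also have "\<dots> = ennreal M * (\<integral>\<^sup>+z. ennreal (heat s z) \<partial>(lborel :: (real^'d) measure)) + ennreal b * (\<integral>\<^sup>+z. envU p C \<mu> z * ennreal (exp (- (norm (z - 0))\<^sup>2 / 32)) \<partial>lborel)"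
      by (subst nn_integral_add) (auto simp: nn_integral_cmult)
    also have "\<dots> \<le> ennreal M * 1 + ennreal b * ennreal (K1 * lg (0::real^'d))"
      using heat_integral[OF s(1)] by (intro add_mono mult_left_mono K1) auto
    also have "\<dots> = ennreal (M + b * (K1 * lg (0::real^'d)))"
      using M0 b0 K1 lg_ge1[of "0::real^'d"] by (simp add: ennreal_mult ennreal_plus)
    finally show ?thesis .
  qed
  moreover have "0 \<le> M + b * (K1 * lg (0::real^'d))" using M0 b0 K1 lg_ge1[of "0::real^'d"] by simp
  ultimately show ?thesis by blast
qed

end

text \<open>Dominates the potential before time \<open>a\<close>, and its excess over \<open>- b\<close> afterwards, when the path should stay near the
  peak \<open>x\<close>.\<close>

definition pathU :: "real \<Rightarrow> real \<Rightarrow> (real^'d::finite) measure \<Rightarrow> real^'d \<Rightarrow> real \<Rightarrow> real \<Rightarrow> real \<Rightarrow> real^'d \<Rightarrow> ennreal" where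
  "pathU p C \<mu> x b a s z = (if s < a then envU p C \<mu> z else (envU p C \<mu> z + ennreal b) * indicator (- cball x 1) z)"

section \<open>Paths that travel to a peak and rest there\<close>

context bm
begin

text \<open>Finiteness of the excess also yields integrability of \<open>Vbar\<close> along the
  path. This is indispensable: otherwise the Bochner integral would be the default value 0, and a
  negative upper bound would be false.\<close>

lemma path_bound:
  fixes \<mu> :: "(real^'d) measure"
  assumes env: "regular_env p C \<mu>" and w: "w \<in> space W" and b: "0 \<le> b" and a: "0 \<le> a" "a \<le> t"
    and vac: "emeasure \<mu> (cball x 2) = 0" and V: "\<And>z. z \<in> cball x 1 \<Longrightarrow> Vbar p \<mu> z \<le> - b"
    and good: "AE s in lborel. s \<in> {0..t} \<longrightarrow> nearE p \<mu> (B w s) < \<infinity>"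
    and Y: "(\<integral>\<^sup>+s. pathU p C \<mu> x b a s (B w s) * indicator {0..t} s \<partial>lborel) \<le> ennreal y" and y: "0 \<le> y"
  shows "(LBINT s:{0..t}. Vbar p \<mu> (B w s)) \<le> y - b * (t - a)"
proof -
  note sets = regular_envD(1)[OF env] and Vm = regular_envD(4)[OF env]
  have C0: "0 \<le> C" by (rule regular_envD(3)[OF env])
  let ?V = "\<lambda>s. indicat_real {0..t} s *\<^sub>R Vbar p \<mu> (B w s)"
  let ?G = "\<lambda>s. pathU p C \<mu> x b a s (B w s) * indicator {0..t} s"
  have Vmeas [measurable]: "?V \<in> borel_measurable borel" by (rule B_section_meas[OF Vm w])
  \<comment> \<open>Within distance 1 of the peak \<open>nearE\<close> vanishes, so
    \<open>envU\<close> is bounded there; this controls the part of the path that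
    \<open>pathU\<close> does not see.\<close>
  define c where "c = C * (lg x * 2)"
  have ball: "envU p C \<mu> z \<le> ennreal c" if "z \<in> cball x 1" for z
  proof -
    have "nearE p \<mu> z = 0" by (rule nearE_vacant[OF sets vac]) (use that in \<open>simp add: dist_commute\<close>)
    moreover have "C * lg z \<le> c"
    proof -
      have "lg z \<le> lg x * (1 + norm (z - x))" by (rule lg_add_le)
      also have "\<dots> \<le> lg x * 2" using that lg_ge1[of x] by (intro mult_left_mono) (auto simp: dist_norm norm_minus_commute)
      finally show ?thesis unfolding c_def using C0 by (rule mult_left_mono)
    qed
    ultimately show ?thesis by (simp add: envU_def ennreal_leI)
  qed
  have int: "integrable lborel ?V"
  proof (rule integrableI_bounded)
    have "(\<integral>\<^sup>+s. ennreal (norm (?V s)) \<partial>lborel) \<le> (\<integral>\<^sup>+s. ?G s + ennreal c * indicator {0..t} s \<partial>lborel)"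
    proof (rule nn_integral_mono_AE)
      show "AE s in lborel. ennreal (norm (?V s)) \<le> ?G s + ennreal c * indicator {0..t} s"
        using good
      proof eventually_elim
        case (elim s)
        show ?case
        proof (cases "s \<in> {0..t}")
          case True
          then have V1: "ennreal \<bar>Vbar p \<mu> (B w s)\<bar> \<le> envU p C \<mu> (B w s)" using elim by (intro Vbar_le_envU[OF env]) auto
          have "envU p C \<mu> (B w s) \<le> pathU p C \<mu> x b a s (B w s) + ennreal c"
            using ball[of "B w s"] by (auto simp: pathU_def indicator_def add_increasing add_increasing2 add.assoc)
          with V1 have "ennreal \<bar>Vbar p \<mu> (B w s)\<bar> \<le> pathU p C \<mu> x b a s (B w s) + ennreal c" by (rule order_trans)
          then show ?thesis using True by simp
        qed simp
      qed
    qed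
    also have "\<dots> = (\<integral>\<^sup>+s. ?G s \<partial>lborel) + ennreal c * ennreal t"
    proof -
      have "?G = (\<lambda>s. (if s < a then envU p C \<mu> (B w (max 0 s)) else (envU p C \<mu> (B w (max 0 s)) + ennreal b) * indicator (- cball x 1) (B w (max 0 s))) * indicator {0..t} s)"
        by (auto simp: fun_eq_iff pathU_def indicator_def max_def)
      also have "\<dots> \<in> borel_measurable borel"
      proof -
        have m: "(\<lambda>s. B w (max 0 s)) \<in> borel_measurable borel"
          using measurable_compose[OF measurable_Pair1'[OF w] B_joint] by simp
        have [measurable]: "(\<lambda>s. envU p C \<mu> (B w (max 0 s))) \<in> borel_measurable borel"
          by (rule measurable_compose[OF m envU_measurable[OF env]])
        have [measurable]: "(\<lambda>s. indicator (- cball x 1) (B w (max 0 s)) :: ennreal) \<in> borel_measurable borel"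
          by (rule measurable_compose[OF m]) (simp add: borel_measurable_indicator)
        show ?thesis by measurable
      qed
      finally have "?G \<in> borel_measurable lborel" by simp
      then show ?thesis using a by (subst nn_integral_add) (auto simp: nn_integral_cmult_indicator)
    qed
    also have "\<dots> < \<infinity>" using Y by (auto simp: ennreal_mult_less_top intro: le_less_trans)
    finally show "(\<integral>\<^sup>+s. ennreal (norm (?V s)) \<partial>lborel) < \<infinity>" .
  qed (use Vmeas in simp)
  let ?f = "\<lambda>s. ?V s + b * indicat_real {a..t} s"
  have "integrable lborel (indicat_real {a..t})" using a by (intro integrable_real_indicator) auto
  then have fi: "integrable lborel ?f" by (intro Bochner_Integration.integrable_add int integrable_mult_right)
  have "(LBINT s. ?f s) = (LBINT s. ?V s) + b * (t - a)"
    using a by (subst Bochner_Integration.integral_add[OF int]) auto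
  moreover have "(LBINT s. ?f s) \<le> y"
  proof -
    have "(\<integral>\<^sup>+s. ennreal (?f s) \<partial>lborel) \<le> (\<integral>\<^sup>+s. ?G s \<partial>lborel)"
    proof (rule nn_integral_mono_AE)
      show "AE s in lborel. ennreal (?f s) \<le> ?G s"
        using good
      proof eventually_elim
        case (elim s)
        show ?case
        proof (cases "s \<in> {0..t}")
          case True
          then have V1: "ennreal \<bar>Vbar p \<mu> (B w s)\<bar> \<le> envU p C \<mu> (B w s)" using elim by (intro Vbar_le_envU[OF env]) auto
          show ?thesis
          proof (cases "s < a")
            case s: True
            have "ennreal (Vbar p \<mu> (B w s)) \<le> envU p C \<mu> (B w s)"
              by (rule order_trans[OF _ V1]) (simp add: ennreal_leI)
            then show ?thesis using True s by (simp add: pathU_def)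
          next
            case s: False
            show ?thesis
            proof (cases "B w s \<in> cball x 1")
              case B: True
              have "Vbar p \<mu> (B w s) + b \<le> 0" using V[OF B] by simp
              then show ?thesis using True s by (simp add: ennreal_neg)
            next
              case B: False
              have "ennreal (Vbar p \<mu> (B w s) + b) \<le> ennreal (\<bar>Vbar p \<mu> (B w s)\<bar> + b)" by (simp add: ennreal_leI)
              also have "\<dots> = ennreal \<bar>Vbar p \<mu> (B w s)\<bar> + ennreal b" using b by (simp add: ennreal_plus)
              also have "\<dots> \<le> envU p C \<mu> (B w s) + ennreal b" by (rule add_right_mono[OF V1])
              finally show ?thesis using True s B by (simp add: pathU_def)
            qed
          qed
        next
          case False
          moreover from this have "s \<notin> {a..t}" using a by auto
          ultimately show ?thesis by simp
        qed
      qed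
    qed
    also have "\<dots> \<le> ennreal y" by (rule Y)
    finally have "enn2real (\<integral>\<^sup>+s. ennreal (?f s) \<partial>lborel) \<le> y" using y by (simp add: enn2real_leI)
    moreover have "(LBINT s. ?f s) \<le> enn2real (\<integral>\<^sup>+s. ennreal (?f s) \<partial>lborel)"
      unfolding real_lebesgue_integral_def[OF fi] by simp
    ultimately show ?thesis by linarith
  qed
  ultimately show ?thesis unfolding set_lebesgue_integral_def by linarith
qed

end

context tilt
begin

text \<open>Multiples of \<open>h\<close> form a null set of times. Every other time before
  \<open>m * h\<close> has the form \<open>k * h + u\<close> with \<open>0 < u < h\<close>, so a
  bound at inserted times can be integrated over the whole interval.\<close>

lemma rho_time_integral:
  fixes G :: "real \<Rightarrow> real^'d \<Rightarrow> ennreal"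
  assumes Gm [measurable]: "(\<lambda>q. G (fst q) (snd q)) \<in> borel_measurable (borel \<Otimes>\<^sub>M borel)"
    and km [measurable]: "\<kappa> \<in> borel_measurable borel"
    and le: "\<And>k u. k < m \<Longrightarrow> 0 < u \<Longrightarrow> u < h \<Longrightarrow>
      (\<integral>\<^sup>+w. rho m w * G (real k * h + u) (B w (real k * h + u)) \<partial>W) \<le> \<kappa> (real k * h + u)"
  shows "(\<integral>\<^sup>+w. rho m w * (\<integral>\<^sup>+s. G s (B w s) * indicator {0..real m * h} s \<partial>lborel) \<partial>W)
    \<le> (\<integral>\<^sup>+s. \<kappa> s * indicator {0..real m * h} s \<partial>lborel)"
    and "(\<lambda>w. \<integral>\<^sup>+s. G s (B w s) * indicator {0..real m * h} s \<partial>lborel) \<in> borel_measurable W"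
proof -
  note [measurable] = rho_measurable[of m]
  interpret L: pair_sigma_finite W lborel ..
  let ?t = "real m * h"
  have Bm: "(\<lambda>q. B (fst q) (max 0 (snd q))) \<in> borel_measurable (W \<Otimes>\<^sub>M borel)"
    using B_joint by (simp add: case_prod_beta')
  have m: "(\<lambda>q. G (snd q) (B (fst q) (max 0 (snd q))) * indicator {0..?t} (snd q)) \<in> borel_measurable (W \<Otimes>\<^sub>M borel)"
    using measurable_compose[OF measurable_Pair[OF measurable_snd Bm] Gm] by simp
  have eq: "G s (B w s) * indicator {0..?t} s = G s (B w (max 0 s)) * indicator {0..?t} s" for w s
    by (auto simp: indicator_def max_def)
  show mW: "(\<lambda>w. \<integral>\<^sup>+s. G s (B w s) * indicator {0..?t} s \<partial>lborel) \<in> borel_measurable W"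
    unfolding eq by (rule lborel.borel_measurable_nn_integral) (use m in \<open>simp add: case_prod_beta' cong: measurable_cong_sets\<close>)
  have "(\<integral>\<^sup>+w. rho m w * (\<integral>\<^sup>+s. G s (B w s) * indicator {0..?t} s \<partial>lborel) \<partial>W)
    = (\<integral>\<^sup>+w. (\<integral>\<^sup>+s. rho m w * (G s (B w (max 0 s)) * indicator {0..?t} s) \<partial>lborel) \<partial>W)"
  proof (rule nn_integral_cong)
    fix w assume w: "w \<in> space W"
    have "(\<lambda>s. G s (B w (max 0 s)) * indicator {0..?t} s) \<in> borel_measurable borel"
      using measurable_compose[OF measurable_Pair1'[OF w] m] by simp
    then show "rho m w * (\<integral>\<^sup>+s. G s (B w s) * indicator {0..?t} s \<partial>lborel) = (\<integral>\<^sup>+s. rho m w * (G s (B w (max 0 s)) * indicator {0..?t} s) \<partial>lborel)"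
      unfolding eq by (intro nn_integral_cmult[symmetric]) simp
  qed
  also have "\<dots> = (\<integral>\<^sup>+s. (\<integral>\<^sup>+w. rho m w * (G s (B w (max 0 s)) * indicator {0..?t} s) \<partial>W) \<partial>lborel)"
  proof (rule L.Fubini'[symmetric])
    have "(\<lambda>q. rho m (fst q) * (G (snd q) (B (fst q) (max 0 (snd q))) * indicator {0..?t} (snd q))) \<in> borel_measurable (W \<Otimes>\<^sub>M borel)"
      by (intro borel_measurable_times_ennreal m measurable_compose[OF measurable_fst rho_measurable])
    then show "(\<lambda>(w, s). rho m w * (G s (B w (max 0 s)) * indicator {0..?t} s)) \<in> borel_measurable (W \<Otimes>\<^sub>M lborel)"
      by (simp add: case_prod_beta' cong: measurable_cong_sets)
  qed
  also have "\<dots> \<le> (\<integral>\<^sup>+s. \<kappa> s * indicator {0..?t} s \<partial>lborel)"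
  proof (rule nn_integral_mono_AE)
    have "AE s in lborel. s \<notin> range (\<lambda>k::nat. real k * h)"
      by (intro AE_not_in countable_imp_null_set_lborel) auto
    then show "AE s in lborel. (\<integral>\<^sup>+w. rho m w * (G s (B w (max 0 s)) * indicator {0..?t} s) \<partial>W) \<le> \<kappa> s * indicator {0..?t} s"
    proof eventually_elim
      case (elim s)
      show ?case
      proof (cases "s \<in> {0..?t}")
        case True
        define k where "k = nat \<lfloor>s / h\<rfloor>"
        have k: "real k \<le> s / h" "s / h < real k + 1"
        proof -
          have "0 \<le> s / h" using True h by simp
          then have "real k = of_int \<lfloor>s / h\<rfloor>" unfolding k_def by (simp add: of_nat_nat)
          then show "real k \<le> s / h" "s / h < real k + 1" by linarith+
        qed
        have s1: "real k * h \<le> s" "s < real k * h + h" using k h by (simp_all add: field_simps)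
        have ne: "s \<noteq> real j * h" for j :: nat using elim by auto
        define u where "u = s - real k * h"
        have u: "0 < u" "u < h" "s = real k * h + u" using s1 ne[of k] by (auto simp: u_def)
        have "real k * h < real m * h" using True ne[of m] s1 by (simp only: atLeastAtMost_iff) linarith
        then have km: "k < m" using h by simp
        show ?thesis using le[OF km u(1,2)] True unfolding u(3)[symmetric] by (simp add: max_def)
      qed simp
    qed
  qed
  finally show "(\<integral>\<^sup>+w. rho m w * (\<integral>\<^sup>+s. G s (B w s) * indicator {0..?t} s \<partial>lborel) \<partial>W)
    \<le> (\<integral>\<^sup>+s. \<kappa> s * indicator {0..?t} s \<partial>lborel)" .
qed

lemma wt_travel: "wt z \<le> ennreal (2 ^ (CARD('d) + 1)) * ennreal (exp (- (norm z)\<^sup>2 / 32))"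
proof -
  have "(norm z)\<^sup>2 / 32 \<le> (norm z)\<^sup>2 / (16 * h)" using h by (intro divide_left_mono) auto
  then have "exp (- (norm z)\<^sup>2 / (16 * h)) \<le> exp (- (norm z)\<^sup>2 / 32)" by simp
  then show ?thesis unfolding wt_def by (subst ennreal_mult[symmetric]) (auto intro!: ennreal_leI)
qed

text \<open>Half of the exponent gives the small factor \<open>exp (- 1 / (32 * h))\<close> for
  being at distance 1 or more; the other half keeps a weight that is independent of \<open>h\<close>
  and integrable against \<open>envU\<close>.\<close>

lemma wt_stay:
  assumes "1 \<le> norm z"
  shows "wt z \<le> ennreal (2 ^ (CARD('d) + 1) * exp (- 1 / (32 * h))) * ennreal (exp (- (norm z)\<^sup>2 / 32))"
proof -
  have n: "1 \<le> (norm z)\<^sup>2" using assms by simp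
  have "(norm z)\<^sup>2 / 32 \<le> (norm z)\<^sup>2 / (32 * h)" using h by (intro divide_left_mono) auto
  moreover have "1 / (32 * h) \<le> (norm z)\<^sup>2 / (32 * h)" using h n by (intro divide_right_mono) auto
  moreover have "(norm z)\<^sup>2 / (16 * h) = (norm z)\<^sup>2 / (32 * h) + (norm z)\<^sup>2 / (32 * h)" using h by (simp add: field_simps)
  ultimately have "- ((norm z)\<^sup>2 / (16 * h)) \<le> - (1 / (32 * h)) + - ((norm z)\<^sup>2 / 32)" by linarith
  then have "exp (- (norm z)\<^sup>2 / (16 * h)) \<le> exp (- 1 / (32 * h)) * exp (- (norm z)\<^sup>2 / 32)"
    by (subst exp_add[symmetric]) simp
  then have "2 ^ (CARD('d) + 1) * exp (- (norm z)\<^sup>2 / (16 * h)) \<le> 2 ^ (CARD('d) + 1) * (exp (- 1 / (32 * h)) * exp (- (norm z)\<^sup>2 / 32))"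
    by (intro mult_left_mono) auto
  then show ?thesis unfolding wt_def by (subst ennreal_mult[symmetric]) (auto intro!: ennreal_leI simp: mult.assoc)
qed

end

lemma ennreal_half_le:
  assumes "1 \<le> ennreal c * Q + ennreal (1 / 2)" "0 < c"
  shows "ennreal (1 / (2 * c)) \<le> Q"
proof (cases Q)
  case (real q)
  then have "ennreal 1 \<le> ennreal (c * q + 1 / 2)" using assms by (simp add: ennreal_mult ennreal_plus)
  then have "1 \<le> c * q + 1 / 2" using real assms by (subst (asm) ennreal_le_iff) auto
  then show ?thesis using assms real by (auto intro!: ennreal_leI simp: field_simps)
qed simp

lemma ennreal_combine:
  "0 \<le> a \<Longrightarrow> 0 \<le> b \<Longrightarrow> 0 \<le> c \<Longrightarrow> 0 \<le> d \<Longrightarrow>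
    ennreal a * (ennreal b + ennreal b) + ennreal c * ennreal d = ennreal (a * (b + b) + c * d)"
  by (simp only: ennreal_mult ennreal_plus mult_nonneg_nonneg add_nonneg_nonneg)

context bm
begin

text \<open>Under the density \<open>rho\<close> the mean excess is at most \<open>y1\<close>, so it
  exceeds \<open>2 * y1\<close> with weight at most 1/2. On the remaining paths the density is at
  most \<open>K ^ m\<close>, and there the potential integral is controlled; this gives the divisor
  \<open>2 * K ^ m\<close>. The two losses in the exponent belong to the travel of \<open>J\<close>
  steps and to excursions from the peak.\<close>

lemma lower_quenched:
  fixes \<mu> :: "(real^'d) measure"
  assumes env: "regular_env p C \<mu>" and p: "0 < p" "p < real CARD('d)" and th: "0 < \<theta>"
    and r: "0 < r" "emeasure \<mu> (cball 0 r) = 0"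
  shows "\<exists>K\<ge>1. \<forall>t h m J y b. 0 < h \<longrightarrow> h \<le> 1 \<longrightarrow> t = real m * h \<longrightarrow> 1 \<le> J \<longrightarrow> J \<le> m \<longrightarrow>
    norm y \<le> real J * sqrt h \<longrightarrow> 0 \<le> b \<longrightarrow> emeasure \<mu> (cball y 2) = 0 \<longrightarrow>
    (\<forall>z\<in>cball y 1. Vbar p \<mu> z \<le> - b) \<longrightarrow>
    ennreal (exp (\<theta> * (b * (t - real J * h)
        - 2 * K * (real J * h * (h powr (- (real CARD('d) / 2)) * lg y)
            + t * (h powr (- (real CARD('d) / 2)) * (exp (- 1 / (32 * h)) * (lg y + b)))))) / (2 * K ^ m))
      \<le> quenched_moment W B p \<theta> \<mu> t"
proof -
  obtain K7 where K7: "K7 \<ge> 0" "\<And>x. (\<integral>\<^sup>+z. envU p C \<mu> z * ennreal (exp (- (norm (z - x))\<^sup>2 / 32)) \<partial>lborel) \<le> ennreal (K7 * lg x)"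
    using env_int[OF env p] by blast
  obtain K9 where K9: "K9 \<ge> 0" "\<And>s. 0 < s \<Longrightarrow> s \<le> 1 \<Longrightarrow> (\<integral>\<^sup>+z. ennreal (heat s z) * envU p C \<mu> z \<partial>lborel) \<le> ennreal K9"
    using env_int0[OF env p r] by blast
  note sets = regular_envD(1)[OF env]
  note Um [measurable] = envU_measurable[OF env]
  note [measurable] = nearE_measurable[OF regular_envD(1,2)[OF env], of p]
  define e :: real where "e = real CARD('d) / 2"
  \<comment> \<open>The constants of the tilted law are repeated because \<open>K\<close> has to be
    fixed before \<open>h\<close> and the skeleton are given; they do not involve
    \<open>h\<close>.\<close>
  define c1 where "c1 = (2 * pi) powr e * exp (9 / 2)"
  define c2 where "c2 = c1 * pi powr (- real CARD('d) / 2)"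
  define v where "v = vd TYPE('d)"
  have v: "0 < v" by (simp add: v_def)
  define G where "G = (2 * pi * 16) powr e"
  define q where "q = (2::real) ^ (CARD('d) + 1)"
  have c12: "0 < c1" "0 < c2" and q0: "0 < q" and G0: "0 < G" by (auto simp: c1_def c2_def q_def G_def)
  define A where "A = c2 / v * (2 * q)"
  have A0: "0 < A" using c12 v q0 by (simp add: A_def)
  define K where "K = 1 + c1 / v + (A * (K7 + G) + c2 * K9)"
  have K1: "1 \<le> K" "c1 / v \<le> K" "A * K7 + c2 * K9 \<le> K" "A * (K7 + G) \<le> K"
    using A0 c12 v G0 K7 K9 unfolding K_def distrib_left by (auto intro!: add_increasing add_increasing2)
  have "ennreal (exp (\<theta> * (b * (t - real J * h)
        - 2 * K * (real J * h * (h powr (- (real CARD('d) / 2)) * lg y)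
            + t * (h powr (- (real CARD('d) / 2)) * (exp (- 1 / (32 * h)) * (lg y + b)))))) / (2 * K ^ m))
      \<le> quenched_moment W B p \<theta> \<mu> t"
    if h: "0 < h" "h \<le> 1" and t: "t = real m * h" and J: "1 \<le> J" "J \<le> m" and y: "norm y \<le> real J * sqrt h" and b: "0 \<le> b"
      and vac: "emeasure \<mu> (cball y 2) = 0" and V: "\<And>z. z \<in> cball y 1 \<Longrightarrow> Vbar p \<mu> z \<le> - b"
    for t h m J b and y :: "real^'d"
  proof -
    \<comment> \<open>A straight walk to \<open>y\<close> in \<open>J\<close> equal steps, each of
      length at most \<open>sqrt h\<close>, followed by rest.\<close>
    define x where "x j = (real (min j J) / real J) *\<^sub>R y" for j
    have xJ: "x j = y" if "J \<le> j" for j using that J by (simp add: x_def)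
    have xn: "norm (x j) \<le> norm y" for j
    proof -
      have "real (min j J) / real J * norm y \<le> 1 * norm y" using J by (intro mult_right_mono) auto
      then show ?thesis by (simp add: x_def)
    qed
    interpret T: tilt W B h x
    proof
      show "x 0 = 0" by (simp add: x_def)
      fix j
      have "x (Suc j) - x j = ((real (min (Suc j) J) - real (min j J)) / real J) *\<^sub>R y"
        by (simp only: x_def diff_divide_distrib scaleR_diff_left)
      then have "dist (x (Suc j)) (x j) = \<bar>(real (min (Suc j) J) - real (min j J)) / real J\<bar> * norm y" by (simp add: dist_norm)
      also have "\<dots> \<le> 1 / real J * norm y" using J by (intro mult_right_mono) (auto simp: min_def divide_right_mono)
      also have "\<dots> \<le> sqrt h" using y J by (simp add: field_simps)
      finally show "dist (x (Suc j)) (x j) \<le> sqrt h" .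
    qed (use h in auto)
    have Tc: "T.C1 = c1" "T.C2 = c2" by (simp_all add: T.C1_def T.C2_def c1_def c2_def e_def)
    define H where "H = h powr (- e)"
    have H1: "1 \<le> H" using h powr_mono'[of "- e" 0 h] by (simp add: H_def e_def)
    have cv: "c2 / T.vol = c2 / v * H"
    proof -
      have "H = inverse (h powr e)" unfolding H_def by (rule powr_minus)
      moreover have "T.vol = v * h powr e" unfolding v_def e_def by (rule T.vol_eq)
      moreover have "c / (a * b) = c / a * inverse b" for a b c :: real by (simp add: divide_inverse)
      ultimately show ?thesis by (simp only:)
    qed
    have l1: "1 \<le> lg y" by (rule lg_ge1)
    define ee where "ee = exp (- 1 / (32 * h))"
    have ee: "0 < ee" by (simp add: ee_def)
    have I1: "(\<integral>\<^sup>+z. envU p C \<mu> z * T.wt (z - x k) \<partial>lborel) \<le> ennreal (q * (K7 * lg y))" for k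
    proof -
      have "(\<integral>\<^sup>+z. envU p C \<mu> z * T.wt (z - x k) \<partial>lborel) \<le> (\<integral>\<^sup>+z. ennreal q * (envU p C \<mu> z * ennreal (exp (- (norm (z - x k))\<^sup>2 / 32))) \<partial>lborel)"
      proof (rule nn_integral_mono)
        fix z
        have "envU p C \<mu> z * T.wt (z - x k) \<le> envU p C \<mu> z * (ennreal q * ennreal (exp (- (norm (z - x k))\<^sup>2 / 32)))"
          unfolding q_def by (intro mult_left_mono T.wt_travel) simp
        then show "envU p C \<mu> z * T.wt (z - x k) \<le> ennreal q * (envU p C \<mu> z * ennreal (exp (- (norm (z - x k))\<^sup>2 / 32)))"
          by (simp only: mult.left_commute)
      qed
      also have "\<dots> = ennreal q * (\<integral>\<^sup>+z. envU p C \<mu> z * ennreal (exp (- (norm (z - x k))\<^sup>2 / 32)) \<partial>lborel)"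
        by (rule nn_integral_cmult) measurable
      also have "\<dots> \<le> ennreal q * ennreal (K7 * lg (x k))" by (intro mult_left_mono K7) simp
      also have "\<dots> \<le> ennreal q * ennreal (K7 * lg y)" using lg_mono[OF xn[of k]] K7 by (intro mult_left_mono ennreal_leI) auto
      also have "\<dots> = ennreal (q * (K7 * lg y))" using q0 K7 l1 by (simp add: ennreal_mult)
      finally show ?thesis .
    qed
    define S where "S z = (envU p C \<mu> z + ennreal b) * indicator (- cball y 1) z" for z
    have [measurable]: "- cball y 1 \<in> sets borel" by (simp add: borel_comp)
    have Sm [measurable]: "S \<in> borel_measurable borel" unfolding S_def[abs_def] by measurable
    have I2: "(\<integral>\<^sup>+z. S z * T.wt (z - y) \<partial>lborel) \<le> ennreal (q * ee * (K7 * lg y + b * G))"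
    proof -
      let ?g = "\<lambda>z. ennreal (exp (- (norm (z - y))\<^sup>2 / 32))"
      have gi: "(\<integral>\<^sup>+z. ?g z \<partial>lborel) = ennreal G"
        using gauss_integral[of 16 y] by (simp add: G_def e_def)
      have "(\<integral>\<^sup>+z. S z * T.wt (z - y) \<partial>lborel) \<le> (\<integral>\<^sup>+z. ennreal (q * ee) * (envU p C \<mu> z * ?g z + ennreal b * ?g z) \<partial>lborel)"
      proof (rule nn_integral_mono)
        fix z
        show "S z * T.wt (z - y) \<le> ennreal (q * ee) * (envU p C \<mu> z * ?g z + ennreal b * ?g z)"
        proof (cases "z \<in> cball y 1")
          case False
          then have "1 \<le> norm (z - y)" by (simp add: dist_norm norm_minus_commute)
          then have "S z * T.wt (z - y) \<le> (envU p C \<mu> z + ennreal b) * (ennreal (q * ee) * ?g z)"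
            unfolding q_def ee_def S_def using False by (intro mult_mono T.wt_stay) auto
          then show ?thesis by (simp only: mult.left_commute distrib_right)
        qed (simp add: S_def)
      qed
      also have "\<dots> = ennreal (q * ee) * ((\<integral>\<^sup>+z. envU p C \<mu> z * ?g z \<partial>lborel) + ennreal b * (\<integral>\<^sup>+z. ?g z \<partial>lborel))"
      proof -
        have "(\<integral>\<^sup>+z. envU p C \<mu> z * ?g z + ennreal b * ?g z \<partial>lborel) = (\<integral>\<^sup>+z. envU p C \<mu> z * ?g z \<partial>lborel) + (\<integral>\<^sup>+z. ennreal b * ?g z \<partial>lborel)"
          by (rule nn_integral_add) measurable
        moreover have "(\<integral>\<^sup>+z. ennreal b * ?g z \<partial>lborel) = ennreal b * (\<integral>\<^sup>+z. ?g z \<partial>lborel)"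
          by (rule nn_integral_cmult) measurable
        ultimately show ?thesis by (subst nn_integral_cmult) auto
      qed
      also have "\<dots> \<le> ennreal (q * ee) * (ennreal (K7 * lg y) + ennreal b * ennreal G)"
        unfolding gi by (intro mult_left_mono add_right_mono K7) simp
      also have "\<dots> = ennreal (q * ee * (K7 * lg y + b * G))"
        using q0 ee K7 l1 b G0 by (simp add: ennreal_mult ennreal_plus)
      finally show ?thesis .
    qed
    define a where "a = real J * h"
    \<comment> \<open>Bounds for the mean excess per unit of time: \<open>\<kappa>1\<close> while
      travelling, \<open>\<kappa>2\<close> while resting.\<close>
    define \<kappa>1 where "\<kappa>1 = K * (H * lg y)"
    define \<kappa>2 where "\<kappa>2 = K * (H * (ee * (lg y + b)))"
    have k12: "0 < \<kappa>1" "0 \<le> \<kappa>2" using K1 H1 l1 ee b by (auto simp: \<kappa>1_def \<kappa>2_def intro!: mult_pos_pos mult_nonneg_nonneg)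
    define \<kappa> where "\<kappa> s = (if s < a then ennreal \<kappa>1 else ennreal \<kappa>2)" for s
    define U where "U = pathU p C \<mu> y b a"
    have Um2: "(\<lambda>q. U (fst q) (snd q)) \<in> borel_measurable (borel \<Otimes>\<^sub>M borel)"
      unfolding U_def pathU_def by measurable
    have occ: "(\<integral>\<^sup>+w. T.rho m w * U (real k * h + u) (B w (real k * h + u)) \<partial>W) \<le> \<kappa> (real k * h + u)"
      if k: "k < m" and u: "0 < u" "u < h" for k u
    proof (cases "k < J")
      case True
      have "(real k + 1) * h \<le> a" unfolding a_def using True h by (intro mult_right_mono) auto
      then have lt: "real k * h + u < a" using u by (simp add: algebra_simps)
      have "(\<integral>\<^sup>+w. T.rho m w * U (real k * h + u) (B w (real k * h + u)) \<partial>W) = (\<integral>\<^sup>+w. T.rho m w * envU p C \<mu> (B w (real k * h + u)) \<partial>W)"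
        using lt by (simp add: U_def pathU_def)
      also have "\<dots> \<le> ennreal (c2 / T.vol) * ((\<integral>\<^sup>+z. envU p C \<mu> z * T.wt (z - x k) \<partial>lborel) + (\<integral>\<^sup>+z. envU p C \<mu> z * T.wt (z - x (Suc k)) \<partial>lborel))
          + (if k = 0 then ennreal c2 * (\<integral>\<^sup>+z. ennreal (heat u z) * envU p C \<mu> z \<partial>lborel) else 0)"
        unfolding Tc[symmetric] by (rule T.rho_occupation[OF k u Um])
      also have "\<dots> \<le> ennreal (c2 / T.vol) * (ennreal (q * (K7 * lg y)) + ennreal (q * (K7 * lg y))) + ennreal c2 * ennreal K9"
        using u h by (intro add_mono mult_left_mono I1) (auto intro!: mult_left_mono K9)
      also have "\<dots> = ennreal (c2 / T.vol * (q * (K7 * lg y) + q * (K7 * lg y)) + c2 * K9)"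
        using c12 T.vol_pos q0 K7 K9 l1 by (intro ennreal_combine) auto
      also have "\<dots> \<le> ennreal \<kappa>1"
      proof (rule ennreal_leI)
        have "c2 / T.vol * (q * (K7 * lg y) + q * (K7 * lg y)) = A * K7 * (H * lg y)" unfolding cv A_def by (simp add: algebra_simps)
        moreover have "c2 * K9 \<le> c2 * K9 * (H * lg y)"
          using mult_left_mono[of 1 "H * lg y" "c2 * K9"] mult_mono[of 1 H 1 "lg y"] c12 K9 H1 l1 by simp
        ultimately have "c2 / T.vol * (q * (K7 * lg y) + q * (K7 * lg y)) + c2 * K9 \<le> (A * K7 + c2 * K9) * (H * lg y)"
          unfolding distrib_right by linarith
        also have "\<dots> \<le> \<kappa>1" unfolding \<kappa>1_def using K1 H1 l1 by (intro mult_right_mono) auto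
        finally show "c2 / T.vol * (q * (K7 * lg y) + q * (K7 * lg y)) + c2 * K9 \<le> \<kappa>1" .
      qed
      finally show ?thesis using lt by (simp add: \<kappa>_def)
    next
      case False
      have "a \<le> real k * h" unfolding a_def using False h by (intro mult_right_mono) auto
      then have ge: "\<not> real k * h + u < a" using u by simp
      have k0: "k \<noteq> 0" and xk: "x k = y" "x (Suc k) = y" using False J xJ by auto
      have "(\<integral>\<^sup>+w. T.rho m w * U (real k * h + u) (B w (real k * h + u)) \<partial>W) = (\<integral>\<^sup>+w. T.rho m w * S (B w (real k * h + u)) \<partial>W)"
        using ge by (simp add: U_def pathU_def S_def)
      also have "\<dots> \<le> ennreal (c2 / T.vol) * ((\<integral>\<^sup>+z. S z * T.wt (z - x k) \<partial>lborel) + (\<integral>\<^sup>+z. S z * T.wt (z - x (Suc k)) \<partial>lborel))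
          + (if k = 0 then ennreal c2 * (\<integral>\<^sup>+z. ennreal (heat u z) * S z \<partial>lborel) else 0)"
        unfolding Tc[symmetric] by (rule T.rho_occupation[OF k u Sm])
      also have "\<dots> \<le> ennreal (c2 / T.vol) * (ennreal (q * ee * (K7 * lg y + b * G)) + ennreal (q * ee * (K7 * lg y + b * G)))"
        unfolding xk if_not_P[OF k0] add_0_right by (intro mult_left_mono add_mono I2) simp
      also have "\<dots> = ennreal (c2 / T.vol * (q * ee * (K7 * lg y + b * G) + q * ee * (K7 * lg y + b * G)))"
        using ennreal_combine[of "c2 / T.vol" "q * ee * (K7 * lg y + b * G)" 0 0] c12 T.vol_pos q0 K7 ee b G0 l1 by auto
      also have "\<dots> \<le> ennreal \<kappa>2"
      proof (rule ennreal_leI)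
        have "c2 / T.vol * (q * ee * (K7 * lg y + b * G) + q * ee * (K7 * lg y + b * G)) = A * (K7 * lg y + b * G) * (H * ee)"
          unfolding cv A_def by (simp add: divide_inverse algebra_simps)
        also have "\<dots> \<le> A * ((K7 + G) * (lg y + b)) * (H * ee)"
        proof (intro mult_right_mono mult_left_mono)
          have "0 \<le> K7 * b" "0 \<le> G * lg y" using K7 b G0 l1 by auto
          then show "K7 * lg y + b * G \<le> (K7 + G) * (lg y + b)" by (simp add: algebra_simps)
        qed (use A0 H1 ee in auto)
        also have "\<dots> = A * (K7 + G) * (H * (ee * (lg y + b)))" by (simp add: ac_simps)
        also have "\<dots> \<le> \<kappa>2" unfolding \<kappa>2_def using K1 H1 ee l1 b by (intro mult_right_mono) auto
        finally show "c2 / T.vol * (q * ee * (K7 * lg y + b * G) + q * ee * (K7 * lg y + b * G)) \<le> \<kappa>2" .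
      qed
      finally show ?thesis using ge by (simp add: \<kappa>_def)
    qed
    have a: "0 < a" "a \<le> t" unfolding a_def t using J h by (auto intro!: mult_right_mono)
    define Y where "Y w = (\<integral>\<^sup>+s. U s (B w s) * indicator {0..t} s \<partial>lborel)" for w
    define y1 where "y1 = a * \<kappa>1 + t * \<kappa>2"
    have y1: "0 < y1" using a k12 by (auto simp: y1_def intro!: add_pos_nonneg)
    have km: "\<kappa> \<in> borel_measurable borel" unfolding \<kappa>_def[abs_def] by measurable
    note rti = T.rho_time_integral[OF Um2 km occ]
    have Ym [measurable]: "Y \<in> borel_measurable W" unfolding Y_def[abs_def] t by (rule rti(2))
    have EY: "(\<integral>\<^sup>+w. T.rho m w * Y w \<partial>W) \<le> ennreal y1"
    proof -
      have "(\<integral>\<^sup>+w. T.rho m w * Y w \<partial>W) \<le> (\<integral>\<^sup>+s. \<kappa> s * indicator {0..t} s \<partial>lborel)"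
        unfolding Y_def t by (rule rti(1))
      also have "\<dots> \<le> (\<integral>\<^sup>+s. ennreal \<kappa>1 * indicator {0..a} s + ennreal \<kappa>2 * indicator {0..t} s \<partial>lborel)"
        using a by (intro nn_integral_mono) (auto simp: \<kappa>_def indicator_def)
      also have "\<dots> = ennreal \<kappa>1 * ennreal a + ennreal \<kappa>2 * ennreal t"
        using a by (subst nn_integral_add) (auto simp: nn_integral_cmult_indicator)
      also have "\<dots> = ennreal y1" using a k12 by (simp add: y1_def ennreal_mult ennreal_plus mult.commute)
      finally show ?thesis .
    qed
    define F where "F w = ennreal (exp (- \<theta> * (LBINT s:{0..t}. Vbar p \<mu> (B w s))))" for w
    define X where "X = \<theta> * (b * (t - a) - 2 * y1)"
    define c where "c = K ^ m * exp (- X)"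
    have c: "0 < c" using K1 by (simp add: c_def)
    have goodAE: "AE w in W. AE s in lborel. s \<in> {0..t} \<longrightarrow> nearE p \<mu> (B w s) < \<infinity>"
      by (rule AE_path[OF AE_nearE_finite[OF regular_envD(1,2)[OF env] p]]) measurable
    \<comment> \<open>Either the excess is at most \<open>2 * y1\<close> and the bound on the
      density applies, or \<open>Y w / (2 * y1)\<close> is at least 1. A single inequality covers
      both cases and can be integrated.\<close>
    have main: "AE w in W. T.rho m w \<le> ennreal c * F w + T.rho m w * Y w * ennreal (1 / (2 * y1))"
      using goodAE AE_space
    proof eventually_elim
      case (elim w)
      show ?case
      proof (cases "Y w \<le> ennreal (2 * y1)")
        case True
        have "(LBINT s:{0..t}. Vbar p \<mu> (B w s)) \<le> 2 * y1 - b * (t - a)"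
          by (rule path_bound[OF env elim(2) b less_imp_le[OF a(1)] a(2) vac V elim(1)])
            (use True y1 in \<open>simp_all add: Y_def U_def\<close>)
        then have "\<theta> * (LBINT s:{0..t}. Vbar p \<mu> (B w s)) \<le> \<theta> * (2 * y1 - b * (t - a))" using th by (intro mult_left_mono) auto
        then have "exp X \<le> exp (- \<theta> * (LBINT s:{0..t}. Vbar p \<mu> (B w s)))" by (simp add: X_def algebra_simps)
        then have "exp (- X) * exp X \<le> exp (- X) * exp (- \<theta> * (LBINT s:{0..t}. Vbar p \<mu> (B w s)))" by (intro mult_left_mono) auto
        then have "K ^ m * 1 \<le> K ^ m * (exp (- X) * exp (- \<theta> * (LBINT s:{0..t}. Vbar p \<mu> (B w s))))"
          using K1 by (intro mult_left_mono) (auto simp: exp_add[symmetric])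
        then have "ennreal (K ^ m) \<le> ennreal (c * exp (- \<theta> * (LBINT s:{0..t}. Vbar p \<mu> (B w s))))"
          by (intro ennreal_leI) (simp add: c_def mult.assoc)
        also have "\<dots> = ennreal c * F w" using c by (simp add: F_def ennreal_mult)
        finally have "ennreal (K ^ m) \<le> ennreal c * F w" .
        moreover have "T.rho m w \<le> ennreal (K ^ m)"
          by (rule order_trans[OF T.rho_le]) (use K1 c12 v in \<open>auto simp: Tc v_def[symmetric] intro!: ennreal_leI power_mono\<close>)
        ultimately have "T.rho m w \<le> ennreal c * F w" by (rule order_trans[rotated])
        then show ?thesis by (rule add_increasing2[rotated]) simp
      next
        case False
        have "ennreal (2 * y1) * ennreal (1 / (2 * y1)) = 1" using y1 by (simp add: ennreal_mult[symmetric])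
        then have "1 \<le> Y w * ennreal (1 / (2 * y1))" using False mult_right_mono[of "ennreal (2 * y1)" "Y w" "ennreal (1 / (2 * y1))"] by simp
        then have "T.rho m w * 1 \<le> T.rho m w * (Y w * ennreal (1 / (2 * y1)))" by (rule mult_left_mono) simp
        then have "T.rho m w \<le> T.rho m w * Y w * ennreal (1 / (2 * y1))" by (simp add: mult.assoc)
        then show ?thesis by (rule add_increasing[rotated]) simp
      qed
    qed
    note rm [measurable] = T.rho_measurable[of m]
    have Fm [measurable]: "F \<in> borel_measurable W"
    proof -
      have Vm [measurable]: "Vbar p \<mu> \<in> borel_measurable borel" by (rule regular_envD(4)[OF env])
      have m: "(\<lambda>q. indicat_real {0..t} (snd q) *\<^sub>R Vbar p \<mu> (B (fst q) (max 0 (snd q)))) \<in> borel_measurable (W \<Otimes>\<^sub>M borel)"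
        by measurable
      have eq: "indicat_real {0..t} s *\<^sub>R Vbar p \<mu> (B w s) = indicat_real {0..t} s *\<^sub>R Vbar p \<mu> (B w (max 0 s))" for w s
        by (auto simp: indicator_def max_def)
      have "(\<lambda>w. LBINT s:{0..t}. Vbar p \<mu> (B w s)) \<in> borel_measurable W"
        unfolding set_lebesgue_integral_def eq
        by (rule lborel.borel_measurable_lebesgue_integral) (use m in \<open>simp add: case_prod_beta' cong: measurable_cong_sets\<close>)
      then show ?thesis unfolding F_def[abs_def] by measurable
    qed
    have "1 = (\<integral>\<^sup>+w. T.rho m w \<partial>W)" by (rule T.rho_integral[symmetric])
    also have "\<dots> \<le> (\<integral>\<^sup>+w. ennreal c * F w + T.rho m w * Y w * ennreal (1 / (2 * y1)) \<partial>W)"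
      by (rule nn_integral_mono_AE[OF main])
    also have "\<dots> = (\<integral>\<^sup>+w. ennreal c * F w \<partial>W) + (\<integral>\<^sup>+w. T.rho m w * Y w * ennreal (1 / (2 * y1)) \<partial>W)"
      by (rule nn_integral_add) measurable
    also have "(\<integral>\<^sup>+w. ennreal c * F w \<partial>W) = ennreal c * quenched_moment W B p \<theta> \<mu> t"
      unfolding quenched_moment_def F_def[symmetric] by (rule nn_integral_cmult) measurable
    also have "(\<integral>\<^sup>+w. T.rho m w * Y w * ennreal (1 / (2 * y1)) \<partial>W) = (\<integral>\<^sup>+w. T.rho m w * Y w \<partial>W) * ennreal (1 / (2 * y1))"
      by (rule nn_integral_multc) measurable
    also have "\<dots> \<le> ennreal y1 * ennreal (1 / (2 * y1))" by (rule mult_right_mono[OF EY]) simp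
    also have "ennreal y1 * ennreal (1 / (2 * y1)) = ennreal (1 / 2)" using y1 by (subst ennreal_mult[symmetric]) auto
    finally have "1 \<le> ennreal c * quenched_moment W B p \<theta> \<mu> t + ennreal (1 / 2)" by (simp add: add_left_mono)
    then have fin: "ennreal (1 / (2 * c)) \<le> quenched_moment W B p \<theta> \<mu> t" using c by (rule ennreal_half_le)
    have "1 / (2 * c) = exp X / (2 * K ^ m)" by (simp add: c_def exp_minus field_simps)
    also have "X = \<theta> * (b * (t - real J * h) - 2 * K * (real J * h * (H * lg y) + t * (H * (ee * (lg y + b)))))"
      unfolding X_def y1_def \<kappa>1_def \<kappa>2_def a_def by (simp add: algebra_simps)
    finally show ?thesis using fin unfolding H_def ee_def e_def by simp
  qed
  with K1(1) show ?thesis by blast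
qed

end

section \<open>Asymptotics\<close>

lemma powr_ratio_tendsto:
  fixes a b e :: real
  assumes "0 < a"
  shows "((\<lambda>t. ((a * ln t + b) powr e) / ln t powr e) \<longlongrightarrow> a powr e) at_top"
proof -
  have "((\<lambda>t::real. (a * ln t + b) / ln t) \<longlongrightarrow> a) at_top" by real_asymp
  then have "((\<lambda>t. ((a * ln t + b) / ln t) powr e) \<longlongrightarrow> a powr e) at_top"
    by (rule tendsto_powr) (use assms in auto)
  moreover have "\<forall>\<^sub>F t in at_top. ((a * ln t + b) / ln t) powr e = ((a * ln t + b) powr e) / ln t powr e"
  proof -
    have "filterlim (\<lambda>t::real. a * ln t + b) at_top at_top" using assms by real_asymp
    then have "\<forall>\<^sub>F t::real in at_top. 0 \<le> a * ln t + b" unfolding filterlim_at_top by blast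
    then show ?thesis using eventually_ge_at_top[of "1::real"]
      by eventually_elim (simp add: powr_divide)
  qed
  ultimately show ?thesis by (rule Lim_transform_eventually)
qed

lemma polylog_decay:
  fixes \<eta> \<kappa> a :: real and k :: nat
  assumes e: "0 < \<eta>" "\<eta> < 1" and k: "0 < \<kappa>"
  shows "((\<lambda>t. t powr - \<eta> * ((1 - \<eta>) * ln t) ^ k) \<longlongrightarrow> 0) at_top"
    and "((\<lambda>t. ((1 - \<eta>) * ln t) ^ k * exp (- (((1 - \<eta>) * ln t - 1) powr \<kappa>) / 32)) \<longlongrightarrow> 0) at_top"
proof -
  have a: "0 < 1 - \<eta>" using e by simp
  show "((\<lambda>t. t powr - \<eta> * ((1 - \<eta>) * ln t) ^ k) \<longlongrightarrow> 0) at_top"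
    using e a by real_asymp
  have x: "filterlim (\<lambda>t::real. (1 - \<eta>) * ln t) at_top at_top" using a by real_asymp
  have "((\<lambda>x::real. x ^ k * exp (- ((x - 1) powr \<kappa>) / 32)) \<longlongrightarrow> 0) at_top"
    using k by real_asymp
  from filterlim_compose[OF this x]
  show "((\<lambda>t. ((1 - \<eta>) * ln t) ^ k * exp (- (((1 - \<eta>) * ln t - 1) powr \<kappa>) / 32)) \<longlongrightarrow> 0) at_top" .
qed

text \<open>For the price of the tilt, whose logarithm is of order
  \<open>t * n powr \<kappa>\<close> with \<kappa> below the exponent \<open>1 - be\<close> of the
  main term.\<close>

lemma sublinear_powr:
  fixes \<eta> :: real
  assumes "\<eta> < 1" "\<kappa> < e"
  shows "((\<lambda>t. ((1 - \<eta>) * ln t) powr \<kappa> / ln t powr e) \<longlongrightarrow> 0) at_top"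
proof -
  have "0 < 1 - \<eta>" "\<kappa> - e < 0" using assms by auto
  have "((\<lambda>x::real. ((1 - \<eta>) * x) powr \<kappa> / x powr e) \<longlongrightarrow> 0) at_top"
  proof -
    have "((\<lambda>x::real. (1 - \<eta>) powr \<kappa> * x powr (\<kappa> - e)) \<longlongrightarrow> 0) at_top" using \<open>\<kappa> - e < 0\<close> by real_asymp
    moreover have "(\<lambda>x::real. ((1 - \<eta>) * x) powr \<kappa> / x powr e) = (\<lambda>x. (1 - \<eta>) powr \<kappa> * x powr (\<kappa> - e))"
      by (simp add: fun_eq_iff powr_mult powr_diff)
    ultimately show ?thesis by simp
  qed
  moreover have "filterlim (\<lambda>t::real. ln t) at_top at_top" by real_asymp
  ultimately show ?thesis by (rule filterlim_compose)
qed

section \<open>Asymptotic bounds in a fixed environment\<close>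

context bm
begin

lemma upper_asymp:
  fixes \<mu> :: "(real^'d) measure" and p \<theta> b be c C :: real
  assumes env: "regular_env p C \<mu>" and p: "0 < p" "p < real CARD('d)" and th: "0 < \<theta>" and b: "0 \<le> b" and be: "0 < be" "be < 1"
    and sup: "\<forall>\<^sub>F n in sequentially. \<forall>z\<in>cball 0 (exp (real n)). nearE p \<mu> z < \<infinity> \<longrightarrow> - Vbar p \<mu> z \<le> b * real n powr (1 - be)"
    and c: "\<theta> * b < c"
  shows "\<forall>\<^sub>F t in at_top. quenched_moment W B p \<theta> \<mu> t \<le> ennreal (exp (c * (t * ln t powr (1 - be))))"
proof -
  \<comment> \<open>Half of the distance to \<open>c\<close> is used for the radius exponent
    \<open>1 + \<eta>\<close>, the other half absorbs the additive constant
    \<open>2 ^ d\<close>.\<close>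
  define c' where "c' = (\<theta> * b + c) / 2"
  have c': "\<theta> * b < c'" "c' < c" "0 \<le> \<theta> * b" using c th b by (auto simp: c'_def)
  have "((\<lambda>\<eta>. \<theta> * b * (1 + \<eta>) powr (1 - be)) \<longlongrightarrow> \<theta> * b * (1 + 0) powr (1 - be)) (at_right 0)"
    by (intro tendsto_intros) auto
  then have "\<forall>\<^sub>F \<eta> in at_right 0. \<theta> * b * (1 + \<eta>) powr (1 - be) < c'" by (rule order_tendstoD) (use c' in simp)
  moreover have "\<forall>\<^sub>F \<eta>::real in at_right 0. 0 < \<eta>" by (rule eventually_at_right_less)
  ultimately have "\<forall>\<^sub>F \<eta> in at_right (0::real). \<theta> * b * (1 + \<eta>) powr (1 - be) < c' \<and> 0 < \<eta>" by (rule eventually_conj)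
  then obtain \<eta> where eta: "\<theta> * b * (1 + \<eta>) powr (1 - be) < c'" "0 < \<eta>"
    using eventually_happens[of _ "at_right (0::real)"] by auto
  have "((\<lambda>t. \<theta> * b * (((1 + \<eta>) * ln t + 1) powr (1 - be) / ln t powr (1 - be))) \<longlongrightarrow> \<theta> * b * (1 + \<eta>) powr (1 - be)) at_top"
    by (intro tendsto_intros powr_ratio_tendsto) (use eta in simp)
  then have e1: "\<forall>\<^sub>F t in at_top. \<theta> * b * (((1 + \<eta>) * ln t + 1) powr (1 - be) / ln t powr (1 - be)) < c'"
    by (rule order_tendstoD) (use eta in simp)
  have "filterlim (\<lambda>t. exp ((c - c') * (t * ln t powr (1 - be)))) at_top at_top"
  proof -
    have "0 < c - c'" "0 < 1 - be" using c' be by auto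
    then show ?thesis by real_asymp
  qed
  then have e2: "\<forall>\<^sub>F t in at_top. 1 + 2 ^ CARD('d) \<le> exp ((c - c') * (t * ln t powr (1 - be)))"
    unfolding filterlim_at_top by blast
  show ?thesis
    using upper_quenched[OF env p th b be eta(2) sup] e1 e2 eventually_gt_at_top[of "exp 1"]
  proof eventually_elim
    case (elim t)
    define X where "X = t * ln t powr (1 - be)"
    have t: "0 < t" "1 < ln t" "t \<noteq> 1"
    proof -
      have e: "1 < exp (1::real)" by simp
      then show "0 < t" "t \<noteq> 1" using elim(4) by linarith+
      then have "ln (exp 1) < ln t" using elim(4) by (subst ln_less_cancel_iff) auto
      then show "1 < ln t" by simp
    qed
    have L: "0 < ln t powr (1 - be)" using t by simp
    have X: "0 \<le> X" using t by (simp add: X_def)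
    have "\<theta> * b * ((1 + \<eta>) * ln t + 1) powr (1 - be) \<le> c' * ln t powr (1 - be)"
      using elim(2) L by (simp add: pos_divide_less_eq)
    then have "t * (\<theta> * b * ((1 + \<eta>) * ln t + 1) powr (1 - be)) \<le> t * (c' * ln t powr (1 - be))" using t by (intro mult_left_mono) auto
    moreover have "t * (\<theta> * b * z) = \<theta> * t * b * z" "t * (c' * z) = c' * (t * z)" for z by simp_all
    ultimately have "exp (\<theta> * t * b * ((1 + \<eta>) * ln t + 1) powr (1 - be)) \<le> exp (c' * X)"
      unfolding X_def by (simp only: exp_le_cancel_iff)
    moreover have "2 ^ CARD('d) \<le> exp (c' * X) * 2 ^ CARD('d)"
    proof -
      have "1 \<le> exp (c' * X)" using c' X by simp
      then show ?thesis by simp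
    qed
    ultimately have "exp (\<theta> * t * b * ((1 + \<eta>) * ln t + 1) powr (1 - be)) + 2 ^ CARD('d) \<le> exp (c' * X) * (1 + 2 ^ CARD('d))"
      unfolding distrib_left by linarith
    also have "\<dots> \<le> exp (c' * X) * exp ((c - c') * X)" using elim(3) by (intro mult_left_mono) (auto simp: X_def)
    also have "\<dots> = exp (c * X)" by (simp add: exp_add[symmetric] algebra_simps)
    finally show ?case unfolding X_def by (rule order_trans[OF elim(1) ennreal_leI])
  qed
qed

lemma lower_asymp:
  fixes \<mu> :: "(real^'d) measure" and p \<theta> b be c C :: real
  assumes env: "regular_env p C \<mu>" and p: "0 < p" "p < real CARD('d)" and th: "0 < \<theta>" and b: "0 < b" and be: "0 < be" "be < 1"
    and r: "0 < r" "emeasure \<mu> (cball 0 r) = 0"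
    and peak: "\<forall>\<^sub>F n in sequentially. \<exists>x\<in>cball 0 (exp (real n)). emeasure \<mu> (cball x 2) = 0 \<and> (\<forall>z\<in>cball x 1. Vbar p \<mu> z \<le> - (b * real n powr (1 - be)))"
    and c: "c < \<theta> * b"
  shows "\<forall>\<^sub>F t in at_top. ennreal (exp (c * (t * ln t powr (1 - be)))) \<le> quenched_moment W B p \<theta> \<mu> t"
proof -
  let ?d = "CARD('d)"
  obtain K where K: "K \<ge> 1" and low: "\<And>t h m J (y :: real^'d) b. \<lbrakk>0 < h; h \<le> 1; t = real m * h; 1 \<le> J; J \<le> m;
    norm y \<le> real J * sqrt h; 0 \<le> b; emeasure \<mu> (cball y 2) = 0; \<forall>z\<in>cball y 1. Vbar p \<mu> z \<le> - b\<rbrakk> \<Longrightarrow>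
    ennreal (exp (\<theta> * (b * (t - real J * h)
        - 2 * K * (real J * h * (h powr (- (real CARD('d) / 2)) * lg y)
            + t * (h powr (- (real CARD('d) / 2)) * (exp (- 1 / (32 * h)) * (lg y + b)))))) / (2 * K ^ m))
      \<le> quenched_moment W B p \<theta> \<mu> t"
    using lower_quenched[OF env p th r] by (elim exE conjE) (rule that; blast)
  obtain n1 where n1: "\<And>n. n \<ge> n1 \<Longrightarrow> \<exists>x\<in>cball 0 (exp (real n)). emeasure \<mu> (cball x 2) = 0 \<and> (\<forall>z\<in>cball x 1. Vbar p \<mu> z \<le> - (b * real n powr (1 - be)))"
    using peak unfolding eventually_sequentially by blast
  have "((\<lambda>\<eta>. \<theta> * b * (1 - \<eta>) powr (1 - be)) \<longlongrightarrow> \<theta> * b * (1 - 0) powr (1 - be)) (at_right 0)"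
    by (intro tendsto_intros) auto
  then have "\<forall>\<^sub>F \<eta> in at_right 0. c < \<theta> * b * (1 - \<eta>) powr (1 - be)" by (rule order_tendstoD) (use c in simp)
  moreover have "\<forall>\<^sub>F \<eta>::real in at_right 0. \<eta> \<in> {0<..<1}" by (rule eventually_at_right_real) simp
  ultimately have "\<forall>\<^sub>F \<eta> in at_right (0::real). c < \<theta> * b * (1 - \<eta>) powr (1 - be) \<and> \<eta> \<in> {0<..<1}" by (rule eventually_conj)
  then obtain \<eta> where eta: "c < \<theta> * b * (1 - \<eta>) powr (1 - be)" "0 < \<eta>" "\<eta> < 1"
    using eventually_happens[of _ "at_right (0::real)"] by auto
  define \<kappa> where "\<kappa> = (1 - be) / 2"
  have kap: "0 < \<kappa>" "\<kappa> < 1 - be" "\<kappa> \<le> 1" using be by (auto simp: \<kappa>_def)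
  define x where "x t = (1 - \<eta>) * ln t" for t :: real
  \<comment> \<open>Losses relative to \<open>t\<close>, up to constants: \<open>R1\<close> for the
    time spent travelling, \<open>R2\<close> for the potential met on the way, \<open>R3\<close> for
    excursions from the peak.\<close>
  define R1 where "R1 t = t powr - \<eta> * x t ^ 1" for t
  define R2 where "R2 t = t powr - \<eta> * x t ^ Suc ?d" for t
  define R3 where "R3 t = x t ^ Suc ?d * exp (- ((x t - 1) powr \<kappa>) / 32)" for t
  define R where "R t = 2 * \<theta> * b * R1 t + 2 * K * \<theta> * (6 * 2 ^ ?d * R2 t + (3 + b) * 2 ^ ?d * R3 t) + ln 2 / t" for t
  define M where "M t = \<theta> * b * ((x t - 1) powr (1 - be) / ln t powr (1 - be)) - R t * (1 / ln t powr (1 - be)) - 2 * ln K * (x t powr \<kappa> / ln t powr (1 - be))" for t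
  have "(R \<longlongrightarrow> 2 * \<theta> * b * 0 + 2 * K * \<theta> * (6 * 2 ^ ?d * 0 + (3 + b) * 2 ^ ?d * 0) + 0) at_top"
    unfolding R_def R1_def R2_def R3_def x_def
    by (intro tendsto_add tendsto_mult_left polylog_decay[OF eta(2,3) kap(1)]) real_asymp
  then have R0: "(R \<longlongrightarrow> 0) at_top" by simp
  have "((\<lambda>t::real. 1 / ln t powr (1 - be)) \<longlongrightarrow> 0) at_top"
  proof -
    have "0 < 1 - be" using be by simp
    then show ?thesis by real_asymp
  qed
  then have "(M \<longlongrightarrow> \<theta> * b * (1 - \<eta>) powr (1 - be) - 0 * 0 - 2 * ln K * 0) at_top"
    unfolding M_def x_def
    using powr_ratio_tendsto[of "1 - \<eta>" "- 1" "1 - be"] eta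
    by (intro tendsto_diff tendsto_mult_left tendsto_mult R0 sublinear_powr kap) auto
  then have eM: "\<forall>\<^sub>F t in at_top. c < M t" by (rule order_tendstoD) (use eta in simp)
  have eR: "\<forall>\<^sub>F t in at_top. 3 * (t powr - \<eta> * x t ^ 1) < 1"
  proof -
    have "((\<lambda>t. 3 * (t powr - \<eta> * x t ^ 1)) \<longlongrightarrow> 3 * 0) at_top"
      unfolding x_def by (intro tendsto_mult_left polylog_decay[OF eta(2,3) kap(1)])
    then show ?thesis by (rule order_tendstoD) simp
  qed
  have ex: "\<forall>\<^sub>F t in at_top. real n1 + 3 \<le> x t"
  proof -
    have "filterlim x at_top at_top" unfolding x_def using eta by real_asymp
    then show ?thesis unfolding filterlim_at_top by blast
  qed
  show ?thesis
    using eM eR ex eventually_gt_at_top[of "exp 1"]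
  proof eventually_elim
    case (elim t)
    have t: "1 < t" "1 < ln t"
    proof -
      have e: "1 < exp (1::real)" by simp
      then show "1 < t" using elim(4) by linarith
      then have "ln (exp 1) < ln t" using elim(4) by (subst ln_less_cancel_iff) auto
      then show "1 < ln t" by simp
    qed
    \<comment> \<open>The peak at this scale lies within distance
      \<open>t powr (1 - \<eta>)\<close>, so reaching it takes a negligible part of the time
      \<open>t\<close>.\<close>
    define n where "n = nat \<lfloor>x t\<rfloor>"
    have n: "real n \<le> x t" "x t - 1 \<le> real n" "real n1 \<le> real n" "2 \<le> real n"
      using elim(3) unfolding n_def by linarith+
    then have nn: "n1 \<le> n" "1 \<le> real n" by auto
    have en: "exp (real n) \<le> t powr (1 - \<eta>)"
      using n(1) t by (simp add: x_def powr_def)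
    obtain y where y: "norm y \<le> exp (real n)" "emeasure \<mu> (cball y 2) = 0" "\<forall>z\<in>cball y 1. Vbar p \<mu> z \<le> - (b * real n powr (1 - be))"
      using n1[OF nn(1)] by auto
    define s where "s = real n powr \<kappa>"
    have s: "1 \<le> s" "s \<le> real n" "s \<le> x t powr \<kappa>" "(x t - 1) powr \<kappa> \<le> s"
    proof -
      show "1 \<le> s" unfolding s_def using nn kap by (intro ge_one_powr_ge_zero) auto
      show "s \<le> real n" unfolding s_def using powr_mono[of \<kappa> 1 "real n"] nn kap by simp
      show "s \<le> x t powr \<kappa>" unfolding s_def using n nn kap by (intro powr_mono2) auto
      show "(x t - 1) powr \<kappa> \<le> s" unfolding s_def using n nn kap elim(3) by (intro powr_mono2) auto
    qed
    \<comment> \<open>Rounding the number of steps up and then setting \<open>h = t / m\<close>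
      makes \<open>t\<close> an exact multiple of \<open>h\<close>, with \<open>h\<close> between
      \<open>1 / (2 * s)\<close> and \<open>1 / s\<close>.\<close>
    define m where "m = nat \<lceil>t * s\<rceil>"
    have ts: "1 \<le> t * s" "t \<le> t * s" using t s mult_mono[of 1 t 1 s] by auto
    have m: "t * s \<le> real m" "real m \<le> 2 * (t * s)" using ts unfolding m_def by linarith+
    define h where "h = t / real m"
    have m0: "0 < real m" using m ts by linarith
    have h: "0 < h" "h \<le> 1 / s" "1 / (2 * s) \<le> h" "t = real m * h"
      using t s m m0 by (auto simp: h_def field_simps)
    have h1: "h \<le> 1" using h(2) s by (meson divide_le_eq_1_pos le_numeral_extra(1) order.trans less_le_trans zero_less_one)
    \<comment> \<open>Enough steps of length \<open>sqrt h\<close> to cover the distance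
      \<open>exp n\<close>.\<close>
    define J where "J = nat \<lceil>exp (real n) / sqrt h\<rceil>"
    have Jp: "0 < exp (real n) / sqrt h" using h by simp
    have J: "1 \<le> J" "exp (real n) / sqrt h \<le> real J" "real J \<le> exp (real n) / sqrt h + 1"
      using Jp unfolding J_def by linarith+
    have Jh: "real J * h \<le> 2 * exp (real n)"
    proof -
      have "real J * h \<le> (exp (real n) / sqrt h + 1) * h" using J h by (intro mult_right_mono) auto
      also have "\<dots> = exp (real n) * sqrt h + h"
      proof -
        have "exp (real n) / sqrt h * h = exp (real n) * (h / sqrt h)" by simp
        then show ?thesis using h by (simp add: distrib_right real_div_sqrt del: times_divide_eq_right times_divide_eq_left)
      qed
      also have "\<dots> \<le> exp (real n) * 1 + exp (real n)"
      proof (intro add_mono mult_left_mono)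
        show "sqrt h \<le> 1" using h1 by simp
        have "1 \<le> exp (real n)" by simp
        with h1 show "h \<le> exp (real n)" by linarith
      qed simp
      finally show ?thesis by simp
    qed
    have tx: "t powr (1 - \<eta>) = t * t powr - \<eta>" using t powr_add[of t 1 "- \<eta>"] by simp
    have tn: "3 * (exp (real n) * real n) \<le> t"
    proof -
      have "3 * (exp (real n) * real n) \<le> 3 * (t * t powr - \<eta> * x t)"
        using en n(1) nn t unfolding tx by (intro mult_left_mono mult_mono) auto
      also have "\<dots> = t * (3 * (t powr - \<eta> * x t ^ 1))" by simp
      also have "\<dots> \<le> t * 1" using elim(2) t by (intro mult_left_mono) auto
      finally show ?thesis by simp
    qed
    have Jm: "J \<le> m"
    proof -
      have "1 / sqrt h \<le> 1 / h"
      proof (rule divide_left_mono)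
        show "h \<le> sqrt h" using h h1 by (intro real_le_rsqrt) (simp add: power2_eq_square mult_left_le)
      qed (use h in auto)
      also have "\<dots> \<le> 2 * s" using h s by (simp add: field_simps)
      also have "\<dots> \<le> 2 * real n" using s by simp
      finally have "exp (real n) * (1 / sqrt h) \<le> exp (real n) * (2 * real n)" by (intro mult_left_mono) auto
      moreover have "1 \<le> exp (real n) * real n" using mult_mono[of 1 "exp (real n)" 1 "real n"] nn by simp
      ultimately have "real J \<le> 3 * (exp (real n) * real n)" using J(3) by simp
      also have "\<dots> \<le> real m" using tn ts m by linarith
      finally show ?thesis by simp
    qed
    have yn: "norm y \<le> real J * sqrt h" using y(1) J(2) h by (simp add: pos_divide_le_eq)
    define b' where "b' = b * real n powr (1 - be)"
    have b': "0 \<le> b'" "b' \<le> b * real n"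
    proof -
      show "0 \<le> b'" using b by (simp add: b'_def)
      have "real n powr (1 - be) \<le> real n" using powr_mono[of "1 - be" 1 "real n"] nn be by simp
      then show "b' \<le> b * real n" unfolding b'_def using b by (intro mult_left_mono) auto
    qed
    define H where "H = h powr (- (real ?d / 2))"
    have H: "0 \<le> H" "H \<le> (2 * real n) ^ ?d"
    proof -
      show "0 \<le> H" by (simp add: H_def)
      have "H = inverse (h powr (real ?d / 2))" unfolding H_def by (rule powr_minus)
      also have "\<dots> = (1 / h) powr (real ?d / 2)" using h by (simp add: powr_divide inverse_eq_divide)
      also have "\<dots> \<le> (2 * real n) powr (real ?d / 2)"
      proof (rule powr_mono2)
        have "1 / h \<le> 2 * s" using h s by (simp add: field_simps)
        then show "1 / h \<le> 2 * real n" using s by linarith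
      qed (use h in auto)
      also have "\<dots> \<le> (2 * real n) powr real ?d" using nn by (intro powr_mono) auto
      also have "\<dots> = (2 * real n) ^ ?d" using nn by (simp add: powr_realpow)
      finally show "H \<le> (2 * real n) ^ ?d" .
    qed
    have ly: "0 \<le> lg y" "lg y \<le> 3 * real n"
    proof -
      show "0 \<le> lg y" using lg_ge1[of y] by linarith
      have "1 + norm y \<le> 2 * exp (real n)" using y(1) one_le_exp_iff[of "real n"] by linarith
      then have "ln (1 + norm y) \<le> ln (2 * exp (real n))" by (simp add: add_pos_nonneg)
      also have "\<dots> = ln 2 + real n" by (simp add: ln_mult)
      finally show "lg y \<le> 3 * real n" unfolding lg_def using ln_le_minus_one[of "2::real"] nn by linarith
    qed
    define ee where "ee = exp (- 1 / (32 * h))"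
    have ee: "0 \<le> ee" "ee \<le> exp (- ((x t - 1) powr \<kappa>) / 32)"
    proof -
      show "0 \<le> ee" by (simp add: ee_def)
      have "s \<le> 1 / h" using h s by (simp add: field_simps)
      with s(4) have "(x t - 1) powr \<kappa> \<le> 1 / h" by (rule order_trans)
      then have "(x t - 1) powr \<kappa> / 32 \<le> 1 / h / 32" by (rule divide_right_mono) simp
      then show "ee \<le> exp (- ((x t - 1) powr \<kappa>) / 32)" by (simp add: ee_def)
    qed
    define E where "E = \<theta> * (b' * (t - real J * h) - 2 * K * (real J * h * (H * lg y) + t * (H * (ee * (lg y + b')))))"
    have low': "ennreal (exp E / (2 * K ^ m)) \<le> quenched_moment W B p \<theta> \<mu> t"
      unfolding E_def H_def ee_def
      by (rule low[OF h(1) h1 h(4) J(1) Jm yn b'(1) y(2)]) (use y(3) in \<open>simp add: b'_def\<close>)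
    have xt: "0 \<le> x t" using n by linarith
    have b'x: "b' \<le> b * x t" by (rule order_trans[OF b'(2)]) (use b n in \<open>intro mult_left_mono; simp\<close>)
    have Je: "real J * h \<le> 2 * t powr (1 - \<eta>)" using Jh en by linarith
    have P1: "b' * (real J * h) \<le> t * (2 * b * R1 t)"
    proof -
      have "b' * (real J * h) \<le> (b * x t) * (2 * t powr (1 - \<eta>))"
        by (rule mult_mono[OF b'x Je]) (use b xt h(1) in auto)
      also have "\<dots> = t * (2 * b * R1 t)" unfolding tx R1_def by simp
      finally show ?thesis .
    qed
    have Hx: "H \<le> (2 * x t) ^ ?d" by (rule order_trans[OF H(2)]) (use n nn in \<open>intro power_mono; simp\<close>)
    have P2: "real J * h * (H * lg y) \<le> t * (6 * 2 ^ ?d * R2 t)"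
    proof -
      have "real J * h * (H * lg y) \<le> (2 * t powr (1 - \<eta>)) * ((2 * x t) ^ ?d * (3 * x t))"
        by (rule mult_mono[OF Je mult_mono[OF Hx order_trans[OF ly(2)]]]) (use n(1) xt h(1) H ly in auto)
      also have "\<dots> = t * (6 * 2 ^ ?d * R2 t)" unfolding tx R2_def by (simp add: power_mult_distrib)
      finally show ?thesis .
    qed
    have P3: "t * (H * (ee * (lg y + b'))) \<le> t * ((3 + b) * 2 ^ ?d * R3 t)"
    proof (intro mult_left_mono)
      have "lg y + b' \<le> (3 + b) * x t"
      proof -
        have "b * real n \<le> b * x t" using b n by (intro mult_left_mono) auto
        then show ?thesis using ly b' n unfolding distrib_right by linarith
      qed
      then have "H * (ee * (lg y + b')) \<le> (2 * x t) ^ ?d * (exp (- ((x t - 1) powr \<kappa>) / 32) * ((3 + b) * x t))"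
        using Hx ee H ly b' xt b by (intro mult_mono) auto
      also have "\<dots> = (3 + b) * 2 ^ ?d * R3 t" unfolding R3_def by (simp add: power_mult_distrib)
      finally show "H * (ee * (lg y + b')) \<le> (3 + b) * 2 ^ ?d * R3 t" .
    qed (use t in simp)
    have P4: "t * (b * (x t - 1) powr (1 - be)) \<le> b' * t"
    proof -
      have "(x t - 1) powr (1 - be) \<le> real n powr (1 - be)" using n nn be elim(3) by (intro powr_mono2) auto
      then have "b * (x t - 1) powr (1 - be) * t \<le> b' * t" unfolding b'_def using b t by (intro mult_right_mono mult_left_mono) auto
      then show ?thesis by (simp add: mult.commute)
    qed
    have lK: "0 \<le> ln K" using K by simp
    have P5: "real m * ln K \<le> t * (2 * ln K * x t powr \<kappa>)"
    proof -
      have "real m * ln K \<le> (2 * (t * x t powr \<kappa>)) * ln K"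
        using m(2) s(3) t lK by (intro mult_right_mono) (auto intro: order_trans)
      then show ?thesis by (simp add: mult.left_commute mult.commute)
    qed
    have cM: "c * (t * ln t powr (1 - be)) \<le> E - real m * ln K - ln 2"
    proof -
      have L: "0 < ln t powr (1 - be)" using t by simp
      have "M t * ln t powr (1 - be) = \<theta> * b * (x t - 1) powr (1 - be) - R t - 2 * ln K * x t powr \<kappa>"
        unfolding M_def left_diff_distrib using L by simp
      moreover have "c * ln t powr (1 - be) \<le> M t * ln t powr (1 - be)" using elim(1) L by (intro mult_right_mono) auto
      ultimately have "t * (c * ln t powr (1 - be)) \<le> t * (\<theta> * b * (x t - 1) powr (1 - be) - R t - 2 * ln K * x t powr \<kappa>)"
        using t by (intro mult_left_mono) auto
      also have "\<dots> = \<theta> * (t * (b * (x t - 1) powr (1 - be)) - t * (2 * b * R1 t) - 2 * K * (t * (6 * 2 ^ ?d * R2 t) + t * ((3 + b) * 2 ^ ?d * R3 t)))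
          - ln 2 - t * (2 * ln K * x t powr \<kappa>)"
        unfolding R_def using t by (simp add: algebra_simps)
      also have "\<dots> \<le> E - ln 2 - real m * ln K"
      proof -
        have "2 * K * (real J * h * (H * lg y) + t * (H * (ee * (lg y + b')))) \<le> 2 * K * (t * (6 * 2 ^ ?d * R2 t) + t * ((3 + b) * 2 ^ ?d * R3 t))"
          using K by (intro mult_left_mono[OF add_mono[OF P2 P3]]) auto
        moreover have "b' * (t - real J * h) = b' * t - b' * (real J * h)" by (rule right_diff_distrib)
        ultimately have "t * (b * (x t - 1) powr (1 - be)) - t * (2 * b * R1 t) - 2 * K * (t * (6 * 2 ^ ?d * R2 t) + t * ((3 + b) * 2 ^ ?d * R3 t))
          \<le> b' * (t - real J * h) - 2 * K * (real J * h * (H * lg y) + t * (H * (ee * (lg y + b'))))"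
          using P1 P4 by linarith
        then have "\<theta> * (t * (b * (x t - 1) powr (1 - be)) - t * (2 * b * R1 t) - 2 * K * (t * (6 * 2 ^ ?d * R2 t) + t * ((3 + b) * 2 ^ ?d * R3 t))) \<le> E"
          unfolding E_def using th by (intro mult_left_mono) auto
        then show ?thesis using P5 by linarith
      qed
      finally show ?thesis by (simp add: mult.left_commute)
    qed
    have "exp (c * (t * ln t powr (1 - be))) \<le> exp (E - real m * ln K - ln 2)" using cM by simp
    also have "\<dots> = exp E / (2 * K ^ m)"
      using K by (simp add: exp_diff exp_of_nat_mult)
    finally show ?case using low' by (blast intro: order_trans ennreal_leI)
  qed
qed

end

section \<open>Passage to the almost sure limit\<close>

lemma rate_scaling:
  fixes n v a be :: real
  assumes "0 < n" "0 < v"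
  shows "n * (n / v) powr - be * a = v powr be * a * n powr (1 - be)"
proof -
  have "(n / v) powr - be = n powr - be * v powr be"
    using assms by (simp add: powr_divide powr_minus inverse_eq_divide)
  moreover have "n * n powr - be = n powr (1 - be)" using assms powr_add[of n 1 "- be"] by simp
  moreover have "n * (x * y) * a = y * a * (n * x)" for x y by simp
  ultimately show ?thesis by (simp only:)
qed

text \<open>The sign of \<open>c\<close> matters in the case \<open>enn2real Q = 0\<close>, where
  \<open>ln\<close> takes the value 0.\<close>

lemma ln_ratio_upper:
  assumes "Q \<le> ennreal (exp (c * X))" "0 < X" "0 \<le> c" shows "ln (enn2real Q) / X \<le> c"
proof -
  have "enn2real Q \<le> exp (c * X)" using assms by (simp add: enn2real_leI)
  then have "ln (enn2real Q) \<le> c * X"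
  proof (cases "enn2real Q = 0")
    case False
    then have "0 < enn2real Q" using enn2real_nonneg[of Q] by linarith
    then have "ln (enn2real Q) \<le> ln (exp (c * X))" using \<open>enn2real Q \<le> exp (c * X)\<close> by (subst ln_le_cancel_iff) auto
    then show ?thesis by simp
  qed (use assms in simp)
  then show ?thesis using assms by (simp add: pos_divide_le_eq)
qed

text \<open>Finiteness matters because \<open>enn2real\<close> sends \<infinity> to 0.\<close>

lemma ln_ratio_lower:
  assumes "ennreal (exp (c * X)) \<le> Q" "Q < \<infinity>" "0 < X" shows "c \<le> ln (enn2real Q) / X"
proof -
  have "exp (c * X) \<le> enn2real Q" using enn2real_mono[OF assms(1)] assms(2) by simp
  then have "ln (exp (c * X)) \<le> ln (enn2real Q)" using less_le_trans[OF exp_gt_zero] by (subst ln_le_cancel_iff) auto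
  then show ?thesis using assms by (simp add: pos_le_divide_eq)
qed

theorem theorem2p1:
  fixes p \<theta> :: real
    and P :: "'w measure" and N :: "'w \<Rightarrow> (real^'d::finite) measure"
    and W :: "'v measure" and B :: "'v \<Rightarrow> real \<Rightarrow> real^'d"
  assumes "real CARD('d) / 2 < p" and "p < real CARD('d)" and "\<theta> > 0"
    and "poisson_random_measure P N"
    and "brownian_motion W B"
  shows "AE \<omega> in P.
           (\<forall>\<^sub>F t in at_top. quenched_moment W B p \<theta> (N \<omega>) t < \<infinity>) \<and>
           ((\<lambda>t. ln (enn2real (quenched_moment W B p \<theta> (N \<omega>) t))
                  / (t * ln t powr ((real CARD('d) - p) / real CARD('d))))
             \<longlongrightarrow> \<theta> * (real CARD('d))\<^sup>2 / (real CARD('d) - p)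
                 * (measure lborel (ball (0::real^'d) 1) / real CARD('d)
                    * Gamma ((2 * p - real CARD('d)) / p)) powr (p / real CARD('d))) at_top"
proof -
  let ?T = "\<theta> * (real CARD('d))\<^sup>2 / (real CARD('d) - p)
                 * (measure lborel (ball (0::real^'d) 1) / real CARD('d)
                    * Gamma ((2 * p - real CARD('d)) / p)) powr (p / real CARD('d))"
  interpret bm W B by (rule bm.intro) fact
  note p = assms(1,2) and th = assms(3) and prm = assms(4)
  define be where "be = p / real CARD('d)"
  define v where "v = vd TYPE('d)"
  have v: "0 < v" by (simp add: v_def)
  have d0: "0 < real CARD('d)" by simp
  have p0: "0 < p" using p d0 by linarith
  have be: "1 / 2 < be" "be < 1" "0 < be" using p d0 p0 by (auto simp: be_def field_simps)
  \<comment> \<open>The value of the entropy problem with budget \<open>d\<close>; the volume of the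
    unit ball enters separately as the factor \<open>v powr be\<close>.\<close>
  define a where "a = real CARD('d) / (1 - be) * (Gamma (2 - 1 / be) / real CARD('d)) powr be"
  have Gp: "0 < Gamma (2 - 1 / be)" using be by (intro Gamma_real_pos) (simp add: field_simps)
  have a0: "0 < a" unfolding a_def using be d0 Gp by (intro mult_pos_pos divide_pos_pos) auto
  have ex: "(real CARD('d) - p) / real CARD('d) = 1 - be" using d0 by (simp add: be_def field_simps)
  define L where "L = ?T"
  \<comment> \<open>With \<open>p = d * be\<close> one has
    \<open>d\<^sup>2 / (d - p) = d / (1 - be)\<close> and
    \<open>(2 * p - d) / p = 2 - 1 / be\<close>; the volume is then taken out of the power.\<close>
  have T: "L = \<theta> * (v powr be * a)"
  proof -
    have g: "(2 * p - real CARD('d)) / p = 2 - 1 / be" using p0 d0 by (simp add: be_def field_simps)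
    have m: "measure lborel (ball (0::real^'d) 1) = v" by (simp add: v_def content_ball)
    have "(v / real CARD('d) * Gamma (2 - 1 / be)) powr be = (v * (Gamma (2 - 1 / be) / real CARD('d))) powr be" by simp
    also have "\<dots> = v powr be * (Gamma (2 - 1 / be) / real CARD('d)) powr be" by (rule powr_mult)
    finally have k: "(v / real CARD('d) * Gamma (2 - 1 / be)) powr be = v powr be * (Gamma (2 - 1 / be) / real CARD('d)) powr be" .
    have "real CARD('d) - p = real CARD('d) * (1 - be)" using d0 by (simp add: be_def field_simps)
    then have c: "\<theta> * (real CARD('d))\<^sup>2 / (real CARD('d) - p) = \<theta> * (real CARD('d) / (1 - be))"
      using d0 be by (simp add: power2_eq_square)
    show ?thesis unfolding L_def g m be_def[symmetric] k c a_def by (simp only: mult.assoc mult.left_commute)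
  qed
  have T0: "0 < L" unfolding T using th v a0 by simp
  have scale: "real n * (real n / vd TYPE('d)) powr - be * a' = v powr be * a' * real n powr (1 - be)" if "0 < n" for n a'
    unfolding v_def by (rule rate_scaling) (use that v in \<open>auto simp: v_def\<close>)
  \<comment> \<open>The levels \<open>a + 1 / (k + 1)\<close> stand for all levels above
    \<open>a\<close>, so that only countably many null sets are excluded.\<close>
  have sup: "AE \<omega> in P. \<forall>k. \<forall>\<^sub>F n in sequentially. \<forall>z\<in>cball 0 (exp (real n)). nearE p (N \<omega>) z < \<infinity> \<longrightarrow>
      - Vbar p (N \<omega>) z \<le> real n * (real n / vd TYPE('d)) powr - be * (a + inverse (real (Suc k)))"
    unfolding AE_all_countable
    by (intro allI sup_AE[OF prm p be_def]) (simp add: a_def)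
  have peak: "AE \<omega> in P. \<forall>k. \<forall>\<^sub>F n in sequentially. \<exists>x\<in>cball 0 (exp (real n)). emeasure (N \<omega>) (cball x 2) = 0 \<and>
      (\<forall>z\<in>cball x 1. Vbar p (N \<omega>) z \<le> - (real n * (real n / vd TYPE('d)) powr - be * (a - inverse (real (Suc k)))))"
    unfolding AE_all_countable
    by (intro allI peak_AE[OF prm p be_def]) (simp add: a_def)
  have inv0: "(\<lambda>k. inverse (real (Suc k))) \<longlonglongrightarrow> 0" by (rule LIMSEQ_inverse_real_of_nat)
  have tX: "\<forall>\<^sub>F t::real in at_top. 0 < t * ln t powr (1 - be)"
    using eventually_gt_at_top[of 1] by eventually_elim auto
  show ?thesis
    using sup peak regular_env_AE[OF prm p] vacant_origin_AE[OF prm]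
  proof eventually_elim
    case (elim \<omega>)
    let ?Q = "quenched_moment W B p \<theta> (N \<omega>)"
    obtain C where env: "regular_env p C (N \<omega>)" using elim(3) by blast
    obtain r where r: "0 < r" "emeasure (N \<omega>) (cball 0 r) = 0" using elim(4) by blast
    have up: "\<forall>\<^sub>F t in at_top. ?Q t \<le> ennreal (exp (c * (t * ln t powr (1 - be))))" if c: "L < c" for c
    proof -
      have "(\<lambda>k. \<theta> * (v powr be * (a + inverse (real (Suc k))))) \<longlonglongrightarrow> \<theta> * (v powr be * (a + 0))"
        by (intro tendsto_intros inv0)
      then have "\<forall>\<^sub>F k in sequentially. \<theta> * (v powr be * (a + inverse (real (Suc k)))) < c"
        by (rule order_tendstoD) (use c T in simp)
      then obtain k where k: "\<theta> * (v powr be * (a + inverse (real (Suc k)))) < c" by (auto simp: eventually_sequentially)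
      show ?thesis
      proof (rule upper_asymp[OF env p0 p(2) th _ be(3,2) _ k])
        show "0 \<le> v powr be * (a + inverse (real (Suc k)))" using a0 by (intro mult_nonneg_nonneg add_nonneg_nonneg) auto
        show "\<forall>\<^sub>F n in sequentially. \<forall>z\<in>cball 0 (exp (real n)). nearE p (N \<omega>) z < \<infinity> \<longrightarrow>
            - Vbar p (N \<omega>) z \<le> v powr be * (a + inverse (real (Suc k))) * real n powr (1 - be)"
          using spec[OF elim(1), of k] eventually_gt_at_top[of "0::nat"] by eventually_elim (simp only: scale)
      qed
    qed
    have lo: "\<forall>\<^sub>F t in at_top. ennreal (exp (c * (t * ln t powr (1 - be)))) \<le> ?Q t" if c: "c < L" for c
    proof -
      have "(\<lambda>k. \<theta> * (v powr be * (a - inverse (real (Suc k))))) \<longlonglongrightarrow> \<theta> * (v powr be * (a - 0))"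
        by (intro tendsto_intros inv0)
      then have "\<forall>\<^sub>F k in sequentially. max 0 c < \<theta> * (v powr be * (a - inverse (real (Suc k))))"
        by (rule order_tendstoD) (use c T T0 in simp)
      then obtain k where "max 0 c < \<theta> * (v powr be * (a - inverse (real (Suc k))))" by (auto simp: eventually_sequentially)
      then have k: "c < \<theta> * (v powr be * (a - inverse (real (Suc k))))" "0 < \<theta> * (v powr be * (a - inverse (real (Suc k))))" by auto
      show ?thesis
      proof (rule lower_asymp[OF env p0 p(2) th _ be(3,2) r _ k(1)])
        show "0 < v powr be * (a - inverse (real (Suc k)))" using k(2) th by (simp only: zero_less_mult_iff) auto
        show "\<forall>\<^sub>F n in sequentially. \<exists>x\<in>cball 0 (exp (real n)). emeasure (N \<omega>) (cball x 2) = 0 \<and>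
            (\<forall>z\<in>cball x 1. Vbar p (N \<omega>) z \<le> - (v powr be * (a - inverse (real (Suc k))) * real n powr (1 - be)))"
          using spec[OF elim(2), of k] eventually_gt_at_top[of "0::nat"] by eventually_elim (simp only: scale)
      qed
    qed
    have fin: "\<forall>\<^sub>F t in at_top. ?Q t < \<infinity>"
    proof -
      have "\<forall>\<^sub>F t in at_top. ?Q t \<le> ennreal (exp ((L + 1) * (t * ln t powr (1 - be))))" by (rule up) simp
      then show ?thesis by eventually_elim (auto intro: le_less_trans)
    qed
    have "((\<lambda>t. ln (enn2real (?Q t)) / (t * ln t powr (1 - be))) \<longlongrightarrow> L) at_top"
    proof (rule order_tendstoI)
      fix c assume "c < L"
      then have c: "c < (c + L) / 2" "(c + L) / 2 < L" by simp_all
      show "\<forall>\<^sub>F t in at_top. c < ln (enn2real (?Q t)) / (t * ln t powr (1 - be))"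
        using lo[OF c(2)] fin tX by eventually_elim (use c(1) ln_ratio_lower in \<open>blast intro: less_le_trans\<close>)
    next
      fix c assume "L < c"
      then have c: "(c + L) / 2 < c" "L < (c + L) / 2" "0 \<le> (c + L) / 2" using T0 by simp_all
      show "\<forall>\<^sub>F t in at_top. ln (enn2real (?Q t)) / (t * ln t powr (1 - be)) < c"
        using up[OF c(2)] tX by eventually_elim (use c(1,3) ln_ratio_upper in \<open>blast intro: le_less_trans\<close>)
    qed
    with fin show ?case unfolding ex L_def by blast
  qed
qed

end
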